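(* Let $G$ be a finite group, $R$ a commutative ring, $\alpha=(D_g,\alpha_g)_{g\in G}$ a unital partial action of $G$ on $R$ with $D_g=R1_g$, and suppose that $R^\alpha\subseteq R$ is an $\alpha$-partial Galois extension. Let $S=R\star_\alpha G$ be the partial skew group ring and let $\Theta_0(g)=D_g\delta_g\subseteq S$ for $g\in G$. Then the map $$\xi:\mathbf{Pic}_{R^\alpha}(R^\alpha)\to\mathcal P_R(S/R)^{(G)},\qquad [P_0]\mapsto\big([P_0\otimes_{R^\alpha}R]\overset{[\phi]}{\Longrightarrow}[P_0\otimes_{R^\alpha}S]\big),$$ is an isomorphism of groups, where $\phi:P_0\otimes_{R^\alpha}R\to P_0\otimes_{R^\alpha}S$ is the inclusion and the $S$-bimodule structure on $P_0\otimes_{R^\alpha}S$ is $s_1\cdot(p\otimes s)\cdot s_2=p\otimes s_1ss_2$.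
   Context: All rings are associative with unity. A unital partial action $\alpha=(D_g,\alpha_g)_{g\in G}$ of $G$ on a commutative ring $R$ consists of ideals $D_g=R1_g$ generated by idempotents $1_g$ and ring isomorphisms $\alpha_g:D_{g^{-1}}\to D_g$ such that $D_1=R$, $\alpha_1=\mathrm{id}$, $\alpha_h^{-1}(D_h\cap D_{g^{-1}})\subseteq D_{(gh)^{-1}}$ and $\alpha_g\circ\alpha_h=\alpha_{gh}$ on $\alpha_h^{-1}(D_h\cap D_{g^{-1}})$. $R^\alpha=\{r\in R:\alpha_g(r1_{g^{-1}})=r1_g\ \forall g\}$. $R\supseteq R^\alpha$ is an $\alpha$-partial Galois extension if there are $m\in\mathbb N$ and $x_i,y_i\in R$, $1\le i\le m$, with $\sum_i x_i\alpha_g(y_i1_{g^{-1}})=\delta_{1,g}$ for all $g\in G$. The partial skew group ring is $R\star_\alpha G=\bigoplus_{g}D_g\delta_g$ with $(a\delta_g)(b\delta_h)=a\alpha_g(b1_{g^{-1}})\delta_{gh}$; $R$ is a subring via $r\mapsto r\delta_1$, and $R^\alpha$ is central in it. $\mathbf{Pic}(T)$ is the group under $\otimes_T$ of isomorphism classes of invertible $T$-bimodules of a ring $T$; $\mathbf{Pic}_k(T)$ is the subgroup of classes of bimodules central over $k$ ($xp=px$ for $x\in k$). For a ring extension $R\subseteq S$, consider objects $P\overset{[\phi]}{\Longrightarrow}X$, where $P$ is an $R$-bimodule, $X$ an $S$-bimodule and $\phi:P\to X$ is an $R$-bilinear map such that $P\otimes_RS\to X$, $p\otimes s\mapsto\phi(p)s$,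 and $S\otimes_RP\to X$, $s\otimes p\mapsto s\phi(p)$, are isomorphisms. An isomorphism from $P\overset{[\phi]}{\Longrightarrow}X$ to $Q\overset{[\psi]}{\Longrightarrow}Y$ is a pair $(a,b)$ of an $R$-bimodule isomorphism $a:P\to Q$ and an $S$-bimodule isomorphism $b:X\to Y$ with $b\phi=\psi a$. $\mathcal P(S/R)$ is the set of isomorphism classes $[P]\overset{[\phi]}{\Longrightarrow}[X]$ with $[P]\in\mathbf{Pic}(R)$, $[X]\in\mathbf{Pic}(S)$; it is a group with product given by $P\otimes_RQ\overset{[\phi\otimes\psi]}{\Longrightarrow}X\otimes_SY$, $(\phi\otimes\psi)(p\otimes q)=\phi(p)\otimes\psi(q)$, and identity the class of the inclusion $R\to S$. $\mathcal P_R(S/R)$ is the subgroup of classes with $[P]\in\mathbf{Pic}_R(R)$, and here $\mathcal P_R(S/R)^{(G)}$ is the subgroup of those classes in $\mathcal P_R(S/R)$ such that $\Theta_0(g)\phi(P)=\phi(P)\Theta_0(g)$ in $X$ for all $g\in G$ (products of subsets denote the sets of finite sums of products). *)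

theory Defs
  imports "HOL-Algebra.Free_Abelian_Groups" "HOL-Algebra.QuotRing"
begin

text \<open>The monoid part of the record is the \<^emph>\<open>additive\<close> group of the bimodule: for a
  bimodule \<open>M\<close>, \<open>x \<otimes>\<^bsub>M\<^esub> y\<close> is the sum of \<open>x\<close> and \<open>y\<close>, \<open>\<one>\<^bsub>M\<^esub>\<close> is the zero element, and
  \<^const>\<open>finprod\<close> over \<open>M\<close> is a finite sum. This lets free abelian groups, quotient groups and
  group isomorphisms of the library be used directly.\<close>

record ('a, 'b, 'm) bimod = "'m monoid" +
  lmul :: "'a \<Rightarrow> 'm \<Rightarrow> 'm"
  rmul :: "'m \<Rightarrow> 'b \<Rightarrow> 'm"

locale bimodule = A: ring A + B: ring B + M: comm_group M
  for A :: "('a, 'y) ring_scheme" and B :: "('b, 'z) ring_scheme" and M :: "('a, 'b, 'm) bimod" +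
  assumes lmul_closed: "\<lbrakk>a \<in> carrier A; m \<in> carrier M\<rbrakk> \<Longrightarrow> lmul M a m \<in> carrier M"
    and rmul_closed: "\<lbrakk>m \<in> carrier M; b \<in> carrier B\<rbrakk> \<Longrightarrow> rmul M m b \<in> carrier M"
    and lmul_add_left: "\<lbrakk>a \<in> carrier A; a' \<in> carrier A; m \<in> carrier M\<rbrakk>
          \<Longrightarrow> lmul M (a \<oplus>\<^bsub>A\<^esub> a') m = lmul M a m \<otimes>\<^bsub>M\<^esub> lmul M a' m"
    and lmul_add_right: "\<lbrakk>a \<in> carrier A; m \<in> carrier M; m' \<in> carrier M\<rbrakk>
          \<Longrightarrow> lmul M a (m \<otimes>\<^bsub>M\<^esub> m') = lmul M a m \<otimes>\<^bsub>M\<^esub> lmul M a m'"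
    and rmul_add_left: "\<lbrakk>m \<in> carrier M; m' \<in> carrier M; b \<in> carrier B\<rbrakk>
          \<Longrightarrow> rmul M (m \<otimes>\<^bsub>M\<^esub> m') b = rmul M m b \<otimes>\<^bsub>M\<^esub> rmul M m' b"
    and rmul_add_right: "\<lbrakk>m \<in> carrier M; b \<in> carrier B; b' \<in> carrier B\<rbrakk>
          \<Longrightarrow> rmul M m (b \<oplus>\<^bsub>B\<^esub> b') = rmul M m b \<otimes>\<^bsub>M\<^esub> rmul M m b'"
    and lmul_assoc: "\<lbrakk>a \<in> carrier A; a' \<in> carrier A; m \<in> carrier M\<rbrakk>
          \<Longrightarrow> lmul M (a \<otimes>\<^bsub>A\<^esub> a') m = lmul M a (lmul M a' m)"
    and rmul_assoc: "\<lbrakk>m \<in> carrier M; b \<in> carrier B; b' \<in> carrier B\<rbrakk>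
          \<Longrightarrow> rmul M m (b \<otimes>\<^bsub>B\<^esub> b') = rmul M (rmul M m b) b'"
    and lmul_one: "m \<in> carrier M \<Longrightarrow> lmul M \<one>\<^bsub>A\<^esub> m = m"
    and rmul_one: "m \<in> carrier M \<Longrightarrow> rmul M m \<one>\<^bsub>B\<^esub> = m"
    and lmul_rmul: "\<lbrakk>a \<in> carrier A; m \<in> carrier M; b \<in> carrier B\<rbrakk>
          \<Longrightarrow> rmul M (lmul M a m) b = lmul M a (rmul M m b)"

definition bimod_hom ::
  "('a, 'y) ring_scheme \<Rightarrow> ('b, 'z) ring_scheme \<Rightarrow> ('a, 'b, 'm) bimod \<Rightarrow> ('a, 'b, 'n) bimod
     \<Rightarrow> ('m \<Rightarrow> 'n) set" where
  "bimod_hom A B M N = {f \<in> hom M N.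
     (\<forall>a\<in>carrier A. \<forall>m\<in>carrier M. f (lmul M a m) = lmul N a (f m)) \<and>
     (\<forall>m\<in>carrier M. \<forall>b\<in>carrier B. f (rmul M m b) = rmul N (f m) b)}"

definition bimod_iso ::
  "('a, 'y) ring_scheme \<Rightarrow> ('b, 'z) ring_scheme \<Rightarrow> ('a, 'b, 'm) bimod \<Rightarrow> ('a, 'b, 'n) bimod
     \<Rightarrow> ('m \<Rightarrow> 'n) set" where
  "bimod_iso A B M N = {f \<in> bimod_hom A B M N. bij_betw f (carrier M) (carrier N)}"

definition bimod_isomorphic ::
  "('a, 'y) ring_scheme \<Rightarrow> ('b, 'z) ring_scheme \<Rightarrow> ('a, 'b, 'm) bimod \<Rightarrow> ('a, 'b, 'n) bimod
     \<Rightarrow> bool" where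
  "bimod_isomorphic A B M N \<longleftrightarrow> bimod_iso A B M N \<noteq> {}"

definition regular_bimod :: "('t, 'z) ring_scheme \<Rightarrow> ('t, 't, 't) bimod" where
  "regular_bimod T = \<lparr>carrier = carrier T, monoid.mult = (\<oplus>\<^bsub>T\<^esub>), one = \<zero>\<^bsub>T\<^esub>,
     lmul = (\<otimes>\<^bsub>T\<^esub>), rmul = (\<otimes>\<^bsub>T\<^esub>)\<rparr>"

definition restrict_scalars ::
  "('c \<Rightarrow> 'a) \<Rightarrow> ('d \<Rightarrow> 'b) \<Rightarrow> ('a, 'b, 'm) bimod \<Rightarrow> ('c, 'd, 'm) bimod" where
  "restrict_scalars i j M = \<lparr>carrier = carrier M, monoid.mult = monoid.mult M, one = one M,
     lmul = (\<lambda>c. lmul M (i c)), rmul = (\<lambda>m d. rmul M m (j d))\<rparr>"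

definition central_over :: "'t set \<Rightarrow> ('t, 't, 'm) bimod \<Rightarrow> bool" where
  "central_over K M \<longleftrightarrow> (\<forall>x\<in>K. \<forall>m\<in>carrier M. lmul M x m = rmul M m x)"

text \<open>\<open>M \<otimes>\<^sub>T N\<close> is the free abelian group on \<open>carrier M \<times> carrier N\<close> (whose elements are finitely
  supported integer-valued functions) modulo the subgroup generated by the usual relations.\<close>

definition tens_free :: "('a, 't, 'm) bimod \<Rightarrow> ('t, 'b, 'n) bimod \<Rightarrow> (('m \<times> 'n) \<Rightarrow>\<^sub>0 int) monoid" where
  "tens_free M N = free_Abelian_group (carrier M \<times> carrier N)"

definition tens_rel ::
  "('t, 'z) ring_scheme \<Rightarrow> ('a, 't, 'm) bimod \<Rightarrow> ('t, 'b, 'n) bimod \<Rightarrow> (('m \<times> 'n) \<Rightarrow>\<^sub>0 int) set" where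
  "tens_rel T M N =
     {frag_of (m \<otimes>\<^bsub>M\<^esub> m', n) - (frag_of (m, n) + frag_of (m', n)) | m m' n.
        m \<in> carrier M \<and> m' \<in> carrier M \<and> n \<in> carrier N} \<union>
     {frag_of (m, n \<otimes>\<^bsub>N\<^esub> n') - (frag_of (m, n) + frag_of (m, n')) | m n n'.
        m \<in> carrier M \<and> n \<in> carrier N \<and> n' \<in> carrier N} \<union>
     {frag_of (rmul M m t, n) - frag_of (m, lmul N t n) | m t n.
        m \<in> carrier M \<and> t \<in> carrier T \<and> n \<in> carrier N}"

definition tens_ker ::
  "('t, 'z) ring_scheme \<Rightarrow> ('a, 't, 'm) bimod \<Rightarrow> ('t, 'b, 'n) bimod \<Rightarrow> (('m \<times> 'n) \<Rightarrow>\<^sub>0 int) set" where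
  "tens_ker T M N = generate (tens_free M N) (tens_rel T M N)"

definition pure_tensor ::
  "('t, 'z) ring_scheme \<Rightarrow> ('a, 't, 'm) bimod \<Rightarrow> ('t, 'b, 'n) bimod
     \<Rightarrow> 'm \<Rightarrow> 'n \<Rightarrow> (('m \<times> 'n) \<Rightarrow>\<^sub>0 int) set" where
  "pure_tensor T M N m n = tens_ker T M N #>\<^bsub>tens_free M N\<^esub> frag_of (m, n)"

text \<open>The additive map into \<open>M \<otimes>\<^sub>T N\<close> induced by a map \<open>h\<close> on pairs, whenever \<open>h\<close> respects the
  tensor relations up to \<^const>\<open>tens_ker\<close>: it sends the coset of \<open>\<Sum> k\<^sub>i (p\<^sub>i, q\<^sub>i)\<close> to the coset of
  \<open>\<Sum> k\<^sub>i h (p\<^sub>i, q\<^sub>i)\<close>. In that case all members of the union below coincide.\<close>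

definition tens_map ::
  "('t, 'z) ring_scheme \<Rightarrow> ('a, 't, 'm) bimod \<Rightarrow> ('t, 'b, 'n) bimod
     \<Rightarrow> ('k \<Rightarrow> 'm \<times> 'n) \<Rightarrow> ('k \<Rightarrow>\<^sub>0 int) set \<Rightarrow> (('m \<times> 'n) \<Rightarrow>\<^sub>0 int) set" where
  "tens_map T M N h C =
     (\<Union>c\<in>C. tens_ker T M N #>\<^bsub>tens_free M N\<^esub> frag_extend (\<lambda>z. frag_of (h z)) c)"

definition tensor ::
  "('t, 'z) ring_scheme \<Rightarrow> ('a, 't, 'm) bimod \<Rightarrow> ('t, 'b, 'n) bimod
     \<Rightarrow> ('a, 'b, (('m \<times> 'n) \<Rightarrow>\<^sub>0 int) set) bimod" where
  "tensor T M N = (let Q = tens_free M N Mod tens_ker T M N in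
     \<lparr>carrier = carrier Q, monoid.mult = monoid.mult Q, one = one Q,
      lmul = (\<lambda>a. tens_map T M N (\<lambda>(m, n). (lmul M a m, n))),
      rmul = (\<lambda>C b. tens_map T M N (\<lambda>(m, n). (m, rmul N n b)) C)\<rparr>)"

text \<open>Isomorphism classes are formed inside a fixed carrier type. An invertible \<open>T\<close>-bimodule is
  finitely generated as a left module, hence isomorphic to a bimodule whose elements are cosets
  in some \<open>T\<^sup>n\<close>, i.e. sets of functions \<open>nat \<Rightarrow> 't\<close>. So every invertible bimodule, whatever its
  carrier type, has a copy with carrier type \<open>'t fg\<close>; in particular it is no restriction to look
  for inverses there. Classes of objects \<open>P \<Rightarrow> X\<close> below are formed in the same way.\<close>

type_synonym 't fg = "(nat \<Rightarrow> 't) set"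

definition invertible_bimod :: "('t, 'z) ring_scheme \<Rightarrow> ('t, 't, 'm) bimod \<Rightarrow> bool" where
  "invertible_bimod T M \<longleftrightarrow> bimodule T T M \<and>
     (\<exists>N :: ('t, 't, 't fg) bimod. bimodule T T N \<and>
        bimod_isomorphic T T (tensor T M N) (regular_bimod T) \<and>
        bimod_isomorphic T T (tensor T N M) (regular_bimod T))"

definition bimod_class ::
  "('t, 'z) ring_scheme \<Rightarrow> ('t, 't, 'm) bimod \<Rightarrow> ('t, 't, 't fg) bimod set" where
  "bimod_class T M = {N. invertible_bimod T N \<and> bimod_isomorphic T T M N}"

definition Pic :: "('t, 'z) ring_scheme \<Rightarrow> ('t, 't, 't fg) bimod set monoid" where
  "Pic T = \<lparr>carrier = {bimod_class T M | M :: ('t, 't, 't fg) bimod. invertible_bimod T M},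
     monoid.mult = (\<lambda>c d. \<Union>P\<in>c. \<Union>Q\<in>d. bimod_class T (tensor T P Q)),
     one = bimod_class T (regular_bimod T)\<rparr>"

definition Pic_central ::
  "'t set \<Rightarrow> ('t, 'z) ring_scheme \<Rightarrow> ('t, 't, 't fg) bimod set monoid" where
  "Pic_central K T = (Pic T)\<lparr>carrier := {c \<in> carrier (Pic T). \<forall>P\<in>c. central_over K P}\<rparr>"

text \<open>A ring extension \<open>R \<subseteq> S\<close> is given by its inclusion homomorphism \<open>i\<close>.\<close>

definition ext_object ::
  "('r \<Rightarrow> 's) \<Rightarrow> ('r, 'y) ring_scheme \<Rightarrow> ('s, 'z) ring_scheme
     \<Rightarrow> ('r, 'r, 'p) bimod \<times> ('s, 's, 'x) bimod \<times> ('p \<Rightarrow> 'x) \<Rightarrow> bool" where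
  "ext_object i R S = (\<lambda>(P, X, \<phi>).
     bimodule R R P \<and> bimodule S S X \<and> \<phi> \<in> bimod_hom R R P (restrict_scalars i i X) \<and>
     (let S' = restrict_scalars i id (regular_bimod S) in
        \<exists>f \<in> bimod_iso R S (tensor R P S') (restrict_scalars i id X).
          \<forall>p\<in>carrier P. \<forall>s\<in>carrier S. f (pure_tensor R P S' p s) = rmul X (\<phi> p) s) \<and>
     (let S' = restrict_scalars id i (regular_bimod S) in
        \<exists>f \<in> bimod_iso S R (tensor R S' P) (restrict_scalars id i X).
          \<forall>s\<in>carrier S. \<forall>p\<in>carrier P. f (pure_tensor R S' P s p) = lmul X s (\<phi> p)))"

definition ext_isomorphic ::
  "('r, 'y) ring_scheme \<Rightarrow> ('s, 'z) ring_scheme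
     \<Rightarrow> ('r, 'r, 'p) bimod \<times> ('s, 's, 'x) bimod \<times> ('p \<Rightarrow> 'x)
     \<Rightarrow> ('r, 'r, 'q) bimod \<times> ('s, 's, 'w) bimod \<times> ('q \<Rightarrow> 'w) \<Rightarrow> bool" where
  "ext_isomorphic R S = (\<lambda>(P, X, \<phi>) (Q, Y, \<psi>).
     \<exists>a \<in> bimod_iso R R P Q. \<exists>b \<in> bimod_iso S S X Y. \<forall>p\<in>carrier P. b (\<phi> p) = \<psi> (a p))"

type_synonym ('r, 's) ext_obj =
  "('r, 'r, 'r fg) bimod \<times> ('s, 's, 's fg) bimod \<times> ('r fg \<Rightarrow> 's fg)"

definition inv_ext_object ::
  "('r \<Rightarrow> 's) \<Rightarrow> ('r, 'y) ring_scheme \<Rightarrow> ('s, 'z) ring_scheme \<Rightarrow> ('r, 's) ext_obj \<Rightarrow> bool" where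
  "inv_ext_object i R S = (\<lambda>(P, X, \<phi>).
     ext_object i R S (P, X, \<phi>) \<and> invertible_bimod R P \<and> invertible_bimod S X)"

definition ext_class ::
  "('r \<Rightarrow> 's) \<Rightarrow> ('r, 'y) ring_scheme \<Rightarrow> ('s, 'z) ring_scheme
     \<Rightarrow> ('r, 'r, 'p) bimod \<times> ('s, 's, 'x) bimod \<times> ('p \<Rightarrow> 'x) \<Rightarrow> ('r, 's) ext_obj set" where
  "ext_class i R S u = {v. inv_ext_object i R S v \<and> ext_isomorphic R S u v}"

definition ext_tensor ::
  "('r, 'y) ring_scheme \<Rightarrow> ('s, 'z) ring_scheme
     \<Rightarrow> ('r, 'r, 'p) bimod \<times> ('s, 's, 'x) bimod \<times> ('p \<Rightarrow> 'x)
     \<Rightarrow> ('r, 'r, 'q) bimod \<times> ('s, 's, 'w) bimod \<times> ('q \<Rightarrow> 'w)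
     \<Rightarrow> ('r, 'r, (('p \<times> 'q) \<Rightarrow>\<^sub>0 int) set) bimod \<times> ('s, 's, (('x \<times> 'w) \<Rightarrow>\<^sub>0 int) set) bimod
        \<times> ((('p \<times> 'q) \<Rightarrow>\<^sub>0 int) set \<Rightarrow> (('x \<times> 'w) \<Rightarrow>\<^sub>0 int) set)" where
  "ext_tensor R S = (\<lambda>(P, X, \<phi>) (Q, Y, \<psi>).
     (tensor R P Q, tensor S X Y, tens_map S X Y (\<lambda>(p, q). (\<phi> p, \<psi> q))))"

definition ext_Pic ::
  "('r \<Rightarrow> 's) \<Rightarrow> ('r, 'y) ring_scheme \<Rightarrow> ('s, 'z) ring_scheme \<Rightarrow> ('r, 's) ext_obj set monoid" where
  "ext_Pic i R S = \<lparr>carrier = {ext_class i R S u | u :: ('r, 's) ext_obj. inv_ext_object i R S u},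
     monoid.mult = (\<lambda>c d. \<Union>u\<in>c. \<Union>v\<in>d. ext_class i R S (ext_tensor R S u v)),
     one = ext_class i R S (regular_bimod R, regular_bimod S, i)\<rparr>"

text \<open>For subsets \<open>A\<close> of the ring and \<open>U\<close> of the bimodule, \<open>AU\<close> and \<open>UA\<close> are the sets of finite
  sums of products.\<close>

definition lprod_set :: "('a, 'b, 'm) bimod \<Rightarrow> 'a set \<Rightarrow> 'm set \<Rightarrow> 'm set" where
  "lprod_set X A U = {finprod X (\<lambda>k. lmul X (a k) (u k)) {..<n} | a u (n::nat).
     a \<in> {..<n} \<rightarrow> A \<and> u \<in> {..<n} \<rightarrow> U}"

definition rprod_set :: "('a, 'b, 'm) bimod \<Rightarrow> 'm set \<Rightarrow> 'b set \<Rightarrow> 'm set" where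
  "rprod_set X U B = {finprod X (\<lambda>k. rmul X (u k) (b k)) {..<n} | u b (n::nat).
     u \<in> {..<n} \<rightarrow> U \<and> b \<in> {..<n} \<rightarrow> B}"

definition ext_Pic_inv ::
  "('r \<Rightarrow> 's) \<Rightarrow> ('r, 'y) ring_scheme \<Rightarrow> ('s, 'z) ring_scheme \<Rightarrow> 'g set \<Rightarrow> ('g \<Rightarrow> 's set)
     \<Rightarrow> ('r, 's) ext_obj set monoid" where
  "ext_Pic_inv i R S I \<Theta> = (ext_Pic i R S)
     \<lparr>carrier := {c \<in> carrier (ext_Pic i R S). \<forall>(P, X, \<phi>)\<in>c. central_over (carrier R) P \<and>
        (\<forall>g\<in>I. lprod_set X (\<Theta> g) (\<phi> ` carrier P) = rprod_set X (\<phi> ` carrier P) (\<Theta> g))}\<rparr>"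

text \<open>\<open>e g\<close> is the idempotent \<open>1\<^sub>g\<close>. The values of \<open>\<alpha> g\<close> matter only on \<open>D\<close> at \<open>inv g\<close>.\<close>

definition pdom :: "('r, 'z) ring_scheme \<Rightarrow> ('g \<Rightarrow> 'r) \<Rightarrow> 'g \<Rightarrow> 'r set" where
  "pdom R e g = PIdl\<^bsub>R\<^esub> (e g)"

locale unital_partial_action = G: group G + R: cring R
  for G :: "('g, 'y) monoid_scheme" and R :: "('r, 'z) ring_scheme"
    and e :: "'g \<Rightarrow> 'r" and \<alpha> :: "'g \<Rightarrow> 'r \<Rightarrow> 'r" +
  assumes e_closed: "g \<in> carrier G \<Longrightarrow> e g \<in> carrier R"
    and e_idem: "g \<in> carrier G \<Longrightarrow> e g \<otimes>\<^bsub>R\<^esub> e g = e g"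
    and alpha_iso: "g \<in> carrier G \<Longrightarrow>
      \<alpha> g \<in> ring_iso (R\<lparr>carrier := pdom R e (inv\<^bsub>G\<^esub> g), one := e (inv\<^bsub>G\<^esub> g)\<rparr>)
                     (R\<lparr>carrier := pdom R e g, one := e g\<rparr>)"
    and dom_one: "pdom R e \<one>\<^bsub>G\<^esub> = carrier R"
    and alpha_one: "r \<in> carrier R \<Longrightarrow> \<alpha> \<one>\<^bsub>G\<^esub> r = r"
    and dom_comp: "\<lbrakk>g \<in> carrier G; h \<in> carrier G; r \<in> pdom R e (inv\<^bsub>G\<^esub> h);
        \<alpha> h r \<in> pdom R e h \<inter> pdom R e (inv\<^bsub>G\<^esub> g)\<rbrakk> \<Longrightarrow> r \<in> pdom R e (inv\<^bsub>G\<^esub> (g \<otimes>\<^bsub>G\<^esub> h))"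
    and alpha_comp: "\<lbrakk>g \<in> carrier G; h \<in> carrier G; r \<in> pdom R e (inv\<^bsub>G\<^esub> h);
        \<alpha> h r \<in> pdom R e h \<inter> pdom R e (inv\<^bsub>G\<^esub> g)\<rbrakk> \<Longrightarrow> \<alpha> g (\<alpha> h r) = \<alpha> (g \<otimes>\<^bsub>G\<^esub> h) r"

definition fixed_ring ::
  "('g, 'y) monoid_scheme \<Rightarrow> ('r, 'z) ring_scheme \<Rightarrow> ('g \<Rightarrow> 'r) \<Rightarrow> ('g \<Rightarrow> 'r \<Rightarrow> 'r)
     \<Rightarrow> ('r, 'z) ring_scheme" where
  "fixed_ring G R e \<alpha> = R\<lparr>carrier :=
     {r \<in> carrier R. \<forall>g\<in>carrier G. \<alpha> g (r \<otimes>\<^bsub>R\<^esub> e (inv\<^bsub>G\<^esub> g)) = r \<otimes>\<^bsub>R\<^esub> e g}\<rparr>"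

definition partial_Galois ::
  "('g, 'y) monoid_scheme \<Rightarrow> ('r, 'z) ring_scheme \<Rightarrow> ('g \<Rightarrow> 'r) \<Rightarrow> ('g \<Rightarrow> 'r \<Rightarrow> 'r) \<Rightarrow> bool" where
  "partial_Galois G R e \<alpha> \<longleftrightarrow> (\<exists>(m::nat) x y. x \<in> {1..m} \<rightarrow> carrier R \<and> y \<in> {1..m} \<rightarrow> carrier R \<and>
     (\<forall>g\<in>carrier G. (\<Oplus>\<^bsub>R\<^esub>k\<in>{1..m}. x k \<otimes>\<^bsub>R\<^esub> \<alpha> g (y k \<otimes>\<^bsub>R\<^esub> e (inv\<^bsub>G\<^esub> g))) =
        (if g = \<one>\<^bsub>G\<^esub> then \<one>\<^bsub>R\<^esub> else \<zero>\<^bsub>R\<^esub>)))"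

text \<open>The partial skew group ring of a \<^emph>\<open>finite\<close> group: \<open>\<Sum> a\<^sub>g \<delta>\<^sub>g\<close> is the function \<open>g \<mapsto> a\<^sub>g\<close>
  (undefined outside \<open>carrier G\<close>). The coefficient of a product at \<open>g\<close> collects the terms
  \<open>a\<^sub>h \<alpha>\<^sub>h(b\<^sub>k 1\<^bsub>inv h\<^esub>)\<close> with \<open>h k = g\<close>, i.e. \<open>k = inv h \<otimes> g\<close>.\<close>

definition skew_ring ::
  "('g, 'y) monoid_scheme \<Rightarrow> ('r, 'z) ring_scheme \<Rightarrow> ('g \<Rightarrow> 'r) \<Rightarrow> ('g \<Rightarrow> 'r \<Rightarrow> 'r)
     \<Rightarrow> ('g \<Rightarrow> 'r) ring" where
  "skew_ring G R e \<alpha> =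
     \<lparr>carrier = (\<Pi>\<^sub>E g\<in>carrier G. pdom R e g),
      monoid.mult = (\<lambda>a b. \<lambda>g\<in>carrier G. \<Oplus>\<^bsub>R\<^esub>h\<in>carrier G.
        a h \<otimes>\<^bsub>R\<^esub> \<alpha> h (b (inv\<^bsub>G\<^esub> h \<otimes>\<^bsub>G\<^esub> g) \<otimes>\<^bsub>R\<^esub> e (inv\<^bsub>G\<^esub> h))),
      one = (\<lambda>g\<in>carrier G. if g = \<one>\<^bsub>G\<^esub> then \<one>\<^bsub>R\<^esub> else \<zero>\<^bsub>R\<^esub>),
      zero = (\<lambda>g\<in>carrier G. \<zero>\<^bsub>R\<^esub>),
      add = (\<lambda>a b. \<lambda>g\<in>carrier G. a g \<oplus>\<^bsub>R\<^esub> b g)\<rparr>"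

definition skew_delta ::
  "('g, 'y) monoid_scheme \<Rightarrow> ('r, 'z) ring_scheme \<Rightarrow> 'r \<Rightarrow> 'g \<Rightarrow> ('g \<Rightarrow> 'r)" where
  "skew_delta G R a g = (\<lambda>h\<in>carrier G. if h = g then a else \<zero>\<^bsub>R\<^esub>)"

definition skew_incl ::
  "('g, 'y) monoid_scheme \<Rightarrow> ('r, 'z) ring_scheme \<Rightarrow> 'r \<Rightarrow> ('g \<Rightarrow> 'r)" where
  "skew_incl G R r = skew_delta G R r \<one>\<^bsub>G\<^esub>"

definition Theta0 ::
  "('g, 'y) monoid_scheme \<Rightarrow> ('r, 'z) ring_scheme \<Rightarrow> ('g \<Rightarrow> 'r) \<Rightarrow> 'g \<Rightarrow> ('g \<Rightarrow> 'r) set" where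
  "Theta0 G R e g = (\<lambda>a. skew_delta G R a g) ` pdom R e g"

text \<open>For a ring homomorphism \<open>j : A \<rightarrow> T\<close> with central image and an \<open>A\<close>-bimodule \<open>P\<close>, the abelian
  group \<open>P \<otimes>\<^sub>A T\<close> with the \<open>T\<close>-bimodule structure \<open>t\<^sub>1 (p \<otimes> t) t\<^sub>2 = p \<otimes> t\<^sub>1 t t\<^sub>2\<close>. Only the right
  action is the one of \<^const>\<open>tensor\<close>.\<close>

definition base_change ::
  "('a, 'y) ring_scheme \<Rightarrow> ('a \<Rightarrow> 't) \<Rightarrow> ('t, 'z) ring_scheme \<Rightarrow> ('a, 'a, 'p) bimod
     \<Rightarrow> ('t, 't, (('p \<times> 't) \<Rightarrow>\<^sub>0 int) set) bimod" where
  "base_change A j T P = (let T' = restrict_scalars j id (regular_bimod T); Q = tensor A P T' in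
     \<lparr>carrier = carrier Q, monoid.mult = monoid.mult Q, one = one Q,
      lmul = (\<lambda>t. tens_map A P T' (\<lambda>(p, s). (p, t \<otimes>\<^bsub>T\<^esub> s))),
      rmul = (\<lambda>C t. tens_map A P T' (\<lambda>(p, s). (p, s \<otimes>\<^bsub>T\<^esub> t)) C)\<rparr>)"

text \<open>For rings \<open>A \<subseteq> R\<close> and an inclusion \<open>i : R \<rightarrow> S\<close>, the object \<open>P \<otimes>\<^sub>A R \<Rightarrow> P \<otimes>\<^sub>A S\<close>,
  \<open>p \<otimes> r \<mapsto> p \<otimes> i r\<close>.\<close>

definition xi_object ::
  "('r, 'x) ring_scheme \<Rightarrow> ('r \<Rightarrow> 's) \<Rightarrow> ('r, 'y) ring_scheme \<Rightarrow> ('s, 'z) ring_scheme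
     \<Rightarrow> ('r, 'r, 'p) bimod
     \<Rightarrow> ('r, 'r, (('p \<times> 'r) \<Rightarrow>\<^sub>0 int) set) bimod \<times> ('s, 's, (('p \<times> 's) \<Rightarrow>\<^sub>0 int) set) bimod
        \<times> ((('p \<times> 'r) \<Rightarrow>\<^sub>0 int) set \<Rightarrow> (('p \<times> 's) \<Rightarrow>\<^sub>0 int) set)" where
  "xi_object A i R S P =
     (base_change A id R P, base_change A i S P,
      tens_map A P (restrict_scalars i id (regular_bimod S)) (\<lambda>(p, r). (p, i r)))"

definition xi ::
  "('r, 'x) ring_scheme \<Rightarrow> ('r \<Rightarrow> 's) \<Rightarrow> ('r, 'y) ring_scheme \<Rightarrow> ('s, 'z) ring_scheme
     \<Rightarrow> ('r, 'r, 'r fg) bimod set \<Rightarrow> ('r, 's) ext_obj set" where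
  "xi A i R S c = (\<Union>P\<in>c. ext_class i R S (xi_object A i R S P))"

end

(* Over a commutative ring T, a central bimodule M is invertible iff finitely many functionals f_i
   with f_i(x) y = f_i(y) x and elements u_i satisfy sum f_i(u_i) = 1. This criterion passes to
   tensor products, yields a dual, and embeds M into a power of T, hence gives a copy of M in the
   fixed carrier type.

   Base change P -> P (x)_A T along a central homomorphism is multiplicative, so it sends invertible
   modules to invertible bimodules over R and over S, and xi is well defined and multiplicative.

   Write d_g = 1_g delta_g and tr(r) = sum_g alpha_g(r 1_(g^-1)). The Galois coordinates give
   r = sum_i x_i tr(y_i r), and by Nakayama some c has tr(c) = 1. Hence an element of
   P (x)_A R that commutes with sum_g d_g in P (x)_A S has the form p (x) 1, so that P can be
   recovered from its image and xi is injective. For surjectivity, an object phi : P -> X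
   commuting with the D_g delta_g carries a partial action, phi(tau_g(p)) = d_g phi(p) d_(g^-1). The
   submodule P_0 of elements whose image commutes with S contains T(p) = sum_g tau_g(p), and
   p |-> sum_i T(y_i p) (x) x_i inverts P_0 (x)_A R -> P. Since xi turns out to be a
   bijection respecting products, its target is a group without constructing inverses there. *)
theory Submission
  imports Defs "HOL-Algebra.Subrings"
begin

section \<open>Finite sums and additive maps\<close>

text \<open>Three obstacles shape the argument. First, the isomorphisms M \<otimes> N = T and N
  \<otimes> M = T that witness invertibility are unrelated, so there is no Morita context to compute
  with; the law f(x) y = f(y) x is reached by showing that bimodule endomorphisms of M are scalars
  and by a nilpotency argument. Second, S is not commutative, so the criterion by functionals lives
  over A and R only; over S all information is carried up from A. Third, a product of classes is a
  union over representatives in a fixed carrier type, and a class without such a representative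
  would make the product empty; hence the coordinate embeddings at every stage.

  The element c with tr(c) = 1 enters through r |-> tr(c r), an A-linear splitting of A in R. It
  yields a retraction of p |-> p \<otimes> 1, and it makes the trace ideal of P_0 all of A, which is
  the invertibility of P_0. The submodule P_0 is cut out by commutation with all of S, not by fixed
  points of the tau_g, so that p \<otimes> s |-> phi(p) s is left S-linear at once.\<close>

lemma comm_group_cong:
  assumes "comm_group K" "carrier L = carrier K" "monoid.mult L = monoid.mult K" "one L = one K"
  shows "comm_group L"
proof -
  interpret K: comm_group K by fact
  show ?thesis
    by (rule comm_groupI) (use K.m_assoc K.m_comm K.l_inv_ex in \<open>auto simp: assms(2-)\<close>)
qed

text \<open>For infinite \<open>I\<close> both sides are neutral elements by the convention for
  \<open>finprod\<close>, so the rule applies to any index set.\<close>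

lemma hom_finprod:
  assumes "comm_group K" "comm_group L" "h \<in> hom K L" "f \<in> I \<rightarrow> carrier K"
  shows "h (finprod K f I) = finprod L (\<lambda>i. h (f i)) I"
proof -
  interpret K: comm_group K by fact
  interpret L: comm_group L by fact
  have one: "h \<one>\<^bsub>K\<^esub> = \<one>\<^bsub>L\<^esub>"
    using assms(3) by (simp add: hom_one K.is_group L.is_group)
  have closed: "\<And>x. x \<in> carrier K \<Longrightarrow> h x \<in> carrier L"
    using assms(3) by (auto simp: hom_def)
  show ?thesis
    using assms(4)
  proof (induction I rule: infinite_finite_induct)
    case (insert i I)
    then have fI: "f \<in> I \<rightarrow> carrier K" and fi: "f i \<in> carrier K" by auto
    have "h (finprod K f (insert i I)) = h (f i \<otimes>\<^bsub>K\<^esub> finprod K f I)"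
      using insert fI fi by simp
    also have "\<dots> = h (f i) \<otimes>\<^bsub>L\<^esub> finprod L (\<lambda>i. h (f i)) I"
      using insert fI fi assms(3) by (simp add: hom_mult)
    also have "\<dots> = finprod L (\<lambda>i. h (f i)) (insert i I)"
      using insert fI fi closed by (subst L.finprod_insert) auto
    finally show ?case .
  qed (auto simp: one)
qed

section \<open>Concatenation and interchange of finite sums\<close>

lemma (in comm_monoid) finprod_lessThan_add:
  fixes k l :: nat
  assumes "f \<in> {..<k + l} \<rightarrow> carrier G"
  shows "finprod G f {..<k + l} = finprod G f {..<k} \<otimes> finprod G (\<lambda>i. f (k + i)) {..<l}"
  using assms
proof (induction l)
  case (Suc l)
  then have f: "f \<in> {..<k + l} \<rightarrow> carrier G" "f (k + l) \<in> carrier G" "f \<in> {..<k} \<rightarrow> carrier G"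
    "(\<lambda>i. f (k + i)) \<in> {..<l} \<rightarrow> carrier G" by auto
  then show ?case
    using Suc.IH by (simp add: lessThan_Suc m_ac)
qed simp

lemma (in comm_monoid) finprod_swap:
  assumes "finite I" "finite K" "\<And>i k. i \<in> I \<Longrightarrow> k \<in> K \<Longrightarrow> f i k \<in> carrier G"
  shows "finprod G (\<lambda>i. finprod G (f i) K) I = finprod G (\<lambda>k. finprod G (\<lambda>i. f i k) I) K"
  using assms(1,3)
proof (induction I rule: finite_induct)
  case (insert i I)
  then have c: "f i \<in> K \<rightarrow> carrier G" "(\<lambda>i. finprod G (f i) K) \<in> I \<rightarrow> carrier G"
    "(\<lambda>k. finprod G (\<lambda>i. f i k) I) \<in> K \<rightarrow> carrier G" by auto
  have "finprod G (\<lambda>i. finprod G (f i) K) (insert i I) =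
      finprod G (f i) K \<otimes> finprod G (\<lambda>k. finprod G (\<lambda>i. f i k) I) K"
    using insert c by simp
  also have "\<dots> = finprod G (\<lambda>k. f i k \<otimes> finprod G (\<lambda>i. f i k) I) K"
    by (rule finprod_multf[symmetric]) (use c in auto)
  also have "\<dots> = finprod G (\<lambda>k. finprod G (\<lambda>i. f i k) (insert i I)) K"
    by (rule finprod_cong') (use insert in \<open>auto simp: Pi_iff\<close>)
  finally show ?case .
qed simp

text \<open>Common shape of \<open>lprod_set\<close>, \<open>rprod_set\<close>, the carrier of a
  tensor product and the trace ideal of a module. Indexing by initial segments makes closure under
  addition a concatenation of two families.\<close>

definition sums_of :: "('a, 'b) monoid_scheme \<Rightarrow> 'a set \<Rightarrow> 'a set" where
  "sums_of K B = {finprod K u {..<n} | u (n::nat). u \<in> {..<n} \<rightarrow> B}"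

context comm_monoid begin

lemma sums_of_incl: "x \<in> B \<Longrightarrow> B \<subseteq> carrier G \<Longrightarrow> x \<in> sums_of G B"
  unfolding sums_of_def
  by (rule CollectI, rule exI[of _ "\<lambda>_. x"], rule exI[of _ 1]) (auto simp: lessThan_Suc)

lemma one_in_sums_of: "\<one> \<in> sums_of G B"
  unfolding sums_of_def
  by (rule CollectI, rule exI[of _ "\<lambda>_. \<one>"], rule exI[of _ 0]) auto

lemma sums_of_closed: "B \<subseteq> carrier G \<Longrightarrow> sums_of G B \<subseteq> carrier G"
  unfolding sums_of_def by (auto intro!: finprod_closed)

lemma sums_of_mult:
  assumes "x \<in> sums_of G B" "y \<in> sums_of G B" "B \<subseteq> carrier G"
  shows "x \<otimes> y \<in> sums_of G B"
proof -
  obtain u k where u: "x = finprod G u {..<k}" "u \<in> {..<k::nat} \<rightarrow> B"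
    using assms by (auto simp: sums_of_def)
  obtain v l where v: "y = finprod G v {..<l}" "v \<in> {..<l::nat} \<rightarrow> B"
    using assms by (auto simp: sums_of_def)
  define w where "w = (\<lambda>i. if i < k then u i else v (i - k))"
  have wB: "w \<in> {..<k + l} \<rightarrow> B" using u v by (auto simp: w_def Pi_iff)
  then have w: "w \<in> {..<k + l} \<rightarrow> carrier G" using assms by auto
  have "finprod G w {..<k} = x"
    unfolding u(1) by (rule finprod_cong) (use u assms in \<open>auto simp: w_def simp_implies_def\<close>)
  moreover have "finprod G (\<lambda>i. w (k + i)) {..<l} = y"
    unfolding v(1) by (rule finprod_cong) (use v assms in \<open>auto simp: w_def simp_implies_def\<close>)
  ultimately have "x \<otimes> y = finprod G w {..<k + l}"
    using finprod_lessThan_add[OF w] by simp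
  then show ?thesis using wB by (auto simp: sums_of_def)
qed

text \<open>Serves as an induction rule: an inclusion of sets of sums is reduced to the generators,
  with \<open>W\<close> either another set of sums or the set of elements having a desired
  property.\<close>

lemma sums_of_minimal:
  assumes "\<one> \<in> W" "B \<subseteq> W" "\<And>x y. x \<in> W \<Longrightarrow> y \<in> W \<Longrightarrow> x \<otimes> y \<in> W" "B \<subseteq> carrier G"
  shows "sums_of G B \<subseteq> W"
proof -
  have "finprod G u {..<n} \<in> W" if "u \<in> {..<n} \<rightarrow> B" for u and n :: nat
    using that
  proof (induction n)
    case (Suc n)
    then have "finprod G u {..<Suc n} = u n \<otimes> finprod G u {..<n}"
      using assms(4) by (auto simp: lessThan_Suc intro!: finprod_insert)
    moreover have "u n \<in> W" "finprod G u {..<n} \<in> W"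
      using Suc assms(2) by (auto simp: Pi_iff)
    ultimately show ?case using assms(3) by simp
  qed (use assms in auto)
  then show ?thesis by (auto simp: sums_of_def)
qed

end

text \<open>\<open>lprod_set\<close> takes the two factors of each summand from separate families,
  \<open>sums_of\<close> takes each summand as a whole; the factors are recovered by choice.\<close>

lemma lprod_set_eq_sums_of:
  assumes "comm_monoid X" "{lmul X a u | a u. a \<in> A \<and> u \<in> U} \<subseteq> carrier X"
  shows "lprod_set X A U = sums_of X {lmul X a u | a u. a \<in> A \<and> u \<in> U}" (is "_ = sums_of X ?B")
proof
  interpret comm_monoid X by fact
  show "lprod_set X A U \<subseteq> sums_of X ?B"
    unfolding lprod_set_def sums_of_def by (fastforce simp: Pi_iff)
  show "sums_of X ?B \<subseteq> lprod_set X A U"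
  proof
    fix x assume "x \<in> sums_of X ?B"
    then obtain v and n :: nat where v: "x = finprod X v {..<n}" "v \<in> {..<n} \<rightarrow> ?B"
      by (auto simp: sums_of_def)
    then have "\<forall>k\<in>{..<n}. \<exists>a u. v k = lmul X a u \<and> a \<in> A \<and> u \<in> U" by (simp add: Pi_iff)
    then obtain a u where au: "\<forall>k\<in>{..<n}. v k = lmul X (a k) (u k) \<and> a k \<in> A \<and> u k \<in> U"
      by metis
    have "x = finprod X (\<lambda>k. lmul X (a k) (u k)) {..<n}"
      unfolding v(1) by (rule finprod_cong) (use au assms(2) in \<open>auto simp: simp_implies_def\<close>)
    then show "x \<in> lprod_set X A U"
      using au by (auto simp: lprod_set_def)
  qed
qed

lemma rprod_set_eq_sums_of:
  assumes "comm_monoid X" "{rmul X u b | b u. b \<in> A \<and> u \<in> U} \<subseteq> carrier X"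
  shows "rprod_set X U A = sums_of X {rmul X u b | b u. b \<in> A \<and> u \<in> U}" (is "_ = sums_of X ?B")
proof
  interpret comm_monoid X by fact
  show "rprod_set X U A \<subseteq> sums_of X ?B"
    unfolding rprod_set_def sums_of_def by (fastforce simp: Pi_iff)
  show "sums_of X ?B \<subseteq> rprod_set X U A"
  proof
    fix x assume "x \<in> sums_of X ?B"
    then obtain v and n :: nat where v: "x = finprod X v {..<n}" "v \<in> {..<n} \<rightarrow> ?B"
      by (auto simp: sums_of_def)
    then have "\<forall>k\<in>{..<n}. \<exists>b u. v k = rmul X u b \<and> b \<in> A \<and> u \<in> U" by (simp add: Pi_iff)
    then obtain b u where au: "\<forall>k\<in>{..<n}. v k = rmul X (u k) (b k) \<and> b k \<in> A \<and> u k \<in> U"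
      by metis
    have "x = finprod X (\<lambda>k. rmul X (u k) (b k)) {..<n}"
      unfolding v(1) by (rule finprod_cong) (use au assms(2) in \<open>auto simp: simp_implies_def\<close>)
    then show "x \<in> rprod_set X U A"
      using au by (auto simp: rprod_set_def)
  qed
qed

text \<open>The determinant trick. The factors \<open>\<one> \<ominus> d k\<close> make an induction on the number of generators
  possible: eliminating one generator multiplies the remaining equations by such a factor.\<close>

lemma (in cring) nakayama:
  fixes n :: nat
  assumes I: "I \<subseteq> carrier R" "\<zero> \<in> I" and add: "\<And>a b. a \<in> I \<Longrightarrow> b \<in> I \<Longrightarrow> a \<oplus> b \<in> I"
    and mult: "\<And>a b. a \<in> I \<Longrightarrow> b \<in> I \<Longrightarrow> a \<otimes> b \<in> I" and neg: "\<And>a. a \<in> I \<Longrightarrow> \<ominus> a \<in> I"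
    and x: "\<And>k. k < n \<Longrightarrow> x k \<in> carrier R" and d: "\<And>k. k < n \<Longrightarrow> d k \<in> I"
    and c: "\<And>k l. k < n \<Longrightarrow> l < n \<Longrightarrow> c k l \<in> I"
    and eq: "\<And>k. k < n \<Longrightarrow> (\<one> \<ominus> d k) \<otimes> x k = (\<Oplus>l\<in>{..<n}. c k l \<otimes> x l)"
  shows "\<exists>a\<in>I. \<forall>k<n. (\<one> \<ominus> a) \<otimes> x k = \<zero>"
  using x d c eq
proof (induction n arbitrary: d c)
  case 0
  then show ?case using I by auto
next
  case (Suc n)
  have Ic: "a \<in> carrier R" if "a \<in> I" for a using I that by blast
  have xc: "x k \<in> carrier R" if "k \<le> n" for k using Suc.prems(1) that by simp
  have dc: "d k \<in> carrier R" if "k \<le> n" for k using Suc.prems(2) that Ic by simp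
  have cc: "c k l \<in> carrier R" if "k \<le> n" "l \<le> n" for k l using Suc.prems(3) that Ic by simp
  have sc: "(\<Oplus>l\<in>{..<n}. c k l \<otimes> x l) \<in> carrier R" if "k \<le> n" for k
    by (rule finsum_closed) (use cc xc that in auto)
  have split: "(\<one> \<ominus> d k) \<otimes> x k = c k n \<otimes> x n \<oplus> (\<Oplus>l\<in>{..<n}. c k l \<otimes> x l)" if "k \<le> n" for k
  proof -
    have "(\<Oplus>l\<in>{..<Suc n}. c k l \<otimes> x l) = c k n \<otimes> x n \<oplus> (\<Oplus>l\<in>{..<n}. c k l \<otimes> x l)"
      unfolding lessThan_Suc by (rule finsum_insert) (use cc xc that in auto)
    then show ?thesis using Suc.prems(4)[of k] that by simp
  qed
  \<comment> \<open>Equation \<open>n\<close> is solved for its own unknown: the diagonal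
    coefficient moves to the left and changes the factor of \<open>x n\<close> to
    \<open>\<one> \<ominus> ?e\<close>.\<close>
  let ?e = "d n \<oplus> c n n"
  have eI: "?e \<in> I" using Suc.prems(2)[of n] Suc.prems(3)[of n n] add by simp
  note eC = Ic[OF eI]
  have last: "(\<one> \<ominus> ?e) \<otimes> x n = (\<Oplus>l\<in>{..<n}. c n l \<otimes> x l)"
  proof -
    have "(\<one> \<ominus> ?e) \<otimes> x n = (\<one> \<ominus> d n) \<otimes> x n \<ominus> c n n \<otimes> x n"
      using xc[of n] dc[of n] cc[of n n] by (simp add: minus_eq minus_add l_distr l_minus a_ac)
    also have "\<dots> = (\<Oplus>l\<in>{..<n}. c n l \<otimes> x l)"
      using split[of n] xc[of n] cc[of n n] sc[of n] by (simp add: minus_eq a_ac r_neg2 r_neg1)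
    finally show ?thesis .
  qed
  define d' where "d' k = d k \<oplus> (?e \<ominus> ?e \<otimes> d k)" for k
  define c' where "c' k l = (c k l \<ominus> ?e \<otimes> c k l) \<oplus> c k n \<otimes> c n l" for k l
  have sub: "a \<ominus> b \<in> I" if "a \<in> I" "b \<in> I" for a b
    unfolding minus_eq by (rule add[OF that(1) neg[OF that(2)]])
  have d'I: "d' k \<in> I" if "k < n" for k
    unfolding d'_def using that by (simp add: add[OF _ sub[OF eI mult[OF eI]]] Suc.prems(2))
  have c'I: "c' k l \<in> I" if "k < n" "l < n" for k l
    unfolding c'_def using that by (simp add: add[OF sub[OF _ mult[OF eI]] mult] Suc.prems(3))
  have "\<exists>a\<in>I. \<forall>k<n. (\<one> \<ominus> a) \<otimes> x k = \<zero>"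
  proof (rule Suc.IH[of d' c'])
    fix k assume k: "k < n"
    have "(\<one> \<ominus> d' k) = (\<one> \<ominus> ?e) \<otimes> (\<one> \<ominus> d k)"
      using k dc[of k] eC by (simp add: d'_def minus_eq minus_add l_distr r_distr l_minus r_minus a_ac)
    then have "(\<one> \<ominus> d' k) \<otimes> x k = (\<one> \<ominus> ?e) \<otimes> ((\<one> \<ominus> d k) \<otimes> x k)"
      using k dc[of k] eC xc[of k] by (simp add: m_assoc)
    also have "\<dots> = (\<one> \<ominus> ?e) \<otimes> (c k n \<otimes> x n) \<oplus> (\<one> \<ominus> ?e) \<otimes> (\<Oplus>l\<in>{..<n}. c k l \<otimes> x l)"
      using k eC xc[of n] cc[of k n] sc[of k] split[of k] by (simp add: r_distr)
    also have "(\<one> \<ominus> ?e) \<otimes> (c k n \<otimes> x n) = c k n \<otimes> (\<Oplus>l\<in>{..<n}. c n l \<otimes> x l)"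
      using k eC xc[of n] cc[of k n] by (simp add: last[symmetric] m_lcomm)
    also have "\<dots> = (\<Oplus>l\<in>{..<n}. c k n \<otimes> (c n l \<otimes> x l))"
      by (rule finsum_rdistr) (use k cc xc in auto)
    also have "(\<one> \<ominus> ?e) \<otimes> (\<Oplus>l\<in>{..<n}. c k l \<otimes> x l) = (\<Oplus>l\<in>{..<n}. (\<one> \<ominus> ?e) \<otimes> (c k l \<otimes> x l))"
      by (rule finsum_rdistr) (use k cc xc eC in auto)
    also have "(\<Oplus>l\<in>{..<n}. c k n \<otimes> (c n l \<otimes> x l)) \<oplus> (\<Oplus>l\<in>{..<n}. (\<one> \<ominus> ?e) \<otimes> (c k l \<otimes> x l)) =
        (\<Oplus>l\<in>{..<n}. c k n \<otimes> (c n l \<otimes> x l) \<oplus> (\<one> \<ominus> ?e) \<otimes> (c k l \<otimes> x l))"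
      by (rule finsum_addf[symmetric]) (use k cc xc eC in auto)
    also have "\<dots> = (\<Oplus>l\<in>{..<n}. c' k l \<otimes> x l)"
    proof (rule finsum_cong')
      fix l assume "l \<in> {..<n}"
      then show "c k n \<otimes> (c n l \<otimes> x l) \<oplus> (\<one> \<ominus> ?e) \<otimes> (c k l \<otimes> x l) = c' k l \<otimes> x l"
        using k cc[of k l] cc[of k n] cc[of n l] xc[of l] eC
        by (simp add: c'_def minus_eq l_distr l_minus m_assoc a_ac)
    qed (use k c'I Ic xc in auto)
    finally show "(\<one> \<ominus> d' k) \<otimes> x k = (\<Oplus>l\<in>{..<n}. c' k l \<otimes> x l)" .
  qed (use xc d'I c'I in auto)
  then obtain a where a: "a \<in> I" "\<And>k. k < n \<Longrightarrow> (\<one> \<ominus> a) \<otimes> x k = \<zero>" by blast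
  note aC = Ic[OF a(1)]
  \<comment> \<open>Chosen so that \<open>\<one> \<ominus> ?a = (\<one> \<ominus> ?e) \<otimes>
    (\<one> \<ominus> a)\<close>. The factor with \<open>a\<close> kills \<open>x k\<close> for
    \<open>k < n\<close>; the factor with \<open>?e\<close> turns \<open>x n\<close> into a
    combination of these, which then dies too.\<close>
  let ?a = "a \<oplus> (?e \<ominus> ?e \<otimes> a)"
  have "?a \<in> I" by (rule add[OF a(1) sub[OF eI mult[OF eI a(1)]]])
  moreover have "(\<one> \<ominus> ?a) \<otimes> x k = \<zero>" if "k < Suc n" for k
  proof -
    have e1: "\<one> \<ominus> ?a = (\<one> \<ominus> ?e) \<otimes> (\<one> \<ominus> a)"
      using aC eC by (simp add: minus_eq minus_add l_distr r_distr l_minus r_minus a_ac)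
    show ?thesis
    proof (cases "k < n")
      case True
      then show ?thesis using a(2)[of k] xc[of k] aC eC unfolding e1 by (simp add: m_assoc)
    next
      case False
      then have k: "k = n" using that by simp
      have "(\<one> \<ominus> ?a) \<otimes> x k = (\<one> \<ominus> a) \<otimes> ((\<one> \<ominus> ?e) \<otimes> x n)"
        unfolding e1 k using aC eC xc[of n] by (simp add: m_ac)
      also have "\<dots> = (\<Oplus>l\<in>{..<n}. (\<one> \<ominus> a) \<otimes> (c n l \<otimes> x l))"
        unfolding last by (rule finsum_rdistr) (use aC cc xc in auto)
      also have "\<dots> = (\<Oplus>l\<in>{..<n}. \<zero>)"
      proof (rule finsum_cong')
        fix l assume "l \<in> {..<n}"
        then show "(\<one> \<ominus> a) \<otimes> (c n l \<otimes> x l) = \<zero>"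
          using aC cc[of n l] xc[of l] a(2)[of l] by (simp add: m_lcomm)
      qed auto
      also have "\<dots> = \<zero>" by simp
      finally show ?thesis .
    qed
  qed
  ultimately show ?case by blast
qed

section \<open>Bimodules\<close>

lemma regular_bimod_simps [simp]:
  "carrier (regular_bimod T) = carrier T"
  "monoid.mult (regular_bimod T) = (\<oplus>\<^bsub>T\<^esub>)"
  "one (regular_bimod T) = \<zero>\<^bsub>T\<^esub>"
  "lmul (regular_bimod T) = (\<otimes>\<^bsub>T\<^esub>)"
  "rmul (regular_bimod T) = (\<otimes>\<^bsub>T\<^esub>)"
  by (simp_all add: regular_bimod_def)

lemma restrict_scalars_simps [simp]:
  "carrier (restrict_scalars i j M) = carrier M"
  "monoid.mult (restrict_scalars i j M) = monoid.mult M"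
  "one (restrict_scalars i j M) = one M"
  "lmul (restrict_scalars i j M) c = lmul M (i c)"
  "rmul (restrict_scalars i j M) m d = rmul M m (j d)"
  by (simp_all add: restrict_scalars_def)

text \<open>Lets the rules for \<open>finprod\<close> and additive maps be applied to sums in a
  ring.\<close>

lemma finprod_regular: "finprod (regular_bimod T) f I = finsum T f I"
  by (simp add: finprod_def finsum_def)

lemma comm_group_regular:
  assumes "ring T" shows "comm_group (regular_bimod T)"
proof -
  interpret ring T by fact
  show ?thesis by (rule comm_group_cong[OF a_comm_group]) auto
qed

lemma bimodule_regular:
  assumes "ring T" shows "bimodule T T (regular_bimod T)"
proof -
  interpret ring T by fact
  interpret M: comm_group "regular_bimod T" by (rule comm_group_regular) fact
  show ?thesis
    by unfold_locales (auto simp: l_distr r_distr m_assoc)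
qed

lemma bimodule_restrict:
  assumes "bimodule A B M" "i \<in> ring_hom C A" "j \<in> ring_hom D B" "ring C" "ring D"
  shows "bimodule C D (restrict_scalars i j M)"
proof -
  interpret bimodule A B M by fact
  interpret C: ring C by fact
  interpret D: ring D by fact
  interpret M': comm_group "restrict_scalars i j M"
    by (rule comm_group_cong[OF M.comm_group_axioms]) auto
  have ic: "\<And>c. c \<in> carrier C \<Longrightarrow> i c \<in> carrier A" and jc: "\<And>c. c \<in> carrier D \<Longrightarrow> j c \<in> carrier B"
    using assms by (auto simp: ring_hom_def)
  show ?thesis
    by unfold_locales
      (simp_all add: ic jc ring_hom_add[OF assms(2)] ring_hom_add[OF assms(3)]
        ring_hom_mult[OF assms(2)] ring_hom_mult[OF assms(3)]
        ring_hom_one[OF assms(2)] ring_hom_one[OF assms(3)]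
        lmul_closed rmul_closed lmul_add_left lmul_add_right rmul_add_left rmul_add_right
        lmul_assoc rmul_assoc lmul_one rmul_one lmul_rmul)
qed

context bimodule begin

lemma lmul_hom: "a \<in> carrier A \<Longrightarrow> lmul M a \<in> hom M M"
  by (simp add: hom_def lmul_closed lmul_add_right)

lemma rmul_hom: "b \<in> carrier B \<Longrightarrow> (\<lambda>m. rmul M m b) \<in> hom M M"
  by (simp add: hom_def rmul_closed rmul_add_left)

lemma lmul_scalar_hom: "m \<in> carrier M \<Longrightarrow> (\<lambda>a. lmul M a m) \<in> hom (regular_bimod A) M"
  by (simp add: hom_def lmul_closed lmul_add_left)

lemma rmul_scalar_hom: "m \<in> carrier M \<Longrightarrow> (\<lambda>a. rmul M m a) \<in> hom (regular_bimod B) M"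
  by (simp add: hom_def rmul_closed rmul_add_right)

lemma lmul_zero [simp]: "a \<in> carrier A \<Longrightarrow> lmul M a \<one>\<^bsub>M\<^esub> = \<one>\<^bsub>M\<^esub>"
  using hom_one[OF lmul_hom] by (simp add: M.is_group)

lemma rmul_zero [simp]: "b \<in> carrier B \<Longrightarrow> rmul M \<one>\<^bsub>M\<^esub> b = \<one>\<^bsub>M\<^esub>"
  using hom_one[OF rmul_hom] by (simp add: M.is_group)

lemma lmul_zero_scalar [simp]: "m \<in> carrier M \<Longrightarrow> lmul M \<zero>\<^bsub>A\<^esub> m = \<one>\<^bsub>M\<^esub>"
  using hom_one[OF lmul_scalar_hom, of m] comm_group_regular[OF A.ring_axioms]
  by (simp add: M.is_group comm_group.axioms)

lemma lmul_finprod: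
  "a \<in> carrier A \<Longrightarrow> f \<in> I \<rightarrow> carrier M \<Longrightarrow>
    lmul M a (finprod M f I) = finprod M (\<lambda>i. lmul M a (f i)) I"
  by (rule hom_finprod[OF M.comm_group_axioms M.comm_group_axioms lmul_hom])

lemma rmul_finprod:
  "a \<in> carrier B \<Longrightarrow> f \<in> I \<rightarrow> carrier M \<Longrightarrow>
    rmul M (finprod M f I) a = finprod M (\<lambda>i. rmul M (f i) a) I"
  by (rule hom_finprod[OF M.comm_group_axioms M.comm_group_axioms rmul_hom])

lemma lmul_finsum:
  "m \<in> carrier M \<Longrightarrow> f \<in> I \<rightarrow> carrier A \<Longrightarrow>
    lmul M (finsum A f I) m = finprod M (\<lambda>i. lmul M (f i) m) I"
  using hom_finprod[OF comm_group_regular[OF A.ring_axioms] M.comm_group_axioms lmul_scalar_hom, of m f I]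
  by (simp add: finprod_regular)

lemma rmul_finsum:
  "m \<in> carrier M \<Longrightarrow> f \<in> I \<rightarrow> carrier B \<Longrightarrow>
    rmul M m (finsum B f I) = finprod M (\<lambda>i. rmul M m (f i)) I"
  using hom_finprod[OF comm_group_regular[OF B.ring_axioms] M.comm_group_axioms rmul_scalar_hom, of m f I]
  by (simp add: finprod_regular)

end

section \<open>Homomorphisms and isomorphisms of bimodules\<close>

lemma bimod_hom_closed: "f \<in> bimod_hom A B M N \<Longrightarrow> m \<in> carrier M \<Longrightarrow> f m \<in> carrier N"
  by (auto simp: bimod_hom_def hom_def)

lemma bimod_hom_hom: "f \<in> bimod_hom A B M N \<Longrightarrow> f \<in> hom M N"
  by (simp add: bimod_hom_def)

lemma bimod_hom_add: "f \<in> bimod_hom A B M N \<Longrightarrow> m \<in> carrier M \<Longrightarrow> m' \<in> carrier M \<Longrightarrow>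
    f (m \<otimes>\<^bsub>M\<^esub> m') = f m \<otimes>\<^bsub>N\<^esub> f m'"
  by (auto simp: bimod_hom_def hom_def)

lemma bimod_hom_lmul: "f \<in> bimod_hom A B M N \<Longrightarrow> a \<in> carrier A \<Longrightarrow> m \<in> carrier M \<Longrightarrow>
    f (lmul M a m) = lmul N a (f m)"
  by (auto simp: bimod_hom_def hom_def)

lemma bimod_hom_rmul: "f \<in> bimod_hom A B M N \<Longrightarrow> b \<in> carrier B \<Longrightarrow> m \<in> carrier M \<Longrightarrow>
    f (rmul M m b) = rmul N (f m) b"
  by (auto simp: bimod_hom_def hom_def)

lemma bimod_homI:
  assumes "\<And>m. m \<in> carrier M \<Longrightarrow> f m \<in> carrier N"
    and "\<And>m m'. m \<in> carrier M \<Longrightarrow> m' \<in> carrier M \<Longrightarrow> f (m \<otimes>\<^bsub>M\<^esub> m') = f m \<otimes>\<^bsub>N\<^esub> f m'"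
    and "\<And>a m. a \<in> carrier A \<Longrightarrow> m \<in> carrier M \<Longrightarrow> f (lmul M a m) = lmul N a (f m)"
    and "\<And>b m. b \<in> carrier B \<Longrightarrow> m \<in> carrier M \<Longrightarrow> f (rmul M m b) = rmul N (f m) b"
  shows "f \<in> bimod_hom A B M N"
  using assms by (auto simp: bimod_hom_def hom_def)

lemma bimod_iso_hom: "f \<in> bimod_iso A B M N \<Longrightarrow> f \<in> bimod_hom A B M N"
  by (simp add: bimod_iso_def)

lemma bimod_iso_bij: "f \<in> bimod_iso A B M N \<Longrightarrow> bij_betw f (carrier M) (carrier N)"
  by (simp add: bimod_iso_def)

lemma bimod_iso_eq_iff:
  "f \<in> bimod_iso A B M N \<Longrightarrow> x \<in> carrier M \<Longrightarrow> y \<in> carrier M \<Longrightarrow> f x = f y \<longleftrightarrow> x = y"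
  by (auto simp: bimod_iso_def bij_betw_def inj_on_def)

lemma bimod_iso_surj: "f \<in> bimod_iso A B M N \<Longrightarrow> y \<in> carrier N \<Longrightarrow> \<exists>x\<in>carrier M. f x = y"
  by (metis bimod_iso_bij bij_betw_imp_surj_on imageE)

lemma bimod_isoI:
  assumes "f \<in> bimod_hom A B M N" "\<And>y. y \<in> carrier N \<Longrightarrow> g y \<in> carrier M"
    "\<And>x. x \<in> carrier M \<Longrightarrow> g (f x) = x" "\<And>y. y \<in> carrier N \<Longrightarrow> f (g y) = y"
  shows "f \<in> bimod_iso A B M N"
  unfolding bimod_iso_def
  using assms by (auto intro!: bij_betwI[where g = g] bimod_hom_closed[OF assms(1)])

lemma bimod_iso_id: "id \<in> bimod_iso A B M M"
  by (auto simp: bimod_iso_def bimod_hom_def hom_def)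

lemma bimod_hom_comp:
  "f \<in> bimod_hom A B M N \<Longrightarrow> g \<in> bimod_hom A B N L \<Longrightarrow> g \<circ> f \<in> bimod_hom A B M L"
  by (auto simp: bimod_hom_def hom_def Pi_iff)

lemma bimod_iso_comp:
  "f \<in> bimod_iso A B M N \<Longrightarrow> g \<in> bimod_iso A B N L \<Longrightarrow> g \<circ> f \<in> bimod_iso A B M L"
  by (auto simp: bimod_iso_def intro: bimod_hom_comp bij_betw_trans)

text \<open>The laws of \<open>M\<close> suffice, since each operation on \<open>N\<close> is the
  image under the bijection of the one on \<open>M\<close>.\<close>

lemma bimod_iso_inv:
  assumes "bimodule A B M" "f \<in> bimod_iso A B M N"
  shows "inv_into (carrier M) f \<in> bimod_iso A B N M"
proof -
  interpret bimodule A B M by fact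
  let ?g = "inv_into (carrier M) f"
  have bij: "bij_betw f (carrier M) (carrier N)" and hom: "f \<in> bimod_hom A B M N"
    using assms(2) by (auto simp: bimod_iso_def)
  have gc: "?g y \<in> carrier M" if "y \<in> carrier N" for y
    using bij that by (metis bij_betw_imp_surj_on inv_into_into)
  have fg: "f (?g y) = y" if "y \<in> carrier N" for y
    using bij that by (metis bij_betw_imp_surj_on f_inv_into_f)
  have gf: "?g (f x) = x" if "x \<in> carrier M" for x
    using bij that by (simp add: bij_betw_def)
  have "?g \<in> bimod_hom A B N M"
  proof (rule bimod_homI)
    fix m m' assume "m \<in> carrier N" "m' \<in> carrier N"
    then show "?g (m \<otimes>\<^bsub>N\<^esub> m') = ?g m \<otimes>\<^bsub>M\<^esub> ?g m'"
      using gf[of "?g m \<otimes>\<^bsub>M\<^esub> ?g m'"] by (simp add: gc fg bimod_hom_add[OF hom])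
  next
    fix a m assume "m \<in> carrier N" "a \<in> carrier A"
    then show "?g (lmul N a m) = lmul M a (?g m)"
      using gf[of "lmul M a (?g m)"] by (simp add: gc fg bimod_hom_lmul[OF hom] lmul_closed)
  next
    fix a m assume "m \<in> carrier N" "a \<in> carrier B"
    then show "?g (rmul N m a) = rmul M (?g m) a"
      using gf[of "rmul M (?g m) a"] by (simp add: gc fg bimod_hom_rmul[OF hom] rmul_closed)
  qed (rule gc)
  then show ?thesis
    by (rule bimod_isoI[where g = f]) (auto simp: gc fg gf bimod_hom_closed[OF hom])
qed

lemma bimod_isomorphic_refl: "bimod_isomorphic A B M M"
  using bimod_iso_id unfolding bimod_isomorphic_def by blast

lemma bimod_isomorphic_sym:
  "bimodule A B M \<Longrightarrow> bimod_isomorphic A B M N \<Longrightarrow> bimod_isomorphic A B N M"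
  using bimod_iso_inv unfolding bimod_isomorphic_def by blast

lemma bimod_isomorphic_trans [trans]:
  "bimod_isomorphic A B M N \<Longrightarrow> bimod_isomorphic A B N L \<Longrightarrow> bimod_isomorphic A B M L"
  using bimod_iso_comp unfolding bimod_isomorphic_def by blast

lemma central_over_iso:
  assumes "bimodule A A M" "f \<in> bimod_iso A A M N" "K \<subseteq> carrier A" "central_over K M"
  shows "central_over K N"
  unfolding central_over_def
proof (intro ballI)
  fix x n assume x: "x \<in> K" and n: "n \<in> carrier N"
  interpret bimodule A A M by fact
  obtain m where m: "m \<in> carrier M" "f m = n" using bimod_iso_surj[OF assms(2) n] by blast
  have "lmul N x n = f (lmul M x m)" "rmul N n x = f (rmul M m x)"
    using bimod_hom_lmul[OF bimod_iso_hom[OF assms(2)], of x m]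
      bimod_hom_rmul[OF bimod_iso_hom[OF assms(2)], of x m] m x assms(3) by auto
  then show "lmul N x n = rmul N n x"
    using assms(4) x m by (simp add: central_over_def)
qed

text \<open>Structure carried along an injection. It moves a bimodule from the carrier type of its
  construction to the type in which classes are formed.\<close>

definition transport :: "('m \<Rightarrow> 'n) \<Rightarrow> ('a, 'b, 'm) bimod \<Rightarrow> ('a, 'b, 'n) bimod" where
  "transport \<kappa> M = (let r = inv_into (carrier M) \<kappa> in
     \<lparr>carrier = \<kappa> ` carrier M, monoid.mult = (\<lambda>x y. \<kappa> (r x \<otimes>\<^bsub>M\<^esub> r y)), one = \<kappa> \<one>\<^bsub>M\<^esub>,
      lmul = (\<lambda>a x. \<kappa> (lmul M a (r x))), rmul = (\<lambda>x b. \<kappa> (rmul M (r x) b))\<rparr>)"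

lemma bimodule_transport:
  assumes "bimodule A B M" "inj_on \<kappa> (carrier M)"
  shows "bimodule A B (transport \<kappa> M)" "\<kappa> \<in> bimod_iso A B M (transport \<kappa> M)"
proof -
  interpret bimodule A B M by fact
  have r [simp]: "inv_into (carrier M) \<kappa> (\<kappa> x) = x" if "x \<in> carrier M" for x
    using assms(2) that by simp
  have car: "carrier (transport \<kappa> M) = \<kappa> ` carrier M" by (simp add: transport_def Let_def)
  note [simp] = lmul_closed rmul_closed
  have eqs [simp]: "\<kappa> x \<otimes>\<^bsub>transport \<kappa> M\<^esub> \<kappa> y = \<kappa> (x \<otimes>\<^bsub>M\<^esub> y)"
    "lmul (transport \<kappa> M) a (\<kappa> x) = \<kappa> (lmul M a x)"
    "rmul (transport \<kappa> M) (\<kappa> x) b = \<kappa> (rmul M x b)"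
    if "x \<in> carrier M" "y \<in> carrier M" for x y a b
    using that by (simp_all add: transport_def Let_def)
  have [simp]: "\<one>\<^bsub>transport \<kappa> M\<^esub> = \<kappa> \<one>\<^bsub>M\<^esub>" by (simp add: transport_def Let_def)
  interpret K: comm_group "transport \<kappa> M"
    by (rule comm_groupI)
      (auto simp: car M.m_ac intro!: bexI[of _ "inv\<^bsub>M\<^esub> _"])
  show "bimodule A B (transport \<kappa> M)"
    by unfold_locales (auto simp: car lmul_add_left lmul_add_right rmul_add_left rmul_add_right
        lmul_assoc rmul_assoc lmul_one rmul_one lmul_rmul)
  have "\<kappa> \<in> bimod_hom A B M (transport \<kappa> M)"
    by (rule bimod_homI) (auto simp: car)
  then show "\<kappa> \<in> bimod_iso A B M (transport \<kappa> M)"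
    using assms(2) by (auto simp: bimod_iso_def bij_betw_def car)
qed

section \<open>Tensor products\<close>

definition balanced ::
  "('t, 'z) ring_scheme \<Rightarrow> ('a, 't, 'm) bimod \<Rightarrow> ('t, 'b, 'n) bimod \<Rightarrow> ('k, 'c) monoid_scheme
     \<Rightarrow> ('m \<Rightarrow> 'n \<Rightarrow> 'k) \<Rightarrow> bool" where
  "balanced T M N K b \<longleftrightarrow>
     (\<forall>m\<in>carrier M. \<forall>n\<in>carrier N. b m n \<in> carrier K) \<and>
     (\<forall>m\<in>carrier M. \<forall>m'\<in>carrier M. \<forall>n\<in>carrier N. b (m \<otimes>\<^bsub>M\<^esub> m') n = b m n \<otimes>\<^bsub>K\<^esub> b m' n) \<and>
     (\<forall>m\<in>carrier M. \<forall>n\<in>carrier N. \<forall>n'\<in>carrier N. b m (n \<otimes>\<^bsub>N\<^esub> n') = b m n \<otimes>\<^bsub>K\<^esub> b m n') \<and>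
     (\<forall>m\<in>carrier M. \<forall>t\<in>carrier T. \<forall>n\<in>carrier N. b (rmul M m t) n = b m (lmul N t n))"

lemma balancedI:
  assumes "\<And>m n. m \<in> carrier M \<Longrightarrow> n \<in> carrier N \<Longrightarrow> b m n \<in> carrier K"
    and "\<And>m m' n. m \<in> carrier M \<Longrightarrow> m' \<in> carrier M \<Longrightarrow> n \<in> carrier N \<Longrightarrow>
           b (m \<otimes>\<^bsub>M\<^esub> m') n = b m n \<otimes>\<^bsub>K\<^esub> b m' n"
    and "\<And>m n n'. m \<in> carrier M \<Longrightarrow> n \<in> carrier N \<Longrightarrow> n' \<in> carrier N \<Longrightarrow>
           b m (n \<otimes>\<^bsub>N\<^esub> n') = b m n \<otimes>\<^bsub>K\<^esub> b m n'"
    and "\<And>m t n. m \<in> carrier M \<Longrightarrow> t \<in> carrier T \<Longrightarrow> n \<in> carrier N \<Longrightarrow>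
           b (rmul M m t) n = b m (lmul N t n)"
  shows "balanced T M N K b"
  using assms by (simp add: balanced_def)

lemma balancedD:
  assumes "balanced T M N K b" "m \<in> carrier M" "n \<in> carrier N"
  shows "b m n \<in> carrier K"
    and "m' \<in> carrier M \<Longrightarrow> b (m \<otimes>\<^bsub>M\<^esub> m') n = b m n \<otimes>\<^bsub>K\<^esub> b m' n"
    and "n' \<in> carrier N \<Longrightarrow> b m (n \<otimes>\<^bsub>N\<^esub> n') = b m n \<otimes>\<^bsub>K\<^esub> b m n'"
    and "t \<in> carrier T \<Longrightarrow> b (rmul M m t) n = b m (lmul N t n)"
  using assms by (simp_all add: balanced_def)

lemma free_Abelian_hom_eq:
  assumes "group K" "f \<in> hom (free_Abelian_group X) K" "g \<in> hom (free_Abelian_group X) K"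
    and "\<And>x. x \<in> X \<Longrightarrow> f (frag_of x) = g (frag_of x)" "Poly_Mapping.keys c \<subseteq> X"
  shows "f c = g c"
proof -
  interpret f: group_hom "free_Abelian_group X" K f
    using assms by (simp add: group_hom_def group_hom_axioms_def)
  interpret g: group_hom "free_Abelian_group X" K g
    using assms by (simp add: group_hom_def group_hom_axioms_def)
  show ?thesis
    using assms(5)
  proof (induction rule: free_Abelian_group_induct[consumes 1, case_names zero diff single])
    case zero
    then show ?case using f.hom_one g.hom_one by simp
  next
    case (diff x y)
    have "f (x + (- y)) = f x \<otimes>\<^bsub>K\<^esub> inv\<^bsub>K\<^esub> f y" "g (x + (- y)) = g x \<otimes>\<^bsub>K\<^esub> inv\<^bsub>K\<^esub> g y"
      using f.hom_mult[of x "- y"] g.hom_mult[of x "- y"] f.hom_inv[of y] g.hom_inv[of y] diff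
      by simp_all
    then show ?case using diff by simp
  next
    case (single a)
    then show ?case using assms by simp
  qed
qed

locale tensor_pair = M: bimodule A T M + N: bimodule T B N
  for A :: "('a, 'x) ring_scheme" and T :: "('t, 'y) ring_scheme" and B :: "('b, 'z) ring_scheme"
    and M :: "('a, 't, 'm) bimod" and N :: "('t, 'b, 'n) bimod"
begin

abbreviation "F \<equiv> tens_free M N"
abbreviation "J \<equiv> tens_ker T M N"
abbreviation "X \<equiv> tensor T M N"
abbreviation "pure \<equiv> pure_tensor T M N"

lemma F_simps [simp]:
  "x \<in> carrier F \<longleftrightarrow> Poly_Mapping.keys x \<subseteq> carrier M \<times> carrier N"
  "x \<otimes>\<^bsub>F\<^esub> y = x + y" "\<one>\<^bsub>F\<^esub> = 0"
  by (simp_all add: tens_free_def)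

sublocale F: comm_group F
  by (simp add: tens_free_def abelian_free_Abelian_group)

lemma keys_rel: "r \<in> tens_rel T M N \<Longrightarrow> r \<in> carrier F"
  unfolding tens_rel_def F_simps
  by (auto dest!: subsetD[OF keys_diff] subsetD[OF keys_add] simp: M.rmul_closed N.lmul_closed)

lemma subgroup_J: "subgroup J F"
  unfolding tens_ker_def by (rule F.generate_is_subgroup) (use keys_rel in blast)

lemma normal_J: "J \<lhd> F"
  using subgroup_J by (simp add: F.normal_iff_subgroup)

lemma X_eqs: "carrier X = carrier (F Mod J)" "monoid.mult X = monoid.mult (F Mod J)"
  "one X = one (F Mod J)"
  by (simp_all add: tensor_def Let_def)

sublocale X: comm_group X
  by (rule comm_group_cong[OF F.abelian_FactGroup[OF subgroup_J]]) (simp_all add: X_eqs)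

lemma coset_hom: "(\<lambda>c. J #>\<^bsub>F\<^esub> c) \<in> hom F X"
  using normal.r_coset_hom_Mod[OF normal_J] by (simp add: hom_def X_eqs)

lemma carrier_X: "carrier X = (\<lambda>c. J #>\<^bsub>F\<^esub> c) ` carrier F"
  by (simp add: X_eqs carrier_FactGroup)

lemma coset_rel:
  assumes "r \<in> tens_rel T M N" "r = x - y" "x \<in> carrier F" "y \<in> carrier F"
  shows "J #>\<^bsub>F\<^esub> x = J #>\<^bsub>F\<^esub> y"
proof -
  have r: "r \<in> carrier F" "r \<in> J"
    using assms(1) keys_rel by (auto simp: tens_ker_def intro: generate.incl)
  have "J #>\<^bsub>F\<^esub> x = J #>\<^bsub>F\<^esub> (r \<otimes>\<^bsub>F\<^esub> y)"
    using assms(2) by simp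
  also have "\<dots> = (J #>\<^bsub>F\<^esub> r) \<otimes>\<^bsub>X\<^esub> (J #>\<^bsub>F\<^esub> y)"
    by (rule hom_mult[OF coset_hom r(1) assms(4)])
  also have "J #>\<^bsub>F\<^esub> r = \<one>\<^bsub>X\<^esub>"
    using F.coset_join2[OF r(1) subgroup_J r(2)] by (simp add: X_eqs)
  finally show ?thesis
    using hom_in_carrier[OF coset_hom] assms(4) by simp
qed

lemma pure_closed [simp]:
  "m \<in> carrier M \<Longrightarrow> n \<in> carrier N \<Longrightarrow> pure m n \<in> carrier X"
  using hom_in_carrier[OF coset_hom] by (simp add: pure_tensor_def)

lemma tens_relI:
  "m \<in> carrier M \<Longrightarrow> m' \<in> carrier M \<Longrightarrow> n \<in> carrier N \<Longrightarrow>
    frag_of (m \<otimes>\<^bsub>M\<^esub> m', n) - (frag_of (m, n) + frag_of (m', n)) \<in> tens_rel T M N"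
  "m \<in> carrier M \<Longrightarrow> n \<in> carrier N \<Longrightarrow> n' \<in> carrier N \<Longrightarrow>
    frag_of (m, n \<otimes>\<^bsub>N\<^esub> n') - (frag_of (m, n) + frag_of (m, n')) \<in> tens_rel T M N"
  "m \<in> carrier M \<Longrightarrow> t \<in> carrier T \<Longrightarrow> n \<in> carrier N \<Longrightarrow>
    frag_of (rmul M m t, n) - frag_of (m, lmul N t n) \<in> tens_rel T M N"
  unfolding tens_rel_def by blast+

lemma F_hom_eq:
  "group K \<Longrightarrow> f \<in> hom F K \<Longrightarrow> g \<in> hom F K \<Longrightarrow>
    (\<And>x. x \<in> carrier M \<times> carrier N \<Longrightarrow> f (frag_of x) = g (frag_of x)) \<Longrightarrow> c \<in> carrier F \<Longrightarrow> f c = g c"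
  using free_Abelian_hom_eq[of K f "carrier M \<times> carrier N" g c] by (simp add: tens_free_def)

lemma frag_pair_closed: "m \<in> carrier M \<Longrightarrow> n \<in> carrier N \<Longrightarrow> frag_of (m, n) \<in> carrier F"
  by simp

lemma pure_balanced: "balanced T M N X pure"
proof (rule balancedI)
  fix m m' n assume *: "m \<in> carrier M" "m' \<in> carrier M" "n \<in> carrier N"
  have "pure (m \<otimes>\<^bsub>M\<^esub> m') n = J #>\<^bsub>F\<^esub> (frag_of (m, n) \<otimes>\<^bsub>F\<^esub> frag_of (m', n))"
    unfolding pure_tensor_def
  proof (rule coset_rel[OF tens_relI(1)[OF *]])
    show "frag_of (m, n) \<otimes>\<^bsub>F\<^esub> frag_of (m', n) \<in> carrier F"
      by (intro F.m_closed frag_pair_closed *)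
  qed (use * in simp_all)
  then show "pure (m \<otimes>\<^bsub>M\<^esub> m') n = pure m n \<otimes>\<^bsub>X\<^esub> pure m' n"
    unfolding pure_tensor_def by (simp add: * hom_mult[OF coset_hom] del: F_simps(2))
next
  fix m n n' assume *: "m \<in> carrier M" "n \<in> carrier N" "n' \<in> carrier N"
  have "pure m (n \<otimes>\<^bsub>N\<^esub> n') = J #>\<^bsub>F\<^esub> (frag_of (m, n) \<otimes>\<^bsub>F\<^esub> frag_of (m, n'))"
    unfolding pure_tensor_def
  proof (rule coset_rel[OF tens_relI(2)[OF *]])
    show "frag_of (m, n) \<otimes>\<^bsub>F\<^esub> frag_of (m, n') \<in> carrier F"
      by (intro F.m_closed frag_pair_closed *)
  qed (use * in simp_all)
  then show "pure m (n \<otimes>\<^bsub>N\<^esub> n') = pure m n \<otimes>\<^bsub>X\<^esub> pure m n'"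
    unfolding pure_tensor_def by (simp add: * hom_mult[OF coset_hom] del: F_simps(2))
next
  fix m t n assume *: "m \<in> carrier M" "t \<in> carrier T" "n \<in> carrier N"
  show "pure (rmul M m t) n = pure m (lmul N t n)"
    unfolding pure_tensor_def
    by (rule coset_rel[OF tens_relI(3)[OF *] refl])
      (use * in \<open>simp_all add: M.rmul_closed N.lmul_closed\<close>)
qed simp

lemmas pure_add_left = balancedD(2)[OF pure_balanced]
lemmas pure_add_right = balancedD(3)[OF pure_balanced]
lemmas pure_middle = balancedD(4)[OF pure_balanced]

lemma pure_left_hom: "n \<in> carrier N \<Longrightarrow> (\<lambda>m. pure m n) \<in> hom M X"
  by (simp add: hom_def pure_add_left)

lemma pure_right_hom: "m \<in> carrier M \<Longrightarrow> pure m \<in> hom N X"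
  by (simp add: hom_def pure_add_right)

lemma pure_zero_right [simp]: "m \<in> carrier M \<Longrightarrow> pure m \<one>\<^bsub>N\<^esub> = \<one>\<^bsub>X\<^esub>"
  using hom_one[OF pure_right_hom] by (simp add: N.M.is_group X.is_group)

lemma pure_inv: "m \<in> carrier M \<Longrightarrow> n \<in> carrier N \<Longrightarrow> pure (inv\<^bsub>M\<^esub> m) n = inv\<^bsub>X\<^esub> (pure m n)"
  using group_hom.hom_inv[of M X "\<lambda>m. pure m n" m] pure_left_hom[of n]
  by (simp add: group_hom_def group_hom_axioms_def M.M.is_group X.is_group)

text \<open>Zero is itself a pure tensor and the negative of m \<otimes> n is (-m) \<otimes> n, so
  pure tensors and sums are the only cases.\<close>

lemma induct [consumes 1, case_names pure add]:
  assumes "x \<in> carrier X"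
    and pure: "\<And>m n. m \<in> carrier M \<Longrightarrow> n \<in> carrier N \<Longrightarrow> P (pure m n)"
    and add: "\<And>x y. x \<in> carrier X \<Longrightarrow> y \<in> carrier X \<Longrightarrow> P x \<Longrightarrow> P y \<Longrightarrow> P (x \<otimes>\<^bsub>X\<^esub> y)"
  shows "P x"
proof -
  let ?q = "\<lambda>c. J #>\<^bsub>F\<^esub> c"
  have qc: "?q c \<in> carrier X" if "c \<in> carrier F" for c
    using hom_in_carrier[OF coset_hom] that by blast
  obtain c where c: "x = ?q c" "Poly_Mapping.keys c \<subseteq> carrier M \<times> carrier N"
    using assms(1) by (auto simp: carrier_X)
  have inv: "?q (- c) = inv\<^bsub>X\<^esub> ?q c" if "c \<in> carrier F" for c
  proof -
    have "?q (c \<otimes>\<^bsub>F\<^esub> (- c)) = ?q c \<otimes>\<^bsub>X\<^esub> ?q (- c)"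
      by (rule hom_mult[OF coset_hom]) (use that in auto)
    moreover have "?q (c \<otimes>\<^bsub>F\<^esub> (- c)) = \<one>\<^bsub>X\<^esub>"
      using hom_one[OF coset_hom F.is_group X.is_group] by simp
    ultimately show ?thesis
      using qc[of c] qc[of "-c"] that by (metis F_simps(1) X.inv_equality X.m_comm keys_minus)
  qed
  \<comment> \<open>The induction on the free abelian group proceeds by differences; treating a
    coset together with its inverse turns a difference into a sum.\<close>
  have "P (?q c) \<and> P (inv\<^bsub>X\<^esub> ?q c)"
    using c(2)
  proof (induction rule: free_Abelian_group_induct[consumes 1, case_names zero diff single])
    case zero
    have "P (pure \<one>\<^bsub>M\<^esub> \<one>\<^bsub>N\<^esub>)" by (rule pure) auto
    moreover have "?q 0 = \<one>\<^bsub>X\<^esub>"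
      using hom_one[OF coset_hom F.is_group X.is_group] by simp
    ultimately show ?case by simp
  next
    case (diff x y)
    then have xy: "x \<in> carrier F" "y \<in> carrier F" "- y \<in> carrier F" by auto
    have "?q (x - y) = ?q x \<otimes>\<^bsub>X\<^esub> inv\<^bsub>X\<^esub> ?q y"
      using hom_mult[OF coset_hom xy(1,3)] inv[OF xy(2)] by simp
    moreover from this have "inv\<^bsub>X\<^esub> ?q (x - y) = inv\<^bsub>X\<^esub> ?q x \<otimes>\<^bsub>X\<^esub> ?q y"
      using qc xy by (simp add: X.inv_mult)
    ultimately show ?case
      using diff qc[OF xy(1)] qc[OF xy(2)] by (auto intro!: add)
  next
    case (single a)
    then obtain m n where a: "a = (m, n)" "m \<in> carrier M" "n \<in> carrier N" by auto
    then have "P (pure m n)" "P (pure (inv\<^bsub>M\<^esub> m) n)" by (auto intro!: pure)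
    then show ?case using a by (simp add: pure_inv) (simp add: pure_tensor_def)
  qed
  then show ?thesis using c by simp
qed

lemma pures_in: "{pure m n | m n. m \<in> carrier M \<and> n \<in> carrier N} \<subseteq> carrier X"
  by auto

lemma carrier_sums_of: "carrier X = sums_of X {pure m n | m n. m \<in> carrier M \<and> n \<in> carrier N}"
proof
  show "carrier X \<subseteq> sums_of X {pure m n | m n. m \<in> carrier M \<and> n \<in> carrier N}"
  proof
    fix x assume "x \<in> carrier X"
    then show "x \<in> sums_of X {pure m n | m n. m \<in> carrier M \<and> n \<in> carrier N}"
    proof (induction rule: induct)
      case (pure m n)
      then show ?case by (intro X.sums_of_incl[OF _ pures_in]) auto
    qed (auto intro: X.sums_of_mult[OF _ _ pures_in])
  qed
qed (rule X.sums_of_closed[OF pures_in])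

lemma finite_sum:
  assumes "x \<in> carrier X"
  obtains k :: nat and u v where "\<And>i. i < k \<Longrightarrow> u i \<in> carrier M" "\<And>i. i < k \<Longrightarrow> v i \<in> carrier N"
    "x = finprod X (\<lambda>i. pure (u i) (v i)) {..<k}"
proof -
  obtain w and k :: nat where w: "x = finprod X w {..<k}"
      "w \<in> {..<k} \<rightarrow> {pure m n | m n. m \<in> carrier M \<and> n \<in> carrier N}"
    using assms unfolding carrier_sums_of sums_of_def by blast
  then have "\<forall>i<k. \<exists>m n. w i = pure m n \<and> m \<in> carrier M \<and> n \<in> carrier N"
    by (simp add: Pi_iff)
  then obtain u v where uv: "\<forall>i<k. w i = pure (u i) (v i) \<and> u i \<in> carrier M \<and> v i \<in> carrier N"
    by metis
  have "x = finprod X (\<lambda>i. pure (u i) (v i)) {..<k}"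
    unfolding w(1) by (rule X.finprod_cong) (use uv in \<open>auto simp: simp_implies_def\<close>)
  then show thesis using uv that by blast
qed

lemma hom_eqI:
  assumes "f \<in> hom X K" "g \<in> hom X K" "x \<in> carrier X"
    and "\<And>m n. m \<in> carrier M \<Longrightarrow> n \<in> carrier N \<Longrightarrow> f (pure m n) = g (pure m n)"
  shows "f x = g x"
  using assms(3) by (induction rule: induct) (auto simp: assms(4) hom_mult[OF assms(1)] hom_mult[OF assms(2)])

text \<open>Universal property: the map defined on the free abelian group kills
  \<open>tens_rel\<close>, hence the subgroup \<open>J\<close> generated by it, and factors through
  the quotient.\<close>

lemma lift_ex:
  assumes "comm_group K" "balanced T M N K b"
  shows "\<exists>f \<in> hom X K. \<forall>m\<in>carrier M. \<forall>n\<in>carrier N. f (pure m n) = b m n"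
proof -
  interpret K: comm_group K by fact
  have "(\<lambda>(m, n). b m n) ` (carrier M \<times> carrier N) \<subseteq> carrier K"
    using balancedD(1)[OF assms(2)] by auto
  then obtain h where h: "h \<in> hom F K"
    "\<And>x. x \<in> carrier M \<times> carrier N \<Longrightarrow> h (frag_of x) = (case x of (m, n) \<Rightarrow> b m n)"
    using K.free_Abelian_group_universal unfolding tens_free_def by metis
  interpret h: group_hom F K h
    using h by (simp add: group_hom_def group_hom_axioms_def F.is_group K.is_group)
  have diff: "h (x - y) = \<one>\<^bsub>K\<^esub>" if "x \<in> carrier F" "y \<in> carrier F" "h x = h y" for x y
  proof -
    have xy: "x - y \<in> carrier F"
      using that keys_diff[of x y] by auto
    have "h (x - y) \<otimes>\<^bsub>K\<^esub> h y = \<one>\<^bsub>K\<^esub> \<otimes>\<^bsub>K\<^esub> h y"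
      using h.hom_mult[OF xy that(2)] that(3) h.hom_closed[OF that(2)] by simp
    then show ?thesis
      using K.right_cancel[of "h y" "h (x - y)" "\<one>\<^bsub>K\<^esub>"] h.hom_closed[OF xy] h.hom_closed[OF that(2)]
      by blast
  qed
  have add: "h (frag_of p + frag_of q) = h (frag_of p) \<otimes>\<^bsub>K\<^esub> h (frag_of q)"
      "frag_of p + frag_of q \<in> carrier F"
    if "p \<in> carrier M \<times> carrier N" "q \<in> carrier M \<times> carrier N" for p q
    using h.hom_mult[of "frag_of p" "frag_of q"] that keys_add[of "frag_of p" "frag_of q"] by auto
  note bD = balancedD[OF assms(2)]
  have rel: "h r = \<one>\<^bsub>K\<^esub>" if "r \<in> tens_rel T M N" for r
    using that unfolding tens_rel_def
  proof (elim UnE CollectE exE conjE)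
    fix m m' n assume "r = frag_of (m \<otimes>\<^bsub>M\<^esub> m', n) - (frag_of (m, n) + frag_of (m', n))"
      "m \<in> carrier M" "m' \<in> carrier M" "n \<in> carrier N"
    then show ?thesis using add[of "(m, n)" "(m', n)"] by (auto intro!: diff simp: h bD)
  next
    fix m n n' assume "r = frag_of (m, n \<otimes>\<^bsub>N\<^esub> n') - (frag_of (m, n) + frag_of (m, n'))"
      "m \<in> carrier M" "n \<in> carrier N" "n' \<in> carrier N"
    then show ?thesis using add[of "(m, n)" "(m, n')"] by (auto intro!: diff simp: h bD)
  next
    fix m t n assume "r = frag_of (rmul M m t, n) - frag_of (m, lmul N t n)"
      "m \<in> carrier M" "t \<in> carrier T" "n \<in> carrier N"
    then show ?thesis by (auto intro!: diff simp: h bD M.rmul_closed N.lmul_closed)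
  qed
  have "J \<subseteq> kernel F K h"
    unfolding tens_ker_def
    by (rule F.generate_subgroup_incl[OF _ h.subgroup_kernel])
      (use rel keys_rel in \<open>auto simp: kernel_def\<close>)
  then have "h x = h y" if "x \<in> carrier F" "y \<in> carrier F" "J #>\<^bsub>F\<^esub> x = J #>\<^bsub>F\<^esub> y" for x y
  proof -
    have "x \<in> J #>\<^bsub>F\<^esub> y" using F.rcos_self[OF that(1) subgroup_J] that by simp
    then obtain j where j: "j \<in> J" "x = j \<otimes>\<^bsub>F\<^esub> y" by (auto simp: r_coset_def)
    then have jF: "j \<in> carrier F" "h j = \<one>\<^bsub>K\<^esub>"
      using \<open>J \<subseteq> kernel F K h\<close> by (auto simp: kernel_def)
    then have "h x = h j \<otimes>\<^bsub>K\<^esub> h y" unfolding j(2) using that(2) by (intro h.hom_mult)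
    then show ?thesis using jF h.hom_closed[OF that(2)] by simp
  qed
  then obtain g where g: "g \<in> hom (F Mod J) K" "\<And>x. x \<in> carrier F \<Longrightarrow> g (J #>\<^bsub>F\<^esub> x) = h x"
    using FactGroup_universal[OF h(1) normal_J] by blast
  have "g \<in> hom X K" using g(1) by (simp add: hom_def X_eqs)
  then show ?thesis
    by (intro bexI[of _ g]) (simp_all add: pure_tensor_def g(2) h(2))
qed

end

text \<open>A lift is determined only on the carrier of the tensor product, its other values being
  arbitrary; hence a choice with \<open>SOME\<close> instead of a unique description.\<close>

definition tlift ::
  "('t, 'z) ring_scheme \<Rightarrow> ('a, 't, 'm) bimod \<Rightarrow> ('t, 'b, 'n) bimod \<Rightarrow> ('k, 'c) monoid_scheme
     \<Rightarrow> ('m \<Rightarrow> 'n \<Rightarrow> 'k) \<Rightarrow> (('m \<times> 'n) \<Rightarrow>\<^sub>0 int) set \<Rightarrow> 'k" where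
  "tlift T M N K b = (SOME f. f \<in> hom (tensor T M N) K \<and>
     (\<forall>m\<in>carrier M. \<forall>n\<in>carrier N. f (pure_tensor T M N m n) = b m n))"

section \<open>Induced maps and the bimodule structure of the tensor product\<close>

context tensor_pair begin

lemma
  assumes "comm_group K" "balanced T M N K b"
  shows tlift_hom: "tlift T M N K b \<in> hom X K"
    and tlift_pure: "\<And>m n. m \<in> carrier M \<Longrightarrow> n \<in> carrier N \<Longrightarrow> tlift T M N K b (pure m n) = b m n"
proof -
  have "\<exists>f. f \<in> hom X K \<and> (\<forall>m\<in>carrier M. \<forall>n\<in>carrier N. f (pure m n) = b m n)"
    using lift_ex[OF assms] by blast
  from someI_ex[OF this] show "tlift T M N K b \<in> hom X K"
    "\<And>m n. m \<in> carrier M \<Longrightarrow> n \<in> carrier N \<Longrightarrow> tlift T M N K b (pure m n) = b m n"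
    unfolding tlift_def by blast+
qed

text \<open>\<open>tens_map\<close> works on representatives. It agrees on generators of the free
  group with the lift \<open>g\<close> from the universal property, so the coset computed from a
  representative depends only on \<open>C\<close>, and the union in the definition has a single
  value.\<close>

lemma tens_map:
  assumes t1: "tensor_pair A1 T1 B1 M1 N1"
    and h: "\<And>m n. m \<in> carrier M1 \<Longrightarrow> n \<in> carrier N1 \<Longrightarrow> h (m, n) \<in> carrier M \<times> carrier N"
    and bal: "balanced T1 M1 N1 X (\<lambda>m n. pure (fst (h (m, n))) (snd (h (m, n))))"
  shows tens_map_hom: "tens_map T M N h \<in> hom (tensor T1 M1 N1) X"
    and tens_map_pure: "\<And>m n. m \<in> carrier M1 \<Longrightarrow> n \<in> carrier N1 \<Longrightarrow>
      tens_map T M N h (pure_tensor T1 M1 N1 m n) = pure (fst (h (m, n))) (snd (h (m, n)))"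
proof -
  interpret P: tensor_pair A1 T1 B1 M1 N1 by fact
  let ?E = "frag_extend (\<lambda>z. frag_of (h z)) :: _ \<Rightarrow> ('m \<times> 'n) \<Rightarrow>\<^sub>0 int"
  obtain g where g: "g \<in> hom P.X X" "\<forall>m\<in>carrier M1. \<forall>n\<in>carrier N1. g (P.pure m n) =
      pure (fst (h (m, n))) (snd (h (m, n)))"
    using P.lift_ex[OF X.comm_group_axioms bal] by blast
  have EF: "?E c \<in> carrier F" if "c \<in> carrier P.F" for c
  proof -
    have "h z \<in> carrier M \<times> carrier N" if "z \<in> Poly_Mapping.keys c" for z
      using that \<open>c \<in> carrier P.F\<close> h[of "fst z" "snd z"] by auto
    then show ?thesis using keys_frag_extend[of "\<lambda>z. frag_of (h z)" c] by force
  qed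
  have "?E \<in> hom P.F F"
    by (rule homI) (use EF in \<open>auto simp: frag_extend_add\<close>)
  then have H: "(\<lambda>c. J #>\<^bsub>F\<^esub> ?E c) \<in> hom P.F X"
    using hom_compose[OF _ coset_hom] by (fastforce simp: comp_def)
  have gH: "(\<lambda>c. g (P.J #>\<^bsub>P.F\<^esub> c)) \<in> hom P.F X"
    using hom_compose[OF P.coset_hom g(1)] by (simp add: comp_def)
  have eq: "J #>\<^bsub>F\<^esub> ?E c = g (P.J #>\<^bsub>P.F\<^esub> c)" if "c \<in> carrier P.F" for c
  proof (rule P.F_hom_eq[OF X.is_group H gH _ that])
    fix x assume "x \<in> carrier M1 \<times> carrier N1"
    then show "J #>\<^bsub>F\<^esub> ?E (frag_of x) = g (P.J #>\<^bsub>P.F\<^esub> frag_of x)"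
      using g(2) by (auto simp: pure_tensor_def)
  qed
  have map: "tens_map T M N h C = g C" if C: "C \<in> carrier P.X" for C
  proof -
    obtain c where c: "c \<in> carrier P.F" "C = P.J #>\<^bsub>P.F\<^esub> c" using C by (auto simp: P.carrier_X)
    have sub: "C \<subseteq> carrier P.F"
      unfolding c(2) using c(1) P.F.r_coset_subset_G subgroup.subset[OF P.subgroup_J] by blast
    have "J #>\<^bsub>F\<^esub> ?E c' = g C" if "c' \<in> C" for c'
      using eq[of c'] that sub P.F.repr_independence[OF _ c(1) P.subgroup_J] c(2) by auto
    moreover have "c \<in> C" using P.F.rcos_self[OF c(1) P.subgroup_J] c(2) by simp
    ultimately show ?thesis unfolding tens_map_def by blast
  qed
  show "tens_map T M N h \<in> hom (tensor T1 M1 N1) X"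
    using g(1) by (auto simp: hom_def map Pi_iff)
  show "tens_map T M N h (pure_tensor T1 M1 N1 m n) = pure (fst (h (m, n))) (snd (h (m, n)))"
    if "m \<in> carrier M1" "n \<in> carrier N1" for m n
    using g(2) that by (simp add: map)
qed

lemma tensor_lmul: "lmul X a = tens_map T M N (\<lambda>(m, n). (lmul M a m, n))"
  by (simp add: tensor_def Let_def)

lemma tensor_rmul: "rmul X C b = tens_map T M N (\<lambda>(m, n). (m, rmul N n b)) C"
  by (simp add: tensor_def Let_def)

lemma
  assumes a: "a \<in> carrier A"
  shows lmul_hom: "lmul X a \<in> hom X X"
    and lmul_pure [simp]: "\<And>m n. m \<in> carrier M \<Longrightarrow> n \<in> carrier N \<Longrightarrow>
      lmul X a (pure m n) = pure (lmul M a m) n"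
proof -
  have "balanced T M N X (\<lambda>m n. pure (lmul M a m) n)"
    by (rule balancedI) (use a in \<open>auto simp: M.lmul_closed M.lmul_add_right pure_add_left
        pure_add_right M.lmul_rmul[symmetric] pure_middle\<close>)
  then have bal: "balanced T M N X (\<lambda>m n. pure (fst ((\<lambda>(m, n). (lmul M a m, n)) (m, n)))
      (snd ((\<lambda>(m, n). (lmul M a m, n)) (m, n))))"
    by simp
  show "lmul X a \<in> hom X X"
    unfolding tensor_lmul
    by (rule tens_map_hom[OF tensor_pair_axioms _ bal]) (use a in \<open>auto simp: M.lmul_closed\<close>)
  show "lmul X a (pure m n) = pure (lmul M a m) n" if "m \<in> carrier M" "n \<in> carrier N" for m n
    unfolding tensor_lmul
    by (subst tens_map_pure[OF tensor_pair_axioms _ bal]) (use a that in \<open>auto simp: M.lmul_closed\<close>)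
qed

lemma
  assumes b: "b \<in> carrier B"
  shows rmul_hom: "(\<lambda>x. rmul X x b) \<in> hom X X"
    and rmul_pure [simp]: "\<And>m n. m \<in> carrier M \<Longrightarrow> n \<in> carrier N \<Longrightarrow>
      rmul X (pure m n) b = pure m (rmul N n b)"
proof -
  have "balanced T M N X (\<lambda>m n. pure m (rmul N n b))"
    by (rule balancedI) (use b in \<open>auto simp: N.rmul_closed N.rmul_add_left pure_add_left
        pure_add_right N.lmul_rmul pure_middle\<close>)
  then have bal: "balanced T M N X (\<lambda>m n. pure (fst ((\<lambda>(m, n). (m, rmul N n b)) (m, n)))
      (snd ((\<lambda>(m, n). (m, rmul N n b)) (m, n))))"
    by simp
  show "(\<lambda>x. rmul X x b) \<in> hom X X"
    unfolding tensor_rmul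
    by (rule tens_map_hom[OF tensor_pair_axioms _ bal]) (use b in \<open>auto simp: N.rmul_closed\<close>)
  show "rmul X (pure m n) b = pure m (rmul N n b)" if "m \<in> carrier M" "n \<in> carrier N" for m n
    unfolding tensor_rmul
    by (subst tens_map_pure[OF tensor_pair_axioms _ bal]) (use b that in \<open>auto simp: N.rmul_closed\<close>)
qed


text \<open>With \<open>u\<close> and \<open>v\<close> scalar actions, this tests the linearity of a
  map out of a tensor product on pure tensors.\<close>

lemma equivariant:
  assumes "f \<in> hom X K" "u \<in> hom X X" "v \<in> hom K K" "x \<in> carrier X"
    and "\<And>m n. m \<in> carrier M \<Longrightarrow> n \<in> carrier N \<Longrightarrow> f (u (pure m n)) = v (f (pure m n))"
  shows "f (u x) = v (f x)"
proof -
  have "(\<lambda>x. f (u x)) \<in> hom X K" "(\<lambda>x. v (f x)) \<in> hom X K"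
    using assms(1-3) by (auto simp: hom_def Pi_iff)
  from hom_eqI[OF this assms(4)] show ?thesis using assms(5) by simp
qed

lemma tensor_bimodule: "bimodule A B X"
proof -
  have lc: "lmul X a x \<in> carrier X" if "a \<in> carrier A" "x \<in> carrier X" for a x
    using hom_in_carrier[OF lmul_hom] that by blast
  have rc: "rmul X x b \<in> carrier X" if "b \<in> carrier B" "x \<in> carrier X" for b x
    using hom_in_carrier[OF rmul_hom] that by blast
  have la: "lmul X a (x \<otimes>\<^bsub>X\<^esub> y) = lmul X a x \<otimes>\<^bsub>X\<^esub> lmul X a y"
    if "a \<in> carrier A" "x \<in> carrier X" "y \<in> carrier X" for a x y
    using hom_mult[OF lmul_hom] that by blast
  have ra: "rmul X (x \<otimes>\<^bsub>X\<^esub> y) a = rmul X x a \<otimes>\<^bsub>X\<^esub> rmul X y a"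
    if "a \<in> carrier B" "x \<in> carrier X" "y \<in> carrier X" for a x y
    using hom_mult[OF rmul_hom] that by blast
  note s = la ra lc rc M.lmul_closed N.rmul_closed
  show ?thesis
  proof unfold_locales
    fix a a' m assume "a \<in> carrier A" "a' \<in> carrier A" and m: "m \<in> carrier X"
    note s' = s this(1,2)
    show "lmul X (a \<oplus>\<^bsub>A\<^esub> a') m = lmul X a m \<otimes>\<^bsub>X\<^esub> lmul X a' m"
      using m by (induction rule: induct) (simp_all add: s' X.m_ac M.lmul_add_left pure_add_left)
    show "lmul X (a \<otimes>\<^bsub>A\<^esub> a') m = lmul X a (lmul X a' m)"
      using m by (induction rule: induct) (simp_all add: s' M.lmul_assoc)
  next
    fix m b b' assume m: "m \<in> carrier X" and "b \<in> carrier B" "b' \<in> carrier B"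
    note s' = s this(2,3)
    show "rmul X m (b \<oplus>\<^bsub>B\<^esub> b') = rmul X m b \<otimes>\<^bsub>X\<^esub> rmul X m b'"
      using m by (induction rule: induct) (simp_all add: s' X.m_ac N.rmul_add_right pure_add_right)
    show "rmul X m (b \<otimes>\<^bsub>B\<^esub> b') = rmul X (rmul X m b) b'"
      using m by (induction rule: induct) (simp_all add: s' N.rmul_assoc)
  next
    fix m assume m: "m \<in> carrier X"
    show "lmul X \<one>\<^bsub>A\<^esub> m = m" "rmul X m \<one>\<^bsub>B\<^esub> = m"
      using m by (induction rule: induct) (simp_all add: s M.lmul_one N.rmul_one)
    fix a b assume ab: "a \<in> carrier A" "b \<in> carrier B"
    show "rmul X (lmul X a m) b = lmul X a (rmul X m b)"
      using m by (induction rule: induct) (simp_all add: s ab)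
  qed (simp_all add: s)
qed

lemma bimod_hom_tensorI:
  assumes "bimodule A B K" "f \<in> hom X K"
    and "\<And>a m n. a \<in> carrier A \<Longrightarrow> m \<in> carrier M \<Longrightarrow> n \<in> carrier N \<Longrightarrow>
      f (pure (lmul M a m) n) = lmul K a (f (pure m n))"
    and "\<And>b m n. b \<in> carrier B \<Longrightarrow> m \<in> carrier M \<Longrightarrow> n \<in> carrier N \<Longrightarrow>
      f (pure m (rmul N n b)) = rmul K (f (pure m n)) b"
  shows "f \<in> bimod_hom A B X K"
proof (rule bimod_homI)
  interpret K: bimodule A B K by fact
  show "f (lmul X a x) = lmul K a (f x)" if "a \<in> carrier A" "x \<in> carrier X" for a x
    by (rule equivariant[OF assms(2) lmul_hom K.lmul_hom]) (use assms(3) that in auto)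
  show "f (rmul X x b) = rmul K (f x) b" if "b \<in> carrier B" "x \<in> carrier X" for b x
    using equivariant[OF assms(2) rmul_hom K.rmul_hom, of b b x] assms(4) that by auto
qed (use assms(2) in \<open>auto simp: hom_def\<close>)

end

lemma
  assumes p: "tensor_pair A T B M N" and p': "tensor_pair A T B M' N'"
    and f: "f \<in> bimod_hom A T M M'" and g: "g \<in> bimod_hom T B N N'"
  shows tensor_map_hom: "tens_map T M' N' (\<lambda>(m, n). (f m, g n)) \<in>
      bimod_hom A B (tensor T M N) (tensor T M' N')"
    and tensor_map_pure: "\<And>m n. m \<in> carrier M \<Longrightarrow> n \<in> carrier N \<Longrightarrow>
      tens_map T M' N' (\<lambda>(m, n). (f m, g n)) (pure_tensor T M N m n) = pure_tensor T M' N' (f m) (g n)"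
proof -
  interpret D: tensor_pair A T B M N by fact
  interpret E: tensor_pair A T B M' N' by fact
  let ?h = "\<lambda>(m, n). (f m, g n)"
  note fs = bimod_hom_closed[OF f] bimod_hom_add[OF f] bimod_hom_lmul[OF f] bimod_hom_rmul[OF f]
  note gs = bimod_hom_closed[OF g] bimod_hom_add[OF g] bimod_hom_lmul[OF g] bimod_hom_rmul[OF g]
  have "balanced T M N E.X (\<lambda>m n. E.pure (f m) (g n))"
    by (rule balancedI) (simp_all add: fs gs E.pure_add_left E.pure_add_right E.pure_middle)
  then have bal: "balanced T M N E.X (\<lambda>m n. E.pure (fst (?h (m, n))) (snd (?h (m, n))))"
    by simp
  have hom: "tens_map T M' N' ?h \<in> hom D.X E.X"
    by (rule E.tens_map_hom[OF p _ bal]) (auto simp: fs gs)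
  show pure: "tens_map T M' N' ?h (D.pure m n) = E.pure (f m) (g n)"
    if "m \<in> carrier M" "n \<in> carrier N" for m n
    by (subst E.tens_map_pure[OF p _ bal]) (use that in \<open>auto simp: fs gs\<close>)
  show "tens_map T M' N' ?h \<in> bimod_hom A B D.X E.X"
    by (rule D.bimod_hom_tensorI[OF E.tensor_bimodule hom])
      (simp_all add: pure fs gs D.M.lmul_closed D.N.rmul_closed)
qed

text \<open>The inverse is the map induced by the two inverses.\<close>

lemma tensor_map_iso:
  assumes p: "tensor_pair A T B M N" and p': "tensor_pair A T B M' N'"
    and f: "f \<in> bimod_iso A T M M'" and g: "g \<in> bimod_iso T B N N'"
  shows "tens_map T M' N' (\<lambda>(m, n). (f m, g n)) \<in> bimod_iso A B (tensor T M N) (tensor T M' N')"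
proof -
  interpret D: tensor_pair A T B M N by fact
  interpret E: tensor_pair A T B M' N' by fact
  let ?f = "inv_into (carrier M) f" and ?g = "inv_into (carrier N) g"
  let ?F = "tens_map T M' N' (\<lambda>(m, n). (f m, g n))"
  let ?G = "tens_map T M N (\<lambda>(m, n). (?f m, ?g n))"
  have f': "?f \<in> bimod_iso A T M' M" and g': "?g \<in> bimod_iso T B N' N"
    using bimod_iso_inv[OF D.M.bimodule_axioms f] bimod_iso_inv[OF D.N.bimodule_axioms g] .
  note fh = bimod_iso_hom[OF f] bimod_iso_hom[OF g] bimod_iso_hom[OF f'] bimod_iso_hom[OF g']
  note F = tensor_map_hom[OF p p' fh(1,2)] tensor_map_pure[OF p p' fh(1,2)]
  note G = tensor_map_hom[OF p' p fh(3,4)] tensor_map_pure[OF p' p fh(3,4)]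
  have ff: "?f (f x) = x" if "x \<in> carrier M" for x
    using bimod_iso_bij[OF f] that by (simp add: bij_betw_def)
  have gg: "?g (g x) = x" if "x \<in> carrier N" for x
    using bimod_iso_bij[OF g] that by (simp add: bij_betw_def)
  have ff': "f (?f x) = x" if "x \<in> carrier M'" for x
    using bimod_iso_bij[OF f] that by (metis bij_betw_imp_surj_on f_inv_into_f)
  have gg': "g (?g x) = x" if "x \<in> carrier N'" for x
    using bimod_iso_bij[OF g] that by (metis bij_betw_imp_surj_on f_inv_into_f)
  note c = bimod_hom_closed[OF fh(1)] bimod_hom_closed[OF fh(2)] bimod_hom_closed[OF fh(3)]
    bimod_hom_closed[OF fh(4)]
  show ?thesis
  proof (rule bimod_isoI[OF F(1), where g = ?G])
    fix x assume x: "x \<in> carrier D.X"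
    show "?G (?F x) = x"
      using x by (induction rule: D.induct)
        (simp_all add: F(2) G(2) c ff gg bimod_hom_add[OF F(1)] bimod_hom_add[OF G(1)]
          bimod_hom_closed[OF F(1)])
  next
    fix x assume x: "x \<in> carrier E.X"
    show "?F (?G x) = x"
      using x by (induction rule: E.induct)
        (simp_all add: F(2) G(2) c ff' gg' bimod_hom_add[OF F(1)] bimod_hom_add[OF G(1)]
          bimod_hom_closed[OF G(1)])
  qed (rule bimod_hom_closed[OF G(1)])
qed

text \<open>Each direction is a lift in two stages: with the outer variable fixed, a lift maps the
  inner tensor product, and the result is balanced in the remaining variable. That the two maps are
  mutually inverse is then checked on pure tensors.\<close>

lemma tensor_assoc:
  assumes p: "tensor_pair A T B M N" and q: "tensor_pair T B C N L"
  obtains f where "f \<in> bimod_iso A C (tensor B (tensor T M N) L) (tensor T M (tensor B N L))"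
    "\<And>m n l. m \<in> carrier M \<Longrightarrow> n \<in> carrier N \<Longrightarrow> l \<in> carrier L \<Longrightarrow>
      f (pure_tensor B (tensor T M N) L (pure_tensor T M N m n) l) =
        pure_tensor T M (tensor B N L) m (pure_tensor B N L n l)"
proof -
  interpret MN: tensor_pair A T B M N by fact
  interpret NL: tensor_pair T B C N L by fact
  interpret U: tensor_pair A B C MN.X L
    using MN.tensor_bimodule NL.N.bimodule_axioms by (rule tensor_pair.intro)
  interpret V: tensor_pair A T C M NL.X
    using MN.M.bimodule_axioms NL.tensor_bimodule by (rule tensor_pair.intro)
  note cl = MN.M.lmul_closed MN.M.rmul_closed MN.N.lmul_closed MN.N.rmul_closed
    NL.N.lmul_closed NL.N.rmul_closed U.M.rmul_closed V.N.lmul_closed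
  define b where "b l = tlift T M N V.X (\<lambda>m n. V.pure m (NL.pure n l))" for l
  have bal: "balanced T M N V.X (\<lambda>m n. V.pure m (NL.pure n l))" if "l \<in> carrier L" for l
  proof (rule balancedI)
    fix m t n assume "m \<in> carrier M" "t \<in> carrier T" "n \<in> carrier N"
    with that show "V.pure (rmul M m t) (NL.pure n l) = V.pure m (NL.pure (lmul N t n) l)"
      by (simp add: V.pure_middle)
  qed (use that in \<open>simp_all add: V.pure_add_left V.pure_add_right NL.pure_add_left\<close>)
  have b: "b l \<in> hom MN.X V.X" "\<And>m n. m \<in> carrier M \<Longrightarrow> n \<in> carrier N \<Longrightarrow> b l (MN.pure m n) =
      V.pure m (NL.pure n l)" if "l \<in> carrier L" for l
    using MN.tlift_hom[OF V.X.comm_group_axioms bal[OF that]]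
      MN.tlift_pure[OF V.X.comm_group_axioms bal[OF that]] by (simp_all add: b_def)
  note bc = hom_in_carrier[OF b(1)] and bm = hom_mult[OF b(1)]
  have bal1: "balanced B MN.X L V.X (\<lambda>x l. b l x)"
  proof (rule balancedI)
    fix x l l' assume x: "x \<in> carrier MN.X" and l: "l \<in> carrier L" "l' \<in> carrier L"
    then show "b (l \<otimes>\<^bsub>L\<^esub> l') x = b l x \<otimes>\<^bsub>V.X\<^esub> b l' x"
      by (induction rule: MN.induct)
        (simp_all add: b bc bm NL.pure_add_right V.pure_add_right V.X.m_ac)
  next
    fix x s l assume x: "x \<in> carrier MN.X" and l: "s \<in> carrier B" "l \<in> carrier L"
    then show "b l (rmul MN.X x s) = b (lmul L s l) x"
      by (induction rule: MN.induct)
        (simp_all add: b bc bm cl NL.pure_middle U.M.rmul_add_left)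
  qed (simp_all add: bc bm)
  define f where "f = tlift B MN.X L V.X (\<lambda>x l. b l x)"
  have f: "f \<in> hom U.X V.X" "\<And>x l. x \<in> carrier MN.X \<Longrightarrow> l \<in> carrier L \<Longrightarrow> f (U.pure x l) = b l x"
    using U.tlift_hom[OF V.X.comm_group_axioms bal1] U.tlift_pure[OF V.X.comm_group_axioms bal1]
    by (simp_all add: f_def)
  define c where "c m = tlift B N L U.X (\<lambda>n l. U.pure (MN.pure m n) l)" for m
  have cal: "balanced B N L U.X (\<lambda>n l. U.pure (MN.pure m n) l)" if "m \<in> carrier M" for m
  proof (rule balancedI)
    fix n t l assume "n \<in> carrier N" "t \<in> carrier B" "l \<in> carrier L"
    with that show "U.pure (MN.pure m (rmul N n t)) l = U.pure (MN.pure m n) (lmul L t l)"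
      by (simp flip: U.pure_middle)
  qed (use that in \<open>simp_all add: U.pure_add_left U.pure_add_right MN.pure_add_right\<close>)
  have c: "c m \<in> hom NL.X U.X" "\<And>n l. n \<in> carrier N \<Longrightarrow> l \<in> carrier L \<Longrightarrow> c m (NL.pure n l) =
      U.pure (MN.pure m n) l" if "m \<in> carrier M" for m
    using NL.tlift_hom[OF U.X.comm_group_axioms cal[OF that]]
      NL.tlift_pure[OF U.X.comm_group_axioms cal[OF that]] by (simp_all add: c_def)
  note cc = hom_in_carrier[OF c(1)] and cm = hom_mult[OF c(1)]
  have cal1: "balanced T M NL.X U.X c"
  proof (rule balancedI)
    fix m m' x assume x: "x \<in> carrier NL.X" and m: "m \<in> carrier M" "m' \<in> carrier M"
    then show "c (m \<otimes>\<^bsub>M\<^esub> m') x = c m x \<otimes>\<^bsub>U.X\<^esub> c m' x"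
      by (induction rule: NL.induct)
        (simp_all add: c cc cm MN.pure_add_left U.pure_add_left U.X.m_ac)
  next
    fix m t x assume x: "x \<in> carrier NL.X" and m: "t \<in> carrier T" "m \<in> carrier M"
    then show "c (rmul M m t) x = c m (lmul NL.X t x)"
      by (induction rule: NL.induct)
        (simp_all add: c cc cm cl MN.pure_middle V.N.lmul_add_right)
  qed (simp_all add: cc cm)
  define g where "g = tlift T M NL.X U.X c"
  have g: "g \<in> hom V.X U.X" "\<And>m x. m \<in> carrier M \<Longrightarrow> x \<in> carrier NL.X \<Longrightarrow> g (V.pure m x) = c m x"
    using V.tlift_hom[OF U.X.comm_group_axioms cal1] V.tlift_pure[OF U.X.comm_group_axioms cal1]
    by (simp_all add: g_def)
  note fc = hom_in_carrier[OF f(1)] and fm = hom_mult[OF f(1)]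
  note gc = hom_in_carrier[OF g(1)] and gm = hom_mult[OF g(1)]
  have gb: "g (b l x) = U.pure x l" if "x \<in> carrier MN.X" "l \<in> carrier L" for x l
    using that by (induction rule: MN.induct)
      (simp_all add: b bc bm g gm c U.pure_add_left)
  have fcc: "f (c m x) = V.pure m x" if "x \<in> carrier NL.X" "m \<in> carrier M" for x m
    using that by (induction rule: NL.induct)
      (simp_all add: c cc cm f fm b V.pure_add_right)
  have gf: "g (f x) = x" if "x \<in> carrier U.X" for x
    using that by (induction rule: U.induct) (simp_all add: f fm fc gm gb)
  have fg: "f (g x) = x" if "x \<in> carrier V.X" for x
    using that by (induction rule: V.induct) (simp_all add: g gm gc fm fcc)
  have "f \<in> bimod_hom A C U.X V.X"
  proof (rule U.bimod_hom_tensorI[OF V.tensor_bimodule f(1)])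
    fix a x l assume a: "a \<in> carrier A" and x: "x \<in> carrier MN.X" and l: "l \<in> carrier L"
    show "f (U.pure (lmul MN.X a x) l) = lmul V.X a (f (U.pure x l))"
      using x a l by (induction rule: MN.induct)
        (simp_all add: f b bc bm cl U.M.lmul_closed U.M.lmul_add_right
          bimodule.lmul_add_right[OF V.tensor_bimodule])
  next
    fix s x l assume a: "s \<in> carrier C" and x: "x \<in> carrier MN.X" and l: "l \<in> carrier L"
    show "f (U.pure x (rmul L l s)) = rmul V.X (f (U.pure x l)) s"
      using x a l by (induction rule: MN.induct)
        (simp_all add: f b bc bm cl bimodule.rmul_add_left[OF V.tensor_bimodule])
  qed
  then have "f \<in> bimod_iso A C U.X V.X"
    by (rule bimod_isoI[where g = g]) (simp_all add: gc gf fg)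
  moreover have "f (U.pure (MN.pure m n) l) = V.pure m (NL.pure n l)"
    if "m \<in> carrier M" "n \<in> carrier N" "l \<in> carrier L" for m n l
    using that by (simp add: f b)
  ultimately show thesis by (rule that)
qed

text \<open>The parameter \<open>j\<close> covers two uses: for the identity this is T \<otimes>_T N
  = N, and for a homomorphism from A it cancels the middle factor T in a product of base
  changes.\<close>

lemma tensor_left_unit:
  assumes N: "bimodule T B N" and A: "ring A" and j: "j \<in> ring_hom A T"
  obtains f where
    "f \<in> bimod_iso A B (tensor T (restrict_scalars j id (regular_bimod T)) N) (restrict_scalars j id N)"
    "\<And>t n. t \<in> carrier T \<Longrightarrow> n \<in> carrier N \<Longrightarrow>
      f (pure_tensor T (restrict_scalars j id (regular_bimod T)) N t n) = lmul N t n"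
proof -
  interpret N: bimodule T B N by fact
  let ?T = "restrict_scalars j id (regular_bimod T)"
  have T: "bimodule A T ?T"
    by (rule bimodule_restrict[OF bimodule_regular[OF N.A.ring_axioms] j _ A N.A.ring_axioms])
      (auto simp: ring_hom_def)
  interpret D: tensor_pair A T B ?T N using T N by (rule tensor_pair.intro)
  have jc: "\<And>a. a \<in> carrier A \<Longrightarrow> j a \<in> carrier T" using j by (auto simp: ring_hom_def)
  have bal: "balanced T ?T N N (lmul N)"
    by (rule balancedI) (simp_all add: N.lmul_closed N.lmul_add_left N.lmul_add_right N.lmul_assoc)
  define f where "f = tlift T ?T N N (lmul N)"
  have f: "f \<in> hom D.X N" "\<And>t n. t \<in> carrier T \<Longrightarrow> n \<in> carrier N \<Longrightarrow> f (D.pure t n) = lmul N t n"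
    using D.tlift_hom[OF N.M.comm_group_axioms bal] D.tlift_pure[OF N.M.comm_group_axioms bal]
    by (simp_all add: f_def)
  have K: "bimodule A B (restrict_scalars j id N)"
    by (rule bimodule_restrict[OF N j _ A N.B.ring_axioms]) (auto simp: ring_hom_def)
  have "f \<in> hom D.X (restrict_scalars j id N)" using f(1) by (simp add: hom_def)
  then have "f \<in> bimod_hom A B D.X (restrict_scalars j id N)"
    by (rule D.bimod_hom_tensorI[OF K])
      (simp_all add: f jc N.lmul_assoc N.rmul_closed N.lmul_rmul)
  moreover have "D.pure \<one>\<^bsub>T\<^esub> (f x) = x" if "x \<in> carrier D.X" for x
  proof (rule D.hom_eqI[OF _ _ that, where g = "\<lambda>x. x"])
    have "D.pure \<one>\<^bsub>T\<^esub> \<in> hom N D.X" by (rule D.pure_right_hom) simp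
    with f(1) show "(\<lambda>x. D.pure \<one>\<^bsub>T\<^esub> (f x)) \<in> hom D.X D.X"
      by (auto simp: hom_def Pi_iff)
    fix t n assume tn: "t \<in> carrier ?T" "n \<in> carrier N"
    then have eq: "f (D.pure t n) = lmul N t n" by (simp add: f)
    show "D.pure \<one>\<^bsub>T\<^esub> (f (D.pure t n)) = D.pure t n"
      using D.pure_middle[of "\<one>\<^bsub>T\<^esub>" n t] tn unfolding eq by simp
  qed (simp add: hom_def)
  ultimately have "f \<in> bimod_iso A B D.X (restrict_scalars j id N)"
    by (intro bimod_isoI[where g = "D.pure \<one>\<^bsub>T\<^esub>"]) (simp_all add: f N.lmul_one)
  then show thesis using f(2) by (rule that)
qed

lemma tensor_right_unit:
  assumes M: "bimodule A T M"
  obtains f where "f \<in> bimod_iso A T (tensor T M (regular_bimod T)) M"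
    "\<And>m t. m \<in> carrier M \<Longrightarrow> t \<in> carrier T \<Longrightarrow> f (pure_tensor T M (regular_bimod T) m t) = rmul M m t"
proof -
  interpret M: bimodule A T M by fact
  interpret D: tensor_pair A T T M "regular_bimod T"
    using M bimodule_regular[OF M.B.ring_axioms] by (rule tensor_pair.intro)
  have bal: "balanced T M (regular_bimod T) M (rmul M)"
    by (rule balancedI) (simp_all add: M.rmul_closed M.rmul_add_left M.rmul_add_right M.rmul_assoc)
  define f where "f = tlift T M (regular_bimod T) M (rmul M)"
  have f: "f \<in> hom D.X M" "\<And>m t. m \<in> carrier M \<Longrightarrow> t \<in> carrier T \<Longrightarrow> f (D.pure m t) = rmul M m t"
    using D.tlift_hom[OF M.M.comm_group_axioms bal] D.tlift_pure[OF M.M.comm_group_axioms bal]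
    by (simp_all add: f_def)
  have "f \<in> bimod_hom A T D.X M"
    by (rule D.bimod_hom_tensorI[OF M f(1)])
      (simp_all add: f M.rmul_assoc M.lmul_closed M.lmul_rmul)
  moreover have "D.pure (f x) \<one>\<^bsub>T\<^esub> = x" if "x \<in> carrier D.X" for x
    using that
  proof (induction rule: D.induct)
    case (pure m t)
    then show ?case using D.pure_middle[of m "\<one>\<^bsub>T\<^esub>" t] by (simp add: f)
  next
    case (add x y)
    then show ?case
      using D.pure_add_left[of "f x" "\<one>\<^bsub>T\<^esub>" "f y"]
      by (simp add: hom_mult[OF f(1)] hom_in_carrier[OF f(1)])
  qed
  ultimately have "f \<in> bimod_iso A T D.X M"
    by (intro bimod_isoI[where g = "\<lambda>m. D.pure m \<one>\<^bsub>T\<^esub>"]) (simp_all add: f M.rmul_one)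
  then show thesis using f(2) by (rule that)
qed

lemma restrict_scalars_id: "restrict_scalars id id M = M"
  by (cases M) (simp add: restrict_scalars_def)

lemma tensor_isomorphic_cong:
  assumes "bimodule A T M" "bimodule T B N" "bimodule A T M'" "bimodule T B N'"
    "bimod_isomorphic A T M M'" "bimod_isomorphic T B N N'"
  shows "bimod_isomorphic A B (tensor T M N) (tensor T M' N')"
  using assms tensor_map_iso[OF tensor_pair.intro tensor_pair.intro]
  unfolding bimod_isomorphic_def by blast

section \<open>Base change along a central homomorphism\<close>

locale central_hom = A: cring A + T: ring T
  for A :: "('a, 'x) ring_scheme" and T :: "('t, 'y) ring_scheme" +
  fixes j :: "'a \<Rightarrow> 't"
  assumes j_hom: "j \<in> ring_hom A T"
    and central: "a \<in> carrier A \<Longrightarrow> t \<in> carrier T \<Longrightarrow> j a \<otimes>\<^bsub>T\<^esub> t = t \<otimes>\<^bsub>T\<^esub> j a"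
begin

lemma j_closed [simp]: "a \<in> carrier A \<Longrightarrow> j a \<in> carrier T"
  using j_hom by (auto simp: ring_hom_def)

lemmas j_mult [simp] = ring_hom_mult[OF j_hom] and j_add [simp] = ring_hom_add[OF j_hom]
  and j_one [simp] = ring_hom_one[OF j_hom]

lemma T'_bimodule: "bimodule A T (restrict_scalars j id (regular_bimod T))"
  by (rule bimodule_restrict[OF bimodule_regular[OF T.ring_axioms] j_hom _ A.ring_axioms T.ring_axioms])
    (auto simp: ring_hom_def)

end

text \<open>As an additive group with right action, a tensor product does not see the left action on
  its first factor. This will identify products formed with \<open>base_change\<close> and with
  \<open>tensor\<close>, whose left actions come from different rings.\<close>

lemma
  assumes "carrier M' = carrier M" "monoid.mult M' = monoid.mult M" "rmul M' = rmul M"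
  shows pure_tensor_left_cong: "pure_tensor T M' N = pure_tensor T M N"
    and tensor_left_cong: "carrier (tensor T M' N) = carrier (tensor T M N)"
      "monoid.mult (tensor T M' N) = monoid.mult (tensor T M N)"
      "one (tensor T M' N) = one (tensor T M N)"
      "rmul (tensor T M' N) = rmul (tensor T M N)"
proof -
  have free: "tens_free M' N = tens_free M N" using assms by (simp add: tens_free_def)
  have "tens_rel T M' N = tens_rel T M N" using assms by (simp add: tens_rel_def)
  then have ker: "tens_ker T M' N = tens_ker T M N" by (simp add: tens_ker_def free)
  show "pure_tensor T M' N = pure_tensor T M N"
    by (intro ext) (simp add: pure_tensor_def free ker)
  show "carrier (tensor T M' N) = carrier (tensor T M N)"
    "monoid.mult (tensor T M' N) = monoid.mult (tensor T M N)"
    "one (tensor T M' N) = one (tensor T M N)"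
    "rmul (tensor T M' N) = rmul (tensor T M N)"
    by (simp_all add: tensor_def Let_def free ker tens_map_def)
qed

locale bc_module = central_hom A T j + P: bimodule A A P
  for A :: "('a, 'x) ring_scheme" and T :: "('t, 'y) ring_scheme" and j :: "'a \<Rightarrow> 't"
    and P :: "('a, 'a, 'p) bimod"
begin

abbreviation "T' \<equiv> restrict_scalars j id (regular_bimod T)"
abbreviation "Y \<equiv> base_change A j T P"
abbreviation "pt \<equiv> pure_tensor A P T'"

sublocale D: tensor_pair A A T P T'
  using P.bimodule_axioms T'_bimodule by (rule tensor_pair.intro)

lemma Y_eqs: "carrier Y = carrier D.X" "monoid.mult Y = monoid.mult D.X" "one Y = one D.X"
  "rmul Y = rmul D.X"
  by (simp_all add: base_change_def tensor_def Let_def)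

sublocale Y: comm_group Y
  by (rule comm_group_cong[OF D.X.comm_group_axioms]) (simp_all add: Y_eqs)

lemma hom_Y_eqs: "hom Y K = hom D.X K" "hom L Y = hom L D.X"
  by (simp_all add: hom_def Y_eqs)

lemma pt_closed [simp]: "p \<in> carrier P \<Longrightarrow> t \<in> carrier T \<Longrightarrow> pt p t \<in> carrier Y"
  by (simp add: Y_eqs)

lemma pt_add_left: "p \<in> carrier P \<Longrightarrow> p' \<in> carrier P \<Longrightarrow> t \<in> carrier T \<Longrightarrow>
    pt (p \<otimes>\<^bsub>P\<^esub> p') t = pt p t \<otimes>\<^bsub>Y\<^esub> pt p' t"
  using D.pure_add_left[of p t p'] by (simp add: Y_eqs)

lemma pt_add_right: "p \<in> carrier P \<Longrightarrow> t \<in> carrier T \<Longrightarrow> t' \<in> carrier T \<Longrightarrow>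
    pt p (t \<oplus>\<^bsub>T\<^esub> t') = pt p t \<otimes>\<^bsub>Y\<^esub> pt p t'"
  using D.pure_add_right[of p t t'] by (simp add: Y_eqs)

lemma pt_middle: "p \<in> carrier P \<Longrightarrow> a \<in> carrier A \<Longrightarrow> t \<in> carrier T \<Longrightarrow>
    pt (rmul P p a) t = pt p (j a \<otimes>\<^bsub>T\<^esub> t)"
  using D.pure_middle[of p t a] by simp

lemma pt_left_hom: "t \<in> carrier T \<Longrightarrow> (\<lambda>p. pt p t) \<in> hom P Y"
  by (simp add: hom_def pt_add_left)

lemma pt_right_hom: "p \<in> carrier P \<Longrightarrow> pt p \<in> hom (regular_bimod T) Y"
  by (simp add: hom_def pt_add_right)

lemma Y_induct [consumes 1, case_names pt add]:
  assumes "x \<in> carrier Y"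
    and "\<And>p t. p \<in> carrier P \<Longrightarrow> t \<in> carrier T \<Longrightarrow> Q (pt p t)"
    and "\<And>x y. x \<in> carrier Y \<Longrightarrow> y \<in> carrier Y \<Longrightarrow> Q x \<Longrightarrow> Q y \<Longrightarrow> Q (x \<otimes>\<^bsub>Y\<^esub> y)"
  shows "Q x"
proof -
  have x: "x \<in> carrier D.X" using assms(1) by (simp add: Y_eqs)
  show ?thesis
    by (rule D.induct[OF x]) (use assms(2,3) in \<open>simp_all add: Y_eqs\<close>)
qed

lemma
  assumes "comm_group K"
    and "\<And>p t. p \<in> carrier P \<Longrightarrow> t \<in> carrier T \<Longrightarrow> b p t \<in> carrier K"
    and "\<And>p p' t. p \<in> carrier P \<Longrightarrow> p' \<in> carrier P \<Longrightarrow> t \<in> carrier T \<Longrightarrow>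
      b (p \<otimes>\<^bsub>P\<^esub> p') t = b p t \<otimes>\<^bsub>K\<^esub> b p' t"
    and "\<And>p t t'. p \<in> carrier P \<Longrightarrow> t \<in> carrier T \<Longrightarrow> t' \<in> carrier T \<Longrightarrow>
      b p (t \<oplus>\<^bsub>T\<^esub> t') = b p t \<otimes>\<^bsub>K\<^esub> b p t'"
    and "\<And>p a t. p \<in> carrier P \<Longrightarrow> a \<in> carrier A \<Longrightarrow> t \<in> carrier T \<Longrightarrow>
      b (rmul P p a) t = b p (j a \<otimes>\<^bsub>T\<^esub> t)"
  shows Y_lift_hom: "tlift A P T' K b \<in> hom Y K"
    and Y_lift_pt: "\<And>p t. p \<in> carrier P \<Longrightarrow> t \<in> carrier T \<Longrightarrow> tlift A P T' K b (pt p t) = b p t"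
proof -
  have bal: "balanced A P T' K b"
    by (rule balancedI) (simp_all add: assms)
  show "tlift A P T' K b \<in> hom Y K" "\<And>p t. p \<in> carrier P \<Longrightarrow> t \<in> carrier T \<Longrightarrow> tlift A P T' K b (pt p t) = b p t"
    using D.tlift_hom[OF assms(1) bal] D.tlift_pure[OF assms(1) bal] by (simp_all add: hom_Y_eqs)
qed

lemma
  assumes t: "t \<in> carrier T"
  shows Y_lmul_hom: "lmul Y t \<in> hom Y Y"
    and Y_lmul_pt [simp]: "\<And>p s. p \<in> carrier P \<Longrightarrow> s \<in> carrier T \<Longrightarrow>
      lmul Y t (pt p s) = pt p (t \<otimes>\<^bsub>T\<^esub> s)"
proof -
  have eq: "lmul Y t = tens_map A P T' (\<lambda>(p, s). (p, t \<otimes>\<^bsub>T\<^esub> s))"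
    by (simp add: base_change_def Let_def)
  have "balanced A P T' D.X (\<lambda>p s. pt p (t \<otimes>\<^bsub>T\<^esub> s))"
  proof (rule balancedI)
    fix p a s assume *: "p \<in> carrier P" "a \<in> carrier A" "s \<in> carrier T'"
    \<comment> \<open>Centrality of \<open>j\<close> at work: left multiplication by
      \<open>t\<close> passes the scalar \<open>j a\<close>.\<close>
    then have "t \<otimes>\<^bsub>T\<^esub> (j a \<otimes>\<^bsub>T\<^esub> s) = j a \<otimes>\<^bsub>T\<^esub> (t \<otimes>\<^bsub>T\<^esub> s)"
      using t central[of a t] T.m_assoc[of t "j a" s] T.m_assoc[of "j a" t s] by simp
    then show "pt (rmul P p a) (t \<otimes>\<^bsub>T\<^esub> s) = pt p (t \<otimes>\<^bsub>T\<^esub> lmul T' a s)"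
      using * t by (simp add: pt_middle)
  qed (use t in \<open>simp_all add: pt_add_left pt_add_right T.r_distr Y_eqs[symmetric]\<close>)
  then have bal: "balanced A P T' D.X (\<lambda>p s. pt (fst ((\<lambda>(p, s). (p, t \<otimes>\<^bsub>T\<^esub> s)) (p, s)))
      (snd ((\<lambda>(p, s). (p, t \<otimes>\<^bsub>T\<^esub> s)) (p, s))))"
    by simp
  show "lmul Y t \<in> hom Y Y"
    unfolding eq hom_Y_eqs
    by (rule D.tens_map_hom[OF D.tensor_pair_axioms _ bal]) (use t in auto)
  show "lmul Y t (pt p s) = pt p (t \<otimes>\<^bsub>T\<^esub> s)" if "p \<in> carrier P" "s \<in> carrier T" for p s
    unfolding eq
    by (subst D.tens_map_pure[OF D.tensor_pair_axioms _ bal]) (use t that in auto)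
qed

lemma Y_rmul_hom: "t \<in> carrier T \<Longrightarrow> (\<lambda>x. rmul Y x t) \<in> hom Y Y"
  using D.rmul_hom[of t] by (simp add: hom_Y_eqs Y_eqs)

lemma Y_rmul_pt [simp]: "t \<in> carrier T \<Longrightarrow> p \<in> carrier P \<Longrightarrow> s \<in> carrier T \<Longrightarrow>
    rmul Y (pt p s) t = pt p (s \<otimes>\<^bsub>T\<^esub> t)"
  using D.rmul_pure[of t p s] by (simp add: Y_eqs)

lemma Y_bimodule: "bimodule T T Y"
proof -
  note s = hom_mult[OF Y_lmul_hom] hom_mult[OF Y_rmul_hom]
    hom_in_carrier[OF Y_lmul_hom] hom_in_carrier[OF Y_rmul_hom]
  show ?thesis
  proof unfold_locales
    fix a a' m assume "a \<in> carrier T" "a' \<in> carrier T" and m: "m \<in> carrier Y"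
    note s' = s this(1,2)
    show "lmul Y (a \<oplus>\<^bsub>T\<^esub> a') m = lmul Y a m \<otimes>\<^bsub>Y\<^esub> lmul Y a' m"
      using m by (induction rule: Y_induct) (simp_all add: s' Y.m_ac T.l_distr pt_add_right)
    show "lmul Y (a \<otimes>\<^bsub>T\<^esub> a') m = lmul Y a (lmul Y a' m)"
      using m by (induction rule: Y_induct) (simp_all add: s' T.m_assoc)
    show "rmul Y m (a \<oplus>\<^bsub>T\<^esub> a') = rmul Y m a \<otimes>\<^bsub>Y\<^esub> rmul Y m a'"
      using m by (induction rule: Y_induct) (simp_all add: s' Y.m_ac T.r_distr pt_add_right)
    show "rmul Y m (a \<otimes>\<^bsub>T\<^esub> a') = rmul Y (rmul Y m a) a'"
      using m by (induction rule: Y_induct) (simp_all add: s' T.m_assoc)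
    show "rmul Y (lmul Y a m) a' = lmul Y a (rmul Y m a')"
      using m by (induction rule: Y_induct) (simp_all add: s' T.m_assoc)
  next
    fix m assume m: "m \<in> carrier Y"
    show "lmul Y \<one>\<^bsub>T\<^esub> m = m" "rmul Y m \<one>\<^bsub>T\<^esub> = m"
      using m by (induction rule: Y_induct) (simp_all add: s)
  qed (simp_all add: s)
qed

sublocale Y: bimodule T T Y by (rule Y_bimodule)

lemma Y_bimod_homI:
  assumes "bimodule T T K" "f \<in> hom Y K"
    and "\<And>s p t. s \<in> carrier T \<Longrightarrow> p \<in> carrier P \<Longrightarrow> t \<in> carrier T \<Longrightarrow>
      f (pt p (s \<otimes>\<^bsub>T\<^esub> t)) = lmul K s (f (pt p t))"
    and "\<And>s p t. s \<in> carrier T \<Longrightarrow> p \<in> carrier P \<Longrightarrow> t \<in> carrier T \<Longrightarrow>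
      f (pt p (t \<otimes>\<^bsub>T\<^esub> s)) = rmul K (f (pt p t)) s"
  shows "f \<in> bimod_hom T T Y K"
proof (rule bimod_homI)
  interpret K: bimodule T T K by fact
  note f = hom_mult[OF assms(2)] hom_in_carrier[OF assms(2)]
  show "f (lmul Y a x) = lmul K a (f x)" if "a \<in> carrier T" "x \<in> carrier Y" for a x
    using that(2,1) by (induction rule: Y_induct)
      (simp_all add: f assms(3) Y.lmul_add_right K.lmul_add_right Y.lmul_closed)
  show "f (rmul Y x a) = rmul K (f x) a" if "a \<in> carrier T" "x \<in> carrier Y" for a x
    using that(2,1) by (induction rule: Y_induct)
      (simp_all add: f assms(4) Y.rmul_add_left K.rmul_add_left Y.rmul_closed)
qed (use assms(2) in \<open>auto simp: hom_def\<close>)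

end

text \<open>The left unit law over A, applied to T as an A-T-bimodule; linearity for the left action
  of T again rests on the centrality of \<open>j\<close>.\<close>

lemma bc_unit:
  assumes "central_hom A T j"
  obtains f where "f \<in> bimod_iso T T (base_change A j T (regular_bimod A)) (regular_bimod T)"
    "\<And>a t. a \<in> carrier A \<Longrightarrow> t \<in> carrier T \<Longrightarrow>
      f (pure_tensor A (regular_bimod A) (restrict_scalars j id (regular_bimod T)) a t) = j a \<otimes>\<^bsub>T\<^esub> t"
proof -
  interpret central_hom A T j by fact
  interpret P: bc_module A T j "regular_bimod A"
    using central_hom_axioms bimodule_regular[OF A.ring_axioms] by (rule bc_module.intro)
  have "id \<in> ring_hom A A" by (auto simp: ring_hom_def)
  then obtain f where f: "f \<in> bimod_iso A T P.D.X P.T'"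
    "\<And>a t. a \<in> carrier A \<Longrightarrow> t \<in> carrier T \<Longrightarrow> f (P.pt a t) = j a \<otimes>\<^bsub>T\<^esub> t"
    using tensor_left_unit[OF T'_bimodule A.ring_axioms, of id] by (auto simp: restrict_scalars_id)
  have "f \<in> hom P.Y (regular_bimod T)"
    using f(1) by (simp add: P.hom_Y_eqs bimod_iso_def bimod_hom_def) (simp add: hom_def)
  then have "f \<in> bimod_hom T T P.Y (regular_bimod T)"
  proof (rule P.Y_bimod_homI[OF bimodule_regular[OF T.ring_axioms]])
    fix s p t assume *: "s \<in> carrier T" "p \<in> carrier (regular_bimod A)" "t \<in> carrier T"
    then show "f (P.pt p (s \<otimes>\<^bsub>T\<^esub> t)) = lmul (regular_bimod T) s (f (P.pt p t))"
      using central[of p s] by (simp add: f(2) T.m_assoc[symmetric])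
    show "f (P.pt p (t \<otimes>\<^bsub>T\<^esub> s)) = rmul (regular_bimod T) (f (P.pt p t)) s"
      using * by (simp add: f(2) T.m_assoc)
  qed
  then have "f \<in> bimod_iso T T P.Y (regular_bimod T)"
    using bimod_iso_bij[OF f(1)] by (simp add: bimod_iso_def P.Y_eqs)
  then show thesis using f(2) by (rule that)
qed

lemma bc_map:
  assumes P: "bc_module A T j P" and Q: "bc_module A T j Q" and f: "f \<in> bimod_iso A A P Q"
  obtains F where "F \<in> bimod_iso T T (base_change A j T P) (base_change A j T Q)"
    "\<And>p t. p \<in> carrier P \<Longrightarrow> t \<in> carrier T \<Longrightarrow>
      F (pure_tensor A P (restrict_scalars j id (regular_bimod T)) p t) =
        pure_tensor A Q (restrict_scalars j id (regular_bimod T)) (f p) t"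
proof -
  interpret P: bc_module A T j P by fact
  interpret Q: bc_module A T j Q by fact
  note id = bimod_iso_id[of A T P.T']
  define F' where "F' = tens_map A Q P.T' (\<lambda>(m, n). (f m, id n))"
  note F = tensor_map_iso[OF P.D.tensor_pair_axioms Q.D.tensor_pair_axioms f id, folded F'_def]
  have pure: "F' (P.pt p t) = Q.pt (f p) t" if "p \<in> carrier P" "t \<in> carrier T" for p t
    using tensor_map_pure[OF P.D.tensor_pair_axioms Q.D.tensor_pair_axioms bimod_iso_hom[OF f]
        bimod_iso_hom[OF id]] that by (simp add: F'_def)
  have "F' \<in> hom P.Y Q.Y"
    using F by (simp add: P.hom_Y_eqs Q.hom_Y_eqs bimod_iso_def bimod_hom_def)
  then have "F' \<in> bimod_hom T T P.Y Q.Y"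
    by (rule P.Y_bimod_homI[OF Q.Y_bimodule])
      (simp_all add: pure bimod_hom_closed[OF bimod_iso_hom[OF f]])
  then have "F' \<in> bimod_iso T T P.Y Q.Y"
    using bimod_iso_bij[OF F] by (simp add: bimod_iso_def P.Y_eqs Q.Y_eqs)
  then show thesis using pure by (rule that)
qed

text \<open>The product (P \<otimes> T) \<otimes>_T (Q \<otimes> T) is rebracketed, the middle T is
  absorbed into Q \<otimes> T, and rebracketing back gives (P \<otimes> Q) \<otimes> T. These steps
  are isomorphisms of A-T-bimodules only, so linearity for the left T-action of
  \<open>base_change\<close> is verified separately on generators.\<close>

lemma bc_mult:
  assumes P: "bc_module A T j P" and Q: "bc_module A T j Q" and cQ: "central_over (carrier A) Q"
  obtains f where "f \<in> bimod_iso T T (tensor T (base_change A j T P) (base_change A j T Q))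
      (base_change A j T (tensor A P Q))"
    "\<And>p t q t'. p \<in> carrier P \<Longrightarrow> t \<in> carrier T \<Longrightarrow> q \<in> carrier Q \<Longrightarrow> t' \<in> carrier T \<Longrightarrow>
      f (pure_tensor T (base_change A j T P) (base_change A j T Q)
          (pure_tensor A P (restrict_scalars j id (regular_bimod T)) p t)
          (pure_tensor A Q (restrict_scalars j id (regular_bimod T)) q t')) =
        pure_tensor A (tensor A P Q) (restrict_scalars j id (regular_bimod T))
          (pure_tensor A P Q p q) (t \<otimes>\<^bsub>T\<^esub> t')"
proof -
  interpret P: bc_module A T j P by fact
  interpret Q: bc_module A T j Q by fact
  interpret PQ: tensor_pair A A A P Q
    using P.P.bimodule_axioms Q.P.bimodule_axioms by (rule tensor_pair.intro)
  interpret W: bc_module A T j PQ.X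
    using P.central_hom_axioms PQ.tensor_bimodule by (rule bc_module.intro)
  interpret U: tensor_pair T T T P.Y Q.Y
    using P.Y_bimodule Q.Y_bimodule by (rule tensor_pair.intro)
  interpret U': tensor_pair A T T P.D.X Q.Y
    using P.D.tensor_bimodule Q.Y_bimodule by (rule tensor_pair.intro)
  interpret TQ: tensor_pair A T T P.T' Q.Y
    using P.T'_bimodule Q.Y_bimodule by (rule tensor_pair.intro)
  let ?QY = "restrict_scalars j id Q.Y"
  have id: "id \<in> ring_hom T T" by (auto simp: ring_hom_def)
  have QY: "bimodule A T ?QY"
    by (rule bimodule_restrict[OF Q.Y_bimodule P.j_hom id P.A.ring_axioms P.T.ring_axioms])
  interpret PTQ: tensor_pair A A T P TQ.X
    using P.P.bimodule_axioms TQ.tensor_bimodule by (rule tensor_pair.intro)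
  interpret PQT: tensor_pair A A T P Q.D.X
    using P.P.bimodule_axioms Q.D.tensor_bimodule by (rule tensor_pair.intro)
  obtain f1 where f1: "f1 \<in> bimod_iso A T U'.X PTQ.X"
    "\<And>m n l. m \<in> carrier P \<Longrightarrow> n \<in> carrier P.T' \<Longrightarrow> l \<in> carrier Q.Y \<Longrightarrow>
      f1 (U'.pure (P.pt m n) l) = PTQ.pure m (TQ.pure n l)"
    using tensor_assoc[OF P.D.tensor_pair_axioms TQ.tensor_pair_axioms] by blast
  obtain f2 where f2: "f2 \<in> bimod_iso A T TQ.X ?QY"
    "\<And>t n. t \<in> carrier T \<Longrightarrow> n \<in> carrier Q.Y \<Longrightarrow> f2 (TQ.pure t n) = lmul Q.Y t n"
    using tensor_left_unit[OF Q.Y_bimodule P.A.ring_axioms P.j_hom] by blast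
  \<comment> \<open>There are two left actions of A on Q \<otimes> T, one through \<open>j\<close>
    on the second factor and one on Q itself. They coincide because Q is central.\<close>
  have act: "lmul Q.Y (j a) x = lmul Q.D.X a x" if a: "a \<in> carrier A" and x: "x \<in> carrier Q.Y" for a x
  proof (rule Q.D.hom_eqI[where f = "lmul Q.Y (j a)" and g = "lmul Q.D.X a" and K = Q.D.X])
    fix q t assume qt: "q \<in> carrier Q" "t \<in> carrier Q.T'"
    have "lmul Q.Y (j a) (Q.pt q t) = Q.pt (lmul Q a q) t"
      using a qt cQ by (simp add: central_over_def Q.pt_middle)
    with qt a show "lmul Q.Y (j a) (Q.pt q t) = lmul Q.D.X a (Q.pt q t)" by simp
  next
    show "lmul Q.Y (j a) \<in> hom Q.D.X Q.D.X"
      using Q.Y_lmul_hom[of "j a"] a by (simp add: Q.hom_Y_eqs)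
    show "lmul Q.D.X a \<in> hom Q.D.X Q.D.X" by (rule Q.D.lmul_hom[OF a])
    show "x \<in> carrier Q.D.X" using x by (simp add: Q.Y_eqs)
  qed
  have "id \<in> bimod_hom A T ?QY Q.D.X"
    by (rule bimod_homI) (simp_all add: Q.Y_eqs act[unfolded Q.Y_eqs])
  then have "id \<in> bimod_iso A T ?QY Q.D.X"
    by (simp add: bimod_iso_def Q.Y_eqs)
  with f2(1) have f3: "id \<circ> f2 \<in> bimod_iso A T TQ.X Q.D.X" by (rule bimod_iso_comp)
  define f4 where "f4 = tens_map A P Q.D.X (\<lambda>(m, n). (id m, (id \<circ> f2) n))"
  have f4: "f4 \<in> bimod_iso A T PTQ.X PQT.X"
    unfolding f4_def by (rule tensor_map_iso[OF PTQ.tensor_pair_axioms PQT.tensor_pair_axioms bimod_iso_id f3])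
  have f4p: "f4 (PTQ.pure m n) = PQT.pure m (f2 n)" if "m \<in> carrier P" "n \<in> carrier TQ.X" for m n
    using tensor_map_pure[OF PTQ.tensor_pair_axioms PQT.tensor_pair_axioms
        bimod_iso_hom[OF bimod_iso_id] bimod_iso_hom[OF f3]] that by (simp add: f4_def)
  obtain f5 where f5: "f5 \<in> bimod_iso A T W.D.X PQT.X"
    "\<And>m n l. m \<in> carrier P \<Longrightarrow> n \<in> carrier Q \<Longrightarrow> l \<in> carrier P.T' \<Longrightarrow>
      f5 (W.pt (PQ.pure m n) l) = PQT.pure m (Q.pt n l)"
    using tensor_assoc[OF PQ.tensor_pair_axioms Q.D.tensor_pair_axioms] by blast
  let ?f6 = "inv_into (carrier W.D.X) f5"
  have f6: "?f6 \<in> bimod_iso A T PQT.X W.D.X"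
    by (rule bimod_iso_inv[OF W.D.tensor_bimodule f5(1)])
  have f6p: "?f6 (PQT.pure m (Q.pt n l)) = W.pt (PQ.pure m n) l"
    if "m \<in> carrier P" "n \<in> carrier Q" "l \<in> carrier T" for m n l
    using f5(2)[of m n l, symmetric] that bimod_iso_bij[OF f5(1)] by (simp add: bij_betw_def)
  define f where "f = ?f6 \<circ> (f4 \<circ> f1)"
  have f: "f \<in> bimod_iso A T U'.X W.D.X"
    unfolding f_def by (intro bimod_iso_comp[OF _ f6] bimod_iso_comp[OF f1(1) f4])
  \<comment> \<open>From here the source is read with \<open>base_change\<close> in place of
    \<open>tensor\<close>; they share all that the tensor product over T uses of its first
    factor.\<close>
  have eqs: "carrier P.D.X = carrier P.Y" "monoid.mult P.D.X = monoid.mult P.Y"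
    "rmul P.D.X = rmul P.Y"
    by (simp_all add: P.Y_eqs)
  note pc = pure_tensor_left_cong[OF eqs] and tc = tensor_left_cong[OF eqs]
  have fp: "f (U.pure (P.pt p t) (Q.pt q t')) = W.pt (PQ.pure p q) (t \<otimes>\<^bsub>T\<^esub> t')"
    if "p \<in> carrier P" "t \<in> carrier T" "q \<in> carrier Q" "t' \<in> carrier T" for p t q t'
    using that by (simp add: f_def f1(2) pc[symmetric] f4p f2(2) f6p)
  have fhom: "f \<in> hom U.X W.Y"
    using bimod_iso_hom[OF f] unfolding bimod_hom_def W.hom_Y_eqs by (simp add: hom_def tc)
  note fm = hom_mult[OF fhom] and fc = hom_in_carrier[OF fhom]
  have "f \<in> bimod_hom T T U.X W.Y"
  proof (rule U.bimod_hom_tensorI[OF W.Y_bimodule fhom])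
    fix a x y assume a: "a \<in> carrier T" and x: "x \<in> carrier P.Y" and y: "y \<in> carrier Q.Y"
    show "f (U.pure (lmul P.Y a x) y) = lmul W.Y a (f (U.pure x y))"
    proof (rule P.Y_induct[OF x])
      fix p t assume p: "p \<in> carrier P" "t \<in> carrier T"
      (* Resolution with the induction rule eta-expands the id inside the restricted scalars;
         unfolding it would hide the tensor terms from the simplifier. *)
      show "f (U.pure (lmul P.Y a (P.pt p t)) y) = lmul W.Y a (f (U.pure (P.pt p t) y))"
        by (rule Q.Y_induct[OF y]) (simp_all del: id_apply add: a p fp P.T.m_assoc U.pure_add_right fm fc
          W.Y.lmul_add_right)
    qed (simp_all del: id_apply add: a y P.Y.lmul_add_right P.Y.lmul_closed U.pure_add_left fm fc W.Y.lmul_add_right)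
    show "f (U.pure x (rmul Q.Y y a)) = rmul W.Y (f (U.pure x y)) a"
    proof (rule P.Y_induct[OF x])
      fix p t assume p: "p \<in> carrier P" "t \<in> carrier T"
      show "f (U.pure (P.pt p t) (rmul Q.Y y a)) = rmul W.Y (f (U.pure (P.pt p t) y)) a"
        by (rule Q.Y_induct[OF y]) (simp_all del: id_apply add: a p fp P.T.m_assoc U.pure_add_right fm fc
          W.Y.rmul_add_left Q.Y.rmul_add_left Q.Y.rmul_closed)
    qed (simp_all del: id_apply add: a y Q.Y.rmul_closed U.pure_add_left fm fc W.Y.rmul_add_left)
  qed
  then have "f \<in> bimod_iso T T U.X W.Y"
    using bimod_iso_bij[OF f] by (simp add: bimod_iso_def W.Y_eqs tc)
  then show thesis using fp by (rule that)
qed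

section \<open>Invertible modules over a commutative ring\<close>

text \<open>The definition of invertibility asks for an inverse in one fixed carrier type; an
  inverse that injects into this type is transported there.\<close>

lemma invertible_bimodI:
  fixes M :: "('t, 't, 'm) bimod" and N :: "('t, 't, 'n) bimod" and \<kappa> :: "'n \<Rightarrow> 't fg"
  assumes M: "bimodule T T M" and N: "bimodule T T N"
    and MN: "bimod_isomorphic T T (tensor T M N) (regular_bimod T)"
    and NM: "bimod_isomorphic T T (tensor T N M) (regular_bimod T)"
    and \<kappa>: "inj_on \<kappa> (carrier N)"
  shows "invertible_bimod T M"
proof -
  let ?N = "transport \<kappa> N"
  have N': "bimodule T T ?N" by (rule bimodule_transport(1)[OF N \<kappa>])
  have "bimod_isomorphic T T N ?N"
    using bimodule_transport(2)[OF N \<kappa>] by (auto simp: bimod_isomorphic_def)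
  then have NN': "bimod_isomorphic T T ?N N"
    by (rule bimod_isomorphic_sym[OF N])
  have "bimod_isomorphic T T (tensor T M ?N) (regular_bimod T)"
    by (rule bimod_isomorphic_trans[OF tensor_isomorphic_cong[OF M N' M N bimod_isomorphic_refl NN'] MN])
  moreover have "bimod_isomorphic T T (tensor T ?N M) (regular_bimod T)"
    by (rule bimod_isomorphic_trans[OF tensor_isomorphic_cong[OF N' M N M NN' bimod_isomorphic_refl] NM])
  ultimately show ?thesis
    unfolding invertible_bimod_def using M N' by blast
qed

lemma invertible_bimod_cong:
  assumes "invertible_bimod T M" "bimodule T T M'" "bimod_isomorphic T T M' M"
  shows "invertible_bimod T M'"
proof -
  obtain N :: "('a, 'a, 'a fg) bimod" where M: "bimodule T T M" and N: "bimodule T T N"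
    and MN: "bimod_isomorphic T T (tensor T M N) (regular_bimod T)"
    and NM: "bimod_isomorphic T T (tensor T N M) (regular_bimod T)"
    using assms(1) by (auto simp: invertible_bimod_def)
  show ?thesis
    by (rule invertible_bimodI[where \<kappa> = "\<lambda>x. x", OF assms(2) N])
      (auto intro: bimod_isomorphic_trans[OF tensor_isomorphic_cong[OF assms(2) N M N assms(3) bimod_isomorphic_refl] MN]
        bimod_isomorphic_trans[OF tensor_isomorphic_cong[OF N assms(2) N M bimod_isomorphic_refl assms(3)] NM])
qed

text \<open>The identity \<open>b m n \<cdot> m' = b m' n \<cdot> m\<close> expresses that the modules have rank one.\<close>

lemma pairing_iso:
  fixes k :: nat
  assumes T: "cring T" and M: "bimodule T T M" and N: "bimodule T T N"
    and cM: "central_over (carrier T) M" and cN: "central_over (carrier T) N"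
    and b: "\<And>m n. m \<in> carrier M \<Longrightarrow> n \<in> carrier N \<Longrightarrow> b m n \<in> carrier T"
    and b_add_left: "\<And>m m' n. m \<in> carrier M \<Longrightarrow> m' \<in> carrier M \<Longrightarrow> n \<in> carrier N \<Longrightarrow>
      b (m \<otimes>\<^bsub>M\<^esub> m') n = b m n \<oplus>\<^bsub>T\<^esub> b m' n"
    and b_add_right: "\<And>m n n'. m \<in> carrier M \<Longrightarrow> n \<in> carrier N \<Longrightarrow> n' \<in> carrier N \<Longrightarrow>
      b m (n \<otimes>\<^bsub>N\<^esub> n') = b m n \<oplus>\<^bsub>T\<^esub> b m n'"
    and b_left: "\<And>t m n. t \<in> carrier T \<Longrightarrow> m \<in> carrier M \<Longrightarrow> n \<in> carrier N \<Longrightarrow>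
      b (lmul M t m) n = t \<otimes>\<^bsub>T\<^esub> b m n"
    and b_right: "\<And>t m n. t \<in> carrier T \<Longrightarrow> m \<in> carrier M \<Longrightarrow> n \<in> carrier N \<Longrightarrow>
      b m (lmul N t n) = t \<otimes>\<^bsub>T\<^esub> b m n"
    and swap: "\<And>m m' n. m \<in> carrier M \<Longrightarrow> m' \<in> carrier M \<Longrightarrow> n \<in> carrier N \<Longrightarrow>
      lmul M (b m n) m' = lmul M (b m' n) m"
    and u: "\<And>i. i < k \<Longrightarrow> u i \<in> carrier M" and v: "\<And>i. i < k \<Longrightarrow> v i \<in> carrier N"
    and uv: "finsum T (\<lambda>i. b (u i) (v i)) {..<k} = \<one>\<^bsub>T\<^esub>"
    and expand: "\<And>n. n \<in> carrier N \<Longrightarrow> n = finprod N (\<lambda>i. lmul N (b (u i) n) (v i)) {..<k}"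
  shows "bimod_isomorphic T T (tensor T M N) (regular_bimod T)"
proof -
  interpret T: cring T by fact
  interpret D: tensor_pair T T T M N using M N by (rule tensor_pair.intro)
  interpret reg: bimodule T T "regular_bimod T" by (rule bimodule_regular[OF T.ring_axioms])
  have rM: "rmul M m t = lmul M t m" if "t \<in> carrier T" "m \<in> carrier M" for t m
    using cM that by (simp add: central_over_def)
  have rN: "rmul N m t = lmul N t m" if "t \<in> carrier T" "m \<in> carrier N" for t m
    using cN that by (simp add: central_over_def)
  have bal: "balanced T M N (regular_bimod T) b"
    by (rule balancedI) (simp_all add: b b_add_left b_add_right b_left b_right rM)
  let ?F = "tlift T M N (regular_bimod T) b"
  note F = D.tlift_hom[OF reg.M.comm_group_axioms bal] D.tlift_pure[OF reg.M.comm_group_axioms bal]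
  have Fhom: "?F \<in> bimod_hom T T D.X (regular_bimod T)"
    by (rule D.bimod_hom_tensorI[OF reg.bimodule_axioms F(1)])
      (simp_all add: F(2) D.M.lmul_closed D.N.rmul_closed D.N.lmul_closed b b_left b_right rN T.m_comm)
  note Fs = bimod_hom_add[OF Fhom] bimod_hom_closed[OF Fhom]
  interpret X: bimodule T T D.X by (rule D.tensor_bimodule)
  \<comment> \<open>The candidate inverse is \<open>t\<close> |-> \<open>t w\<close>. The element
    \<open>w\<close> is mapped to one, and \<open>swap\<close> with \<open>expand\<close> show that
    every tensor is its own value times \<open>w\<close>.\<close>
  define w where "w = finprod D.X (\<lambda>i. D.pure (u i) (v i)) {..<k}"
  have pw: "(\<lambda>i. D.pure (u i) (v i)) \<in> {..<k} \<rightarrow> carrier D.X" using u v by auto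
  have w: "w \<in> carrier D.X" unfolding w_def by (rule D.X.finprod_closed[OF pw])
  have "?F w = finprod (regular_bimod T) (\<lambda>i. ?F (D.pure (u i) (v i))) {..<k}"
    unfolding w_def by (rule hom_finprod[OF D.X.comm_group_axioms reg.M.comm_group_axioms F(1) pw])
  also have "\<dots> = finsum T (\<lambda>i. b (u i) (v i)) {..<k}"
    unfolding finprod_regular
    by (rule T.finsum_cong') (use u v in \<open>auto simp: F(2) b\<close>)
  finally have Fw: "?F w = \<one>\<^bsub>T\<^esub>" by (simp add: uv)
  have "lmul D.X (?F x) w = x" if "x \<in> carrier D.X" for x
    using that
  proof (induction rule: D.induct)
    case (pure m n)
    have "lmul D.X (b m n) w = finprod D.X (\<lambda>i. lmul D.X (b m n) (D.pure (u i) (v i))) {..<k}"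
      unfolding w_def by (rule X.lmul_finprod[OF b[OF pure] pw])
    also have "\<dots> = finprod D.X (\<lambda>i. D.pure m (lmul N (b (u i) n) (v i))) {..<k}"
    proof (rule D.X.finprod_cong')
      fix i assume "i \<in> {..<k}"
      then have i: "u i \<in> carrier M" "v i \<in> carrier N" using u v by auto
      \<comment> \<open>The exchange law replaces \<open>u i\<close> by \<open>m\<close> and leaves
        the coefficient \<open>b (u i) n\<close>, which crosses the tensor sign to reassemble
        \<open>n\<close>.\<close>
      have "lmul D.X (b m n) (D.pure (u i) (v i)) = D.pure (lmul M (b (u i) n) m) (v i)"
        using i pure by (simp add: b swap[of m "u i" n])
      also have "\<dots> = D.pure m (lmul N (b (u i) n) (v i))"
        using D.pure_middle[of m "v i" "b (u i) n"] i pure by (simp add: b rM)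
      finally show "lmul D.X (b m n) (D.pure (u i) (v i)) = D.pure m (lmul N (b (u i) n) (v i))" .
    qed (use u v pure in \<open>auto simp: b D.N.lmul_closed\<close>)
    also have "\<dots> = D.pure m (finprod N (\<lambda>i. lmul N (b (u i) n) (v i)) {..<k})"
      by (rule hom_finprod[symmetric, OF D.N.M.comm_group_axioms D.X.comm_group_axioms D.pure_right_hom])
        (use u v pure in \<open>auto simp: b D.N.lmul_closed\<close>)
    also have "finprod N (\<lambda>i. lmul N (b (u i) n) (v i)) {..<k} = n"
      using expand[OF pure(2)] by simp
    finally show ?case using pure by (simp add: F(2))
  next
    case (add x y)
    then show ?case using w Fs(2) by (simp add: Fs(1) X.lmul_add_left)
  qed
  moreover have "?F (lmul D.X t w) = t" if "t \<in> carrier T" for t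
    using bimod_hom_lmul[OF Fhom that w] that by (simp add: Fw)
  ultimately have "?F \<in> bimod_iso T T D.X (regular_bimod T)"
    by (intro bimod_isoI[OF Fhom, where g = "\<lambda>t. lmul D.X t w"]) (use w in \<open>auto simp: X.lmul_closed\<close>)
  then show ?thesis unfolding bimod_isomorphic_def by blast
qed

text \<open>\<open>sum_fu\<close> says that the trace ideal of M is the whole ring,
  \<open>f_swap\<close> that M has rank at most one, any two elements being proportional through
  each \<open>f i\<close>.\<close>

locale rank_one = T: cring T + M: bimodule T T M
  for T :: "('t, 'y) ring_scheme" and M :: "('t, 't, 'm) bimod" +
  fixes k :: nat and f :: "nat \<Rightarrow> 'm \<Rightarrow> 't" and u :: "nat \<Rightarrow> 'm"
  assumes cM: "central_over (carrier T) M"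
    and f_hom: "i < k \<Longrightarrow> f i \<in> bimod_hom T T M (regular_bimod T)"
    and f_swap: "i < k \<Longrightarrow> x \<in> carrier M \<Longrightarrow> y \<in> carrier M \<Longrightarrow> lmul M (f i x) y = lmul M (f i y) x"
    and u_closed: "i < k \<Longrightarrow> u i \<in> carrier M"
    and sum_fu: "finsum T (\<lambda>i. f i (u i)) {..<k} = \<one>\<^bsub>T\<^esub>"
begin

lemma functional:
  assumes "g \<in> bimod_hom T T M (regular_bimod T)" "x \<in> carrier M"
  shows "g x \<in> carrier T"
    and "y \<in> carrier M \<Longrightarrow> g (x \<otimes>\<^bsub>M\<^esub> y) = g x \<oplus>\<^bsub>T\<^esub> g y"
    and "t \<in> carrier T \<Longrightarrow> g (lmul M t x) = t \<otimes>\<^bsub>T\<^esub> g x"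
  using assms bimod_hom_closed[OF assms(1)] bimod_hom_add[OF assms(1)] bimod_hom_lmul[OF assms(1)]
  by simp_all

lemma rmul_eq: "t \<in> carrier T \<Longrightarrow> m \<in> carrier M \<Longrightarrow> rmul M m t = lmul M t m"
  using cM by (simp add: central_over_def)

lemma f_closed: "i < k \<Longrightarrow> x \<in> carrier M \<Longrightarrow> f i x \<in> carrier T"
  using functional(1)[OF f_hom] by blast

text \<open>Multiply \<open>m\<close> by one, written as the sum of the f_i(u_i), and exchange
  \<open>m\<close> with \<open>u i\<close>: the \<open>u i\<close> generate M with coordinates
  \<open>f i\<close>, so the two families form a dual basis.\<close>

lemma expand:
  assumes m: "m \<in> carrier M"
  shows "m = finprod M (\<lambda>i. lmul M (f i m) (u i)) {..<k}"
proof -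
  have "m = lmul M (finsum T (\<lambda>i. f i (u i)) {..<k}) m"
    by (simp add: sum_fu M.lmul_one m)
  also have "\<dots> = finprod M (\<lambda>i. lmul M (f i (u i)) m) {..<k}"
    by (rule M.lmul_finsum[OF m]) (auto simp: f_closed u_closed)
  also have "\<dots> = finprod M (\<lambda>i. lmul M (f i m) (u i)) {..<k}"
    by (rule M.M.finprod_cong') (use m in \<open>auto simp: f_swap[of _ m] u_closed f_closed M.lmul_closed\<close>)
  finally show ?thesis .
qed

lemma coordinates_inj:
  assumes "x \<in> carrier M" "y \<in> carrier M" "\<And>i. i < k \<Longrightarrow> f i x = f i y"
  shows "x = y"
proof -
  have "finprod M (\<lambda>i. lmul M (f i x) (u i)) {..<k} = finprod M (\<lambda>i. lmul M (f i y) (u i)) {..<k}"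
    by (rule M.M.finprod_cong') (use assms in \<open>auto simp: u_closed f_closed M.lmul_closed\<close>)
  then show ?thesis using expand[OF assms(1)] expand[OF assms(2)] by simp
qed

text \<open>The exchange law passes from the \<open>f i\<close> to every functional, because the
  equation can be tested on the coordinates \<open>f i\<close>, whose values lie in a commutative
  ring.\<close>

lemma hom_swap:
  assumes g: "g \<in> bimod_hom T T M (regular_bimod T)" and x: "x \<in> carrier M" and y: "y \<in> carrier M"
  shows "lmul M (g x) y = lmul M (g y) x"
proof (rule coordinates_inj)
  fix i assume i: "i < k"
  note F = functional[OF f_hom[OF i]] and G = functional[OF g]
  have "g x \<otimes>\<^bsub>T\<^esub> f i y = g (lmul M (f i y) x)"
    using x y by (simp add: G F T.m_comm)
  also have "\<dots> = g (lmul M (f i x) y)" using f_swap[OF i x y] by simp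
  also have "\<dots> = g y \<otimes>\<^bsub>T\<^esub> f i x"
    using x y by (simp add: G F T.m_comm)
  finally show "f i (lmul M (g x) y) = f i (lmul M (g y) x)"
    using x y by (simp add: F G)
qed (use x y functional(1)[OF g] in \<open>auto simp: M.lmul_closed\<close>)

end

text \<open>Functionals are extensional on the carrier of M, so that agreement on M is equality of
  elements.\<close>

definition dual_bimod :: "('t, 'y) ring_scheme \<Rightarrow> ('t, 't, 'm) bimod \<Rightarrow> ('t, 't, 'm \<Rightarrow> 't) bimod" where
  "dual_bimod T M =
     \<lparr>carrier = bimod_hom T T M (regular_bimod T) \<inter> extensional (carrier M),
      monoid.mult = (\<lambda>g h. \<lambda>x\<in>carrier M. g x \<oplus>\<^bsub>T\<^esub> h x), one = (\<lambda>x\<in>carrier M. \<zero>\<^bsub>T\<^esub>),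
      lmul = (\<lambda>t g. \<lambda>x\<in>carrier M. t \<otimes>\<^bsub>T\<^esub> g x), rmul = (\<lambda>g t. \<lambda>x\<in>carrier M. g x \<otimes>\<^bsub>T\<^esub> t)\<rparr>"

section \<open>The dual module and the inverse it provides\<close>

context rank_one begin

abbreviation "Dual \<equiv> dual_bimod T M"

lemma Dual_carrier: "g \<in> carrier Dual \<longleftrightarrow>
    g \<in> extensional (carrier M) \<and> (\<forall>x\<in>carrier M. g x \<in> carrier T) \<and>
    (\<forall>x\<in>carrier M. \<forall>y\<in>carrier M. g (x \<otimes>\<^bsub>M\<^esub> y) = g x \<oplus>\<^bsub>T\<^esub> g y) \<and>
    (\<forall>t\<in>carrier T. \<forall>x\<in>carrier M. g (lmul M t x) = t \<otimes>\<^bsub>T\<^esub> g x)"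
  by (auto simp: dual_bimod_def bimod_hom_def hom_def Pi_iff rmul_eq T.m_comm)

lemma Dual_eqs:
  "x \<in> carrier M \<Longrightarrow> (g \<otimes>\<^bsub>Dual\<^esub> h) x = g x \<oplus>\<^bsub>T\<^esub> h x"
  "x \<in> carrier M \<Longrightarrow> \<one>\<^bsub>Dual\<^esub> x = \<zero>\<^bsub>T\<^esub>"
  "x \<in> carrier M \<Longrightarrow> lmul Dual t g x = t \<otimes>\<^bsub>T\<^esub> g x"
  "x \<in> carrier M \<Longrightarrow> rmul Dual g t x = g x \<otimes>\<^bsub>T\<^esub> t"
  "g \<otimes>\<^bsub>Dual\<^esub> h \<in> extensional (carrier M)" "\<one>\<^bsub>Dual\<^esub> \<in> extensional (carrier M)"
  "lmul Dual t g \<in> extensional (carrier M)" "rmul Dual g t \<in> extensional (carrier M)"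
  by (simp_all add: dual_bimod_def)

lemma Dual_hom: "g \<in> carrier Dual \<Longrightarrow> g \<in> bimod_hom T T M (regular_bimod T)"
  by (simp add: dual_bimod_def)

lemma Dual_eqI:
  assumes "g \<in> extensional (carrier M)" "h \<in> extensional (carrier M)"
    "\<And>x. x \<in> carrier M \<Longrightarrow> g x = h x"
  shows "g = h"
  using assms by (rule extensionalityI)

lemma Dual_bimodule: "bimodule T T Dual"
proof -
  have ext: "g \<in> extensional (carrier M)" if "g \<in> carrier Dual" for g
    using that by (simp add: Dual_carrier)
  have cl: "g x \<in> carrier T" if "g \<in> carrier Dual" "x \<in> carrier M" for g x
    using that by (simp add: Dual_carrier)
  note s = Dual_eqs M.lmul_closed T.a_ac T.l_distr T.r_distr T.m_ac
  have neg: "\<exists>h\<in>carrier Dual. h \<otimes>\<^bsub>Dual\<^esub> g = \<one>\<^bsub>Dual\<^esub>" if g: "g \<in> carrier Dual" for g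
  proof (rule bexI[of _ "\<lambda>x\<in>carrier M. \<ominus>\<^bsub>T\<^esub> g x"])
    show "(\<lambda>x\<in>carrier M. \<ominus>\<^bsub>T\<^esub> g x) \<otimes>\<^bsub>Dual\<^esub> g = \<one>\<^bsub>Dual\<^esub>"
      by (rule Dual_eqI) (use g in \<open>auto simp: s cl T.l_neg T.r_neg\<close>)
    show "(\<lambda>x\<in>carrier M. \<ominus>\<^bsub>T\<^esub> g x) \<in> carrier Dual"
      using g by (auto simp: Dual_carrier T.minus_add T.r_minus M.lmul_closed)
  qed
  interpret comm_group Dual
  proof (rule comm_groupI)
    fix x y assume "x \<in> carrier Dual" "y \<in> carrier Dual"
    then show "x \<otimes>\<^bsub>Dual\<^esub> y \<in> carrier Dual" "x \<otimes>\<^bsub>Dual\<^esub> y = y \<otimes>\<^bsub>Dual\<^esub> x"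
      by (auto intro!: Dual_eqI simp: s cl) (auto simp: Dual_carrier s)
  next
    fix x y z assume "x \<in> carrier Dual" "y \<in> carrier Dual" "z \<in> carrier Dual"
    then show "x \<otimes>\<^bsub>Dual\<^esub> y \<otimes>\<^bsub>Dual\<^esub> z = x \<otimes>\<^bsub>Dual\<^esub> (y \<otimes>\<^bsub>Dual\<^esub> z)"
      by (auto intro!: Dual_eqI simp: s cl)
  next
    fix x assume x: "x \<in> carrier Dual"
    then show "\<one>\<^bsub>Dual\<^esub> \<otimes>\<^bsub>Dual\<^esub> x = x" by (intro Dual_eqI) (auto simp: s cl ext)
    show "\<exists>y\<in>carrier Dual. y \<otimes>\<^bsub>Dual\<^esub> x = \<one>\<^bsub>Dual\<^esub>" by (rule neg[OF x])
  qed (auto simp: Dual_carrier s)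
  show ?thesis
  proof unfold_locales
    fix a m assume "a \<in> carrier T" "m \<in> carrier Dual"
    then show "lmul Dual a m \<in> carrier Dual" "rmul Dual m a \<in> carrier Dual"
      by (auto simp: Dual_carrier s)
  qed (auto intro!: Dual_eqI simp: s cl ext)
qed

text \<open>The roles are exchanged: evaluations at the \<open>u i\<close> are functionals on the
  dual, and the \<open>f i\<close> are its elements. The exchange law for evaluations is
  \<open>hom_swap\<close> read at a point.\<close>

lemma Dual_rank_one: "rank_one T Dual k (\<lambda>i g. g (u i)) (\<lambda>i. restrict (f i) (carrier M))"
proof -
  interpret D: bimodule T T Dual by (rule Dual_bimodule)
  have cl: "g x \<in> carrier T" if "g \<in> carrier Dual" "x \<in> carrier M" for g x
    using that by (simp add: Dual_carrier)
  show ?thesis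
  proof unfold_locales
    show "central_over (carrier T) Dual"
      by (auto simp: central_over_def intro!: Dual_eqI simp: Dual_eqs cl T.m_comm)
    fix i assume i: "i < k"
    show "(\<lambda>g. g (u i)) \<in> bimod_hom T T Dual (regular_bimod T)"
      by (rule bimod_homI) (auto simp: cl Dual_eqs u_closed[OF i])
    show "restrict (f i) (carrier M) \<in> carrier Dual"
      using functional[OF f_hom[OF i]] by (auto simp: Dual_carrier M.lmul_closed)
    fix g h assume gh: "g \<in> carrier Dual" "h \<in> carrier Dual"
    show "lmul Dual (g (u i)) h = lmul Dual (h (u i)) g"
    proof (rule Dual_eqI)
      fix x assume x: "x \<in> carrier M"
      have "g (u i) \<otimes>\<^bsub>T\<^esub> h x = h (lmul M (g (u i)) x)"
        using gh x u_closed[OF i] by (simp add: functional[OF Dual_hom] cl)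
      also have "\<dots> = h (lmul M (g x) (u i))"
        using hom_swap[OF Dual_hom[OF gh(1)] u_closed[OF i] x] by simp
      also have "\<dots> = h (u i) \<otimes>\<^bsub>T\<^esub> g x"
        using gh x u_closed[OF i] by (simp add: functional[OF Dual_hom] cl T.m_comm)
      finally show "lmul Dual (g (u i)) h x = lmul Dual (h (u i)) g x"
        using x by (simp add: Dual_eqs)
    qed (simp_all add: Dual_eqs)
  next
    show "(\<Oplus>\<^bsub>T\<^esub>i\<in>{..<k}. restrict (f i) (carrier M) (u i)) = \<one>\<^bsub>T\<^esub>"
      unfolding sum_fu[symmetric] by (rule T.finsum_cong') (auto simp: u_closed f_closed)
  qed
qed

text \<open>Evaluation is the pairing in both orders; the dual bases of the dual and of M supply the
  two expansions that \<open>pairing_iso\<close> asks for.\<close>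

lemma Dual_inverse:
  shows "bimod_isomorphic T T (tensor T M Dual) (regular_bimod T)"
    and "bimod_isomorphic T T (tensor T Dual M) (regular_bimod T)"
proof -
  interpret D: rank_one T Dual k "\<lambda>i g. g (u i)" "\<lambda>i. restrict (f i) (carrier M)"
    by (rule Dual_rank_one)
  have cl: "g x \<in> carrier T" if "g \<in> carrier Dual" "x \<in> carrier M" for g x
    using that by (simp add: Dual_carrier)
  have sum: "finsum T (\<lambda>i. restrict (f i) (carrier M) (u i)) {..<k} = \<one>\<^bsub>T\<^esub>" by (rule D.sum_fu)
  show "bimod_isomorphic T T (tensor T M Dual) (regular_bimod T)"
    by (rule pairing_iso[where b = "\<lambda>m g. g m", OF T.cring_axioms M.bimodule_axioms
          Dual_bimodule cM D.cM _ _ _ _ _ _ u_closed D.u_closed sum D.expand])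
      (auto simp: cl Dual_eqs functional[OF Dual_hom] hom_swap[OF Dual_hom])
  show "bimod_isomorphic T T (tensor T Dual M) (regular_bimod T)"
  proof (rule pairing_iso[where b = "\<lambda>g m. g m", OF T.cring_axioms Dual_bimodule M.bimodule_axioms
          D.cM cM _ _ _ _ _ _ D.u_closed u_closed sum])
    fix g h x assume *: "g \<in> carrier Dual" "h \<in> carrier Dual" "x \<in> carrier M"
    show "lmul Dual (g x) h = lmul Dual (h x) g"
    proof (rule Dual_eqI)
      fix y assume y: "y \<in> carrier M"
      have "h (lmul M (g x) y) = h (lmul M (g y) x)"
        using hom_swap[OF Dual_hom[OF *(1)] *(3) y] by simp
      then show "lmul Dual (g x) h y = lmul Dual (h x) g y"
        using * y by (simp add: Dual_eqs functional[OF Dual_hom] cl T.m_comm)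
    qed (simp_all add: Dual_eqs)
  next
    fix n assume n: "n \<in> carrier M"
    have "finprod M (\<lambda>i. lmul M (restrict (f i) (carrier M) n) (u i)) {..<k} =
        finprod M (\<lambda>i. lmul M (f i n) (u i)) {..<k}"
      by (rule M.M.finprod_cong') (use n in \<open>auto simp: u_closed f_closed M.lmul_closed\<close>)
    then show "n = finprod M (\<lambda>i. lmul M (restrict (f i) (carrier M) n) (u i)) {..<k}"
      using expand[OF n] by simp
  qed (auto simp: cl Dual_eqs functional[OF Dual_hom])
qed

text \<open>The coordinate vector is padded by zero to a sequence; the singleton merely brings it
  into the type \<open>'t fg\<close> of sets of sequences.\<close>

definition coords :: "'m \<Rightarrow> 't fg" where
  "coords x = {\<lambda>i. if i < k then f i x else \<zero>\<^bsub>T\<^esub>}"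

lemma coords_inj: "inj_on coords (carrier M)"
proof (rule inj_onI)
  fix x y assume xy: "x \<in> carrier M" "y \<in> carrier M" "coords x = coords y"
  then have "(\<lambda>i. if i < k then f i x else \<zero>\<^bsub>T\<^esub>) = (\<lambda>i. if i < k then f i y else \<zero>\<^bsub>T\<^esub>)"
    by (simp add: coords_def)
  then have "f i x = f i y" if "i < k" for i using that by (metis (full_types))
  then show "x = y" using coordinates_inj xy by blast
qed

lemma invertible: "invertible_bimod T M"
proof -
  interpret D: rank_one T Dual k "\<lambda>i g. g (u i)" "\<lambda>i. restrict (f i) (carrier M)"
    by (rule Dual_rank_one)
  show ?thesis
    by (rule invertible_bimodI[OF M.bimodule_axioms Dual_bimodule Dual_inverse D.coords_inj])
qed

lemma copy:
  obtains M' :: "('t, 't, 't fg) bimod" and \<kappa> where "\<kappa> \<in> bimod_iso T T M M'" "bimodule T T M'"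
  using bimodule_transport[OF M.bimodule_axioms coords_inj] by blast

end

text \<open>Each summand acts nilpotently on \<open>d\<close>, hence so does the sum, which yet acts
  as the identity. In the induction \<open>d\<close> is replaced by \<open>d \<otimes> a j\<close>;
  this is annihilated by \<open>a j\<close>, so the summand \<open>j\<close> drops out.\<close>

lemma (in cring) square_annihilator:
  assumes "finite F" "d \<in> carrier R" "a \<in> F \<rightarrow> carrier R"
    and "\<And>i. i \<in> F \<Longrightarrow> d \<otimes> (a i \<otimes> a i) = \<zero>" and "d \<otimes> finsum R a F = d"
  shows "d = \<zero>"
  using assms
proof (induction F arbitrary: d rule: finite_induct)
  case (insert j F)
  then have aj: "a j \<in> carrier R" and aF: "a \<in> F \<rightarrow> carrier R" by auto
  then have sc: "finsum R a F \<in> carrier R" by simp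
  have d: "d \<otimes> a j \<oplus> d \<otimes> finsum R a F = d"
    using insert aj aF sc by (simp add: r_distr)
  have sq: "d \<otimes> a j \<otimes> a j = \<zero>" using insert.prems(1,3) aj by (simp add: m_assoc)
  have "d \<otimes> a j = \<zero>"
  proof (rule insert.IH)
    fix i assume "i \<in> F"
    then have "d \<otimes> (a i \<otimes> a i) = \<zero>" "a i \<in> carrier R" using insert by auto
    then show "d \<otimes> a j \<otimes> (a i \<otimes> a i) = \<zero>"
      using insert.prems(1) aj by (metis l_null m_closed m_comm m_assoc)
  next
    have "(d \<otimes> a j \<oplus> d \<otimes> finsum R a F) \<otimes> a j = d \<otimes> a j \<otimes> a j \<oplus> d \<otimes> finsum R a F \<otimes> a j"
      using insert.prems(1) aj sc by (simp only: l_distr m_closed)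
    also have "\<dots> = d \<otimes> a j \<otimes> finsum R a F"
      using insert.prems(1) aj sc by (simp add: sq) (simp add: m_ac)
    finally show "d \<otimes> a j \<otimes> finsum R a F = d \<otimes> a j" using d by simp
  qed (use insert.prems(1) aj aF in auto)
  then have "d \<otimes> finsum R a F = d" using d insert.prems(1) sc by simp
  then show ?case using insert aF by auto
qed simp

text \<open>The functionals are m |-> \<theta>(m \<otimes> v_i), where the sum of the u_i \<otimes>
  v_i is the preimage of one. The hard point is the exchange law, since \<theta> and \<eta> need not
  be compatible; \<eta> enters only through the nondegeneracy of the pairing
  \<open>b\<close>.\<close>

lemma rank_oneI_inverse:
  assumes T: "cring T" and M: "bimodule T T M" and N: "bimodule T T N"
    and cM: "central_over (carrier T) M"
    and MN: "bimod_isomorphic T T (tensor T M N) (regular_bimod T)"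
    and NM: "bimod_isomorphic T T (tensor T N M) (regular_bimod T)"
  obtains k f u where "rank_one T M k f u"
proof -
  interpret T: cring T by fact
  interpret M: bimodule T T M by fact
  interpret MN: tensor_pair T T T M N using M N by (rule tensor_pair.intro)
  interpret NM: tensor_pair T T T N M using N M by (rule tensor_pair.intro)
  interpret X: bimodule T T MN.X by (rule MN.tensor_bimodule)
  interpret reg: bimodule T T "regular_bimod T" by (rule bimodule_regular[OF T.ring_axioms])
  have rM: "rmul M m t = lmul M t m" if "t \<in> carrier T" "m \<in> carrier M" for t m
    using cM that by (simp add: central_over_def)
  obtain \<theta> where \<theta>: "\<theta> \<in> bimod_iso T T MN.X (regular_bimod T)"
    using MN by (auto simp: bimod_isomorphic_def)
  obtain \<eta> where \<eta>: "\<eta> \<in> bimod_iso T T NM.X (regular_bimod T)"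
    using NM by (auto simp: bimod_isomorphic_def)
  note \<theta>h = bimod_iso_hom[OF \<theta>] and \<eta>h = bimod_iso_hom[OF \<eta>]
  define b where "b m n = \<theta> (MN.pure m n)" for m n
  define c where "c n m = \<eta> (NM.pure n m)" for m n
  have b: "b m n \<in> carrier T" if "m \<in> carrier M" "n \<in> carrier N" for m n
    using bimod_hom_closed[OF \<theta>h] that by (simp add: b_def)
  have c: "c n m \<in> carrier T" if "m \<in> carrier M" "n \<in> carrier N" for m n
    using bimod_hom_closed[OF \<eta>h] that by (simp add: c_def)
  have b_lmul: "b (lmul M t m) n = t \<otimes>\<^bsub>T\<^esub> b m n"
    if "t \<in> carrier T" "m \<in> carrier M" "n \<in> carrier N" for t m n
    using bimod_hom_lmul[OF \<theta>h, of t "MN.pure m n"] that by (simp add: b_def)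
  have b_add: "b (m \<otimes>\<^bsub>M\<^esub> m') n = b m n \<oplus>\<^bsub>T\<^esub> b m' n"
    if "m \<in> carrier M" "m' \<in> carrier M" "n \<in> carrier N" for m m' n
    using bimod_hom_add[OF \<theta>h, of "MN.pure m n" "MN.pure m' n"] that by (simp add: b_def MN.pure_add_left)
  have c_lmul: "c (lmul N t n) m = t \<otimes>\<^bsub>T\<^esub> c n m"
    if "t \<in> carrier T" "m \<in> carrier M" "n \<in> carrier N" for t m n
    using bimod_hom_lmul[OF \<eta>h, of t "NM.pure n m"] that by (simp add: c_def)
  have c_add: "c (n \<otimes>\<^bsub>N\<^esub> n') m = c n m \<oplus>\<^bsub>T\<^esub> c n' m"
    if "m \<in> carrier M" "n \<in> carrier N" "n' \<in> carrier N" for m n n'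
    using bimod_hom_add[OF \<eta>h, of "NM.pure n m" "NM.pure n' m"] that by (simp add: c_def NM.pure_add_left)
  obtain w where w: "w \<in> carrier MN.X" "\<theta> w = \<one>\<^bsub>T\<^esub>"
    using bimod_iso_surj[OF \<theta>, of "\<one>\<^bsub>T\<^esub>"] by auto
  obtain k :: nat and u v where u: "\<And>i. i < k \<Longrightarrow> u i \<in> carrier M"
    and v: "\<And>i. i < k \<Longrightarrow> v i \<in> carrier N" and wuv: "w = finprod MN.X (\<lambda>i. MN.pure (u i) (v i)) {..<k}"
    by (rule MN.finite_sum[OF w(1)]) blast
  have "\<theta> w = finsum T (\<lambda>i. b (u i) (v i)) {..<k}"
    unfolding wuv b_def finprod_regular[symmetric]
    by (rule hom_finprod[OF MN.X.comm_group_axioms reg.M.comm_group_axioms bimod_hom_hom[OF \<theta>h]])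
      (use u v in auto)
  then have sum: "finsum T (\<lambda>i. b (u i) (v i)) {..<k} = \<one>\<^bsub>T\<^esub>" using w by simp
  obtain w' where w': "w' \<in> carrier NM.X" "\<eta> w' = \<one>\<^bsub>T\<^esub>"
    using bimod_iso_surj[OF \<eta>, of "\<one>\<^bsub>T\<^esub>"] by auto
  obtain l :: nat and q p where q: "\<And>i. i < l \<Longrightarrow> q i \<in> carrier N"
    and p: "\<And>i. i < l \<Longrightarrow> p i \<in> carrier M" and wqp: "w' = finprod NM.X (\<lambda>i. NM.pure (q i) (p i)) {..<l}"
    by (rule NM.finite_sum[OF w'(1)]) blast
  have "\<eta> w' = finsum T (\<lambda>i. c (q i) (p i)) {..<l}"
    unfolding wqp c_def finprod_regular[symmetric]
    by (rule hom_finprod[OF NM.X.comm_group_axioms reg.M.comm_group_axioms bimod_hom_hom[OF \<eta>h]])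
      (use q p in auto)
  then have sum': "finsum T (\<lambda>i. c (q i) (p i)) {..<l} = \<one>\<^bsub>T\<^esub>" using w' by simp
  \<comment> \<open>Injectivity of \<theta> gives x \<otimes> n = y \<otimes> n for all n.
    Contracting with \<open>c\<close> gives x c(n, m) = y c(n, m), and summing over the preimage of
    one under \<eta> gives x = y.\<close>
  have nondeg: "x = y" if xy: "x \<in> carrier M" "y \<in> carrier M"
    and eq: "\<And>n. n \<in> carrier N \<Longrightarrow> b x n = b y n" for x y
  proof -
    have pure: "MN.pure x n = MN.pure y n" if "n \<in> carrier N" for n
      using eq[OF that] bimod_iso_eq_iff[OF \<theta>, of "MN.pure x n" "MN.pure y n"] xy that
      by (simp add: b_def)
    have cxy: "rmul M x (c n m) = rmul M y (c n m)" if n: "n \<in> carrier N" and m: "m \<in> carrier M" for n m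
    proof -
      have bal: "balanced T M N M (\<lambda>x n. rmul M x (c n m))"
        by (rule balancedI) (use m in \<open>simp_all add: c c_add c_lmul M.rmul_closed M.rmul_add_left
          M.rmul_add_right M.rmul_assoc\<close>)
      show ?thesis
        using MN.tlift_pure[OF M.M.comm_group_axioms bal, of x n]
          MN.tlift_pure[OF M.M.comm_group_axioms bal, of y n] pure[OF n] xy n by simp
    qed
    have ex: "x = finprod M (\<lambda>i. rmul M x (c (q i) (p i))) {..<l}" if "x \<in> carrier M" for x
    proof -
      have "x = rmul M x (finsum T (\<lambda>i. c (q i) (p i)) {..<l})"
        using that by (simp add: sum' M.rmul_one)
      also have "\<dots> = finprod M (\<lambda>i. rmul M x (c (q i) (p i))) {..<l}"
        by (rule M.rmul_finsum[OF that]) (use q p c in auto)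
      finally show ?thesis .
    qed
    have "finprod M (\<lambda>i. rmul M x (c (q i) (p i))) {..<l} = finprod M (\<lambda>i. rmul M y (c (q i) (p i))) {..<l}"
      by (rule M.M.finprod_cong') (use q p xy in \<open>auto simp: cxy M.rmul_closed c\<close>)
    then show "x = y" using ex[OF xy(1)] ex[OF xy(2)] by simp
  qed
  \<comment> \<open>An endomorphism of M induces one of M \<otimes> N, which is isomorphic to T;
    there it is multiplication by a scalar, determined at the preimage \<open>w\<close> of one.
    Nondegeneracy brings the scalar back to M.\<close>
  have endo: "\<exists>r\<in>carrier T. \<forall>x\<in>carrier M. h x = lmul M r x" if h: "h \<in> bimod_hom T T M M" for h
  proof -
    define H where "H = tens_map T M N (\<lambda>(m, n). (h m, id n))"
    note pr = MN.tensor_pair_axioms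
    have H: "H \<in> bimod_hom T T MN.X MN.X"
      and Hp: "\<And>m n. m \<in> carrier M \<Longrightarrow> n \<in> carrier N \<Longrightarrow> H (MN.pure m n) = MN.pure (h m) n"
      using tensor_map_hom[OF pr pr h bimod_iso_hom[OF bimod_iso_id]]
        tensor_map_pure[OF pr pr h bimod_iso_hom[OF bimod_iso_id]] by (simp_all add: H_def)
    have Hw: "\<theta> (H w) \<in> carrier T"
      using bimod_hom_closed[OF \<theta>h bimod_hom_closed[OF H w(1)]] by simp
    have \<theta>H: "\<theta> (H x) = \<theta> x \<otimes>\<^bsub>T\<^esub> \<theta> (H w)" if x: "x \<in> carrier MN.X" for x
    proof -
      have \<theta>x: "\<theta> x \<in> carrier T" using bimod_hom_closed[OF \<theta>h x] by simp
      have "\<theta> (lmul MN.X (\<theta> x) w) = \<theta> x"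
        using bimod_hom_lmul[OF \<theta>h \<theta>x w(1)] w(2) \<theta>x by simp
      then have "x = lmul MN.X (\<theta> x) w"
        using bimod_iso_eq_iff[OF \<theta> _ x] X.lmul_closed[OF \<theta>x w(1)] by metis
      then have "\<theta> (H x) = \<theta> (lmul MN.X (\<theta> x) (H w))"
        using bimod_hom_lmul[OF H \<theta>x w(1)] by simp
      also have "\<dots> = \<theta> x \<otimes>\<^bsub>T\<^esub> \<theta> (H w)"
        using bimod_hom_lmul[OF \<theta>h \<theta>x bimod_hom_closed[OF H w(1)]] by simp
      finally show ?thesis .
    qed
    have "h x = lmul M (\<theta> (H w)) x" if x: "x \<in> carrier M" for x
    proof (rule nondeg)
      fix n assume n: "n \<in> carrier N"
      have "b (h x) n = \<theta> (H (MN.pure x n))" using Hp[OF x n] by (simp add: b_def)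
      also have "\<dots> = b x n \<otimes>\<^bsub>T\<^esub> \<theta> (H w)" using \<theta>H[of "MN.pure x n"] x n by (simp add: b_def)
      also have "\<dots> = b (lmul M (\<theta> (H w)) x) n" using Hw x n by (simp add: b_lmul b T.m_comm)
      finally show "b (h x) n = b (lmul M (\<theta> (H w)) x) n" .
    qed (use x Hw bimod_hom_closed[OF h] in \<open>auto simp: M.lmul_closed\<close>)
    then show ?thesis using Hw by blast
  qed
  have swap: "lmul M (b x n) y = lmul M (b y n) x"
    if x: "x \<in> carrier M" and y: "y \<in> carrier M" and n: "n \<in> carrier N" for x y n
  proof -
    \<comment> \<open>The map x |-> b(x, n) y is an endomorphism and hence a scalar; what remains is
      to identify this scalar with b(y, n).\<close>
    have ex: "\<exists>r\<in>carrier T. \<forall>x\<in>carrier M. lmul M (b x n) y = lmul M r x" if y: "y \<in> carrier M" for y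
      by (rule endo, rule bimod_homI)
        (use y n in \<open>simp_all add: b b_add b_lmul rM M.lmul_closed M.lmul_add_left M.lmul_assoc\<close>)
    obtain r where r: "r \<in> carrier T" "\<And>x. x \<in> carrier M \<Longrightarrow> lmul M (b x n) y = lmul M r x"
      using ex[OF y] by blast
    note byn = b[OF y n]
    \<comment> \<open>The two scalars agree after multiplication by the square of each b(u_i, v_i).
      These elements sum to one, so the difference vanishes.\<close>
    let ?d = "r \<ominus>\<^bsub>T\<^esub> b y n"
    have "?d = \<zero>\<^bsub>T\<^esub>"
    proof (rule T.square_annihilator[where F = "{..<k}" and a = "\<lambda>i. b (u i) (v i)"])
      fix i assume "i \<in> {..<k}"
      then have ui: "u i \<in> carrier M" and vi: "v i \<in> carrier N" using u v by auto
      let ?p = "u i" and ?g = "b (u i) (v i)"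
      \<comment> \<open>The same endomorphism with \<open>u i\<close> in place of \<open>y\<close>
        gives a second scalar \<open>s\<close>. Evaluated at \<open>u i\<close> and at
        \<open>y\<close>, it trades b(u_i, n) for b(y, n) at the cost of a factor
        \<open>?g\<close>.\<close>
      obtain s where s: "s \<in> carrier T" "\<And>x. x \<in> carrier M \<Longrightarrow> lmul M (b x n) ?p = lmul M s x"
        using ex[OF ui] by blast
      note cs = b[OF ui vi] b[OF y vi] b[OF ui n] byn r(1) s(1)
      have "r \<otimes>\<^bsub>T\<^esub> ?g = b ?p n \<otimes>\<^bsub>T\<^esub> b y (v i)"
        using r(2)[OF ui] b_lmul[OF r(1) ui vi] b_lmul[OF cs(3) y vi] by simp
      then have "r \<otimes>\<^bsub>T\<^esub> (?g \<otimes>\<^bsub>T\<^esub> ?g) = (b ?p n \<otimes>\<^bsub>T\<^esub> ?g) \<otimes>\<^bsub>T\<^esub> b y (v i)"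
        using cs by (simp add: T.m_assoc[symmetric]) (simp add: T.m_ac)
      also have "b ?p n \<otimes>\<^bsub>T\<^esub> ?g = s \<otimes>\<^bsub>T\<^esub> ?g"
        using s(2)[OF ui] b_lmul[OF s(1) ui vi] b_lmul[OF cs(3) ui vi] by simp
      also have "s \<otimes>\<^bsub>T\<^esub> ?g \<otimes>\<^bsub>T\<^esub> b y (v i) = ?g \<otimes>\<^bsub>T\<^esub> (s \<otimes>\<^bsub>T\<^esub> b y (v i))"
        using cs by (simp add: T.m_ac)
      also have "s \<otimes>\<^bsub>T\<^esub> b y (v i) = b y n \<otimes>\<^bsub>T\<^esub> ?g"
        using s(2)[OF y] b_lmul[OF s(1) y vi] b_lmul[OF byn ui vi] by simp
      finally have "r \<otimes>\<^bsub>T\<^esub> (?g \<otimes>\<^bsub>T\<^esub> ?g) = b y n \<otimes>\<^bsub>T\<^esub> (?g \<otimes>\<^bsub>T\<^esub> ?g)"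
        using cs by (simp add: T.m_ac)
      then show "?d \<otimes>\<^bsub>T\<^esub> (?g \<otimes>\<^bsub>T\<^esub> ?g) = \<zero>\<^bsub>T\<^esub>"
        using cs by (simp add: T.minus_eq T.l_distr T.l_minus T.r_neg)
    qed (use r byn b u v sum in auto)
    moreover have "?d \<oplus>\<^bsub>T\<^esub> b y n = r"
      using r(1) byn by (simp add: T.minus_eq T.a_assoc T.l_neg)
    ultimately have "r = b y n" using byn by simp
    then show ?thesis using r(2)[OF x] by simp
  qed
  have "rank_one T M k (\<lambda>i m. b m (v i)) u"
  proof unfold_locales
    fix i assume "i < k"
    then have vi: "v i \<in> carrier N" using v by simp
    show "(\<lambda>m. b m (v i)) \<in> bimod_hom T T M (regular_bimod T)"
      by (rule bimod_homI) (use vi in \<open>simp_all add: b b_add b_lmul rM T.m_comm\<close>)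
    show "lmul M (b x (v i)) y = lmul M (b y (v i)) x" if "x \<in> carrier M" "y \<in> carrier M" for x y
      using swap vi that by simp
  qed (use cM u sum in auto)
  then show thesis by (rule that)
qed

text \<open>Variant for descent: there one is only known to be a sum of values of functionals, and
  the indexed families are extracted here.\<close>

lemma rank_oneI_sums:
  assumes T: "cring T" and M: "bimodule T T M" and cM: "central_over (carrier T) M"
    and one: "\<one>\<^bsub>T\<^esub> \<in> sums_of (regular_bimod T) {f x | f x. f \<in> bimod_hom T T M (regular_bimod T) \<and>
      (\<forall>x\<in>carrier M. \<forall>y\<in>carrier M. lmul M (f x) y = lmul M (f y) x) \<and> x \<in> carrier M}"
  obtains k f u where "rank_one T M k f u"
proof -
  interpret T: cring T by fact
  interpret M: bimodule T T M by fact
  obtain w and k :: nat where w: "\<one>\<^bsub>T\<^esub> = finprod (regular_bimod T) w {..<k}"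
    "w \<in> {..<k} \<rightarrow> {f x | f x. f \<in> bimod_hom T T M (regular_bimod T) \<and>
      (\<forall>x\<in>carrier M. \<forall>y\<in>carrier M. lmul M (f x) y = lmul M (f y) x) \<and> x \<in> carrier M}"
    using one unfolding sums_of_def by blast
  then have "\<forall>i<k. \<exists>f x. w i = f x \<and> f \<in> bimod_hom T T M (regular_bimod T) \<and>
      (\<forall>x\<in>carrier M. \<forall>y\<in>carrier M. lmul M (f x) y = lmul M (f y) x) \<and> x \<in> carrier M"
    by (simp add: Pi_iff)
  then obtain f u where fu: "\<forall>i<k. w i = f i (u i) \<and> f i \<in> bimod_hom T T M (regular_bimod T) \<and>
      (\<forall>x\<in>carrier M. \<forall>y\<in>carrier M. lmul M (f i x) y = lmul M (f i y) x) \<and> u i \<in> carrier M"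
    by metis
  have "finsum T (\<lambda>i. f i (u i)) {..<k} = finsum T w {..<k}"
  proof (rule T.finsum_cong')
    show "w \<in> {..<k} \<rightarrow> carrier T"
    proof
      fix i assume "i \<in> {..<k}"
      then have "w i = f i (u i)" "f i \<in> bimod_hom T T M (regular_bimod T)" "u i \<in> carrier M"
        using fu by auto
      then show "w i \<in> carrier T" using bimod_hom_closed[of "f i" T T M "regular_bimod T" "u i"] by simp
    qed
  qed (use fu in auto)
  then have "finsum T (\<lambda>i. f i (u i)) {..<k} = \<one>\<^bsub>T\<^esub>" using w(1) by (simp add: finprod_regular)
  then have "rank_one T M k f u"
    by unfold_locales (use fu cM in auto)
  then show thesis by (rule that)
qed

section \<open>The Picard group of a commutative ring\<close>

definition central_invertible :: "('t, 'y) ring_scheme \<Rightarrow> ('t, 't, 'm) bimod \<Rightarrow> bool" where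
  "central_invertible T M \<longleftrightarrow> invertible_bimod T M \<and> central_over (carrier T) M"

lemma central_invertible_bimodule: "central_invertible T M \<Longrightarrow> bimodule T T M"
  by (simp add: central_invertible_def invertible_bimod_def)

lemma central_invertible_rank_one:
  assumes "cring T" "central_invertible T M"
  obtains k f u where "rank_one T M k f u"
proof -
  have "invertible_bimod T M" "central_over (carrier T) M"
    using assms(2) by (simp_all add: central_invertible_def)
  then show thesis
    using rank_oneI_inverse[OF assms(1) _ _ \<open>central_over (carrier T) M\<close>] that
    unfolding invertible_bimod_def by blast
qed

lemma rank_one_central_invertible: "rank_one T M k f u \<Longrightarrow> central_invertible T M"
  by (simp add: central_invertible_def rank_one.invertible rank_one.cM)

lemma central_invertible_cong:
  assumes "central_invertible T M" "bimodule T T M'" "bimod_isomorphic T T M M'"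
  shows "central_invertible T M'"
proof -
  have M: "bimodule T T M" by (rule central_invertible_bimodule[OF assms(1)])
  obtain f where "f \<in> bimod_iso T T M M'" using assms(3) by (auto simp: bimod_isomorphic_def)
  then have "central_over (carrier T) M'"
    using central_over_iso[OF M] assms(1) by (auto simp: central_invertible_def)
  moreover have "invertible_bimod T M'"
    using assms(1) invertible_bimod_cong[OF _ assms(2) bimod_isomorphic_sym[OF M assms(3)]]
    by (simp add: central_invertible_def)
  ultimately show ?thesis by (simp add: central_invertible_def)
qed

lemma tensor_assoc_isomorphic:
  assumes "bimodule A T M" "bimodule T B N" "bimodule B C L"
  shows "bimod_isomorphic A C (tensor B (tensor T M N) L) (tensor T M (tensor B N L))"
proof -
  obtain f where "f \<in> bimod_iso A C (tensor B (tensor T M N) L) (tensor T M (tensor B N L))"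
    by (rule tensor_assoc[OF tensor_pair.intro[OF assms(1,2)] tensor_pair.intro[OF assms(2,3)]])
  then show ?thesis by (auto simp: bimod_isomorphic_def)
qed

lemma tensor_unit_isomorphic:
  assumes "bimodule T T M"
  shows "bimod_isomorphic T T (tensor T (regular_bimod T) M) M"
    and "bimod_isomorphic T T (tensor T M (regular_bimod T)) M"
proof -
  interpret bimodule T T M by fact
  have id: "id \<in> ring_hom T T" by (auto simp: ring_hom_def)
  obtain f where "f \<in> bimod_iso T T (tensor T (restrict_scalars id id (regular_bimod T)) M)
      (restrict_scalars id id M)"
    by (rule tensor_left_unit[OF assms A.ring_axioms id])
  then show "bimod_isomorphic T T (tensor T (regular_bimod T) M) M"
    by (auto simp: restrict_scalars_id bimod_isomorphic_def)
  obtain f where "f \<in> bimod_iso T T (tensor T M (regular_bimod T)) M"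
    by (rule tensor_right_unit[OF assms])
  then show "bimod_isomorphic T T (tensor T M (regular_bimod T)) M"
    by (auto simp: bimod_isomorphic_def)
qed

lemma tensor_inverse:
  assumes M: "bimodule T T M" and N: "bimodule T T N" and M': "bimodule T T M'" and N': "bimodule T T N'"
    and MM: "bimod_isomorphic T T (tensor T M M') (regular_bimod T)"
    and NN: "bimod_isomorphic T T (tensor T N N') (regular_bimod T)"
  shows "bimod_isomorphic T T (tensor T (tensor T M N) (tensor T N' M')) (regular_bimod T)"
proof -
  interpret M: bimodule T T M by fact
  have T: "bimodule T T (regular_bimod T)" by (rule bimodule_regular[OF M.A.ring_axioms])
  have b: "bimodule T T (tensor T P Q)" if "bimodule T T P" "bimodule T T Q"
    for P :: "('a, 'a, 'p) bimod" and Q :: "('a, 'a, 'q) bimod"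
    by (rule tensor_pair.tensor_bimodule[OF tensor_pair.intro[OF that]])
  note refl = bimod_isomorphic_refl[of T T]
  have N'M': "bimodule T T (tensor T N' M')" by (rule b[OF N' M'])
  have "bimod_isomorphic T T (tensor T N (tensor T N' M')) (tensor T (tensor T N N') M')"
    by (rule bimod_isomorphic_sym[OF b[OF b[OF N N'] M'] tensor_assoc_isomorphic[OF N N' M']])
  also have "bimod_isomorphic T T \<dots> (tensor T (regular_bimod T) M')"
    by (rule tensor_isomorphic_cong[OF b[OF N N'] M' T M' NN refl])
  also have "bimod_isomorphic T T \<dots> M'"
    by (rule tensor_unit_isomorphic[OF M'])
  finally have 1: "bimod_isomorphic T T (tensor T N (tensor T N' M')) M'" .
  have "bimod_isomorphic T T (tensor T (tensor T M N) (tensor T N' M')) (tensor T M (tensor T N (tensor T N' M')))"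
    by (rule tensor_assoc_isomorphic[OF M N N'M'])
  also have "bimod_isomorphic T T \<dots> (tensor T M M')"
    by (rule tensor_isomorphic_cong[OF M b[OF N N'M'] M M' refl 1])
  also note MM
  finally show ?thesis .
qed

lemma central_over_tensor:
  assumes "tensor_pair T T T M N" "central_over (carrier T) M" "central_over (carrier T) N"
  shows "central_over (carrier T) (tensor T M N)"
proof -
  interpret tensor_pair T T T M N by fact
  interpret X: bimodule T T X by (rule tensor_bimodule)
  have "lmul X t x = rmul X x t" if t: "t \<in> carrier T" and x: "x \<in> carrier X" for t x
    using x
  proof (induction rule: induct)
    case (pure m n)
    then show ?case
      using t pure_middle[of m n t] assms(2,3) by (simp add: central_over_def)
  qed (simp add: t X.lmul_add_right X.rmul_add_left)
  then show ?thesis by (simp add: central_over_def)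
qed

text \<open>The product of the duals in reverse order is a two-sided inverse, but not in the
  prescribed carrier type. Passing through \<open>rank_one\<close> repairs this, as it comes with a
  dual that has coordinates.\<close>

lemma central_invertible_tensor:
  assumes T: "cring T" and M: "central_invertible T M" and N: "central_invertible T N"
  shows "central_invertible T (tensor T M N)"
proof -
  obtain k f u l g v where "rank_one T M k f u" "rank_one T N l g v"
    using central_invertible_rank_one[OF T] M N by metis
  then interpret M: rank_one T M k f u + N: rank_one T N l g v .
  note b = M.M.bimodule_axioms N.M.bimodule_axioms M.Dual_bimodule N.Dual_bimodule
  have p: "tensor_pair T T T M N" "tensor_pair T T T N.Dual M.Dual"
    using b by (auto intro: tensor_pair.intro)
  obtain k' f' u' where "rank_one T (tensor T M N) k' f' u'"
    by (rule rank_oneI_inverse[OF T tensor_pair.tensor_bimodule[OF p(1)]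
          tensor_pair.tensor_bimodule[OF p(2)] central_over_tensor[OF p(1) M.cM N.cM]
          tensor_inverse[OF b M.Dual_inverse(1) N.Dual_inverse(1)]
          tensor_inverse[OF b(4,3,2,1) N.Dual_inverse(2) M.Dual_inverse(2)]])
  then show ?thesis by (rule rank_one_central_invertible)
qed

lemma rank_one_regular:
  assumes "cring T" shows "rank_one T (regular_bimod T) 1 (\<lambda>_ x. x) (\<lambda>_. \<one>\<^bsub>T\<^esub>)"
proof -
  interpret cring T by fact
  interpret bimodule T T "regular_bimod T" by (rule bimodule_regular[OF ring_axioms])
  show ?thesis
    by unfold_locales (auto simp: central_over_def m_comm bimod_hom_def hom_def lessThan_Suc)
qed

lemma bimod_class_mem: "N \<in> bimod_class T M \<longleftrightarrow> invertible_bimod T N \<and> bimod_isomorphic T T M N"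
  by (simp add: bimod_class_def)

lemma bimod_class_eqI:
  assumes "bimodule T T M" "bimod_isomorphic T T M N"
  shows "bimod_class T M = bimod_class T N"
  using bimod_isomorphic_trans[OF bimod_isomorphic_sym[OF assms]] bimod_isomorphic_trans[OF assms(2)]
  by (auto simp: bimod_class_def)

lemma bimod_class_self:
  fixes M :: "('t, 't, 't fg) bimod"
  shows "invertible_bimod T M \<Longrightarrow> M \<in> bimod_class T M"
  by (simp add: bimod_class_def bimod_isomorphic_refl)

lemma bimod_class_central:
  assumes "central_invertible T M" "N \<in> bimod_class T M"
  shows "central_invertible T N" "bimod_isomorphic T T M N"
  using assms central_invertible_cong[OF assms(1)]
  by (auto simp: bimod_class_mem invertible_bimod_def)

text \<open>Coordinates embed M into sequences over T. Thus each class is nonempty, on which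
  products of classes, being unions, depend.\<close>

lemma central_invertible_copy:
  fixes M :: "('t, 't, 'm) bimod"
  assumes "cring T" "central_invertible T M"
  obtains M' :: "('t, 't, 't fg) bimod" where "M' \<in> bimod_class T M"
proof -
  obtain k f u where "rank_one T M k f u"
    using central_invertible_rank_one[OF assms] by blast
  then interpret rank_one T M k f u .
  obtain M' :: "('t, 't, 't fg) bimod" and \<kappa> where M': "\<kappa> \<in> bimod_iso T T M M'" "bimodule T T M'"
    by (rule copy)
  then have iso: "bimod_isomorphic T T M M'" by (auto simp: bimod_isomorphic_def)
  then have "central_invertible T M'" using central_invertible_cong assms M'(2) by blast
  then have "M' \<in> bimod_class T M" using iso by (simp add: bimod_class_mem central_invertible_def)
  then show thesis by (rule that)
qed

section \<open>The group of classes of central invertible modules\<close>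

context cring begin

lemma Pic_central_carrier:
  "c \<in> carrier (Pic_central (carrier R) R) \<longleftrightarrow>
     (\<exists>M :: ('a, 'a, 'a fg) bimod. central_invertible R M \<and> c = bimod_class R M)"
proof
  assume "c \<in> carrier (Pic_central (carrier R) R)"
  then obtain M :: "('a, 'a, 'a fg) bimod" where "invertible_bimod R M" "c = bimod_class R M"
    "\<forall>P\<in>c. central_over (carrier R) P"
    by (auto simp: Pic_central_def Pic_def)
  then show "\<exists>M :: ('a, 'a, 'a fg) bimod. central_invertible R M \<and> c = bimod_class R M"
    using bimod_class_self by (auto simp: central_invertible_def)
next
  assume "\<exists>M :: ('a, 'a, 'a fg) bimod. central_invertible R M \<and> c = bimod_class R M"
  then obtain M :: "('a, 'a, 'a fg) bimod" where M: "central_invertible R M" "c = bimod_class R M"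
    by blast
  then show "c \<in> carrier (Pic_central (carrier R) R)"
    using bimod_class_central(1)[OF M(1)]
    by (auto simp: Pic_central_def Pic_def central_invertible_def)
qed

lemma bimod_class_in_Pic:
  assumes "central_invertible R M"
  shows "bimod_class R M \<in> carrier (Pic_central (carrier R) R)"
proof -
  obtain M' :: "('a, 'a, 'a fg) bimod" where M': "M' \<in> bimod_class R M"
    using central_invertible_copy[OF cring_axioms assms] by blast
  then have "bimod_class R M = bimod_class R M'" "central_invertible R M'"
    using bimod_class_central[OF assms M'] bimod_class_eqI[OF central_invertible_bimodule[OF assms]]
    by blast+
  then show ?thesis unfolding Pic_central_carrier by blast
qed

text \<open>M and N may have any carrier types, so the rule applies to iterated tensor products and
  to duals, and the group laws reduce to isomorphisms of modules.\<close>

lemma Pic_central_mult: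
  assumes M: "central_invertible R M" and N: "central_invertible R N"
  shows "bimod_class R M \<otimes>\<^bsub>Pic_central (carrier R) R\<^esub> bimod_class R N = bimod_class R (tensor R M N)"
proof -
  have eq: "bimod_class R (tensor R P Q) = bimod_class R (tensor R M N)"
    if P: "P \<in> bimod_class R M" and Q: "Q \<in> bimod_class R N" for P Q
  proof -
    note iso = bimod_class_central[OF M P] bimod_class_central[OF N Q]
    note b = central_invertible_bimodule[OF M] central_invertible_bimodule[OF N]
      central_invertible_bimodule[OF iso(1)] central_invertible_bimodule[OF iso(3)]
    show ?thesis
      by (rule bimod_class_eqI[symmetric, OF tensor_pair.tensor_bimodule[OF tensor_pair.intro[OF b(1,2)]]
            tensor_isomorphic_cong[OF b iso(2,4)]])
  qed
  \<comment> \<open>Both classes have members, so the union of equal sets is that set.\<close>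
  obtain P Q :: "('a, 'a, 'a fg) bimod" where PQ: "P \<in> bimod_class R M" "Q \<in> bimod_class R N"
    using central_invertible_copy[OF cring_axioms] M N by metis
  have "bimod_class R M \<otimes>\<^bsub>Pic_central (carrier R) R\<^esub> bimod_class R N =
      (\<Union>P\<in>bimod_class R M. \<Union>Q\<in>bimod_class R N. bimod_class R (tensor R P Q))"
    by (simp add: Pic_central_def Pic_def)
  also have "\<dots> = (\<Union>P\<in>bimod_class R M. \<Union>Q\<in>bimod_class R N. bimod_class R (tensor R M N))"
    using eq by simp
  also have "\<dots> = bimod_class R (tensor R M N)" using PQ by auto
  finally show ?thesis .
qed

lemma Pic_central_one: "\<one>\<^bsub>Pic_central (carrier R) R\<^esub> = bimod_class R (regular_bimod R)"
  by (simp add: Pic_central_def Pic_def)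

lemma central_invertible_regular: "central_invertible R (regular_bimod R)"
  by (rule rank_one_central_invertible[OF rank_one_regular[OF cring_axioms]])

theorem group_Pic_central: "group (Pic_central (carrier R) R)" (is "group ?G")
proof (rule groupI)
  note ten = central_invertible_tensor[OF cring_axioms]
  note bim = central_invertible_bimodule
  note inP = bimod_class_in_Pic
  have E: thesis if "c \<in> carrier ?G"
    "\<And>M :: ('a, 'a, 'a fg) bimod. central_invertible R M \<Longrightarrow> c = bimod_class R M \<Longrightarrow> thesis" for c thesis
    using that unfolding Pic_central_carrier by blast
  show "\<one>\<^bsub>?G\<^esub> \<in> carrier ?G"
    unfolding Pic_central_one by (rule inP[OF central_invertible_regular])
  fix x assume x: "x \<in> carrier ?G"
  obtain M :: "('a, 'a, 'a fg) bimod" where M: "central_invertible R M" "x = bimod_class R M"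
    by (rule E[OF x])
  show "\<one>\<^bsub>?G\<^esub> \<otimes>\<^bsub>?G\<^esub> x = x"
    unfolding Pic_central_one M(2) Pic_central_mult[OF central_invertible_regular M(1)]
    by (rule bimod_class_eqI[OF bim[OF ten[OF central_invertible_regular M(1)]]
          tensor_unit_isomorphic(1)[OF bim[OF M(1)]]])
  obtain k f u where "rank_one R M k f u"
    using central_invertible_rank_one[OF cring_axioms M(1)] by blast
  then interpret M: rank_one R M k f u .
  note D = rank_one_central_invertible[OF M.Dual_rank_one]
  have "bimod_class R M.Dual \<otimes>\<^bsub>?G\<^esub> x = \<one>\<^bsub>?G\<^esub>"
    unfolding Pic_central_one M(2) Pic_central_mult[OF D M(1)]
    by (rule bimod_class_eqI[OF bim[OF ten[OF D M(1)]] M.Dual_inverse(2)])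
  then show "\<exists>y\<in>carrier ?G. y \<otimes>\<^bsub>?G\<^esub> x = \<one>\<^bsub>?G\<^esub>" using inP[OF D] by blast
  fix y assume y: "y \<in> carrier ?G"
  obtain N :: "('a, 'a, 'a fg) bimod" where N: "central_invertible R N" "y = bimod_class R N"
    by (rule E[OF y])
  show "x \<otimes>\<^bsub>?G\<^esub> y \<in> carrier ?G"
    unfolding M(2) N(2) Pic_central_mult[OF M(1) N(1)] by (rule inP[OF ten[OF M(1) N(1)]])
  fix z assume z: "z \<in> carrier ?G"
  obtain L :: "('a, 'a, 'a fg) bimod" where L: "central_invertible R L" "z = bimod_class R L"
    by (rule E[OF z])
  show "x \<otimes>\<^bsub>?G\<^esub> y \<otimes>\<^bsub>?G\<^esub> z = x \<otimes>\<^bsub>?G\<^esub> (y \<otimes>\<^bsub>?G\<^esub> z)"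
    unfolding M(2) N(2) L(2) Pic_central_mult[OF M(1) N(1)] Pic_central_mult[OF N(1) L(1)]
      Pic_central_mult[OF ten[OF M(1) N(1)] L(1)] Pic_central_mult[OF M(1) ten[OF N(1) L(1)]]
    by (rule bimod_class_eqI[OF bim[OF ten[OF ten[OF M(1) N(1)] L(1)]]
          tensor_assoc_isomorphic[OF bim[OF M(1)] bim[OF N(1)] bim[OF L(1)]]])
qed

end

section \<open>Base change of invertible modules\<close>

locale bc_rank_one = bc_module A T j P + P: rank_one A P k f u
  for A :: "('a, 'x) ring_scheme" and T :: "('t, 'y) ring_scheme" and j :: "'a \<Rightarrow> 't"
    and P :: "('a, 'a, 'p) bimod" and k f u
begin

definition Yf :: "nat \<Rightarrow> (('p \<times> 't) \<Rightarrow>\<^sub>0 int) set \<Rightarrow> 't" where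
  "Yf i = tlift A P T' (regular_bimod T) (\<lambda>p t. j (f i p) \<otimes>\<^bsub>T\<^esub> t)"

lemma
  assumes i: "i < k"
  shows Yf_hom: "Yf i \<in> hom Y (regular_bimod T)"
    and Yf_pt: "\<And>p t. p \<in> carrier P \<Longrightarrow> t \<in> carrier T \<Longrightarrow> Yf i (pt p t) = j (f i p) \<otimes>\<^bsub>T\<^esub> t"
proof -
  note F = P.functional[OF P.f_hom[OF i]]
  note L = Y_lift_hom[OF comm_group_regular[OF T.ring_axioms]]
    Y_lift_pt[OF comm_group_regular[OF T.ring_axioms]]
  have mid: "j (f i (rmul P p a)) \<otimes>\<^bsub>T\<^esub> t = j (f i p) \<otimes>\<^bsub>T\<^esub> (j a \<otimes>\<^bsub>T\<^esub> t)"
    if "p \<in> carrier P" "a \<in> carrier A" "t \<in> carrier T" for p a t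
    using that by (simp add: P.rmul_eq F A.m_comm[of a] T.m_assoc)
  show "Yf i \<in> hom Y (regular_bimod T)"
    unfolding Yf_def by (rule L) (simp_all add: F T.l_distr T.r_distr mid)
  show "Yf i (pt p t) = j (f i p) \<otimes>\<^bsub>T\<^esub> t" if "p \<in> carrier P" "t \<in> carrier T" for p t
    unfolding Yf_def by (rule L) (simp_all add: F T.l_distr T.r_distr mid that)
qed

lemma Yf_closed: "i < k \<Longrightarrow> x \<in> carrier Y \<Longrightarrow> Yf i x \<in> carrier T"
  using hom_in_carrier[OF Yf_hom] by simp

lemma Y_expand:
  assumes "x \<in> carrier Y"
  shows "x = finprod Y (\<lambda>i. pt (u i) (Yf i x)) {..<k}"
  using assms
proof (rule Y_induct)
  fix p t assume pt: "p \<in> carrier P" "t \<in> carrier T"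
  have "pt p t = pt (finprod P (\<lambda>i. lmul P (f i p) (u i)) {..<k}) t"
    using P.expand[OF pt(1)] by simp
  also have "\<dots> = finprod Y (\<lambda>i. pt (lmul P (f i p) (u i)) t) {..<k}"
    by (rule hom_finprod[OF P.M.comm_group_axioms Y.comm_group_axioms pt_left_hom])
      (use pt in \<open>auto simp: P.f_closed P.u_closed P.lmul_closed\<close>)
  also have "\<dots> = finprod Y (\<lambda>i. pt (u i) (Yf i (pt p t))) {..<k}"
  proof (rule Y.finprod_cong')
    fix i assume "i \<in> {..<k}"
    then have i: "i < k" by simp
    have "pt (lmul P (f i p) (u i)) t = pt (u i) (j (f i p) \<otimes>\<^bsub>T\<^esub> t)"
      using pt_middle[of "u i" "f i p" t] i pt by (simp add: P.u_closed P.f_closed P.rmul_eq)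
    then show "pt (lmul P (f i p) (u i)) t = pt (u i) (Yf i (pt p t))"
      using i pt by (simp add: Yf_pt)
  qed (use pt in \<open>auto simp: P.u_closed Yf_closed\<close>)
  finally show "pt p t = finprod Y (\<lambda>i. pt (u i) (Yf i (pt p t))) {..<k}" .
next
  fix x y assume xy: "x \<in> carrier Y" "y \<in> carrier Y"
    and IH: "x = finprod Y (\<lambda>i. pt (u i) (Yf i x)) {..<k}" "y = finprod Y (\<lambda>i. pt (u i) (Yf i y)) {..<k}"
  have "finprod Y (\<lambda>i. pt (u i) (Yf i (x \<otimes>\<^bsub>Y\<^esub> y))) {..<k} =
      finprod Y (\<lambda>i. pt (u i) (Yf i x) \<otimes>\<^bsub>Y\<^esub> pt (u i) (Yf i y)) {..<k}"
    by (rule Y.finprod_cong')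
      (use xy in \<open>auto simp: P.u_closed Yf_closed hom_mult[OF Yf_hom] pt_add_right\<close>)
  also have "\<dots> = finprod Y (\<lambda>i. pt (u i) (Yf i x)) {..<k} \<otimes>\<^bsub>Y\<^esub> finprod Y (\<lambda>i. pt (u i) (Yf i y)) {..<k}"
    by (rule Y.finprod_multf) (use xy in \<open>auto simp: P.u_closed Yf_closed\<close>)
  finally show "x \<otimes>\<^bsub>Y\<^esub> y = finprod Y (\<lambda>i. pt (u i) (Yf i (x \<otimes>\<^bsub>Y\<^esub> y))) {..<k}"
    using IH by simp
qed

definition Y_coords :: "(('p \<times> 't) \<Rightarrow>\<^sub>0 int) set \<Rightarrow> 't fg" where
  "Y_coords x = {\<lambda>i. if i < k then Yf i x else \<zero>\<^bsub>T\<^esub>}"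

lemma Y_coords_inj: "inj_on Y_coords (carrier Y)"
proof (rule inj_onI)
  fix x y assume xy: "x \<in> carrier Y" "y \<in> carrier Y" "Y_coords x = Y_coords y"
  then have "(\<lambda>i. if i < k then Yf i x else \<zero>\<^bsub>T\<^esub>) = (\<lambda>i. if i < k then Yf i y else \<zero>\<^bsub>T\<^esub>)"
    by (simp add: Y_coords_def)
  then have eq: "Yf i x = Yf i y" if "i < k" for i using that by (metis (full_types))
  have "finprod Y (\<lambda>i. pt (u i) (Yf i x)) {..<k} = finprod Y (\<lambda>i. pt (u i) (Yf i y)) {..<k}"
    by (rule Y.finprod_cong') (use xy in \<open>auto simp: eq P.u_closed Yf_closed\<close>)
  then show "x = y" using Y_expand[OF xy(1)] Y_expand[OF xy(2)] by simp
qed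

text \<open>The inverse is the base change of the dual. Both products are base changes of modules
  isomorphic to A by \<open>bc_mult\<close>, and the coordinates of the dual bring the inverse into
  the required carrier type.\<close>

lemma Y_invertible: "invertible_bimod T Y"
proof -
  interpret D: bc_module A T j P.Dual
    using central_hom_axioms P.Dual_bimodule by (rule bc_module.intro)
  interpret D: bc_rank_one A T j P.Dual k "\<lambda>i g. g (u i)" "\<lambda>i. restrict (f i) (carrier P)"
    using D.bc_module_axioms P.Dual_rank_one by (rule bc_rank_one.intro)
  have cD: "central_over (carrier A) P.Dual" by (rule D.P.cM)
  have b: "tensor_pair A A A P P.Dual" "tensor_pair A A A P.Dual P"
    using P.bimodule_axioms P.Dual_bimodule by (auto intro: tensor_pair.intro)
  have bc: "bc_module A T j (tensor A P P.Dual)" "bc_module A T j (tensor A P.Dual P)"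
    "bc_module A T j (regular_bimod A)"
    using central_hom_axioms b[THEN tensor_pair.tensor_bimodule] bimodule_regular[OF A.ring_axioms]
    by (auto intro: bc_module.intro)
  obtain f0 where "f0 \<in> bimod_iso T T (base_change A j T (regular_bimod A)) (regular_bimod T)"
    by (rule bc_unit[OF central_hom_axioms])
  then have reg: "bimod_isomorphic T T (base_change A j T (regular_bimod A)) (regular_bimod T)"
    by (auto simp: bimod_isomorphic_def)
  have map: "bimod_isomorphic T T (base_change A j T Q) (base_change A j T (regular_bimod A))"
    if Q: "bc_module A T j Q" "bimod_isomorphic A A Q (regular_bimod A)" for Q :: "('a, 'a, 'q) bimod"
  proof -
    obtain g where "g \<in> bimod_iso A A Q (regular_bimod A)"
      using Q(2) by (auto simp: bimod_isomorphic_def)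
    then obtain F where "F \<in> bimod_iso T T (base_change A j T Q) (base_change A j T (regular_bimod A))"
      by (rule bc_map[OF Q(1) bc(3)])
    then show ?thesis by (auto simp: bimod_isomorphic_def)
  qed
  obtain f1 where "f1 \<in> bimod_iso T T (tensor T Y D.Y) (base_change A j T (tensor A P P.Dual))"
    by (rule bc_mult[OF bc_module_axioms D.bc_module_axioms cD])
  then have "bimod_isomorphic T T (tensor T Y D.Y) (base_change A j T (tensor A P P.Dual))"
    by (auto simp: bimod_isomorphic_def)
  also note map[OF bc(1) P.Dual_inverse(1)]
  also note reg
  finally have 1: "bimod_isomorphic T T (tensor T Y D.Y) (regular_bimod T)" .
  obtain f2 where "f2 \<in> bimod_iso T T (tensor T D.Y Y) (base_change A j T (tensor A P.Dual P))"
    by (rule bc_mult[OF D.bc_module_axioms bc_module_axioms P.cM])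
  then have "bimod_isomorphic T T (tensor T D.Y Y) (base_change A j T (tensor A P.Dual P))"
    by (auto simp: bimod_isomorphic_def)
  also note map[OF bc(2) P.Dual_inverse(2)]
  also note reg
  finally have 2: "bimod_isomorphic T T (tensor T D.Y Y) (regular_bimod T)" .
  show ?thesis
    by (rule invertible_bimodI[OF Y_bimodule D.Y_bimodule 1 2 D.Y_coords_inj])
qed

end

section \<open>Objects over a ring extension\<close>

text \<open>The part of \<open>ext_object\<close> that symmetry of isomorphism needs. It is
  immediate for \<open>ext_tensor\<close>, so classes of products can be compared without verifying
  the two tensor conditions for the product itself.\<close>

definition ext_pre ::
  "('r, 'y) ring_scheme \<Rightarrow> ('s, 'z) ring_scheme
     \<Rightarrow> ('r, 'r, 'p) bimod \<times> ('s, 's, 'x) bimod \<times> ('p \<Rightarrow> 'x) \<Rightarrow> bool" where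
  "ext_pre R S = (\<lambda>(P, X, \<phi>). bimodule R R P \<and> bimodule S S X \<and> \<phi> \<in> carrier P \<rightarrow> carrier X)"

lemma ext_object_parts:
  assumes "ext_object i R S (P, X, \<phi>)"
  shows "bimodule R R P" "bimodule S S X" "\<phi> \<in> bimod_hom R R P (restrict_scalars i i X)"
  using assms by (auto simp: ext_object_def)

lemma ext_object_pre: "ext_object i R S u \<Longrightarrow> ext_pre R S u"
  by (cases u) (auto simp: ext_pre_def ext_object_def bimod_hom_def hom_def)

lemma ext_isomorphicI:
  assumes "a \<in> bimod_iso R R P Q" "b \<in> bimod_iso S S X Y" "\<And>p. p \<in> carrier P \<Longrightarrow> b (\<phi> p) = \<psi> (a p)"
  shows "ext_isomorphic R S (P, X, \<phi>) (Q, Y, \<psi>)"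
  using assms unfolding ext_isomorphic_def by auto

lemma ext_isomorphicE:
  assumes "ext_isomorphic R S (P, X, \<phi>) (Q, Y, \<psi>)"
  obtains a b where "a \<in> bimod_iso R R P Q" "b \<in> bimod_iso S S X Y"
    "\<And>p. p \<in> carrier P \<Longrightarrow> b (\<phi> p) = \<psi> (a p)"
  using assms unfolding ext_isomorphic_def by auto

lemma ext_isomorphic_refl: "ext_isomorphic R S u u"
proof -
  obtain P X \<phi> where u: "u = (P, X, \<phi>)" by (cases u)
  show ?thesis
    unfolding u by (rule ext_isomorphicI[OF bimod_iso_id bimod_iso_id]) simp
qed

lemma ext_isomorphic_trans [trans]:
  assumes "ext_isomorphic R S u v" "ext_isomorphic R S v w"
  shows "ext_isomorphic R S u w"
proof -
  obtain P X \<phi> Q Y \<psi> L Z \<chi> where e: "u = (P, X, \<phi>)" "v = (Q, Y, \<psi>)" "w = (L, Z, \<chi>)"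
    by (metis prod_cases3)
  obtain a b where ab: "a \<in> bimod_iso R R P Q" "b \<in> bimod_iso S S X Y"
    "\<And>p. p \<in> carrier P \<Longrightarrow> b (\<phi> p) = \<psi> (a p)"
    by (rule ext_isomorphicE[OF assms(1)[unfolded e]]) blast
  obtain c d where cd: "c \<in> bimod_iso R R Q L" "d \<in> bimod_iso S S Y Z"
    "\<And>p. p \<in> carrier Q \<Longrightarrow> d (\<psi> p) = \<chi> (c p)"
    by (rule ext_isomorphicE[OF assms(2)[unfolded e]]) blast
  show ?thesis
    unfolding e
    by (rule ext_isomorphicI[OF bimod_iso_comp[OF ab(1) cd(1)] bimod_iso_comp[OF ab(2) cd(2)]])
      (simp add: ab(3) cd(3) bimod_hom_closed[OF bimod_iso_hom[OF ab(1)]])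
qed

lemma ext_isomorphic_sym:
  assumes u: "ext_pre R S u" and uv: "ext_isomorphic R S u v"
  shows "ext_isomorphic R S v u"
proof -
  obtain P X \<phi> Q Y \<psi> where e: "u = (P, X, \<phi>)" "v = (Q, Y, \<psi>)"
    by (metis prod_cases3)
  obtain a b where ab: "a \<in> bimod_iso R R P Q" "b \<in> bimod_iso S S X Y"
    "\<And>p. p \<in> carrier P \<Longrightarrow> b (\<phi> p) = \<psi> (a p)"
    by (rule ext_isomorphicE[OF uv[unfolded e]]) blast
  have u': "bimodule R R P" "bimodule S S X" "\<And>p. p \<in> carrier P \<Longrightarrow> \<phi> p \<in> carrier X"
    using u by (auto simp: e ext_pre_def)
  show ?thesis
    unfolding e
  proof (rule ext_isomorphicI[OF bimod_iso_inv[OF u'(1) ab(1)] bimod_iso_inv[OF u'(2) ab(2)]])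
    fix q assume "q \<in> carrier Q"
    then obtain p where p: "p \<in> carrier P" "q = a p" using bimod_iso_surj[OF ab(1)] by blast
    have "inv_into (carrier X) b (\<psi> q) = inv_into (carrier X) b (b (\<phi> p))" using ab(3) p by simp
    also have "\<dots> = \<phi> p" using bimod_iso_bij[OF ab(2)] u'(3)[OF p(1)] by (simp add: bij_betw_def)
    also have "\<phi> p = \<phi> (inv_into (carrier P) a q)"
      using bimod_iso_bij[OF ab(1)] p by (simp add: bij_betw_def)
    finally show "inv_into (carrier X) b (\<psi> q) = \<phi> (inv_into (carrier P) a q)" .
  qed
qed

lemma ext_class_eqI:
  assumes "ext_pre R S u" "ext_isomorphic R S u v"
  shows "ext_class i R S u = ext_class i R S v"
  using ext_isomorphic_trans[OF ext_isomorphic_sym[OF assms]] ext_isomorphic_trans[OF assms(2)]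
  by (auto simp: ext_class_def)

text \<open>The two isomorphisms required of the new object are the old ones, preceded by the map
  that \<open>a'\<close> induces on the tensor product and followed by \<open>b\<close>.\<close>

lemma ext_object_cong:
  fixes P :: "('r, 'r, 'p) bimod" and Q :: "('r, 'r, 'q) bimod"
    and X :: "('s, 's, 'x) bimod" and Y :: "('s, 's, 'w) bimod"
  assumes u: "ext_object i R S (P, X, \<phi>)" and Q: "bimodule R R Q" and Y: "bimodule S S Y"
    and uv: "ext_isomorphic R S (P, X, \<phi>) (Q, Y, \<psi>)" and i: "i \<in> ring_hom R S"
  shows "ext_object i R S (Q, Y, \<psi>)"
proof -
  note p = ext_object_parts[OF u]
  interpret P: bimodule R R P by (rule p)
  interpret X: bimodule S S X by (rule p)
  interpret Q: bimodule R R Q by fact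
  interpret Y: bimodule S S Y by fact
  have ic: "\<And>r. r \<in> carrier R \<Longrightarrow> i r \<in> carrier S" using i by (auto simp: ring_hom_def)
  obtain a b where ab: "a \<in> bimod_iso R R P Q" "b \<in> bimod_iso S S X Y"
    "\<And>p. p \<in> carrier P \<Longrightarrow> b (\<phi> p) = \<psi> (a p)"
    by (rule ext_isomorphicE[OF uv]) blast
  define a' where "a' = inv_into (carrier P) a"
  have a': "a' \<in> bimod_iso R R Q P" unfolding a'_def by (rule bimod_iso_inv[OF p(1) ab(1)])
  have a'c: "\<And>q. q \<in> carrier Q \<Longrightarrow> a' q \<in> carrier P" by (rule bimod_hom_closed[OF bimod_iso_hom[OF a']])
  have aa': "\<And>q. q \<in> carrier Q \<Longrightarrow> a (a' q) = q"
    using bimod_iso_bij[OF ab(1)] by (metis a'_def bij_betw_imp_surj_on f_inv_into_f)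
  have \<psi>: "\<psi> q = b (\<phi> (a' q))" if "q \<in> carrier Q" for q
    using ab(3)[OF a'c[OF that]] aa'[OF that] by simp
  note \<phi>c = bimod_hom_closed[OF p(3), simplified]
  note bh = bimod_iso_hom[OF ab(2)] and ah = bimod_iso_hom[OF a']
  have b_iso: "b \<in> bimod_iso R S (restrict_scalars i id X) (restrict_scalars i id Y)"
    "b \<in> bimod_iso S R (restrict_scalars id i X) (restrict_scalars id i Y)"
    using ab(2) by (auto simp: bimod_iso_def bimod_hom_def ic hom_def)
  have \<psi>_hom: "\<psi> \<in> bimod_hom R R Q (restrict_scalars i i Y)"
  proof (rule bimod_homI)
    fix m m' assume "m \<in> carrier Q" "m' \<in> carrier Q"
    then show "\<psi> (m \<otimes>\<^bsub>Q\<^esub> m') = \<psi> m \<otimes>\<^bsub>restrict_scalars i i Y\<^esub> \<psi> m'"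
      by (simp add: \<psi> bimod_hom_add[OF ah] bimod_hom_add[OF p(3)] bimod_hom_add[OF bh] a'c \<phi>c)
  qed (simp_all add: \<psi> a'c \<phi>c ic bimod_hom_closed[OF bh] bimod_hom_lmul[OF ah] bimod_hom_lmul[OF p(3)]
      bimod_hom_lmul[OF bh] bimod_hom_rmul[OF ah] bimod_hom_rmul[OF p(3)] bimod_hom_rmul[OF bh]
      P.lmul_closed P.rmul_closed Q.lmul_closed Q.rmul_closed)
  have idS: "id \<in> ring_hom S S" by (auto simp: ring_hom_def)
  let ?S1 = "restrict_scalars i id (regular_bimod S)" and ?S2 = "restrict_scalars id i (regular_bimod S)"
  have S1: "bimodule R S ?S1"
    by (rule bimodule_restrict[OF bimodule_regular[OF X.A.ring_axioms] i idS P.A.ring_axioms X.A.ring_axioms])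
  have S2: "bimodule S R ?S2"
    by (rule bimodule_restrict[OF bimodule_regular[OF X.A.ring_axioms] idS i X.A.ring_axioms P.A.ring_axioms])
  obtain f1 where f1: "f1 \<in> bimod_iso R S (tensor R P ?S1) (restrict_scalars i id X)"
    "\<forall>p\<in>carrier P. \<forall>s\<in>carrier S. f1 (pure_tensor R P ?S1 p s) = rmul X (\<phi> p) s"
    using u unfolding ext_object_def Let_def by auto
  obtain f2 where f2: "f2 \<in> bimod_iso S R (tensor R ?S2 P) (restrict_scalars id i X)"
    "\<forall>s\<in>carrier S. \<forall>p\<in>carrier P. f2 (pure_tensor R ?S2 P s p) = lmul X s (\<phi> p)"
    using u unfolding ext_object_def Let_def by auto
  have t1: "tensor_pair R R S Q ?S1" "tensor_pair R R S P ?S1"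
    and t2: "tensor_pair S R R ?S2 Q" "tensor_pair S R R ?S2 P"
    by (intro tensor_pair.intro Q p(1) S1 S2)+
  define g1 where "g1 = tens_map R P ?S1 (\<lambda>(q, s). (a' q, id s))"
  define g2 where "g2 = tens_map R ?S2 P (\<lambda>(s, q). (id s, a' q))"
  note id = bimod_iso_id
  have g1: "g1 \<in> bimod_iso R S (tensor R Q ?S1) (tensor R P ?S1)"
    "\<And>q s. q \<in> carrier Q \<Longrightarrow> s \<in> carrier S \<Longrightarrow>
      g1 (pure_tensor R Q ?S1 q s) = pure_tensor R P ?S1 (a' q) s"
    using tensor_map_iso[OF t1 a' id] tensor_map_pure[OF t1 ah bimod_iso_hom[OF id]]
    by (simp_all add: g1_def)
  have g2: "g2 \<in> bimod_iso S R (tensor R ?S2 Q) (tensor R ?S2 P)"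
    "\<And>q s. q \<in> carrier Q \<Longrightarrow> s \<in> carrier S \<Longrightarrow>
      g2 (pure_tensor R ?S2 Q s q) = pure_tensor R ?S2 P s (a' q)"
    using tensor_map_iso[OF t2 id a'] tensor_map_pure[OF t2 bimod_iso_hom[OF id] ah]
    by (simp_all add: g2_def)
  have "\<exists>f \<in> bimod_iso R S (tensor R Q ?S1) (restrict_scalars i id Y).
      \<forall>q\<in>carrier Q. \<forall>s\<in>carrier S. f (pure_tensor R Q ?S1 q s) = rmul Y (\<psi> q) s"
  proof (rule bexI)
    show "b \<circ> (f1 \<circ> g1) \<in> bimod_iso R S (tensor R Q ?S1) (restrict_scalars i id Y)"
      by (rule bimod_iso_comp[OF bimod_iso_comp[OF g1(1) f1(1)] b_iso(1)])
    show "\<forall>q\<in>carrier Q. \<forall>s\<in>carrier S. (b \<circ> (f1 \<circ> g1)) (pure_tensor R Q ?S1 q s) = rmul Y (\<psi> q) s"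
      using f1(2) by (simp add: g1(2) a'c \<psi> bimod_hom_rmul[OF bh] \<phi>c)
  qed
  moreover have "\<exists>f \<in> bimod_iso S R (tensor R ?S2 Q) (restrict_scalars id i Y).
      \<forall>s\<in>carrier S. \<forall>q\<in>carrier Q. f (pure_tensor R ?S2 Q s q) = lmul Y s (\<psi> q)"
  proof (rule bexI)
    show "b \<circ> (f2 \<circ> g2) \<in> bimod_iso S R (tensor R ?S2 Q) (restrict_scalars id i Y)"
      by (rule bimod_iso_comp[OF bimod_iso_comp[OF g2(1) f2(1)] b_iso(2)])
    show "\<forall>s\<in>carrier S. \<forall>q\<in>carrier Q. (b \<circ> (f2 \<circ> g2)) (pure_tensor R ?S2 Q s q) = lmul Y s (\<psi> q)"
      using f2(2) by (simp add: g2(2) a'c \<psi> bimod_hom_lmul[OF bh] \<phi>c)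
  qed
  ultimately show ?thesis
    unfolding ext_object_def Let_def using Q Y \<psi>_hom by auto
qed

text \<open>\<open>\<phi>\<close> and \<open>\<psi>\<close> respect scalars from R only; a scalar of
  R becomes one of S through \<open>i\<close> and crosses the tensor sign over S.\<close>

lemma ext_tensor_map:
  fixes P :: "('r, 'r, 'p) bimod" and Q :: "('r, 'r, 'q) bimod"
    and X :: "('s, 's, 'x) bimod" and Y :: "('s, 's, 'w) bimod"
  assumes b: "bimodule R R P" "bimodule S S X" "bimodule R R Q" "bimodule S S Y"
    and \<phi>: "\<phi> \<in> bimod_hom R R P (restrict_scalars i i X)"
    and \<psi>: "\<psi> \<in> bimod_hom R R Q (restrict_scalars i i Y)" and i: "i \<in> ring_hom R S"
  shows "tens_map S X Y (\<lambda>(p, q). (\<phi> p, \<psi> q)) \<in> hom (tensor R P Q) (tensor S X Y)"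
    and "\<And>p q. p \<in> carrier P \<Longrightarrow> q \<in> carrier Q \<Longrightarrow>
      tens_map S X Y (\<lambda>(p, q). (\<phi> p, \<psi> q)) (pure_tensor R P Q p q) = pure_tensor S X Y (\<phi> p) (\<psi> q)"
proof -
  have ic: "\<And>r. r \<in> carrier R \<Longrightarrow> i r \<in> carrier S" using i by (auto simp: ring_hom_def)
  interpret D: tensor_pair R R R P Q using b by (intro tensor_pair.intro)
  interpret E: tensor_pair S S S X Y using b by (intro tensor_pair.intro)
  note s = bimod_hom_closed[OF \<phi>, simplified] bimod_hom_closed[OF \<psi>, simplified]
    bimod_hom_add[OF \<phi>, simplified] bimod_hom_add[OF \<psi>, simplified]
    bimod_hom_rmul[OF \<phi>, simplified] bimod_hom_lmul[OF \<psi>, simplified] ic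
  let ?h = "\<lambda>(p, q). (\<phi> p, \<psi> q)"
  have "balanced R P Q E.X (\<lambda>p q. E.pure (\<phi> p) (\<psi> q))"
    by (rule balancedI) (simp_all add: s E.pure_add_left E.pure_add_right E.pure_middle)
  then have bal: "balanced R P Q E.X (\<lambda>p q. E.pure (fst (?h (p, q))) (snd (?h (p, q))))" by simp
  show "tens_map S X Y ?h \<in> hom D.X E.X"
    by (rule E.tens_map_hom[OF D.tensor_pair_axioms _ bal]) (auto simp: s)
  show "tens_map S X Y ?h (D.pure p q) = E.pure (\<phi> p) (\<psi> q)"
    if "p \<in> carrier P" "q \<in> carrier Q" for p q
    by (subst E.tens_map_pure[OF D.tensor_pair_axioms _ bal]) (use that in \<open>auto simp: s\<close>)
qed

lemma ext_pre_tensor: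
  assumes u: "ext_object i R S u" and v: "ext_object i R S v" and i: "i \<in> ring_hom R S"
  shows "ext_pre R S (ext_tensor R S u v)"
proof -
  obtain P X \<phi> Q Y \<psi> where e: "u = (P, X, \<phi>)" "v = (Q, Y, \<psi>)"
    by (metis prod_cases3)
  note p = ext_object_parts[OF u[unfolded e]] and q = ext_object_parts[OF v[unfolded e]]
  show ?thesis
    using ext_tensor_map(1)[OF p(1,2) q(1,2) p(3) q(3) i]
      tensor_pair.tensor_bimodule[OF tensor_pair.intro[OF p(1) q(1)]]
      tensor_pair.tensor_bimodule[OF tensor_pair.intro[OF p(2) q(2)]]
    by (auto simp: ext_pre_def ext_tensor_def e hom_def)
qed

lemma ext_tensor_cong:
  fixes u :: "('r, 'r, 'p) bimod \<times> ('s, 's, 'x) bimod \<times> ('p \<Rightarrow> 'x)"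
    and v :: "('r, 'r, 'q) bimod \<times> ('s, 's, 'w) bimod \<times> ('q \<Rightarrow> 'w)"
    and u' :: "('r, 'r, 'p1) bimod \<times> ('s, 's, 'x1) bimod \<times> ('p1 \<Rightarrow> 'x1)"
    and v' :: "('r, 'r, 'q1) bimod \<times> ('s, 's, 'w1) bimod \<times> ('q1 \<Rightarrow> 'w1)"
  assumes u: "ext_object i R S u" and v: "ext_object i R S v"
    and u': "ext_object i R S u'" and v': "ext_object i R S v'"
    and uu': "ext_isomorphic R S u u'" and vv': "ext_isomorphic R S v v'" and i: "i \<in> ring_hom R S"
  shows "ext_isomorphic R S (ext_tensor R S u v) (ext_tensor R S u' v')"
proof -
  obtain P X \<phi> Q Y \<psi> where e: "u = (P, X, \<phi>)" "v = (Q, Y, \<psi>)"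
    by (metis prod_cases3)
  obtain P' X' \<phi>' Q' Y' \<psi>' where e': "u' = (P', X', \<phi>')" "v' = (Q', Y', \<psi>')"
    by (metis prod_cases3)
  note p = ext_object_parts[OF u[unfolded e]] and q = ext_object_parts[OF v[unfolded e]]
  note p' = ext_object_parts[OF u'[unfolded e']] and q' = ext_object_parts[OF v'[unfolded e']]
  obtain a b where ab: "a \<in> bimod_iso R R P P'" "b \<in> bimod_iso S S X X'"
    "\<And>p. p \<in> carrier P \<Longrightarrow> b (\<phi> p) = \<phi>' (a p)"
    by (rule ext_isomorphicE[OF uu'[unfolded e e']]) blast
  obtain c d where cd: "c \<in> bimod_iso R R Q Q'" "d \<in> bimod_iso S S Y Y'"
    "\<And>p. p \<in> carrier Q \<Longrightarrow> d (\<psi> p) = \<psi>' (c p)"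
    by (rule ext_isomorphicE[OF vv'[unfolded e e']]) blast
  note t = tensor_pair.intro[OF p(1) q(1)] tensor_pair.intro[OF p'(1) q'(1)]
    tensor_pair.intro[OF p(2) q(2)] tensor_pair.intro[OF p'(2) q'(2)]
  interpret D: tensor_pair R R R P Q by (rule t)
  interpret E: tensor_pair S S S X Y by (rule t)
  interpret D': tensor_pair R R R P' Q' by (rule t)
  interpret E': tensor_pair S S S X' Y' by (rule t)
  note h = ab(1,2)[THEN bimod_iso_hom] cd(1,2)[THEN bimod_iso_hom]
  define F where "F = tens_map R P' Q' (\<lambda>(m, n). (a m, c n))"
  define G where "G = tens_map S X' Y' (\<lambda>(m, n). (b m, d n))"
  have F: "F \<in> bimod_iso R R D.X D'.X"
    "\<And>m n. m \<in> carrier P \<Longrightarrow> n \<in> carrier Q \<Longrightarrow> F (D.pure m n) = D'.pure (a m) (c n)"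
    unfolding F_def by (rule tensor_map_iso[OF t(1,2) ab(1) cd(1)]) (rule tensor_map_pure[OF t(1,2) h(1,3)])
  have G: "G \<in> bimod_iso S S E.X E'.X"
    "\<And>m n. m \<in> carrier X \<Longrightarrow> n \<in> carrier Y \<Longrightarrow> G (E.pure m n) = E'.pure (b m) (d n)"
    unfolding G_def by (rule tensor_map_iso[OF t(3,4) ab(2) cd(2)]) (rule tensor_map_pure[OF t(3,4) h(2,4)])
  define \<theta> where "\<theta> = tens_map S X Y (\<lambda>(p, q). (\<phi> p, \<psi> q))"
  define \<theta>' where "\<theta>' = tens_map S X' Y' (\<lambda>(p, q). (\<phi>' p, \<psi>' q))"
  note \<theta> = ext_tensor_map[OF p(1,2) q(1,2) p(3) q(3) i, folded \<theta>_def]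
  note \<theta>' = ext_tensor_map[OF p'(1,2) q'(1,2) p'(3) q'(3) i, folded \<theta>'_def]
  have "G (\<theta> z) = \<theta>' (F z)" if "z \<in> carrier D.X" for z
  proof (rule D.hom_eqI[where f = "\<lambda>z. G (\<theta> z)" and g = "\<lambda>z. \<theta>' (F z)" and K = E'.X, OF _ _ that])
    show "(\<lambda>z. G (\<theta> z)) \<in> hom D.X E'.X" "(\<lambda>z. \<theta>' (F z)) \<in> hom D.X E'.X"
      using hom_compose[OF \<theta>(1) bimod_hom_hom[OF bimod_iso_hom[OF G(1)]]]
        hom_compose[OF bimod_hom_hom[OF bimod_iso_hom[OF F(1)]] \<theta>'(1)] by (simp_all add: comp_def)
    fix m n assume mn: "m \<in> carrier P" "n \<in> carrier Q"
    then show "G (\<theta> (D.pure m n)) = \<theta>' (F (D.pure m n))"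
      using bimod_hom_closed[OF p(3) mn(1)] bimod_hom_closed[OF q(3) mn(2)]
      by (simp add: \<theta>(2) G(2) F(2) \<theta>'(2) ab(3) cd(3) bimod_hom_closed[OF h(1)] bimod_hom_closed[OF h(3)])
  qed
  then show ?thesis
    unfolding e e' ext_tensor_def prod.case by (intro ext_isomorphicI[OF F(1) G(1)]) (simp add: \<theta>_def \<theta>'_def)
qed

section \<open>The objects \<open>P \<otimes>\<^sub>A R \<Rightarrow> P \<otimes>\<^sub>A S\<close>\<close>

text \<open>A and R share a carrier type, so the inclusion is expressed by the identity being a
  homomorphism; \<open>i\<close> sends A into the centre of S.\<close>

locale tower = A: cring A + R: cring R + S: ring S
  for A :: "('r, 'x) ring_scheme" and R :: "('r, 'y) ring_scheme" and S :: "('s, 'z) ring_scheme" +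
  fixes i :: "'r \<Rightarrow> 's"
  assumes id_hom: "id \<in> ring_hom A R" and i_hom: "i \<in> ring_hom R S"
    and i_central: "a \<in> carrier A \<Longrightarrow> s \<in> carrier S \<Longrightarrow> i a \<otimes>\<^bsub>S\<^esub> s = s \<otimes>\<^bsub>S\<^esub> i a"
begin

lemma A_in_R: "a \<in> carrier A \<Longrightarrow> a \<in> carrier R"
  using id_hom by (auto simp: ring_hom_def)

lemma i_closed [simp]: "r \<in> carrier R \<Longrightarrow> i r \<in> carrier S"
  using i_hom by (auto simp: ring_hom_def)

lemmas i_mult [simp] = ring_hom_mult[OF i_hom] and i_add [simp] = ring_hom_add[OF i_hom]
  and i_one [simp] = ring_hom_one[OF i_hom]

lemma AR: "central_hom A R id"
  by unfold_locales (simp_all add: id_hom A_in_R R.m_comm)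

lemma AS: "central_hom A S i"
proof unfold_locales
  show "i \<in> ring_hom A S" using ring_hom_trans[OF id_hom i_hom] by simp
qed (rule i_central)

end

locale tower_module = tower A R S i + P: bimodule A A P
  for A :: "('r, 'x) ring_scheme" and R :: "('r, 'y) ring_scheme" and S :: "('s, 'z) ring_scheme"
    and i :: "'r \<Rightarrow> 's" and P :: "('r, 'r, 'p) bimod"
begin

sublocale PR: bc_module A R id P
  using AR P.bimodule_axioms by (rule bc_module.intro)

sublocale PS: bc_module A S i P
  using AS P.bimodule_axioms by (rule bc_module.intro)

abbreviation "\<phi> \<equiv> tens_map A P PS.T' (\<lambda>(p, r). (p, i r))"

lemma xi_object_eq: "xi_object A i R S P = (PR.Y, PS.Y, \<phi>)"
  by (simp add: xi_object_def)

lemma PR_middle: "p \<in> carrier P \<Longrightarrow> a \<in> carrier A \<Longrightarrow> r \<in> carrier R \<Longrightarrow>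
    PR.pt (rmul P p a) r = PR.pt p (a \<otimes>\<^bsub>R\<^esub> r)"
  using PR.pt_middle[of p a r] by simp

lemma phi_hom: "\<phi> \<in> hom PR.Y PS.Y"
  and phi_pt [simp]: "\<And>p r. p \<in> carrier P \<Longrightarrow> r \<in> carrier R \<Longrightarrow> \<phi> (PR.pt p r) = PS.pt p (i r)"
proof -
  let ?h = "\<lambda>(p, r). (p, i r)"
  have "balanced A P PR.T' PS.D.X (\<lambda>p r. PS.pt p (i r))"
    by (rule balancedI) (simp_all add: PS.D.pure_add_left PS.pt_add_right A_in_R PS.pt_middle
        flip: PS.Y_eqs)
  then have bal: "balanced A P PR.T' PS.D.X (\<lambda>p r. PS.pt (fst (?h (p, r))) (snd (?h (p, r))))" by simp
  show "\<phi> \<in> hom PR.Y PS.Y"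
    unfolding PR.hom_Y_eqs PS.hom_Y_eqs
    by (rule PS.D.tens_map_hom[OF PR.D.tensor_pair_axioms _ bal]) auto
  show "\<phi> (PR.pt p r) = PS.pt p (i r)" if "p \<in> carrier P" "r \<in> carrier R" for p r
    by (subst PS.D.tens_map_pure[OF PR.D.tensor_pair_axioms _ bal]) (use that in auto)
qed

lemma phi_bimod_hom: "\<phi> \<in> bimod_hom R R PR.Y (restrict_scalars i i PS.Y)"
proof (rule PR.Y_bimod_homI)
  show "bimodule R R (restrict_scalars i i PS.Y)"
    by (rule bimodule_restrict[OF PS.Y_bimodule i_hom i_hom R.ring_axioms R.ring_axioms])
  show "\<phi> \<in> hom PR.Y (restrict_scalars i i PS.Y)" using phi_hom by (simp add: hom_def)
qed simp_all

text \<open>The inverses send p \<otimes> s to (p \<otimes> 1) \<otimes> s and to s \<otimes> (p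
  \<otimes> 1). That the second one is balanced uses that \<open>i a\<close> is central in
  S.\<close>

lemma xi_ext_object: "ext_object i R S (xi_object A i R S P)"
proof -
  have idS: "id \<in> ring_hom S S" by (auto simp: ring_hom_def)
  let ?S1 = "restrict_scalars i id (regular_bimod S)" and ?S2 = "restrict_scalars id i (regular_bimod S)"
  have S1: "bimodule R S ?S1"
    by (rule bimodule_restrict[OF bimodule_regular[OF S.ring_axioms] i_hom idS R.ring_axioms S.ring_axioms])
  have S2: "bimodule S R ?S2"
    by (rule bimodule_restrict[OF bimodule_regular[OF S.ring_axioms] idS i_hom S.ring_axioms R.ring_axioms])
  interpret D1: tensor_pair R R S PR.Y ?S1 using PR.Y_bimodule S1 by (rule tensor_pair.intro)
  interpret D2: tensor_pair S R R ?S2 PR.Y using S2 PR.Y_bimodule by (rule tensor_pair.intro)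
  note \<phi>s = bimod_hom_closed[OF phi_bimod_hom, simplified] bimod_hom_add[OF phi_bimod_hom, simplified]
    bimod_hom_lmul[OF phi_bimod_hom, simplified] bimod_hom_rmul[OF phi_bimod_hom, simplified]
  note Ys = PS.Y.lmul_closed PS.Y.rmul_closed PS.Y.lmul_add_left PS.Y.lmul_add_right
    PS.Y.rmul_add_left PS.Y.rmul_add_right PS.Y.lmul_assoc PS.Y.rmul_assoc PS.Y.lmul_rmul
  have bal1: "balanced R PR.Y ?S1 PS.Y (\<lambda>x s. rmul PS.Y (\<phi> x) s)"
    by (rule balancedI) (simp_all add: \<phi>s Ys)
  have bal2: "balanced R ?S2 PR.Y PS.Y (\<lambda>s x. lmul PS.Y s (\<phi> x))"
    by (rule balancedI) (simp_all add: \<phi>s Ys)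
  define f1 where "f1 = tlift R PR.Y ?S1 PS.Y (\<lambda>x s. rmul PS.Y (\<phi> x) s)"
  define f2 where "f2 = tlift R ?S2 PR.Y PS.Y (\<lambda>s x. lmul PS.Y s (\<phi> x))"
  have f1: "f1 \<in> hom D1.X PS.Y"
    "\<And>x s. x \<in> carrier PR.Y \<Longrightarrow> s \<in> carrier S \<Longrightarrow> f1 (D1.pure x s) = rmul PS.Y (\<phi> x) s"
    using D1.tlift_hom[OF PS.Y.comm_group_axioms bal1] D1.tlift_pure[OF PS.Y.comm_group_axioms bal1]
    by (simp_all add: f1_def)
  have f2: "f2 \<in> hom D2.X PS.Y"
    "\<And>x s. x \<in> carrier PR.Y \<Longrightarrow> s \<in> carrier S \<Longrightarrow> f2 (D2.pure s x) = lmul PS.Y s (\<phi> x)"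
    using D2.tlift_hom[OF PS.Y.comm_group_axioms bal2] D2.tlift_pure[OF PS.Y.comm_group_axioms bal2]
    by (simp_all add: f2_def)
  have mid1: "D1.pure (PR.pt (rmul P p a) \<one>\<^bsub>R\<^esub>) s = D1.pure (PR.pt p \<one>\<^bsub>R\<^esub>) (i a \<otimes>\<^bsub>S\<^esub> s)"
    if "p \<in> carrier P" "a \<in> carrier R" "a \<in> carrier A" "s \<in> carrier S" for p a s
    using that D1.pure_middle[of "PR.pt p \<one>\<^bsub>R\<^esub>" s a] by (simp add: PR_middle)
  have mid2: "D2.pure s (PR.pt (rmul P p a) \<one>\<^bsub>R\<^esub>) = D2.pure (i a \<otimes>\<^bsub>S\<^esub> s) (PR.pt p \<one>\<^bsub>R\<^esub>)"
    if "p \<in> carrier P" "a \<in> carrier R" "a \<in> carrier A" "s \<in> carrier S" for p a s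
    using that D2.pure_middle[of s "PR.pt p \<one>\<^bsub>R\<^esub>" a] by (simp add: PR_middle i_central)
  define g1 where "g1 = tlift A P PS.T' D1.X (\<lambda>p s. D1.pure (PR.pt p \<one>\<^bsub>R\<^esub>) s)"
  define g2 where "g2 = tlift A P PS.T' D2.X (\<lambda>p s. D2.pure s (PR.pt p \<one>\<^bsub>R\<^esub>))"
  note L1 = PS.Y_lift_hom[OF D1.X.comm_group_axioms] PS.Y_lift_pt[OF D1.X.comm_group_axioms]
  note L2 = PS.Y_lift_hom[OF D2.X.comm_group_axioms] PS.Y_lift_pt[OF D2.X.comm_group_axioms]
  have a1: "D1.pure x (s \<oplus>\<^bsub>S\<^esub> s') = D1.pure x s \<otimes>\<^bsub>D1.X\<^esub> D1.pure x s'"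
    if "x \<in> carrier PR.Y" "s \<in> carrier S" "s' \<in> carrier S" for x s s'
    using D1.pure_add_right[of x s s'] that by simp
  have a2: "D2.pure (s \<oplus>\<^bsub>S\<^esub> s') x = D2.pure s x \<otimes>\<^bsub>D2.X\<^esub> D2.pure s' x"
    if "x \<in> carrier PR.Y" "s \<in> carrier S" "s' \<in> carrier S" for x s s'
    using D2.pure_add_left[of s x s'] that by simp
  have g1: "g1 \<in> hom PS.Y D1.X"
    unfolding g1_def by (rule L1) (simp_all add: PR.pt_add_left D1.pure_add_left a1 mid1 A_in_R)
  have g1p: "g1 (PS.pt p s) = D1.pure (PR.pt p \<one>\<^bsub>R\<^esub>) s" if "p \<in> carrier P" "s \<in> carrier S" for p s
    unfolding g1_def by (rule L1) (simp_all add: PR.pt_add_left D1.pure_add_left a1 mid1 A_in_R that)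
  have g2: "g2 \<in> hom PS.Y D2.X"
    unfolding g2_def by (rule L2) (simp_all add: PR.pt_add_left D2.pure_add_right a2 mid2 A_in_R)
  have g2p: "g2 (PS.pt p s) = D2.pure s (PR.pt p \<one>\<^bsub>R\<^esub>)" if "p \<in> carrier P" "s \<in> carrier S" for p s
    unfolding g2_def by (rule L2) (simp_all add: PR.pt_add_left D2.pure_add_right a2 mid2 A_in_R that)
  note c = hom_in_carrier[OF f1(1)] hom_in_carrier[OF f2(1)] hom_in_carrier[OF g1] hom_in_carrier[OF g2]
  note m = hom_mult[OF f1(1)] hom_mult[OF f2(1)] hom_mult[OF g1] hom_mult[OF g2]
  have gf1: "g1 (f1 (D1.pure x s)) = D1.pure x s" if x: "x \<in> carrier PR.Y" and s: "s \<in> carrier S" for x s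
  proof (rule PR.Y_induct[OF x])
    fix p r assume pr: "p \<in> carrier P" "r \<in> carrier R"
    have "D1.pure (PR.pt p \<one>\<^bsub>R\<^esub>) (i r \<otimes>\<^bsub>S\<^esub> s) = D1.pure (PR.pt p r) s"
      using D1.pure_middle[of "PR.pt p \<one>\<^bsub>R\<^esub>" s r] pr s by simp
    then show "g1 (f1 (D1.pure (PR.pt p r) s)) = D1.pure (PR.pt p r) s"
      using pr s by (simp add: f1(2) g1p)
  qed (simp_all del: id_apply add: D1.pure_add_left s m c)
  have gf2: "g2 (f2 (D2.pure s x)) = D2.pure s x" if x: "x \<in> carrier PR.Y" and s: "s \<in> carrier S" for x s
  proof (rule PR.Y_induct[OF x])
    fix p r assume pr: "p \<in> carrier P" "r \<in> carrier R"
    have "D2.pure (s \<otimes>\<^bsub>S\<^esub> i r) (PR.pt p \<one>\<^bsub>R\<^esub>) = D2.pure s (PR.pt p r)"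
      using D2.pure_middle[of s "PR.pt p \<one>\<^bsub>R\<^esub>" r] pr s by simp
    then show "g2 (f2 (D2.pure s (PR.pt p r))) = D2.pure s (PR.pt p r)"
      using pr s by (simp add: f2(2) g2p)
  qed (simp_all del: id_apply add: D2.pure_add_right s m c)
  have fg1: "f1 (g1 y) = y" if y: "y \<in> carrier PS.Y" for y
    by (rule PS.Y_induct[OF y]) (simp_all del: id_apply add: g1p f1(2) m c)
  have fg2: "f2 (g2 y) = y" if y: "y \<in> carrier PS.Y" for y
    by (rule PS.Y_induct[OF y]) (simp_all del: id_apply add: g2p f2(2) m c)
  have gf1': "g1 (f1 z) = z" if z: "z \<in> carrier D1.X" for z
    by (rule D1.hom_eqI[where f = "\<lambda>z. g1 (f1 z)" and g = "\<lambda>z. z" and K = D1.X, OF _ _ z])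
      (use hom_compose[OF f1(1) g1] gf1 in \<open>auto simp: comp_def hom_def\<close>)
  have gf2': "g2 (f2 z) = z" if z: "z \<in> carrier D2.X" for z
    by (rule D2.hom_eqI[where f = "\<lambda>z. g2 (f2 z)" and g = "\<lambda>z. z" and K = D2.X, OF _ _ z])
      (use hom_compose[OF f2(1) g2] gf2 in \<open>auto simp: comp_def hom_def\<close>)
  have K1: "bimodule R S (restrict_scalars i id PS.Y)"
    by (rule bimodule_restrict[OF PS.Y_bimodule i_hom idS R.ring_axioms S.ring_axioms])
  have K2: "bimodule S R (restrict_scalars id i PS.Y)"
    by (rule bimodule_restrict[OF PS.Y_bimodule idS i_hom S.ring_axioms R.ring_axioms])
  have "f1 \<in> bimod_hom R S D1.X (restrict_scalars i id PS.Y)"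
    by (rule D1.bimod_hom_tensorI[OF K1])
      (use f1(1) in \<open>simp_all add: hom_def f1(2) \<phi>s Ys PR.Y.lmul_closed\<close>)
  then have i1: "f1 \<in> bimod_iso R S D1.X (restrict_scalars i id PS.Y)"
    by (rule bimod_isoI[where g = g1]) (simp_all add: c gf1' fg1)
  have "f2 \<in> bimod_hom S R D2.X (restrict_scalars id i PS.Y)"
    by (rule D2.bimod_hom_tensorI[OF K2])
      (use f2(1) in \<open>simp_all add: hom_def f2(2) \<phi>s Ys PR.Y.rmul_closed\<close>)
  then have i2: "f2 \<in> bimod_iso S R D2.X (restrict_scalars id i PS.Y)"
    by (rule bimod_isoI[where g = g2]) (simp_all add: c gf2' fg2)
  have "\<exists>f\<in>bimod_iso R S D1.X (restrict_scalars i id PS.Y).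
      \<forall>x\<in>carrier PR.Y. \<forall>s\<in>carrier S. f (D1.pure x s) = rmul PS.Y (\<phi> x) s"
    by (rule bexI[OF _ i1]) (simp add: f1(2))
  moreover have "\<exists>f\<in>bimod_iso S R D2.X (restrict_scalars id i PS.Y).
      \<forall>s\<in>carrier S. \<forall>x\<in>carrier PR.Y. f (D2.pure s x) = lmul PS.Y s (\<phi> x)"
    by (rule bexI[OF _ i2]) (simp add: f2(2))
  ultimately show ?thesis
    unfolding xi_object_eq ext_object_def prod.case Let_def
    using PR.Y_bimodule PS.Y_bimodule phi_bimod_hom by blast
qed

end

lemma xi_object_cong:
  assumes P: "tower_module A R S i P" and Q: "tower_module A R S i Q" and f: "f \<in> bimod_iso A A P Q"
  shows "ext_isomorphic R S (xi_object A i R S P) (xi_object A i R S Q)"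
proof -
  interpret P: tower_module A R S i P by fact
  interpret Q: tower_module A R S i Q by fact
  obtain a where a: "a \<in> bimod_iso R R P.PR.Y Q.PR.Y"
    "\<And>p t. p \<in> carrier P \<Longrightarrow> t \<in> carrier R \<Longrightarrow> a (P.PR.pt p t) = Q.PR.pt (f p) t"
    by (rule bc_map[OF P.PR.bc_module_axioms Q.PR.bc_module_axioms f]) blast
  obtain b where b: "b \<in> bimod_iso S S P.PS.Y Q.PS.Y"
    "\<And>p t. p \<in> carrier P \<Longrightarrow> t \<in> carrier S \<Longrightarrow> b (P.PS.pt p t) = Q.PS.pt (f p) t"
    by (rule bc_map[OF P.PS.bc_module_axioms Q.PS.bc_module_axioms f]) blast
  note ah = bimod_iso_hom[OF a(1)] and bh = bimod_iso_hom[OF b(1)] and fh = bimod_iso_hom[OF f]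
  show ?thesis
    unfolding P.xi_object_eq Q.xi_object_eq
  proof (rule ext_isomorphicI[OF a(1) b(1)])
    fix x assume x: "x \<in> carrier P.PR.Y"
    show "b (P.\<phi> x) = Q.\<phi> (a x)"
      by (rule P.PR.Y_induct[OF x]) (simp_all del: id_apply add: a(2) b(2) bimod_hom_closed[OF fh]
        bimod_hom_add[OF ah] bimod_hom_add[OF bh] hom_mult[OF P.phi_hom] hom_mult[OF Q.phi_hom]
        hom_in_carrier[OF P.phi_hom] bimod_hom_closed[OF ah])
  qed
qed

text \<open>The isomorphisms of \<open>bc_mult\<close> over R and over S have the same formula on
  pure tensors, hence they are compatible with the structure maps.\<close>

lemma xi_object_tensor:
  assumes P: "tower_module A R S i P" and Q: "tower_module A R S i Q"
    and PQ: "tower_module A R S i (tensor A P Q)" and cQ: "central_over (carrier A) Q"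
  shows "ext_isomorphic R S (ext_tensor R S (xi_object A i R S P) (xi_object A i R S Q))
    (xi_object A i R S (tensor A P Q))"
proof -
  interpret P: tower_module A R S i P by fact
  interpret Q: tower_module A R S i Q by fact
  interpret PQ: tower_module A R S i "tensor A P Q" by fact
  interpret D: tensor_pair A A A P Q
    using P.P.bimodule_axioms Q.P.bimodule_axioms by (rule tensor_pair.intro)
  interpret DR: tensor_pair R R R P.PR.Y Q.PR.Y
    using P.PR.Y_bimodule Q.PR.Y_bimodule by (rule tensor_pair.intro)
  interpret DS: tensor_pair S S S P.PS.Y Q.PS.Y
    using P.PS.Y_bimodule Q.PS.Y_bimodule by (rule tensor_pair.intro)
  obtain a where a: "a \<in> bimod_iso R R DR.X PQ.PR.Y"
    "\<And>p t q t'. p \<in> carrier P \<Longrightarrow> t \<in> carrier R \<Longrightarrow> q \<in> carrier Q \<Longrightarrow> t' \<in> carrier R \<Longrightarrow>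
      a (DR.pure (P.PR.pt p t) (Q.PR.pt q t')) = PQ.PR.pt (D.pure p q) (t \<otimes>\<^bsub>R\<^esub> t')"
    by (rule bc_mult[OF P.PR.bc_module_axioms Q.PR.bc_module_axioms cQ]) blast
  obtain b where b: "b \<in> bimod_iso S S DS.X PQ.PS.Y"
    "\<And>p t q t'. p \<in> carrier P \<Longrightarrow> t \<in> carrier S \<Longrightarrow> q \<in> carrier Q \<Longrightarrow> t' \<in> carrier S \<Longrightarrow>
      b (DS.pure (P.PS.pt p t) (Q.PS.pt q t')) = PQ.PS.pt (D.pure p q) (t \<otimes>\<^bsub>S\<^esub> t')"
    by (rule bc_mult[OF P.PS.bc_module_axioms Q.PS.bc_module_axioms cQ]) blast
  define \<theta> where "\<theta> = tens_map S P.PS.Y Q.PS.Y (\<lambda>(p, q). (P.\<phi> p, Q.\<phi> q))"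
  note \<theta> = ext_tensor_map[OF P.PR.Y_bimodule P.PS.Y_bimodule Q.PR.Y_bimodule Q.PS.Y_bimodule
      P.phi_bimod_hom Q.phi_bimod_hom P.i_hom, folded \<theta>_def]
  note ah = bimod_iso_hom[OF a(1)] and bh = bimod_iso_hom[OF b(1)]
  note s = bimod_hom_add[OF ah] bimod_hom_add[OF bh] bimod_hom_closed[OF ah] bimod_hom_closed[OF bh]
    hom_mult[OF \<theta>(1)] hom_in_carrier[OF \<theta>(1)] hom_mult[OF PQ.phi_hom]
  have pure: "b (\<theta> (DR.pure x y)) = PQ.\<phi> (a (DR.pure x y))"
    if x: "x \<in> carrier P.PR.Y" and y: "y \<in> carrier Q.PR.Y" for x y
  proof (rule P.PR.Y_induct[OF x])
    fix p r assume p: "p \<in> carrier P" "r \<in> carrier R"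
    show "b (\<theta> (DR.pure (P.PR.pt p r) y)) = PQ.\<phi> (a (DR.pure (P.PR.pt p r) y))"
    proof (rule Q.PR.Y_induct[OF y])
      fix q r' assume "q \<in> carrier Q" "r' \<in> carrier R"
      with p show "b (\<theta> (DR.pure (P.PR.pt p r) (Q.PR.pt q r'))) =
          PQ.\<phi> (a (DR.pure (P.PR.pt p r) (Q.PR.pt q r')))"
        by (simp add: \<theta>(2) a(2) b(2))
    qed (simp_all del: id_apply add: DR.pure_add_right p s)
  qed (simp_all del: id_apply add: DR.pure_add_left y s)
  have "b (\<theta> z) = PQ.\<phi> (a z)" if z: "z \<in> carrier DR.X" for z
    by (rule DR.hom_eqI[where f = "\<lambda>z. b (\<theta> z)" and g = "\<lambda>z. PQ.\<phi> (a z)" and K = PQ.PS.Y, OF _ _ z pure])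
      (use hom_compose[OF \<theta>(1) bimod_hom_hom[OF bh]] hom_compose[OF bimod_hom_hom[OF ah] PQ.phi_hom]
        in \<open>simp_all add: comp_def\<close>)
  then show ?thesis
    unfolding P.xi_object_eq Q.xi_object_eq PQ.xi_object_eq ext_tensor_def prod.case
    by (intro ext_isomorphicI[OF a(1) b(1)]) (simp add: \<theta>_def)
qed

lemma (in tower) xi_object_regular:
  "ext_isomorphic R S (xi_object A i R S (regular_bimod A)) (regular_bimod R, regular_bimod S, i)"
proof -
  interpret P: tower_module A R S i "regular_bimod A"
    using tower_axioms bimodule_regular[OF A.ring_axioms] by (rule tower_module.intro)
  obtain a where a: "a \<in> bimod_iso R R P.PR.Y (regular_bimod R)"
    "\<And>x r. x \<in> carrier A \<Longrightarrow> r \<in> carrier R \<Longrightarrow> a (P.PR.pt x r) = id x \<otimes>\<^bsub>R\<^esub> r"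
    by (rule bc_unit[OF AR]) blast
  obtain b where b: "b \<in> bimod_iso S S P.PS.Y (regular_bimod S)"
    "\<And>x s. x \<in> carrier A \<Longrightarrow> s \<in> carrier S \<Longrightarrow> b (P.PS.pt x s) = i x \<otimes>\<^bsub>S\<^esub> s"
    by (rule bc_unit[OF AS]) blast
  note ah = bimod_iso_hom[OF a(1)] and bh = bimod_iso_hom[OF b(1)]
  show ?thesis
    unfolding P.xi_object_eq
  proof (rule ext_isomorphicI[OF a(1) b(1)])
    fix x assume x: "x \<in> carrier P.PR.Y"
    show "b (P.\<phi> x) = i (a x)"
    proof (rule P.PR.Y_induct[OF x])
      fix p r assume "p \<in> carrier (regular_bimod A)" "r \<in> carrier R"
      then show "b (P.\<phi> (P.PR.pt p r)) = i (a (P.PR.pt p r))"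
        by (simp add: a(2) b(2) A_in_R)
    qed (use bimod_hom_closed[OF ah] in \<open>simp_all del: id_apply add: bimod_hom_add[OF ah]
        bimod_hom_add[OF bh] hom_mult[OF P.phi_hom] hom_in_carrier[OF P.phi_hom]\<close>)
  qed
qed

text \<open>Both components are transported along coordinates that come from one dual basis of P
  over A. This makes the class of the object nonempty.\<close>

lemma xi_object_copy:
  fixes A :: "('r, 'x) ring_scheme" and S :: "('s, 'z) ring_scheme"
  assumes t: "tower A R S i" and P: "central_invertible A P"
  obtains v :: "('r, 's) ext_obj" where "v \<in> ext_class i R S (xi_object A i R S P)"
proof -
  interpret tower A R S i by fact
  interpret tower_module A R S i P
    using t central_invertible_bimodule[OF P] by (rule tower_module.intro)
  obtain k f u where r: "rank_one A P k f u"
    using central_invertible_rank_one[OF A.cring_axioms P] by blast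
  interpret PR: bc_rank_one A R id P k f u using PR.bc_module_axioms r by (rule bc_rank_one.intro)
  interpret PS: bc_rank_one A S i P k f u using PS.bc_module_axioms r by (rule bc_rank_one.intro)
  let ?P = "transport PR.Y_coords PR.Y" and ?X = "transport PS.Y_coords PS.Y"
  note tR = bimodule_transport[OF PR.Y_bimodule PR.Y_coords_inj]
    and tS = bimodule_transport[OF PS.Y_bimodule PS.Y_coords_inj]
  let ?\<psi> = "\<lambda>q. PS.Y_coords (\<phi> (inv_into (carrier PR.Y) PR.Y_coords q))"
  have iso: "ext_isomorphic R S (PR.Y, PS.Y, \<phi>) (?P, ?X, ?\<psi>)"
    by (rule ext_isomorphicI[OF tR(2) tS(2)]) (simp add: inv_into_f_f[OF PR.Y_coords_inj])
  have obj: "ext_object i R S (?P, ?X, ?\<psi>)"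
    by (rule ext_object_cong[OF xi_ext_object[unfolded xi_object_eq] tR(1) tS(1) iso i_hom])
  have "bimod_isomorphic R R ?P PR.Y"
    using bimod_isomorphic_sym[OF PR.Y_bimodule] tR(2) by (auto simp: bimod_isomorphic_def)
  then have "invertible_bimod R ?P" by (rule invertible_bimod_cong[OF PR.Y_invertible tR(1)])
  moreover have "bimod_isomorphic S S ?X PS.Y"
    using bimod_isomorphic_sym[OF PS.Y_bimodule] tS(2) by (auto simp: bimod_isomorphic_def)
  then have "invertible_bimod S ?X" by (rule invertible_bimod_cong[OF PS.Y_invertible tS(1)])
  ultimately have "(?P, ?X, ?\<psi>) \<in> ext_class i R S (xi_object A i R S P)"
    using obj iso by (simp add: ext_class_def inv_ext_object_def xi_object_eq)
  then show thesis by (rule that)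
qed

section \<open>Unital partial actions\<close>

context unital_partial_action begin

text \<open>Extends \<open>\<alpha> g\<close> to all of R by cutting down to its domain first. The
  result is additive and multiplicative, but sends one to \<open>e g\<close>.\<close>

definition act :: "'g \<Rightarrow> 'r \<Rightarrow> 'r" where
  "act g r = \<alpha> g (r \<otimes>\<^bsub>R\<^esub> e (inv\<^bsub>G\<^esub> g))"

lemma pdom_iff: "g \<in> carrier G \<Longrightarrow> r \<in> pdom R e g \<longleftrightarrow> r \<in> carrier R \<and> r \<otimes>\<^bsub>R\<^esub> e g = r"
  using e_closed[of g] e_idem[of g] by (auto simp: pdom_def cgenideal_def R.m_assoc) metis

lemma e_one: "e \<one>\<^bsub>G\<^esub> = \<one>\<^bsub>R\<^esub>"
proof -
  have "\<one>\<^bsub>R\<^esub> \<in> pdom R e \<one>\<^bsub>G\<^esub>" by (simp add: dom_one)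
  then show ?thesis using e_closed[of "\<one>\<^bsub>G\<^esub>"] by (simp add: pdom_iff)
qed

lemma
  assumes g: "g \<in> carrier G"
  shows alpha_dom: "\<And>r. r \<in> pdom R e (inv\<^bsub>G\<^esub> g) \<Longrightarrow> \<alpha> g r \<in> pdom R e g"
    and alpha_mult: "\<And>r s. r \<in> pdom R e (inv\<^bsub>G\<^esub> g) \<Longrightarrow> s \<in> pdom R e (inv\<^bsub>G\<^esub> g) \<Longrightarrow>
      \<alpha> g (r \<otimes>\<^bsub>R\<^esub> s) = \<alpha> g r \<otimes>\<^bsub>R\<^esub> \<alpha> g s"
    and alpha_add: "\<And>r s. r \<in> pdom R e (inv\<^bsub>G\<^esub> g) \<Longrightarrow> s \<in> pdom R e (inv\<^bsub>G\<^esub> g) \<Longrightarrow>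
      \<alpha> g (r \<oplus>\<^bsub>R\<^esub> s) = \<alpha> g r \<oplus>\<^bsub>R\<^esub> \<alpha> g s"
    and alpha_e: "\<alpha> g (e (inv\<^bsub>G\<^esub> g)) = e g"
    and alpha_surj: "\<And>s. s \<in> pdom R e g \<Longrightarrow> \<exists>r\<in>pdom R e (inv\<^bsub>G\<^esub> g). \<alpha> g r = s"
proof -
  note h = alpha_iso[OF g, unfolded ring_iso_def ring_hom_def]
  show "\<alpha> g r \<in> pdom R e g" if "r \<in> pdom R e (inv\<^bsub>G\<^esub> g)" for r
    using h that by auto
  show "\<alpha> g (r \<otimes>\<^bsub>R\<^esub> s) = \<alpha> g r \<otimes>\<^bsub>R\<^esub> \<alpha> g s" "\<alpha> g (r \<oplus>\<^bsub>R\<^esub> s) = \<alpha> g r \<oplus>\<^bsub>R\<^esub> \<alpha> g s"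
    if "r \<in> pdom R e (inv\<^bsub>G\<^esub> g)" "s \<in> pdom R e (inv\<^bsub>G\<^esub> g)" for r s
    using h that by auto
  show "\<alpha> g (e (inv\<^bsub>G\<^esub> g)) = e g" using h by auto
  show "\<exists>r\<in>pdom R e (inv\<^bsub>G\<^esub> g). \<alpha> g r = s" if "s \<in> pdom R e g" for s
  proof -
    have "s \<in> \<alpha> g ` pdom R e (inv\<^bsub>G\<^esub> g)" using h that by (auto simp: bij_betw_def)
    then show ?thesis by blast
  qed
qed

lemma cut_dom: "g \<in> carrier G \<Longrightarrow> r \<in> carrier R \<Longrightarrow> r \<otimes>\<^bsub>R\<^esub> e g \<in> pdom R e g"
  by (simp add: pdom_iff e_closed e_idem R.m_assoc)

lemma act_dom: "g \<in> carrier G \<Longrightarrow> r \<in> carrier R \<Longrightarrow> act g r \<in> pdom R e g"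
  by (simp add: act_def alpha_dom cut_dom)

lemma act_closed [simp]: "g \<in> carrier G \<Longrightarrow> r \<in> carrier R \<Longrightarrow> act g r \<in> carrier R"
  using act_dom pdom_iff by blast

lemma act_e [simp]: "g \<in> carrier G \<Longrightarrow> r \<in> carrier R \<Longrightarrow> act g r \<otimes>\<^bsub>R\<^esub> e g = act g r"
  using act_dom pdom_iff by blast

lemma act_e' [simp]: "g \<in> carrier G \<Longrightarrow> r \<in> carrier R \<Longrightarrow> e g \<otimes>\<^bsub>R\<^esub> act g r = act g r"
  using act_e by (simp add: R.m_comm e_closed)

lemma act_add: "g \<in> carrier G \<Longrightarrow> r \<in> carrier R \<Longrightarrow> s \<in> carrier R \<Longrightarrow>
    act g (r \<oplus>\<^bsub>R\<^esub> s) = act g r \<oplus>\<^bsub>R\<^esub> act g s"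
  by (simp add: act_def R.l_distr e_closed alpha_add cut_dom)

lemma act_mult: "g \<in> carrier G \<Longrightarrow> r \<in> carrier R \<Longrightarrow> s \<in> carrier R \<Longrightarrow>
    act g (r \<otimes>\<^bsub>R\<^esub> s) = act g r \<otimes>\<^bsub>R\<^esub> act g s"
proof -
  assume *: "g \<in> carrier G" "r \<in> carrier R" "s \<in> carrier R"
  let ?e = "e (inv\<^bsub>G\<^esub> g)"
  have ec: "?e \<in> carrier R" and ee: "?e \<otimes>\<^bsub>R\<^esub> ?e = ?e" using * by (simp_all add: e_closed e_idem)
  have "r \<otimes>\<^bsub>R\<^esub> s \<otimes>\<^bsub>R\<^esub> ?e = r \<otimes>\<^bsub>R\<^esub> s \<otimes>\<^bsub>R\<^esub> (?e \<otimes>\<^bsub>R\<^esub> ?e)" using ee by simp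
  also have "\<dots> = (r \<otimes>\<^bsub>R\<^esub> ?e) \<otimes>\<^bsub>R\<^esub> (s \<otimes>\<^bsub>R\<^esub> ?e)" using * ec by (simp add: R.m_ac)
  finally show ?thesis using * by (simp add: act_def alpha_mult cut_dom)
qed

lemma act_unit: "g \<in> carrier G \<Longrightarrow> act g \<one>\<^bsub>R\<^esub> = e g"
  by (simp add: act_def e_closed alpha_e)

lemma act_e_inv: "g \<in> carrier G \<Longrightarrow> act g (e (inv\<^bsub>G\<^esub> g)) = e g"
  by (simp add: act_def e_closed e_idem alpha_e)

lemma act_id [simp]: "r \<in> carrier R \<Longrightarrow> act \<one>\<^bsub>G\<^esub> r = r"
  by (simp add: act_def e_one alpha_one)

lemma act_hom: "g \<in> carrier G \<Longrightarrow> act g \<in> hom (regular_bimod R) (regular_bimod R)"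
  by (simp add: hom_def act_add)

lemma act_zero [simp]: "g \<in> carrier G \<Longrightarrow> act g \<zero>\<^bsub>R\<^esub> = \<zero>\<^bsub>R\<^esub>"
  using hom_one[OF act_hom, of g] comm_group_regular[OF R.ring_axioms] by (simp add: comm_group.axioms)

lemma act_finsum: "g \<in> carrier G \<Longrightarrow> f \<in> I \<rightarrow> carrier R \<Longrightarrow>
    act g (finsum R f I) = finsum R (\<lambda>i. act g (f i)) I"
  using hom_finprod[OF comm_group_regular[OF R.ring_axioms] comm_group_regular[OF R.ring_axioms] act_hom]
  by (simp add: finprod_regular)

text \<open>The idempotent of the domain of the composite is not identified yet. A preimage
  \<open>w\<close> of 1_h 1_(g^-1) under \<open>\<alpha> h\<close> takes its place:
  \<open>r \<otimes> w\<close> lies in all domains involved, so the composition law applies to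
  it.\<close>

lemma act_act_aux:
  assumes g: "g \<in> carrier G" and h: "h \<in> carrier G" and r: "r \<in> carrier R"
  shows "act g (act h r) = act (g \<otimes>\<^bsub>G\<^esub> h) r \<otimes>\<^bsub>R\<^esub> act g (e h)"
proof -
  let ?gi = "e (inv\<^bsub>G\<^esub> g)" and ?gh = "g \<otimes>\<^bsub>G\<^esub> h"
  note ec = e_closed[OF h] e_closed[OF G.inv_closed[OF g]] e_closed[OF G.inv_closed[OF h]]
    e_closed[OF G.inv_closed[OF G.m_closed[OF g h]]]
  have in_both: "s \<otimes>\<^bsub>R\<^esub> ?gi \<in> pdom R e h \<inter> pdom R e (inv\<^bsub>G\<^esub> g)" if "s \<in> pdom R e h" for s
  proof -
    have s: "s \<in> carrier R" "s \<otimes>\<^bsub>R\<^esub> e h = s" using that h by (simp_all add: pdom_iff)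
    have "s \<otimes>\<^bsub>R\<^esub> ?gi \<otimes>\<^bsub>R\<^esub> e h = s \<otimes>\<^bsub>R\<^esub> e h \<otimes>\<^bsub>R\<^esub> ?gi" using s(1) ec by (simp add: R.m_ac)
    then show ?thesis using s g h ec by (simp add: pdom_iff R.m_assoc e_idem)
  qed
  have "e h \<in> pdom R e h" using h by (simp add: pdom_iff e_closed e_idem)
  note eh = in_both[OF this]
  obtain w where w: "w \<in> pdom R e (inv\<^bsub>G\<^esub> h)" "\<alpha> h w = e h \<otimes>\<^bsub>R\<^esub> ?gi"
    using alpha_surj[OF h] eh by blast
  have w': "w \<in> pdom R e (inv\<^bsub>G\<^esub> ?gh)" using dom_comp[OF g h w(1)] w(2) eh by simp
  have weq: "act g (e h) = \<alpha> ?gh w" using alpha_comp[OF g h w(1)] w(2) eh by (simp add: act_def)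
  have wc: "w \<in> carrier R" "w \<otimes>\<^bsub>R\<^esub> e (inv\<^bsub>G\<^esub> h) = w" "w \<otimes>\<^bsub>R\<^esub> e (inv\<^bsub>G\<^esub> ?gh) = w"
    using w w' g h by (simp_all add: pdom_iff)
  have x1: "r \<otimes>\<^bsub>R\<^esub> w = (r \<otimes>\<^bsub>R\<^esub> e (inv\<^bsub>G\<^esub> h)) \<otimes>\<^bsub>R\<^esub> w"
  proof -
    have "(r \<otimes>\<^bsub>R\<^esub> e (inv\<^bsub>G\<^esub> h)) \<otimes>\<^bsub>R\<^esub> w = r \<otimes>\<^bsub>R\<^esub> (w \<otimes>\<^bsub>R\<^esub> e (inv\<^bsub>G\<^esub> h))"
      using r wc(1) ec by (simp add: R.m_ac)
    then show ?thesis using wc by simp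
  qed
  have x2: "r \<otimes>\<^bsub>R\<^esub> w = (r \<otimes>\<^bsub>R\<^esub> e (inv\<^bsub>G\<^esub> ?gh)) \<otimes>\<^bsub>R\<^esub> w"
  proof -
    have "(r \<otimes>\<^bsub>R\<^esub> e (inv\<^bsub>G\<^esub> ?gh)) \<otimes>\<^bsub>R\<^esub> w = r \<otimes>\<^bsub>R\<^esub> (w \<otimes>\<^bsub>R\<^esub> e (inv\<^bsub>G\<^esub> ?gh))"
      using r wc(1) ec by (simp add: R.m_ac)
    then show ?thesis using wc by simp
  qed
  have xdom: "r \<otimes>\<^bsub>R\<^esub> w \<in> pdom R e (inv\<^bsub>G\<^esub> h)"
    using r wc h by (simp add: pdom_iff R.m_assoc e_closed)
  have ax: "\<alpha> h (r \<otimes>\<^bsub>R\<^esub> w) = act h r \<otimes>\<^bsub>R\<^esub> ?gi"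
  proof -
    have "\<alpha> h (r \<otimes>\<^bsub>R\<^esub> w) = act h r \<otimes>\<^bsub>R\<^esub> (e h \<otimes>\<^bsub>R\<^esub> ?gi)"
      unfolding x1 using r w h by (simp add: alpha_mult cut_dom act_def)
    then show ?thesis using r h ec by (simp add: R.m_assoc[symmetric])
  qed
  have "act g (act h r) = \<alpha> g (\<alpha> h (r \<otimes>\<^bsub>R\<^esub> w))" unfolding ax by (simp add: act_def)
  also have "\<dots> = \<alpha> ?gh (r \<otimes>\<^bsub>R\<^esub> w)"
    by (rule alpha_comp[OF g h xdom]) (use ax in_both[OF act_dom[OF h r]] in simp)
  also have "\<dots> = act ?gh r \<otimes>\<^bsub>R\<^esub> act g (e h)"
    unfolding x2 weq using r w' g h by (simp add: alpha_mult cut_dom act_def)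
  finally show ?thesis .
qed

text \<open>\<open>act_act_aux\<close> at one puts act g (1_h) below 1_(gh). The same for g^-1 and
  gh, pushed forward by g, bounds 1_g 1_(gh) by act g (1_h); being idempotents, the two are
  equal.\<close>

lemma act_e_eq:
  assumes g: "g \<in> carrier G" and h: "h \<in> carrier G"
  shows "act g (e h) = e g \<otimes>\<^bsub>R\<^esub> e (g \<otimes>\<^bsub>G\<^esub> h)"
proof -
  have below: "act g (e h) = e (g \<otimes>\<^bsub>G\<^esub> h) \<otimes>\<^bsub>R\<^esub> act g (e h)" if "g \<in> carrier G" "h \<in> carrier G" for g h
    using act_act_aux[OF that R.one_closed] that by (simp add: act_unit)
  let ?gh = "g \<otimes>\<^bsub>G\<^esub> h"
  note c = e_closed[OF g] e_closed[OF h] e_closed[OF G.m_closed[OF g h]]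
  have "inv\<^bsub>G\<^esub> g \<otimes>\<^bsub>G\<^esub> ?gh = h" using g h by (simp add: G.m_assoc[symmetric])
  then have 1: "act (inv\<^bsub>G\<^esub> g) (e ?gh) = e h \<otimes>\<^bsub>R\<^esub> act (inv\<^bsub>G\<^esub> g) (e ?gh)"
    using below[of "inv\<^bsub>G\<^esub> g" ?gh] g h by simp
  have 2: "act g (act (inv\<^bsub>G\<^esub> g) (e ?gh)) = e ?gh \<otimes>\<^bsub>R\<^esub> e g"
    using act_act_aux[of g "inv\<^bsub>G\<^esub> g" "e ?gh"] g h c by (simp add: act_e_inv)
  have "act g (e h \<otimes>\<^bsub>R\<^esub> act (inv\<^bsub>G\<^esub> g) (e ?gh)) = act g (e h) \<otimes>\<^bsub>R\<^esub> (e ?gh \<otimes>\<^bsub>R\<^esub> e g)"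
    using g h c by (simp add: act_mult 2)
  then have "e ?gh \<otimes>\<^bsub>R\<^esub> e g = act g (e h) \<otimes>\<^bsub>R\<^esub> (e ?gh \<otimes>\<^bsub>R\<^esub> e g)"
    using 1 2 by simp
  also have "\<dots> = e ?gh \<otimes>\<^bsub>R\<^esub> (act g (e h) \<otimes>\<^bsub>R\<^esub> e g)"
    using g h c by (simp add: R.m_ac del: act_e act_e')
  also have "act g (e h) \<otimes>\<^bsub>R\<^esub> e g = act g (e h)" using g c by simp
  also have "e ?gh \<otimes>\<^bsub>R\<^esub> act g (e h) = act g (e h)" by (rule below[OF g h, symmetric])
  finally show ?thesis using c by (simp add: R.m_comm)
qed

text \<open>For the extended maps, the failure of the composition law is exactly the idempotent
  1_g.\<close>

lemma act_act:
  assumes g: "g \<in> carrier G" and h: "h \<in> carrier G" and r: "r \<in> carrier R"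
  shows "act g (act h r) = e g \<otimes>\<^bsub>R\<^esub> act (g \<otimes>\<^bsub>G\<^esub> h) r"
proof -
  have "act (g \<otimes>\<^bsub>G\<^esub> h) r \<otimes>\<^bsub>R\<^esub> (e g \<otimes>\<^bsub>R\<^esub> e (g \<otimes>\<^bsub>G\<^esub> h)) = e g \<otimes>\<^bsub>R\<^esub> (act (g \<otimes>\<^bsub>G\<^esub> h) r \<otimes>\<^bsub>R\<^esub> e (g \<otimes>\<^bsub>G\<^esub> h))"
    using g h r by (simp add: R.m_ac e_closed del: act_e act_e')
  then show ?thesis using g h r by (simp add: act_act_aux act_e_eq)
qed

section \<open>The ring of invariants\<close>

abbreviation "A \<equiv> fixed_ring G R e \<alpha>"

lemma fixed_carrier: "a \<in> carrier A \<longleftrightarrow> a \<in> carrier R \<and> (\<forall>g\<in>carrier G. act g a = a \<otimes>\<^bsub>R\<^esub> e g)"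
  by (simp add: fixed_ring_def act_def)

lemma fixed_ops [simp]: "monoid.mult A = monoid.mult R" "one A = one R" "zero A = zero R" "add A = add R"
  by (simp_all add: fixed_ring_def)

lemma fixed_in_R: "a \<in> carrier A \<Longrightarrow> a \<in> carrier R"
  by (simp add: fixed_carrier)

lemma fixed_act: "a \<in> carrier A \<Longrightarrow> g \<in> carrier G \<Longrightarrow> act g a = a \<otimes>\<^bsub>R\<^esub> e g"
  by (simp add: fixed_carrier)

lemma act_neg: "g \<in> carrier G \<Longrightarrow> r \<in> carrier R \<Longrightarrow> act g (\<ominus>\<^bsub>R\<^esub> r) = \<ominus>\<^bsub>R\<^esub> act g r"
proof -
  assume *: "g \<in> carrier G" "r \<in> carrier R"
  have "act g (\<ominus>\<^bsub>R\<^esub> r) \<oplus>\<^bsub>R\<^esub> act g r = \<zero>\<^bsub>R\<^esub>"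
    using act_add[of g "\<ominus>\<^bsub>R\<^esub> r" r] * by (simp add: R.l_neg)
  then show ?thesis using * by (metis R.add.inv_equality R.add.inv_closed act_closed)
qed

lemma fixed_cring: "cring A"
proof -
  have sub: "carrier A \<subseteq> carrier R" by (auto simp: fixed_carrier)
  have "subring (carrier A) R"
  proof (rule R.subringI[OF sub])
    fix h assume h: "h \<in> carrier A"
    then show "\<ominus>\<^bsub>R\<^esub> h \<in> carrier A" by (simp add: fixed_carrier act_neg R.l_minus e_closed)
    fix k assume k: "k \<in> carrier A"
    show "h \<oplus>\<^bsub>R\<^esub> k \<in> carrier A"
      using h k by (simp add: fixed_carrier act_add R.l_distr e_closed)
    have "act g (h \<otimes>\<^bsub>R\<^esub> k) = h \<otimes>\<^bsub>R\<^esub> k \<otimes>\<^bsub>R\<^esub> e g" if g: "g \<in> carrier G" for g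
    proof -
      have "act g (h \<otimes>\<^bsub>R\<^esub> k) = act g h \<otimes>\<^bsub>R\<^esub> (k \<otimes>\<^bsub>R\<^esub> e g)"
        using g h k by (simp add: fixed_carrier act_mult)
      also have "\<dots> = (act g h \<otimes>\<^bsub>R\<^esub> e g) \<otimes>\<^bsub>R\<^esub> k"
        using g h k by (simp add: fixed_in_R R.m_ac e_closed del: act_e act_e')
      also have "\<dots> = h \<otimes>\<^bsub>R\<^esub> e g \<otimes>\<^bsub>R\<^esub> k" using g h by (simp add: fixed_in_R fixed_act R.m_assoc e_closed e_idem)
      finally show ?thesis using g h k by (simp add: fixed_in_R R.m_ac e_closed)
    qed
    then show "h \<otimes>\<^bsub>R\<^esub> k \<in> carrier A" using h k by (simp add: fixed_carrier)
  qed (simp add: fixed_carrier act_unit e_closed)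
  then have "subcring (carrier A) R"
    by (rule R.subcringI')
  then have "cring (R\<lparr>carrier := carrier A\<rparr>)" using R.subcring_iff[OF sub] by simp
  then show ?thesis by (simp add: fixed_ring_def)
qed

end

section \<open>The trace and the partial skew group ring of a finite group\<close>

locale finite_partial_action = unital_partial_action G R e \<alpha>
  for G :: "('g, 'y) monoid_scheme" and R :: "('r, 'z) ring_scheme"
    and e :: "'g \<Rightarrow> 'r" and \<alpha> :: "'g \<Rightarrow> 'r \<Rightarrow> 'r" +
  assumes fin: "finite (carrier G)"
begin

text \<open>Left translation permutes G. This is behind the invariance of the traces on R and on P
  and the reindexing in the associativity of S.\<close>

lemma finprod_shift:
  assumes "comm_monoid K" "h \<in> carrier G" "f \<in> carrier G \<rightarrow> carrier K"
  shows "finprod K (\<lambda>g. f (h \<otimes>\<^bsub>G\<^esub> g)) (carrier G) = finprod K f (carrier G)"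
proof -
  interpret K: comm_monoid K by fact
  have "finprod K f ((\<lambda>g. h \<otimes>\<^bsub>G\<^esub> g) ` carrier G) = finprod K (\<lambda>g. f (h \<otimes>\<^bsub>G\<^esub> g)) (carrier G)"
    by (rule K.finprod_reindex) (use assms in \<open>auto simp: G.inj_on_cmult\<close>)
  then show ?thesis using G.surj_const_mult[OF assms(2)] by simp
qed

lemma finsum_shift:
  "h \<in> carrier G \<Longrightarrow> f \<in> carrier G \<rightarrow> carrier R \<Longrightarrow>
    finsum R (\<lambda>g. f (h \<otimes>\<^bsub>G\<^esub> g)) (carrier G) = finsum R f (carrier G)"
  using finprod_shift[of "regular_bimod R" h f] comm_group_regular[OF R.ring_axioms]
  by (simp add: finprod_regular comm_group.axioms)

lemma finsum_single:
  "g \<in> carrier G \<Longrightarrow> a \<in> carrier R \<Longrightarrow> finsum R (\<lambda>h. if h = g then a else \<zero>\<^bsub>R\<^esub>) (carrier G) = a"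
  using R.add.finprod_singleton_swap[of g "carrier G" "\<lambda>_. a"] fin by simp

definition tr :: "'r \<Rightarrow> 'r" where
  "tr r = finsum R (\<lambda>g. act g r) (carrier G)"

lemma tr_closed [simp]: "r \<in> carrier R \<Longrightarrow> tr r \<in> carrier R"
  unfolding tr_def by (rule R.finsum_closed) auto

text \<open>Applying h to the sum translates its index by h and produces the factor 1_h from
  \<open>act_act\<close>, which is the defining condition for invariants.\<close>

lemma tr_fixed:
  assumes r: "r \<in> carrier R" shows "tr r \<in> carrier A"
  unfolding fixed_carrier
proof (intro conjI ballI)
  fix h assume h: "h \<in> carrier G"
  have "act h (tr r) = finsum R (\<lambda>g. act h (act g r)) (carrier G)"
    unfolding tr_def by (rule act_finsum[OF h]) (use r in auto)
  also have "\<dots> = finsum R (\<lambda>g. e h \<otimes>\<^bsub>R\<^esub> act (h \<otimes>\<^bsub>G\<^esub> g) r) (carrier G)"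
    by (rule R.finsum_cong') (use h r in \<open>auto simp: act_act e_closed\<close>)
  also have "\<dots> = finsum R (\<lambda>g. e h \<otimes>\<^bsub>R\<^esub> act g r) (carrier G)"
    by (rule finsum_shift[OF h]) (use h r in \<open>auto simp: e_closed\<close>)
  also have "\<dots> = e h \<otimes>\<^bsub>R\<^esub> tr r"
    unfolding tr_def by (rule R.finsum_rdistr[symmetric]) (use h r fin in \<open>auto simp: e_closed\<close>)
  finally show "act h (tr r) = tr r \<otimes>\<^bsub>R\<^esub> e h" using h r by (simp add: R.m_comm e_closed)
qed (use r in simp)

lemma tr_add: "r \<in> carrier R \<Longrightarrow> s \<in> carrier R \<Longrightarrow> tr (r \<oplus>\<^bsub>R\<^esub> s) = tr r \<oplus>\<^bsub>R\<^esub> tr s"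
proof -
  assume *: "r \<in> carrier R" "s \<in> carrier R"
  have "tr (r \<oplus>\<^bsub>R\<^esub> s) = finsum R (\<lambda>g. act g r \<oplus>\<^bsub>R\<^esub> act g s) (carrier G)"
    unfolding tr_def by (rule R.finsum_cong') (use * in \<open>auto simp: act_add\<close>)
  also have "\<dots> = tr r \<oplus>\<^bsub>R\<^esub> tr s"
    unfolding tr_def by (rule R.finsum_addf) (use * in auto)
  finally show ?thesis .
qed

lemma tr_hom: "tr \<in> hom (regular_bimod R) (regular_bimod R)"
  by (simp add: hom_def tr_add)

lemma tr_linear:
  assumes a: "a \<in> carrier A" and r: "r \<in> carrier R"
  shows "tr (a \<otimes>\<^bsub>R\<^esub> r) = a \<otimes>\<^bsub>R\<^esub> tr r"
proof -
  have aR: "a \<in> carrier R" by (rule fixed_in_R[OF a])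
  have "tr (a \<otimes>\<^bsub>R\<^esub> r) = finsum R (\<lambda>g. a \<otimes>\<^bsub>R\<^esub> act g r) (carrier G)"
    unfolding tr_def by (rule R.finsum_cong')
      (use aR r in \<open>auto simp: act_mult fixed_act[OF a] R.m_assoc e_closed\<close>)
  also have "\<dots> = a \<otimes>\<^bsub>R\<^esub> tr r"
    unfolding tr_def by (rule R.finsum_rdistr[symmetric]) (use aR r fin in auto)
  finally show ?thesis .
qed

section \<open>Ring structure of the partial skew group ring\<close>

abbreviation "S \<equiv> skew_ring G R e \<alpha>"
abbreviation "\<iota> \<equiv> skew_incl G R"

lemma S_carrier: "s \<in> carrier S \<longleftrightarrow> s \<in> extensional (carrier G) \<and>
    (\<forall>g\<in>carrier G. s g \<in> carrier R \<and> s g \<otimes>\<^bsub>R\<^esub> e g = s g)"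
  by (auto simp: skew_ring_def PiE_def Pi_iff pdom_iff)

lemma S_memI:
  assumes "s \<in> extensional (carrier G)" "\<And>g. g \<in> carrier G \<Longrightarrow> s g \<in> carrier R"
    "\<And>g. g \<in> carrier G \<Longrightarrow> s g \<otimes>\<^bsub>R\<^esub> e g = s g"
  shows "s \<in> carrier S"
  using assms by (simp add: S_carrier)

lemma S_ext: "s \<in> carrier S \<Longrightarrow> s \<in> extensional (carrier G)"
  by (simp add: S_carrier)

lemma S_val [simp]: "s \<in> carrier S \<Longrightarrow> g \<in> carrier G \<Longrightarrow> s g \<in> carrier R"
  by (simp add: S_carrier)

lemma S_val_e [simp]: "s \<in> carrier S \<Longrightarrow> g \<in> carrier G \<Longrightarrow> s g \<otimes>\<^bsub>R\<^esub> e g = s g"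
  by (simp add: S_carrier)

lemma S_eqs:
  "g \<in> carrier G \<Longrightarrow> (a \<otimes>\<^bsub>S\<^esub> b) g = finsum R (\<lambda>h. a h \<otimes>\<^bsub>R\<^esub> act h (b (inv\<^bsub>G\<^esub> h \<otimes>\<^bsub>G\<^esub> g))) (carrier G)"
  "g \<in> carrier G \<Longrightarrow> \<one>\<^bsub>S\<^esub> g = (if g = \<one>\<^bsub>G\<^esub> then \<one>\<^bsub>R\<^esub> else \<zero>\<^bsub>R\<^esub>)"
  "g \<in> carrier G \<Longrightarrow> \<zero>\<^bsub>S\<^esub> g = \<zero>\<^bsub>R\<^esub>"
  "g \<in> carrier G \<Longrightarrow> (a \<oplus>\<^bsub>S\<^esub> b) g = a g \<oplus>\<^bsub>R\<^esub> b g"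
  "a \<otimes>\<^bsub>S\<^esub> b \<in> extensional (carrier G)" "\<one>\<^bsub>S\<^esub> \<in> extensional (carrier G)"
  "\<zero>\<^bsub>S\<^esub> \<in> extensional (carrier G)" "a \<oplus>\<^bsub>S\<^esub> b \<in> extensional (carrier G)"
  by (simp_all add: skew_ring_def act_def)

lemma S_eqI:
  assumes "a \<in> carrier S" "b \<in> carrier S" "\<And>g. g \<in> carrier G \<Longrightarrow> a g = b g"
  shows "a = b"
  by (rule extensionalityI[where A = "carrier G"]) (use assms S_ext in auto)

lemma S_term:
  assumes "a \<in> carrier S" "b \<in> carrier S" "h \<in> carrier G" "g \<in> carrier G"
  shows "a h \<otimes>\<^bsub>R\<^esub> act h (b (inv\<^bsub>G\<^esub> h \<otimes>\<^bsub>G\<^esub> g)) \<in> carrier R"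
  using assms by simp

text \<open>With k = h^-1 g, the map \<open>act h\<close> sends 1_k to 1_h 1_g, so the summand for h
  lies in D_g.\<close>

lemma S_mult_closed:
  assumes a: "a \<in> carrier S" and b: "b \<in> carrier S"
  shows "a \<otimes>\<^bsub>S\<^esub> b \<in> carrier S"
proof (rule S_memI)
  fix g assume g: "g \<in> carrier G"
  note t = S_term[OF a b _ g]
  show "(a \<otimes>\<^bsub>S\<^esub> b) g \<in> carrier R"
    unfolding S_eqs(1)[OF g] by (rule R.finsum_closed, rule Pi_I, rule t)
  have "(a \<otimes>\<^bsub>S\<^esub> b) g \<otimes>\<^bsub>R\<^esub> e g =
      finsum R (\<lambda>h. a h \<otimes>\<^bsub>R\<^esub> act h (b (inv\<^bsub>G\<^esub> h \<otimes>\<^bsub>G\<^esub> g)) \<otimes>\<^bsub>R\<^esub> e g) (carrier G)"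
    unfolding S_eqs(1)[OF g] by (rule R.finsum_ldistr[OF fin e_closed[OF g]]) (rule Pi_I, rule t)
  also have "\<dots> = finsum R (\<lambda>h. a h \<otimes>\<^bsub>R\<^esub> act h (b (inv\<^bsub>G\<^esub> h \<otimes>\<^bsub>G\<^esub> g))) (carrier G)"
  proof (rule R.finsum_cong')
    fix h assume h: "h \<in> carrier G"
    let ?k = "inv\<^bsub>G\<^esub> h \<otimes>\<^bsub>G\<^esub> g"
    have k: "?k \<in> carrier G" "h \<otimes>\<^bsub>G\<^esub> ?k = g" using g h by (simp_all add: G.m_assoc[symmetric])
    have "act h (b ?k) = act h (b ?k \<otimes>\<^bsub>R\<^esub> e ?k)" using b k by simp
    also have "\<dots> = act h (b ?k) \<otimes>\<^bsub>R\<^esub> e h \<otimes>\<^bsub>R\<^esub> e g"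
      unfolding act_mult[OF h S_val[OF b k(1)] e_closed[OF k(1)]] act_e_eq[OF h k(1)] k(2)
      using h g k b by (simp add: R.m_assoc e_closed del: act_e act_e')
    finally have eq: "act h (b ?k) = act h (b ?k) \<otimes>\<^bsub>R\<^esub> e g" using h k b by simp
    have "a h \<otimes>\<^bsub>R\<^esub> act h (b ?k) \<otimes>\<^bsub>R\<^esub> e g = a h \<otimes>\<^bsub>R\<^esub> (act h (b ?k) \<otimes>\<^bsub>R\<^esub> e g)"
      using a b h k g by (simp add: R.m_assoc e_closed)
    then show "a h \<otimes>\<^bsub>R\<^esub> act h (b ?k) \<otimes>\<^bsub>R\<^esub> e g = a h \<otimes>\<^bsub>R\<^esub> act h (b ?k)" using eq by simp
  qed (use t in auto)
  finally show "(a \<otimes>\<^bsub>S\<^esub> b) g \<otimes>\<^bsub>R\<^esub> e g = (a \<otimes>\<^bsub>S\<^esub> b) g" unfolding S_eqs(1)[OF g] .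
qed (rule S_eqs)

lemma S_add_closed: "a \<in> carrier S \<Longrightarrow> b \<in> carrier S \<Longrightarrow> a \<oplus>\<^bsub>S\<^esub> b \<in> carrier S"
  by (rule S_memI) (simp_all add: S_eqs R.l_distr e_closed)

lemma S_consts: "\<one>\<^bsub>S\<^esub> \<in> carrier S" "\<zero>\<^bsub>S\<^esub> \<in> carrier S"
  by (rule S_memI; simp add: S_eqs e_closed e_one)+

text \<open>Both sides become a double sum over h and the partial product k, with terms a_h
  act_h(b_(h^-1 k)) act_k(c_(k^-1 g)). On the right the inner index is replaced by h^-1 k, and the
  idempotent 1_h from \<open>act_act\<close> is absorbed by a_h.\<close>

lemma S_mult_assoc:
  assumes a: "a \<in> carrier S" and b: "b \<in> carrier S" and c: "c \<in> carrier S"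
  shows "a \<otimes>\<^bsub>S\<^esub> b \<otimes>\<^bsub>S\<^esub> c = a \<otimes>\<^bsub>S\<^esub> (b \<otimes>\<^bsub>S\<^esub> c)"
proof (rule S_eqI)
  fix g assume g: "g \<in> carrier G"
  let ?i = "\<lambda>h. inv\<^bsub>G\<^esub> h"
  let ?F = "\<lambda>h k. a h \<otimes>\<^bsub>R\<^esub> act h (b (?i h \<otimes>\<^bsub>G\<^esub> k)) \<otimes>\<^bsub>R\<^esub> act k (c (?i k \<otimes>\<^bsub>G\<^esub> g))"
  have F: "?F h k \<in> carrier R" if "h \<in> carrier G" "k \<in> carrier G" for h k using that a b c g by simp
  have "(a \<otimes>\<^bsub>S\<^esub> b \<otimes>\<^bsub>S\<^esub> c) g = finsum R (\<lambda>k. finsum R (\<lambda>h. ?F h k) (carrier G)) (carrier G)"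
    unfolding S_eqs(1)[OF g]
  proof (rule R.finsum_cong')
    fix k assume k: "k \<in> carrier G"
    show "(a \<otimes>\<^bsub>S\<^esub> b) k \<otimes>\<^bsub>R\<^esub> act k (c (?i k \<otimes>\<^bsub>G\<^esub> g)) = finsum R (\<lambda>h. ?F h k) (carrier G)"
      unfolding S_eqs(1)[OF k] by (rule R.finsum_ldistr) (use a b c g k fin in auto)
  qed (use F in auto)
  also have "\<dots> = finsum R (\<lambda>h. finsum R (\<lambda>k. ?F h k) (carrier G)) (carrier G)"
    by (rule R.add.finprod_swap[OF fin fin]) (use F in auto)
  also have "\<dots> = (a \<otimes>\<^bsub>S\<^esub> (b \<otimes>\<^bsub>S\<^esub> c)) g"
    unfolding S_eqs(1)[OF g]
  proof (rule R.finsum_cong')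
    fix h assume h: "h \<in> carrier G"
    let ?t = "\<lambda>l. b l \<otimes>\<^bsub>R\<^esub> act l (c (?i l \<otimes>\<^bsub>G\<^esub> (?i h \<otimes>\<^bsub>G\<^esub> g)))"
    have gh: "?i h \<otimes>\<^bsub>G\<^esub> g \<in> carrier G" using g h by simp
    have t: "?t l \<in> carrier R" if "l \<in> carrier G" for l using that b c g h by simp
    have "a h \<otimes>\<^bsub>R\<^esub> act h ((b \<otimes>\<^bsub>S\<^esub> c) (?i h \<otimes>\<^bsub>G\<^esub> g)) =
        a h \<otimes>\<^bsub>R\<^esub> finsum R (\<lambda>l. act h (?t l)) (carrier G)"
      unfolding S_eqs(1)[OF gh] by (subst act_finsum[OF h]) (use t in auto)
    also have "finsum R (\<lambda>l. act h (?t l)) (carrier G) =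
        finsum R (\<lambda>k. act h (?t (?i h \<otimes>\<^bsub>G\<^esub> k))) (carrier G)"
      by (rule finsum_shift[symmetric]) (use h t in auto)
    also have "a h \<otimes>\<^bsub>R\<^esub> \<dots> = finsum R (\<lambda>k. a h \<otimes>\<^bsub>R\<^esub> act h (?t (?i h \<otimes>\<^bsub>G\<^esub> k))) (carrier G)"
      by (rule R.finsum_rdistr) (use h t a fin in auto)
    also have "\<dots> = finsum R (\<lambda>k. ?F h k) (carrier G)"
    proof (rule R.finsum_cong')
      fix k assume k: "k \<in> carrier G"
      let ?l = "?i h \<otimes>\<^bsub>G\<^esub> k" and ?z = "c (?i k \<otimes>\<^bsub>G\<^esub> g)"
      have l: "?l \<in> carrier G" "h \<otimes>\<^bsub>G\<^esub> ?l = k" "?i ?l \<otimes>\<^bsub>G\<^esub> (?i h \<otimes>\<^bsub>G\<^esub> g) = ?i k \<otimes>\<^bsub>G\<^esub> g"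
      proof -
        show "?l \<in> carrier G" "h \<otimes>\<^bsub>G\<^esub> ?l = k" using h k by (simp_all add: G.m_assoc[symmetric])
        have "?i ?l \<otimes>\<^bsub>G\<^esub> (?i h \<otimes>\<^bsub>G\<^esub> g) = ?i k \<otimes>\<^bsub>G\<^esub> (h \<otimes>\<^bsub>G\<^esub> (?i h \<otimes>\<^bsub>G\<^esub> g))"
          using h k g by (simp add: G.inv_mult_group G.m_assoc)
        also have "h \<otimes>\<^bsub>G\<^esub> (?i h \<otimes>\<^bsub>G\<^esub> g) = g" using h g by (simp add: G.m_assoc[symmetric])
        finally show "?i ?l \<otimes>\<^bsub>G\<^esub> (?i h \<otimes>\<^bsub>G\<^esub> g) = ?i k \<otimes>\<^bsub>G\<^esub> g" .
      qed
      have z: "?z \<in> carrier R" using c k g by simp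
      have "a h \<otimes>\<^bsub>R\<^esub> act h (?t ?l) = a h \<otimes>\<^bsub>R\<^esub> (act h (b ?l) \<otimes>\<^bsub>R\<^esub> (e h \<otimes>\<^bsub>R\<^esub> act k ?z))"
        unfolding l(3) using h l(1) z b by (simp add: act_mult act_act l(2))
      also have "\<dots> = a h \<otimes>\<^bsub>R\<^esub> e h \<otimes>\<^bsub>R\<^esub> act h (b ?l) \<otimes>\<^bsub>R\<^esub> act k ?z"
        using a b z h k l(1) by (simp add: R.m_ac e_closed del: act_e act_e' S_val_e)
      finally show "a h \<otimes>\<^bsub>R\<^esub> act h (?t ?l) = ?F h k" using a h by simp
    qed (use F h in auto)
    finally show "finsum R (\<lambda>k. ?F h k) (carrier G) = a h \<otimes>\<^bsub>R\<^esub> act h ((b \<otimes>\<^bsub>S\<^esub> c) (?i h \<otimes>\<^bsub>G\<^esub> g))"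
      by simp
  qed (use a S_mult_closed[OF b c] g in auto)
  finally show "(a \<otimes>\<^bsub>S\<^esub> b \<otimes>\<^bsub>S\<^esub> c) g = (a \<otimes>\<^bsub>S\<^esub> (b \<otimes>\<^bsub>S\<^esub> c)) g" .
qed (use a b c in \<open>auto intro: S_mult_closed\<close>)

lemma delta_val: "h \<in> carrier G \<Longrightarrow> skew_delta G R r g h = (if h = g then r else \<zero>\<^bsub>R\<^esub>)"
  by (simp add: skew_delta_def)

lemma delta_closed: "g \<in> carrier G \<Longrightarrow> r \<in> pdom R e g \<Longrightarrow> skew_delta G R r g \<in> carrier S"
  by (rule S_memI) (auto simp: delta_val pdom_iff e_closed, simp add: skew_delta_def)

lemma incl_closed [simp]: "r \<in> carrier R \<Longrightarrow> \<iota> r \<in> carrier S"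
  unfolding skew_incl_def by (rule delta_closed) (auto simp: pdom_iff e_one)

lemma incl_val: "h \<in> carrier G \<Longrightarrow> \<iota> r h = (if h = \<one>\<^bsub>G\<^esub> then r else \<zero>\<^bsub>R\<^esub>)"
  by (simp add: skew_incl_def delta_val)

lemma incl_mult:
  assumes r: "r \<in> carrier R" and s: "s \<in> carrier S" and g: "g \<in> carrier G"
  shows "(\<iota> r \<otimes>\<^bsub>S\<^esub> s) g = r \<otimes>\<^bsub>R\<^esub> s g" "(s \<otimes>\<^bsub>S\<^esub> \<iota> r) g = s g \<otimes>\<^bsub>R\<^esub> act g r"
proof -
  have "(\<iota> r \<otimes>\<^bsub>S\<^esub> s) g = finsum R (\<lambda>h. if h = \<one>\<^bsub>G\<^esub> then r \<otimes>\<^bsub>R\<^esub> s g else \<zero>\<^bsub>R\<^esub>) (carrier G)"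
    unfolding S_eqs(1)[OF g] by (rule R.finsum_cong') (use r s g in \<open>auto simp: incl_val\<close>)
  then show "(\<iota> r \<otimes>\<^bsub>S\<^esub> s) g = r \<otimes>\<^bsub>R\<^esub> s g" using r s g by (simp add: finsum_single)
  have iff: "inv\<^bsub>G\<^esub> h \<otimes>\<^bsub>G\<^esub> g = \<one>\<^bsub>G\<^esub> \<longleftrightarrow> h = g" if "h \<in> carrier G" for h
    using that g by (metis G.inv_closed G.inv_inv G.inv_equality G.l_inv)
  have "(s \<otimes>\<^bsub>S\<^esub> \<iota> r) g = finsum R (\<lambda>h. if h = g then s g \<otimes>\<^bsub>R\<^esub> act g r else \<zero>\<^bsub>R\<^esub>) (carrier G)"
    unfolding S_eqs(1)[OF g] by (rule R.finsum_cong') (use r s g in \<open>auto simp: incl_val iff\<close>)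
  then show "(s \<otimes>\<^bsub>S\<^esub> \<iota> r) g = s g \<otimes>\<^bsub>R\<^esub> act g r" using r s g by (simp add: finsum_single)
qed

lemma S_one_incl: "\<one>\<^bsub>S\<^esub> = \<iota> \<one>\<^bsub>R\<^esub>"
  by (rule S_eqI) (simp_all add: S_consts S_eqs incl_val)

lemma S_ring: "ring S"
proof (rule ringI)
  show "abelian_group S"
  proof (rule abelian_groupI)
    fix x assume x: "x \<in> carrier S"
    show "\<exists>y\<in>carrier S. y \<oplus>\<^bsub>S\<^esub> x = \<zero>\<^bsub>S\<^esub>"
    proof (rule bexI[of _ "\<lambda>g\<in>carrier G. \<ominus>\<^bsub>R\<^esub> x g"])
      show "(\<lambda>g\<in>carrier G. \<ominus>\<^bsub>R\<^esub> x g) \<in> carrier S"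
        by (rule S_memI) (use x in \<open>simp_all add: R.l_minus e_closed\<close>)
      with x show "(\<lambda>g\<in>carrier G. \<ominus>\<^bsub>R\<^esub> x g) \<oplus>\<^bsub>S\<^esub> x = \<zero>\<^bsub>S\<^esub>"
        by (intro S_eqI) (simp_all add: S_add_closed S_consts S_eqs R.l_neg)
    qed
  qed (auto intro!: S_eqI simp: S_add_closed S_consts S_eqs R.a_ac)
  show "monoid S"
  proof (rule monoidI)
    fix x assume x: "x \<in> carrier S"
    show "\<one>\<^bsub>S\<^esub> \<otimes>\<^bsub>S\<^esub> x = x" "x \<otimes>\<^bsub>S\<^esub> \<one>\<^bsub>S\<^esub> = x"
      unfolding S_one_incl
      using x by (auto intro!: S_eqI simp: S_mult_closed incl_mult act_unit)
  qed (simp_all add: S_mult_closed S_consts S_mult_assoc)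
  fix x y z assume xyz: "x \<in> carrier S" "y \<in> carrier S" "z \<in> carrier S"
  note cl = S_mult_closed S_add_closed xyz
  show "(x \<oplus>\<^bsub>S\<^esub> y) \<otimes>\<^bsub>S\<^esub> z = x \<otimes>\<^bsub>S\<^esub> z \<oplus>\<^bsub>S\<^esub> y \<otimes>\<^bsub>S\<^esub> z"
  proof (rule S_eqI)
    fix g assume g: "g \<in> carrier G"
    have "((x \<oplus>\<^bsub>S\<^esub> y) \<otimes>\<^bsub>S\<^esub> z) g = finsum R (\<lambda>h. x h \<otimes>\<^bsub>R\<^esub> act h (z (inv\<^bsub>G\<^esub> h \<otimes>\<^bsub>G\<^esub> g))
        \<oplus>\<^bsub>R\<^esub> y h \<otimes>\<^bsub>R\<^esub> act h (z (inv\<^bsub>G\<^esub> h \<otimes>\<^bsub>G\<^esub> g))) (carrier G)"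
      unfolding S_eqs(1)[OF g]
      by (rule R.finsum_cong') (use xyz g in \<open>auto simp: S_eqs R.l_distr\<close>)
    also have "\<dots> = (x \<otimes>\<^bsub>S\<^esub> z) g \<oplus>\<^bsub>R\<^esub> (y \<otimes>\<^bsub>S\<^esub> z) g"
      unfolding S_eqs(1)[OF g] by (rule R.finsum_addf) (use xyz g in auto)
    finally show "((x \<oplus>\<^bsub>S\<^esub> y) \<otimes>\<^bsub>S\<^esub> z) g = (x \<otimes>\<^bsub>S\<^esub> z \<oplus>\<^bsub>S\<^esub> y \<otimes>\<^bsub>S\<^esub> z) g"
      using g by (simp add: S_eqs(4))
  qed (simp_all add: cl)
  show "z \<otimes>\<^bsub>S\<^esub> (x \<oplus>\<^bsub>S\<^esub> y) = z \<otimes>\<^bsub>S\<^esub> x \<oplus>\<^bsub>S\<^esub> z \<otimes>\<^bsub>S\<^esub> y"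
  proof (rule S_eqI)
    fix g assume g: "g \<in> carrier G"
    have "(z \<otimes>\<^bsub>S\<^esub> (x \<oplus>\<^bsub>S\<^esub> y)) g = finsum R (\<lambda>h. z h \<otimes>\<^bsub>R\<^esub> act h (x (inv\<^bsub>G\<^esub> h \<otimes>\<^bsub>G\<^esub> g))
        \<oplus>\<^bsub>R\<^esub> z h \<otimes>\<^bsub>R\<^esub> act h (y (inv\<^bsub>G\<^esub> h \<otimes>\<^bsub>G\<^esub> g))) (carrier G)"
      unfolding S_eqs(1)[OF g]
      by (rule R.finsum_cong') (use xyz g in \<open>auto simp: S_eqs R.r_distr act_add\<close>)
    also have "\<dots> = (z \<otimes>\<^bsub>S\<^esub> x) g \<oplus>\<^bsub>R\<^esub> (z \<otimes>\<^bsub>S\<^esub> y) g"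
      unfolding S_eqs(1)[OF g] by (rule R.finsum_addf) (use xyz g in auto)
    finally show "(z \<otimes>\<^bsub>S\<^esub> (x \<oplus>\<^bsub>S\<^esub> y)) g = (z \<otimes>\<^bsub>S\<^esub> x \<oplus>\<^bsub>S\<^esub> z \<otimes>\<^bsub>S\<^esub> y) g"
      using g by (simp add: S_eqs(4))
  qed (simp_all add: cl)
qed

sublocale S: ring S by (rule S_ring)

lemma incl_hom: "\<iota> \<in> ring_hom R S"
proof (rule ring_hom_memI)
  fix r s assume rs: "r \<in> carrier R" "s \<in> carrier R"
  show "\<iota> (r \<otimes>\<^bsub>R\<^esub> s) = \<iota> r \<otimes>\<^bsub>S\<^esub> \<iota> s"
    by (rule S_eqI) (use rs in \<open>simp_all add: incl_mult(1) incl_val\<close>)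
  show "\<iota> (r \<oplus>\<^bsub>R\<^esub> s) = \<iota> r \<oplus>\<^bsub>S\<^esub> \<iota> s"
    by (rule S_eqI) (use rs in \<open>simp_all add: S_eqs(4) incl_val\<close>)
qed (simp_all add: S_one_incl)

text \<open>An invariant satisfies act g a = a 1_g, and the coefficient of s at g absorbs
  1_g.\<close>

lemma incl_central: "a \<in> carrier A \<Longrightarrow> s \<in> carrier S \<Longrightarrow> \<iota> a \<otimes>\<^bsub>S\<^esub> s = s \<otimes>\<^bsub>S\<^esub> \<iota> a"
proof -
  assume *: "a \<in> carrier A" "s \<in> carrier S"
  have aR: "a \<in> carrier R" by (rule fixed_in_R[OF *(1)])
  show ?thesis
  proof (rule S_eqI)
    fix g assume g: "g \<in> carrier G"
    have "s g \<otimes>\<^bsub>R\<^esub> (a \<otimes>\<^bsub>R\<^esub> e g) = a \<otimes>\<^bsub>R\<^esub> (s g \<otimes>\<^bsub>R\<^esub> e g)"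
      using g aR * by (simp add: R.m_ac e_closed del: S_val_e)
    then show "(\<iota> a \<otimes>\<^bsub>S\<^esub> s) g = (s \<otimes>\<^bsub>S\<^esub> \<iota> a) g"
      using g aR * by (simp add: incl_mult fixed_act)
  qed (use aR * in simp_all)
qed

lemma S_tower: "tower A R S \<iota>"
proof -
  interpret A: cring A by (rule fixed_cring)
  have "id \<in> ring_hom A R" by (rule ring_hom_memI) (simp_all add: fixed_in_R)
  then show ?thesis by unfold_locales (simp_all add: incl_hom incl_central)
qed

section \<open>The elements 1_g \<delta>_g, written d_g below\<close>

abbreviation \<delta> :: "'g \<Rightarrow> 'g \<Rightarrow> 'r" where "\<delta> g \<equiv> skew_delta G R (e g) g"

lemma \<delta>_closed [simp]: "g \<in> carrier G \<Longrightarrow> \<delta> g \<in> carrier S"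
  by (rule delta_closed) (simp_all add: pdom_iff e_closed e_idem)

lemma \<delta>_one: "\<delta> \<one>\<^bsub>G\<^esub> = \<one>\<^bsub>S\<^esub>"
  unfolding e_one S_one_incl skew_incl_def ..

lemma incl_\<delta>: "g \<in> carrier G \<Longrightarrow> r \<in> carrier R \<Longrightarrow> \<iota> r \<otimes>\<^bsub>S\<^esub> \<delta> g = skew_delta G R (r \<otimes>\<^bsub>R\<^esub> e g) g"
  by (rule S_eqI) (simp_all add: incl_mult delta_val cut_dom delta_closed)

lemma Theta0_eq: "g \<in> carrier G \<Longrightarrow> Theta0 G R e g = {\<iota> r \<otimes>\<^bsub>S\<^esub> \<delta> g | r. r \<in> carrier R}"
proof (rule Set.set_eqI, rule iffI)
  fix s assume g: "g \<in> carrier G" and "s \<in> Theta0 G R e g"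
  then obtain r where "r \<in> pdom R e g" "s = skew_delta G R r g" by (auto simp: Theta0_def)
  then show "s \<in> {\<iota> r \<otimes>\<^bsub>S\<^esub> \<delta> g | r. r \<in> carrier R}"
    using g by (auto simp: incl_\<delta> pdom_iff intro!: exI[of _ r])
next
  fix s assume "g \<in> carrier G" "s \<in> {\<iota> r \<otimes>\<^bsub>S\<^esub> \<delta> g | r. r \<in> carrier R}"
  then show "s \<in> Theta0 G R e g" by (auto simp: Theta0_def incl_\<delta> cut_dom)
qed

lemma Theta0_memI: "g \<in> carrier G \<Longrightarrow> r \<in> carrier R \<Longrightarrow> \<iota> r \<otimes>\<^bsub>S\<^esub> \<delta> g \<in> Theta0 G R e g"
  by (auto simp: Theta0_eq)

lemma \<delta>_mult:
  assumes g: "g \<in> carrier G" and s: "s \<in> carrier S" and h: "h \<in> carrier G"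
  shows "(\<delta> g \<otimes>\<^bsub>S\<^esub> s) h = act g (s (inv\<^bsub>G\<^esub> g \<otimes>\<^bsub>G\<^esub> h))"
proof -
  have "(\<delta> g \<otimes>\<^bsub>S\<^esub> s) h = finsum R (\<lambda>k. if k = g then act g (s (inv\<^bsub>G\<^esub> g \<otimes>\<^bsub>G\<^esub> h)) else \<zero>\<^bsub>R\<^esub>) (carrier G)"
    unfolding S_eqs(1)[OF h] by (rule R.finsum_cong') (use g s h in \<open>auto simp: delta_val\<close>)
  then show ?thesis using g s h by (simp add: finsum_single)
qed

lemma \<delta>_incl: 
  assumes g: "g \<in> carrier G" and r: "r \<in> carrier R"
  shows "\<delta> g \<otimes>\<^bsub>S\<^esub> \<iota> r = \<iota> (act g r) \<otimes>\<^bsub>S\<^esub> \<delta> g"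
  by (rule S_eqI) (use g r in \<open>auto simp: incl_mult delta_val R.m_comm e_closed\<close>)

text \<open>The d_g multiply like group elements up to the idempotent 1_g; in particular d_g
  d_(g^-1) = 1_g.\<close>

lemma \<delta>_\<delta>:
  assumes g: "g \<in> carrier G" and h: "h \<in> carrier G"
  shows "\<delta> g \<otimes>\<^bsub>S\<^esub> \<delta> h = \<iota> (e g) \<otimes>\<^bsub>S\<^esub> \<delta> (g \<otimes>\<^bsub>G\<^esub> h)"
proof (rule S_eqI)
  fix k assume k: "k \<in> carrier G"
  have "inv\<^bsub>G\<^esub> g \<otimes>\<^bsub>G\<^esub> k = h \<longleftrightarrow> k = g \<otimes>\<^bsub>G\<^esub> h"
    using g h k by (metis G.inv_closed G.inv_solve_left G.inv_inv)
  then show "(\<delta> g \<otimes>\<^bsub>S\<^esub> \<delta> h) k = (\<iota> (e g) \<otimes>\<^bsub>S\<^esub> \<delta> (g \<otimes>\<^bsub>G\<^esub> h)) k"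
    using g h k by (auto simp: \<delta>_mult incl_mult e_closed delta_val act_e_eq)
qed (use g h e_closed in simp_all)

lemma S_eval_hom: "g \<in> carrier G \<Longrightarrow> (\<lambda>s. s g) \<in> hom (regular_bimod S) (regular_bimod R)"
  by (simp add: hom_def S_eqs)

lemma S_finsum_val:
  "g \<in> carrier G \<Longrightarrow> f \<in> I \<rightarrow> carrier S \<Longrightarrow> (finsum S f I) g = finsum R (\<lambda>i. f i g) I"
  using hom_finprod[OF comm_group_regular[OF S.ring_axioms] comm_group_regular[OF R.ring_axioms]
      S_eval_hom] by (simp add: finprod_regular)

lemma S_expand:
  assumes s: "s \<in> carrier S"
  shows "s = finsum S (\<lambda>g. \<iota> (s g) \<otimes>\<^bsub>S\<^esub> \<delta> g) (carrier G)"
proof (rule S_eqI[OF s])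
  have f: "(\<lambda>g. \<iota> (s g) \<otimes>\<^bsub>S\<^esub> \<delta> g) \<in> carrier G \<rightarrow> carrier S" using s by simp
  then show "finsum S (\<lambda>g. \<iota> (s g) \<otimes>\<^bsub>S\<^esub> \<delta> g) (carrier G) \<in> carrier S" by (rule S.finsum_closed)
  fix h assume h: "h \<in> carrier G"
  have "(finsum S (\<lambda>g. \<iota> (s g) \<otimes>\<^bsub>S\<^esub> \<delta> g) (carrier G)) h =
      finsum R (\<lambda>g. if g = h then s h else \<zero>\<^bsub>R\<^esub>) (carrier G)"
    unfolding S_finsum_val[OF h f]
    by (rule R.finsum_cong') (use s h in \<open>auto simp: incl_mult delta_val\<close>)
  then show "s h = (finsum S (\<lambda>g. \<iota> (s g) \<otimes>\<^bsub>S\<^esub> \<delta> g) (carrier G)) h"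
    using s h by (simp add: finsum_single)
qed

text \<open>The sum of all \<open>1\<^sub>g \<delta>\<^sub>g\<close>.\<close>

definition \<sigma> :: "'g \<Rightarrow> 'r" where "\<sigma> = restrict e (carrier G)"

lemma \<sigma>_closed [simp]: "\<sigma> \<in> carrier S"
  by (rule S_memI) (simp_all add: \<sigma>_def e_closed e_idem)

lemma \<sigma>_val: "g \<in> carrier G \<Longrightarrow> \<sigma> g = e g"
  by (simp add: \<sigma>_def)

end

locale partial_Galois_action = finite_partial_action G R e \<alpha>
  for G :: "('g, 'y) monoid_scheme" and R :: "('r, 'z) ring_scheme"
    and e :: "'g \<Rightarrow> 'r" and \<alpha> :: "'g \<Rightarrow> 'r \<Rightarrow> 'r" +
  fixes m :: nat and x y :: "nat \<Rightarrow> 'r"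
  assumes x_closed: "k < m \<Longrightarrow> x k \<in> carrier R" and y_closed: "k < m \<Longrightarrow> y k \<in> carrier R"
    and Galois: "g \<in> carrier G \<Longrightarrow> finsum R (\<lambda>k. x k \<otimes>\<^bsub>R\<^esub> act g (y k)) {..<m} =
      (if g = \<one>\<^bsub>G\<^esub> then \<one>\<^bsub>R\<^esub> else \<zero>\<^bsub>R\<^esub>)"
begin

text \<open>Expanding the trace and interchanging the sums leaves the coefficients sum_k x_k
  act_g(y_k), which vanish except at the identity.\<close>

lemma tr_expand:
  assumes r: "r \<in> carrier R"
  shows "finsum R (\<lambda>k. x k \<otimes>\<^bsub>R\<^esub> tr (y k \<otimes>\<^bsub>R\<^esub> r)) {..<m} = r"
proof -
  have "finsum R (\<lambda>k. x k \<otimes>\<^bsub>R\<^esub> tr (y k \<otimes>\<^bsub>R\<^esub> r)) {..<m} =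
      finsum R (\<lambda>k. finsum R (\<lambda>g. x k \<otimes>\<^bsub>R\<^esub> act g (y k) \<otimes>\<^bsub>R\<^esub> act g r) (carrier G)) {..<m}"
  proof (rule R.finsum_cong')
    fix k assume "k \<in> {..<m}"
    then have k: "x k \<in> carrier R" "y k \<in> carrier R" by (simp_all add: x_closed y_closed)
    have "x k \<otimes>\<^bsub>R\<^esub> tr (y k \<otimes>\<^bsub>R\<^esub> r) = finsum R (\<lambda>g. x k \<otimes>\<^bsub>R\<^esub> act g (y k \<otimes>\<^bsub>R\<^esub> r)) (carrier G)"
      unfolding tr_def by (rule R.finsum_rdistr) (use k r fin in auto)
    also have "\<dots> = finsum R (\<lambda>g. x k \<otimes>\<^bsub>R\<^esub> act g (y k) \<otimes>\<^bsub>R\<^esub> act g r) (carrier G)"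
      by (rule R.finsum_cong') (use k r in \<open>auto simp: act_mult R.m_assoc\<close>)
    finally show "x k \<otimes>\<^bsub>R\<^esub> tr (y k \<otimes>\<^bsub>R\<^esub> r) =
      finsum R (\<lambda>g. x k \<otimes>\<^bsub>R\<^esub> act g (y k) \<otimes>\<^bsub>R\<^esub> act g r) (carrier G)" .
  qed (use r in \<open>auto simp: x_closed y_closed\<close>)
  also have "\<dots> = finsum R (\<lambda>g. finsum R (\<lambda>k. x k \<otimes>\<^bsub>R\<^esub> act g (y k) \<otimes>\<^bsub>R\<^esub> act g r) {..<m}) (carrier G)"
    by (rule R.add.finprod_swap[OF _ fin]) (use r in \<open>auto simp: x_closed y_closed\<close>)
  also have "\<dots> = finsum R (\<lambda>g. if g = \<one>\<^bsub>G\<^esub> then r else \<zero>\<^bsub>R\<^esub>) (carrier G)"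
  proof (rule R.finsum_cong')
    fix g assume g: "g \<in> carrier G"
    have "finsum R (\<lambda>k. x k \<otimes>\<^bsub>R\<^esub> act g (y k) \<otimes>\<^bsub>R\<^esub> act g r) {..<m} =
        finsum R (\<lambda>k. x k \<otimes>\<^bsub>R\<^esub> act g (y k)) {..<m} \<otimes>\<^bsub>R\<^esub> act g r"
      by (rule R.finsum_ldistr[symmetric]) (use g r in \<open>auto simp: x_closed y_closed\<close>)
    then show "finsum R (\<lambda>k. x k \<otimes>\<^bsub>R\<^esub> act g (y k) \<otimes>\<^bsub>R\<^esub> act g r) {..<m} = (if g = \<one>\<^bsub>G\<^esub> then r else \<zero>\<^bsub>R\<^esub>)"
      using g r by (simp add: Galois)
  qed (use r in auto)
  also have "\<dots> = r" using r by (simp add: finsum_single)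
  finally show ?thesis .
qed

lemma trace_one: "\<exists>c\<in>carrier R. tr c = \<one>\<^bsub>R\<^esub>"
proof -
  let ?I = "tr ` carrier R"
  have add: "a \<oplus>\<^bsub>R\<^esub> b \<in> ?I" if "a \<in> ?I" "b \<in> ?I" for a b
    using that by (auto simp: tr_add[symmetric])
  have mult: "a \<otimes>\<^bsub>R\<^esub> b \<in> ?I" if ab: "a \<in> ?I" "b \<in> ?I" for a b
  proof -
    obtain r s where "r \<in> carrier R" "s \<in> carrier R" "a = tr r" "b = tr s" using ab by auto
    then have "a \<otimes>\<^bsub>R\<^esub> b = tr (tr r \<otimes>\<^bsub>R\<^esub> s)" "tr r \<otimes>\<^bsub>R\<^esub> s \<in> carrier R"
      by (simp_all add: tr_linear tr_fixed)
    then show ?thesis by blast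
  qed
  have tr0: "tr \<zero>\<^bsub>R\<^esub> = \<zero>\<^bsub>R\<^esub>"
    using hom_one[OF tr_hom] comm_group_regular[OF R.ring_axioms] by (simp add: comm_group.axioms)
  have neg: "\<ominus>\<^bsub>R\<^esub> a \<in> ?I" if a: "a \<in> ?I" for a
  proof -
    obtain r where r: "r \<in> carrier R" "a = tr r" using a by auto
    have "tr (\<ominus>\<^bsub>R\<^esub> r) \<oplus>\<^bsub>R\<^esub> tr r = \<zero>\<^bsub>R\<^esub>"
      using tr_add[of "\<ominus>\<^bsub>R\<^esub> r" r] r by (simp add: R.l_neg tr0)
    then have "tr (\<ominus>\<^bsub>R\<^esub> r) = \<ominus>\<^bsub>R\<^esub> tr r"
      using r by (metis R.add.inv_equality R.add.inv_closed tr_closed)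
    then show ?thesis using r by (metis R.add.inv_closed imageI)
  qed
  \<comment> \<open>By \<open>tr_expand\<close> each x_k is a combination of the x_l with
    coefficients tr(y_l x_k) in the image of the trace, so some 1 - tr(c) annihilates every
    x_k.\<close>
  have "\<exists>a\<in>?I. \<forall>k<m. (\<one>\<^bsub>R\<^esub> \<ominus>\<^bsub>R\<^esub> a) \<otimes>\<^bsub>R\<^esub> x k = \<zero>\<^bsub>R\<^esub>"
  proof (rule R.nakayama[where d = "\<lambda>_. \<zero>\<^bsub>R\<^esub>" and c = "\<lambda>k l. tr (y l \<otimes>\<^bsub>R\<^esub> x k)", OF _ _ add mult neg])
    show "\<zero>\<^bsub>R\<^esub> \<in> ?I" using tr0 R.zero_closed by (metis imageI)
    then show "\<zero>\<^bsub>R\<^esub> \<in> ?I" .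
    fix k assume k: "k < m"
    have "finsum R (\<lambda>l. tr (y l \<otimes>\<^bsub>R\<^esub> x k) \<otimes>\<^bsub>R\<^esub> x l) {..<m} =
        finsum R (\<lambda>l. x l \<otimes>\<^bsub>R\<^esub> tr (y l \<otimes>\<^bsub>R\<^esub> x k)) {..<m}"
      by (rule R.finsum_cong') (use k in \<open>auto simp: x_closed y_closed R.m_comm\<close>)
    then show "(\<one>\<^bsub>R\<^esub> \<ominus>\<^bsub>R\<^esub> \<zero>\<^bsub>R\<^esub>) \<otimes>\<^bsub>R\<^esub> x k = finsum R (\<lambda>l. tr (y l \<otimes>\<^bsub>R\<^esub> x k) \<otimes>\<^bsub>R\<^esub> x l) {..<m}"
      using k tr_expand[of "x k"] by (simp add: x_closed R.minus_eq)
  qed (auto simp: x_closed y_closed)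
  then obtain c where c: "c \<in> carrier R" "\<And>k. k < m \<Longrightarrow> (\<one>\<^bsub>R\<^esub> \<ominus>\<^bsub>R\<^esub> tr c) \<otimes>\<^bsub>R\<^esub> x k = \<zero>\<^bsub>R\<^esub>"
    by auto
  \<comment> \<open>One is a combination of the x_k, again by \<open>tr_expand\<close>, so
    \<open>?u\<close> annihilates one.\<close>
  let ?u = "\<one>\<^bsub>R\<^esub> \<ominus>\<^bsub>R\<^esub> tr c"
  have u: "?u \<in> carrier R" using c by simp
  have "?u = ?u \<otimes>\<^bsub>R\<^esub> finsum R (\<lambda>k. x k \<otimes>\<^bsub>R\<^esub> tr (y k \<otimes>\<^bsub>R\<^esub> \<one>\<^bsub>R\<^esub>)) {..<m}"
    using u tr_expand[OF R.one_closed] by simp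
  also have "\<dots> = finsum R (\<lambda>k. ?u \<otimes>\<^bsub>R\<^esub> (x k \<otimes>\<^bsub>R\<^esub> tr (y k \<otimes>\<^bsub>R\<^esub> \<one>\<^bsub>R\<^esub>))) {..<m}"
    by (rule R.finsum_rdistr) (use u in \<open>auto simp: x_closed y_closed\<close>)
  also have "\<dots> = finsum R (\<lambda>k. \<zero>\<^bsub>R\<^esub>) {..<m}"
    by (rule R.finsum_cong') (use u c(2) in \<open>auto simp: x_closed y_closed R.m_assoc[symmetric]\<close>)
  finally have "?u = \<zero>\<^bsub>R\<^esub>" by simp
  moreover have "?u \<oplus>\<^bsub>R\<^esub> tr c = \<one>\<^bsub>R\<^esub>" using c by (simp add: R.minus_eq R.a_assoc R.l_neg)
  ultimately show ?thesis using c by auto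
qed

end

lemma partial_GaloisE:
  assumes "unital_partial_action G R e \<alpha>" "finite (carrier G)" "partial_Galois G R e \<alpha>"
  obtains m x y where "partial_Galois_action G R e \<alpha> m x y"
proof -
  interpret unital_partial_action G R e \<alpha> by fact
  interpret finite_partial_action G R e \<alpha> by unfold_locales fact
  obtain m :: nat and x y where xy: "x \<in> {1..m} \<rightarrow> carrier R" "y \<in> {1..m} \<rightarrow> carrier R"
    "\<And>g. g \<in> carrier G \<Longrightarrow> finsum R (\<lambda>k. x k \<otimes>\<^bsub>R\<^esub> act g (y k)) {1..m} =
      (if g = \<one>\<^bsub>G\<^esub> then \<one>\<^bsub>R\<^esub> else \<zero>\<^bsub>R\<^esub>)"
    using assms(3) unfolding partial_Galois_def act_def by auto
  \<comment> \<open>The definition numbers the coordinates from one, the locale from zero.\<close>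
  have "partial_Galois_action G R e \<alpha> m (\<lambda>k. x (Suc k)) (\<lambda>k. y (Suc k))"
  proof unfold_locales
    fix g assume g: "g \<in> carrier G"
    have "finsum R (\<lambda>k. x k \<otimes>\<^bsub>R\<^esub> act g (y k)) (Suc ` {..<m}) =
        finsum R (\<lambda>k. x (Suc k) \<otimes>\<^bsub>R\<^esub> act g (y (Suc k))) {..<m}"
      by (rule R.add.finprod_reindex) (use xy(1,2) g in \<open>auto simp: Pi_iff\<close>)
    then show "finsum R (\<lambda>k. x (Suc k) \<otimes>\<^bsub>R\<^esub> act g (y (Suc k))) {..<m} = (if g = \<one>\<^bsub>G\<^esub> then \<one>\<^bsub>R\<^esub> else \<zero>\<^bsub>R\<^esub>)"
      using xy(3)[OF g] by (simp add: image_Suc_lessThan)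
  qed (use xy(1,2) in \<open>auto simp: Pi_iff\<close>)
  then show thesis by (rule that)
qed

section \<open>Objects coming from A are invariant and determine their module\<close>

context partial_Galois_action begin

sublocale TW: tower A R S \<iota> by (rule S_tower)

text \<open>On a generator p \<otimes> r, both actions of S touch only the second factor. An element
  of D_g \<delta>_g moves past r and stays in D_g \<delta>_g, because d_g r = act_g(r) d_g.\<close>

lemma xi_central_Theta:
  fixes P :: "('r, 'r, 'p) bimod" and Q :: "('r, 'r, 'q) bimod"
  assumes P: "tower_module A R S \<iota> P" and v: "ext_object \<iota> R S (Q, Y, \<psi>)"
    and iso: "ext_isomorphic R S (xi_object A \<iota> R S P) (Q, Y, \<psi>)" and g: "g \<in> carrier G"
  shows "central_over (carrier R) Q"
    and "lprod_set Y (Theta0 G R e g) (\<psi> ` carrier Q) = rprod_set Y (\<psi> ` carrier Q) (Theta0 G R e g)"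
proof -
  interpret P: tower_module A R S \<iota> P by fact
  note vp = ext_object_parts[OF v]
  interpret Y: bimodule S S Y by (rule vp)
  obtain a b where ab: "a \<in> bimod_iso R R P.PR.Y Q" "b \<in> bimod_iso S S P.PS.Y Y"
    "\<And>p. p \<in> carrier P.PR.Y \<Longrightarrow> b (P.\<phi> p) = \<psi> (a p)"
    by (rule ext_isomorphicE[OF iso[unfolded P.xi_object_eq]]) blast
  have "central_over (carrier R) P.PR.Y"
    unfolding central_over_def
  proof (intro ballI)
    fix r z assume r: "r \<in> carrier R" and z: "z \<in> carrier P.PR.Y"
    show "lmul P.PR.Y r z = rmul P.PR.Y z r"
      by (rule P.PR.Y_induct[OF z]) (simp_all del: id_apply add: r R.m_comm P.PR.Y.lmul_add_right P.PR.Y.rmul_add_left)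
  qed
  then show "central_over (carrier R) Q"
    by (rule central_over_iso[OF P.PR.Y_bimodule ab(1) subset_refl])
  let ?\<Theta> = "Theta0 G R e g"
  have \<Theta>: "\<theta> \<in> carrier S" if "\<theta> \<in> ?\<Theta>" for \<theta> using that g by (auto simp: Theta0_eq)
  note bh = bimod_iso_hom[OF ab(2)]
  have \<phi>c: "P.\<phi> z \<in> carrier P.PS.Y" if "z \<in> carrier P.PR.Y" for z
    using hom_in_carrier[OF P.phi_hom that] .
  have img: "\<psi> ` carrier Q = (\<lambda>z. b (P.\<phi> z)) ` carrier P.PR.Y"
  proof -
    have "carrier Q = a ` carrier P.PR.Y"
      using bimod_iso_bij[OF ab(1)] by (simp add: bij_betw_def)
    then show ?thesis using ab(3) by (simp add: image_image)
  qed
  let ?U = "\<psi> ` carrier Q"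
  let ?L = "{lmul Y \<theta> u | \<theta> u. \<theta> \<in> ?\<Theta> \<and> u \<in> ?U}" and ?R = "{rmul Y u \<theta> | \<theta> u. \<theta> \<in> ?\<Theta> \<and> u \<in> ?U}"
  have U1: "b (P.\<phi> (P.PR.pt p \<one>\<^bsub>R\<^esub>)) \<in> ?U" if "p \<in> carrier P" for p
    unfolding img by (rule image_eqI[where x = "P.PR.pt p \<one>\<^bsub>R\<^esub>"]) (use that in simp_all)
  have Uc: "?U \<subseteq> carrier Y" unfolding img using bimod_hom_closed[OF bh] \<phi>c by auto
  have Lc: "?L \<subseteq> carrier Y" using Uc \<Theta> Y.lmul_closed by blast
  have Rc: "?R \<subseteq> carrier Y" using Uc \<Theta> Y.rmul_closed by blast
  note Ys = Y.M.sums_of_incl Y.M.sums_of_mult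
  have \<phi>m: "P.\<phi> (z \<otimes>\<^bsub>P.PR.Y\<^esub> w) = P.\<phi> z \<otimes>\<^bsub>P.PS.Y\<^esub> P.\<phi> w"
    if "z \<in> carrier P.PR.Y" "w \<in> carrier P.PR.Y" for z w
    using hom_mult[OF P.phi_hom that] .
  have L: "lmul Y \<theta> (b (P.\<phi> z)) \<in> sums_of Y ?R" if \<theta>: "\<theta> \<in> ?\<Theta>" and z: "z \<in> carrier P.PR.Y" for \<theta> z
  proof (rule P.PR.Y_induct[OF z])
    fix p r assume pr: "p \<in> carrier P" "r \<in> carrier R"
    obtain t where t: "t \<in> carrier R" "\<theta> = \<iota> t \<otimes>\<^bsub>S\<^esub> \<delta> g" using \<theta> g by (auto simp: Theta0_eq)
    \<comment> \<open>The scalar \<open>r\<close> is absorbed by the element of D_g \<delta>_g, so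
      it can be written on the right of p \<otimes> 1.\<close>
    let ?\<theta> = "\<iota> (t \<otimes>\<^bsub>R\<^esub> act g r) \<otimes>\<^bsub>S\<^esub> \<delta> g"
    have \<theta>': "?\<theta> \<in> ?\<Theta>"
      by (rule Theta0_memI[OF g]) (use t pr g in simp)
    have "\<theta> \<otimes>\<^bsub>S\<^esub> \<iota> r = ?\<theta>" using t pr g by (simp add: S.m_assoc \<delta>_incl)
    then have "lmul Y \<theta> (b (P.\<phi> (P.PR.pt p r))) = b (P.PS.pt p ?\<theta>)"
      using bimod_hom_lmul[OF bh \<Theta>[OF \<theta>], of "P.PS.pt p (\<iota> r)"] pr \<Theta>[OF \<theta>] by simp
    also have "\<dots> = rmul Y (b (P.\<phi> (P.PR.pt p \<one>\<^bsub>R\<^esub>))) ?\<theta>"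
      using bimod_hom_rmul[OF bh \<Theta>[OF \<theta>'], of "P.PS.pt p \<one>\<^bsub>S\<^esub>"] pr \<Theta>[OF \<theta>'] by simp
    also have "\<dots> \<in> ?R" using \<theta>' U1[OF pr(1)] by blast
    finally show "lmul Y \<theta> (b (P.\<phi> (P.PR.pt p r))) \<in> sums_of Y ?R" by (rule Ys(1)[OF _ Rc])
  next
    fix z w assume zw: "z \<in> carrier P.PR.Y" "w \<in> carrier P.PR.Y"
      and IH: "lmul Y \<theta> (b (P.\<phi> z)) \<in> sums_of Y ?R" "lmul Y \<theta> (b (P.\<phi> w)) \<in> sums_of Y ?R"
    have "lmul Y \<theta> (b (P.\<phi> (z \<otimes>\<^bsub>P.PR.Y\<^esub> w))) = lmul Y \<theta> (b (P.\<phi> z)) \<otimes>\<^bsub>Y\<^esub> lmul Y \<theta> (b (P.\<phi> w))"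
      using zw by (simp only: \<phi>m bimod_hom_add[OF bh] \<phi>c Y.lmul_add_right \<Theta>[OF \<theta>] bimod_hom_closed[OF bh])
    then show "lmul Y \<theta> (b (P.\<phi> (z \<otimes>\<^bsub>P.PR.Y\<^esub> w))) \<in> sums_of Y ?R"
      using Ys(2)[OF IH Rc] by simp
  qed
  have R: "rmul Y (b (P.\<phi> z)) \<theta> \<in> sums_of Y ?L" if \<theta>: "\<theta> \<in> ?\<Theta>" and z: "z \<in> carrier P.PR.Y" for \<theta> z
  proof (rule P.PR.Y_induct[OF z])
    fix p r assume pr: "p \<in> carrier P" "r \<in> carrier R"
    obtain t where t: "t \<in> carrier R" "\<theta> = \<iota> t \<otimes>\<^bsub>S\<^esub> \<delta> g" using \<theta> g by (auto simp: Theta0_eq)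
    let ?\<theta> = "\<iota> (r \<otimes>\<^bsub>R\<^esub> t) \<otimes>\<^bsub>S\<^esub> \<delta> g"
    have \<theta>': "?\<theta> \<in> ?\<Theta>"
      by (rule Theta0_memI[OF g]) (use t pr g in simp)
    have "\<iota> r \<otimes>\<^bsub>S\<^esub> \<theta> = ?\<theta>" using t pr g by (simp add: S.m_assoc)
    then have "rmul Y (b (P.\<phi> (P.PR.pt p r))) \<theta> = b (P.PS.pt p ?\<theta>)"
      using bimod_hom_rmul[OF bh \<Theta>[OF \<theta>], of "P.PS.pt p (\<iota> r)"] pr \<Theta>[OF \<theta>] by simp
    also have "\<dots> = lmul Y ?\<theta> (b (P.\<phi> (P.PR.pt p \<one>\<^bsub>R\<^esub>)))"
      using bimod_hom_lmul[OF bh \<Theta>[OF \<theta>'], of "P.PS.pt p \<one>\<^bsub>S\<^esub>"] pr \<Theta>[OF \<theta>'] by simp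
    also have "\<dots> \<in> ?L" using \<theta>' U1[OF pr(1)] by blast
    finally show "rmul Y (b (P.\<phi> (P.PR.pt p r))) \<theta> \<in> sums_of Y ?L" by (rule Ys(1)[OF _ Lc])
  next
    fix z w assume zw: "z \<in> carrier P.PR.Y" "w \<in> carrier P.PR.Y"
      and IH: "rmul Y (b (P.\<phi> z)) \<theta> \<in> sums_of Y ?L" "rmul Y (b (P.\<phi> w)) \<theta> \<in> sums_of Y ?L"
    have "rmul Y (b (P.\<phi> (z \<otimes>\<^bsub>P.PR.Y\<^esub> w))) \<theta> = rmul Y (b (P.\<phi> z)) \<theta> \<otimes>\<^bsub>Y\<^esub> rmul Y (b (P.\<phi> w)) \<theta>"
      using zw by (simp only: \<phi>m bimod_hom_add[OF bh] \<phi>c Y.rmul_add_left \<Theta>[OF \<theta>] bimod_hom_closed[OF bh])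
    then show "rmul Y (b (P.\<phi> (z \<otimes>\<^bsub>P.PR.Y\<^esub> w))) \<theta> \<in> sums_of Y ?L"
      using Ys(2)[OF IH Lc] by simp
  qed
  have "sums_of Y ?L \<subseteq> sums_of Y ?R"
    by (rule Y.M.sums_of_minimal[OF Y.M.one_in_sums_of _ _ Lc])
      (use L Ys(2)[OF _ _ Rc] img in auto)
  moreover have "sums_of Y ?R \<subseteq> sums_of Y ?L"
    by (rule Y.M.sums_of_minimal[OF Y.M.one_in_sums_of _ _ Rc])
      (use R Ys(2)[OF _ _ Lc] img in auto)
  ultimately show "lprod_set Y ?\<Theta> ?U = rprod_set Y ?U ?\<Theta>"
    using lprod_set_eq_sums_of[OF Y.M.comm_monoid_axioms Lc] rprod_set_eq_sums_of[OF Y.M.comm_monoid_axioms Rc]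
    by simp
qed

text \<open>Apply the map
  \<open>q \<otimes> s \<mapsto> q \<otimes> \<Sum>\<^sub>g s\<^sub>g \<alpha>\<^sub>g(c 1\<^bsub>inv g\<^esub>)\<close> to both sides of the commutation relation.\<close>

lemma xi_fixed:
  fixes Q :: "('r, 'r, 'q) bimod"
  assumes Q: "tower_module A R S \<iota> Q"
  obtains \<rho> where "\<rho> \<in> hom (base_change A id R Q) Q"
    "\<And>q. q \<in> carrier Q \<Longrightarrow> \<rho> (pure_tensor A Q (restrict_scalars id id (regular_bimod R)) q \<one>\<^bsub>R\<^esub>) = q"
    "\<And>z. z \<in> carrier (base_change A id R Q) \<Longrightarrow>
      lmul (base_change A \<iota> S Q) \<sigma> (tens_map A Q (restrict_scalars \<iota> id (regular_bimod S)) (\<lambda>(p, r). (p, \<iota> r)) z) =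
      rmul (base_change A \<iota> S Q) (tens_map A Q (restrict_scalars \<iota> id (regular_bimod S)) (\<lambda>(p, r). (p, \<iota> r)) z) \<sigma> \<Longrightarrow>
      z = pure_tensor A Q (restrict_scalars id id (regular_bimod R)) (\<rho> z) \<one>\<^bsub>R\<^esub>"
proof -
  interpret Q: tower_module A R S \<iota> Q by fact
  obtain c where c: "c \<in> carrier R" "tr c = \<one>\<^bsub>R\<^esub>" using trace_one by blast
  have trA: "tr (c \<otimes>\<^bsub>R\<^esub> r) \<in> carrier A" if "r \<in> carrier R" for r using c that by (simp add: tr_fixed)
  have tr_mid: "tr (c \<otimes>\<^bsub>R\<^esub> (a \<otimes>\<^bsub>R\<^esub> r)) = a \<otimes>\<^bsub>R\<^esub> tr (c \<otimes>\<^bsub>R\<^esub> r)" if "a \<in> carrier A" "r \<in> carrier R" for a r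
    using tr_linear[OF that(1), of "c \<otimes>\<^bsub>R\<^esub> r"] c that fixed_in_R[OF that(1)] by (simp add: R.m_lcomm)
  \<comment> \<open>A retraction of q |-> q \<otimes> 1, induced by the A-linear map r |-> tr(c r),
    which is one at r = 1.\<close>
  define \<rho> where "\<rho> = tlift A Q Q.PR.T' Q (\<lambda>q r. rmul Q q (tr (c \<otimes>\<^bsub>R\<^esub> r)))"
  note L = Q.PR.Y_lift_hom[OF Q.P.M.comm_group_axioms] Q.PR.Y_lift_pt[OF Q.P.M.comm_group_axioms]
  have rho_add: "rmul Q q (tr (c \<otimes>\<^bsub>R\<^esub> (r \<oplus>\<^bsub>R\<^esub> r'))) = rmul Q q (tr (c \<otimes>\<^bsub>R\<^esub> r)) \<otimes>\<^bsub>Q\<^esub> rmul Q q (tr (c \<otimes>\<^bsub>R\<^esub> r'))"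
    if "q \<in> carrier Q" "r \<in> carrier R" "r' \<in> carrier R" for q r r'
    using that c Q.P.rmul_add_right[of q "tr (c \<otimes>\<^bsub>R\<^esub> r)" "tr (c \<otimes>\<^bsub>R\<^esub> r')"] by (simp add: R.r_distr tr_add trA)
  have rho_mid: "rmul Q (rmul Q q a) (tr (c \<otimes>\<^bsub>R\<^esub> r)) = rmul Q q (tr (c \<otimes>\<^bsub>R\<^esub> (id a \<otimes>\<^bsub>R\<^esub> r)))"
    if "q \<in> carrier Q" "a \<in> carrier A" "r \<in> carrier R" for q a r
    using that Q.P.rmul_assoc[of q a "tr (c \<otimes>\<^bsub>R\<^esub> r)"] by (simp add: tr_mid trA)
  have \<rho>: "\<rho> \<in> hom Q.PR.Y Q"
    unfolding \<rho>_def
    by (rule L) (simp_all del: id_apply add: rho_add rho_mid trA Q.P.rmul_closed Q.P.rmul_add_left)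
  have \<rho>p: "\<rho> (Q.PR.pt q r) = rmul Q q (tr (c \<otimes>\<^bsub>R\<^esub> r))" if "q \<in> carrier Q" "r \<in> carrier R" for q r
    unfolding \<rho>_def
    by (rule L) (simp_all del: id_apply add: rho_add rho_mid trA Q.P.rmul_closed Q.P.rmul_add_left that)
  have \<rho>1: "\<rho> (Q.PR.pt q \<one>\<^bsub>R\<^esub>) = q" if "q \<in> carrier Q" for q
    using that c Q.P.rmul_one[of q] by (simp add: \<rho>p)
  define lam where "lam s = finsum R (\<lambda>g. s g \<otimes>\<^bsub>R\<^esub> act g c) (carrier G)" for s
  have lam_c: "lam s \<in> carrier R" if "s \<in> carrier S" for s
    unfolding lam_def by (rule R.finsum_closed) (use that c in auto)
  have lam_add: "lam (s \<oplus>\<^bsub>S\<^esub> t) = lam s \<oplus>\<^bsub>R\<^esub> lam t" if "s \<in> carrier S" "t \<in> carrier S" for s t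
  proof -
    have "lam (s \<oplus>\<^bsub>S\<^esub> t) = finsum R (\<lambda>g. s g \<otimes>\<^bsub>R\<^esub> act g c \<oplus>\<^bsub>R\<^esub> t g \<otimes>\<^bsub>R\<^esub> act g c) (carrier G)"
      unfolding lam_def by (rule R.finsum_cong') (use that c in \<open>auto simp: S_eqs R.l_distr\<close>)
    also have "\<dots> = lam s \<oplus>\<^bsub>R\<^esub> lam t"
      unfolding lam_def by (rule R.finsum_addf) (use that c in auto)
    finally show ?thesis .
  qed
  have lam_l: "lam (\<iota> r \<otimes>\<^bsub>S\<^esub> s) = r \<otimes>\<^bsub>R\<^esub> lam s" if "r \<in> carrier R" "s \<in> carrier S" for r s
  proof -
    have "lam (\<iota> r \<otimes>\<^bsub>S\<^esub> s) = finsum R (\<lambda>g. r \<otimes>\<^bsub>R\<^esub> (s g \<otimes>\<^bsub>R\<^esub> act g c)) (carrier G)"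
      unfolding lam_def by (rule R.finsum_cong') (use that c in \<open>auto simp: incl_mult R.m_assoc\<close>)
    also have "\<dots> = r \<otimes>\<^bsub>R\<^esub> lam s"
      unfolding lam_def by (rule R.finsum_rdistr[symmetric]) (use that c fin in auto)
    finally show ?thesis .
  qed
  \<comment> \<open>The two sides of the relation behave differently: \<open>lam\<close> is left
    R-linear and so returns r from r \<sigma>, whereas \<sigma> r has the coefficients act_g(r) and
    yields tr(c r), an invariant that can cross the tensor sign.\<close>
  have "lam \<sigma> = tr c"
    unfolding lam_def tr_def by (rule R.finsum_cong') (use c in \<open>auto simp: \<sigma>_val\<close>)
  then have lam_\<sigma>: "lam (\<iota> r \<otimes>\<^bsub>S\<^esub> \<sigma>) = r" if "r \<in> carrier R" for r
    using lam_l[OF that \<sigma>_closed] c that by simp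
  have lam_\<sigma>': "lam (\<sigma> \<otimes>\<^bsub>S\<^esub> \<iota> r) = tr (c \<otimes>\<^bsub>R\<^esub> r)" if r: "r \<in> carrier R" for r
    unfolding lam_def tr_def
    by (rule R.finsum_cong') (use r c in \<open>auto simp: incl_mult \<sigma>_val act_mult R.m_comm\<close>)
  define \<Lambda> where "\<Lambda> = tlift A Q Q.PS.T' Q.PR.Y (\<lambda>q s. Q.PR.pt q (lam s))"
  note L = Q.PS.Y_lift_hom[OF Q.PR.Y.comm_group_axioms] Q.PS.Y_lift_pt[OF Q.PR.Y.comm_group_axioms]
  have mid: "Q.PR.pt (rmul Q q a) (lam s) = Q.PR.pt q (lam (\<iota> a \<otimes>\<^bsub>S\<^esub> s))"
    if "q \<in> carrier Q" "a \<in> carrier A" "s \<in> carrier S" for q a s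
    using that by (simp add: Q.PR_middle lam_c lam_l fixed_in_R)
  have \<Lambda>: "\<Lambda> \<in> hom Q.PS.Y Q.PR.Y"
    unfolding \<Lambda>_def
    by (rule L) (simp_all del: id_apply add: mid lam_c lam_add Q.PR.pt_add_left Q.PR.pt_add_right)
  have \<Lambda>p: "\<Lambda> (Q.PS.pt q s) = Q.PR.pt q (lam s)" if "q \<in> carrier Q" "s \<in> carrier S" for q s
    unfolding \<Lambda>_def
    by (rule L) (simp_all del: id_apply add: mid lam_c lam_add Q.PR.pt_add_left Q.PR.pt_add_right that)
  note m = hom_mult[OF Q.phi_hom] hom_in_carrier[OF Q.phi_hom] hom_mult[OF \<Lambda>] hom_in_carrier[OF \<Lambda>]
    hom_mult[OF \<rho>] hom_in_carrier[OF \<rho>]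
  have r: "\<Lambda> (rmul Q.PS.Y (Q.\<phi> z) \<sigma>) = z" if z: "z \<in> carrier Q.PR.Y" for z
    by (rule Q.PR.Y_induct[OF z])
      (simp_all del: id_apply add: m \<Lambda>p lam_\<sigma> Q.PS.Y.rmul_add_left Q.PS.Y.rmul_closed)
  have l: "\<Lambda> (lmul Q.PS.Y \<sigma> (Q.\<phi> z)) = Q.PR.pt (\<rho> z) \<one>\<^bsub>R\<^esub>" if z: "z \<in> carrier Q.PR.Y" for z
  proof (rule Q.PR.Y_induct[OF z])
    fix q r assume qr: "q \<in> carrier Q" "r \<in> carrier R"
    have "Q.PR.pt q (tr (c \<otimes>\<^bsub>R\<^esub> r)) = Q.PR.pt (rmul Q q (tr (c \<otimes>\<^bsub>R\<^esub> r))) \<one>\<^bsub>R\<^esub>"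
      using qr c trA[of r] by (simp add: Q.PR_middle)
    then show "\<Lambda> (lmul Q.PS.Y \<sigma> (Q.\<phi> (Q.PR.pt q r))) = Q.PR.pt (\<rho> (Q.PR.pt q r)) \<one>\<^bsub>R\<^esub>"
      using qr by (simp add: \<Lambda>p lam_\<sigma>' \<rho>p)
  qed (simp_all del: id_apply add: m Q.PS.Y.lmul_add_right Q.PS.Y.lmul_closed Q.PR.pt_add_left)
  show thesis
  proof (rule that[OF \<rho> \<rho>1])
    fix z assume z: "z \<in> carrier Q.PR.Y" and eq: "lmul Q.PS.Y \<sigma> (Q.\<phi> z) = rmul Q.PS.Y (Q.\<phi> z) \<sigma>"
    have "\<Lambda> (rmul Q.PS.Y (Q.\<phi> z) \<sigma>) = Q.PR.pt (\<rho> z) \<one>\<^bsub>R\<^esub>" by (rule trans[OF arg_cong[OF eq[symmetric], where f = \<Lambda>] l[OF z]])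
    then show "z = Q.PR.pt (\<rho> z) \<one>\<^bsub>R\<^esub>" by (rule trans[OF r[OF z, symmetric]])
  qed
qed

text \<open>Inside P \<otimes>_A R the elements p \<otimes> 1 are those whose images commute with
  \<sigma>. As \<open>b\<close> is S-bilinear, \<open>a\<close> and its inverse preserve this
  condition; \<open>f\<close> and \<open>g\<close> read off the restrictions by means of the
  retractions.\<close>

lemma xi_iso_descends:
  fixes P :: "('r, 'r, 'p) bimod" and Q :: "('r, 'r, 'q) bimod"
  assumes P: "tower_module A R S \<iota> P" and Q: "tower_module A R S \<iota> Q"
    and cP: "central_over (carrier A) P" and cQ: "central_over (carrier A) Q"
    and iso: "ext_isomorphic R S (xi_object A \<iota> R S P) (xi_object A \<iota> R S Q)"
  shows "bimod_isomorphic A A P Q"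
proof -
  interpret P: tower_module A R S \<iota> P by fact
  interpret Q: tower_module A R S \<iota> Q by fact
  obtain a b where ab: "a \<in> bimod_iso R R P.PR.Y Q.PR.Y" "b \<in> bimod_iso S S P.PS.Y Q.PS.Y"
    "\<And>p. p \<in> carrier P.PR.Y \<Longrightarrow> b (P.\<phi> p) = Q.\<phi> (a p)"
    by (rule ext_isomorphicE[OF iso[unfolded P.xi_object_eq Q.xi_object_eq]]) blast
  obtain a' b' where ab': "a' \<in> bimod_iso R R Q.PR.Y P.PR.Y" "b' \<in> bimod_iso S S Q.PS.Y P.PS.Y"
    "\<And>p. p \<in> carrier Q.PR.Y \<Longrightarrow> b' (Q.\<phi> p) = P.\<phi> (a' p)"
    and a'a: "\<And>p. p \<in> carrier P.PR.Y \<Longrightarrow> a' (a p) = p" "\<And>p. p \<in> carrier Q.PR.Y \<Longrightarrow> a (a' p) = p"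
  proof
    let ?a = "inv_into (carrier P.PR.Y) a" and ?b = "inv_into (carrier P.PS.Y) b"
    show "?a \<in> bimod_iso R R Q.PR.Y P.PR.Y" by (rule bimod_iso_inv[OF P.PR.Y_bimodule ab(1)])
    show "?b \<in> bimod_iso S S Q.PS.Y P.PS.Y" by (rule bimod_iso_inv[OF P.PS.Y_bimodule ab(2)])
    show 1: "?a (a p) = p" if "p \<in> carrier P.PR.Y" for p
      by (rule bij_betw_inv_into_left[OF bimod_iso_bij[OF ab(1)] that])
    show 2: "a (?a p) = p" if "p \<in> carrier Q.PR.Y" for p
      by (rule bij_betw_inv_into_right[OF bimod_iso_bij[OF ab(1)] that])
    show "?b (Q.\<phi> p) = P.\<phi> (?a p)" if p: "p \<in> carrier Q.PR.Y" for p
    proof -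
      have c: "?a p \<in> carrier P.PR.Y"
        using bimod_hom_closed[OF bimod_iso_hom[OF bimod_iso_inv[OF P.PR.Y_bimodule ab(1)]] p] .
      have "?b (Q.\<phi> p) = ?b (b (P.\<phi> (?a p)))" using ab(3)[OF c] 2[OF p] by simp
      also have "\<dots> = P.\<phi> (?a p)"
        using bimod_iso_bij[OF ab(2)] hom_in_carrier[OF P.phi_hom c] by (simp add: bij_betw_def)
      finally show ?thesis .
    qed
  qed
  obtain \<rho>P where \<rho>P: "\<rho>P \<in> hom P.PR.Y P" "\<And>q. q \<in> carrier P \<Longrightarrow> \<rho>P (P.PR.pt q \<one>\<^bsub>R\<^esub>) = q"
    "\<And>z. z \<in> carrier P.PR.Y \<Longrightarrow> lmul P.PS.Y \<sigma> (P.\<phi> z) = rmul P.PS.Y (P.\<phi> z) \<sigma> \<Longrightarrow>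
      z = P.PR.pt (\<rho>P z) \<one>\<^bsub>R\<^esub>"
    by (rule xi_fixed[OF P]) blast
  obtain \<rho>Q where \<rho>Q: "\<rho>Q \<in> hom Q.PR.Y Q" "\<And>q. q \<in> carrier Q \<Longrightarrow> \<rho>Q (Q.PR.pt q \<one>\<^bsub>R\<^esub>) = q"
    "\<And>z. z \<in> carrier Q.PR.Y \<Longrightarrow> lmul Q.PS.Y \<sigma> (Q.\<phi> z) = rmul Q.PS.Y (Q.\<phi> z) \<sigma> \<Longrightarrow>
      z = Q.PR.pt (\<rho>Q z) \<one>\<^bsub>R\<^esub>"
    by (rule xi_fixed[OF Q]) blast
  define f where "f p = \<rho>Q (a (P.PR.pt p \<one>\<^bsub>R\<^esub>))" for p
  define g where "g q = \<rho>P (a' (Q.PR.pt q \<one>\<^bsub>R\<^esub>))" for q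
  note ah = bimod_iso_hom[OF ab(1)] and bh = bimod_iso_hom[OF ab(2)]
  note ah' = bimod_iso_hom[OF ab'(1)] and bh' = bimod_iso_hom[OF ab'(2)]
  have f: "a (P.PR.pt p \<one>\<^bsub>R\<^esub>) = Q.PR.pt (f p) \<one>\<^bsub>R\<^esub>" if p: "p \<in> carrier P" for p
    unfolding f_def
  proof (rule \<rho>Q(3))
    have pt: "P.PR.pt p \<one>\<^bsub>R\<^esub> \<in> carrier P.PR.Y" using p by simp
    show "a (P.PR.pt p \<one>\<^bsub>R\<^esub>) \<in> carrier Q.PR.Y" by (rule bimod_hom_closed[OF ah pt])
    show "lmul Q.PS.Y \<sigma> (Q.\<phi> (a (P.PR.pt p \<one>\<^bsub>R\<^esub>))) = rmul Q.PS.Y (Q.\<phi> (a (P.PR.pt p \<one>\<^bsub>R\<^esub>))) \<sigma>"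
      unfolding ab(3)[OF pt, symmetric]
      using p bimod_hom_lmul[OF bh \<sigma>_closed, of "P.PS.pt p \<one>\<^bsub>S\<^esub>"]
        bimod_hom_rmul[OF bh \<sigma>_closed, of "P.PS.pt p \<one>\<^bsub>S\<^esub>"] by simp
  qed
  have g: "a' (Q.PR.pt q \<one>\<^bsub>R\<^esub>) = P.PR.pt (g q) \<one>\<^bsub>R\<^esub>" if q: "q \<in> carrier Q" for q
    unfolding g_def
  proof (rule \<rho>P(3))
    have pt: "Q.PR.pt q \<one>\<^bsub>R\<^esub> \<in> carrier Q.PR.Y" using q by simp
    show "a' (Q.PR.pt q \<one>\<^bsub>R\<^esub>) \<in> carrier P.PR.Y" by (rule bimod_hom_closed[OF ah' pt])
    show "lmul P.PS.Y \<sigma> (P.\<phi> (a' (Q.PR.pt q \<one>\<^bsub>R\<^esub>))) = rmul P.PS.Y (P.\<phi> (a' (Q.PR.pt q \<one>\<^bsub>R\<^esub>))) \<sigma>"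
      unfolding ab'(3)[OF pt, symmetric]
      using q bimod_hom_lmul[OF bh' \<sigma>_closed, of "Q.PS.pt q \<one>\<^bsub>S\<^esub>"]
        bimod_hom_rmul[OF bh' \<sigma>_closed, of "Q.PS.pt q \<one>\<^bsub>S\<^esub>"] by simp
  qed
  have fc: "f p \<in> carrier Q" if "p \<in> carrier P" for p
    unfolding f_def using hom_in_carrier[OF \<rho>Q(1)] bimod_hom_closed[OF ah] that by simp
  have gc: "g q \<in> carrier P" if "q \<in> carrier Q" for q
    unfolding g_def using hom_in_carrier[OF \<rho>P(1)] bimod_hom_closed[OF ah'] that by simp
  have gf: "g (f p) = p" if p: "p \<in> carrier P" for p
    using a'a(1)[of "P.PR.pt p \<one>\<^bsub>R\<^esub>"] \<rho>P(2)[OF p] p unfolding g_def f[OF p, symmetric] by simp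
  have fg: "f (g q) = q" if q: "q \<in> carrier Q" for q
    using a'a(2)[of "Q.PR.pt q \<one>\<^bsub>R\<^esub>"] \<rho>Q(2)[OF q] q unfolding f_def g[OF q, symmetric] by simp
  have lin: "f (lmul P x p) = lmul Q x (f p)" if x: "x \<in> carrier A" and p: "p \<in> carrier P" for x p
  proof -
    have xR: "x \<in> carrier R" by (rule fixed_in_R[OF x])
    have "P.PR.pt (lmul P x p) \<one>\<^bsub>R\<^esub> = lmul P.PR.Y x (P.PR.pt p \<one>\<^bsub>R\<^esub>)"
      using P.PR_middle[OF p x R.one_closed] cP x p xR by (simp add: central_over_def)
    then have "a (P.PR.pt (lmul P x p) \<one>\<^bsub>R\<^esub>) = lmul Q.PR.Y x (Q.PR.pt (f p) \<one>\<^bsub>R\<^esub>)"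
      using bimod_hom_lmul[OF ah xR, of "P.PR.pt p \<one>\<^bsub>R\<^esub>"] p f by simp
    also have "\<dots> = Q.PR.pt (lmul Q x (f p)) \<one>\<^bsub>R\<^esub>"
      using Q.PR_middle[OF fc[OF p] x R.one_closed] cQ x fc[OF p] xR by (simp add: central_over_def)
    finally show ?thesis unfolding f_def[of "lmul P x p"] using \<rho>Q(2) Q.P.lmul_closed x fc[OF p] by simp
  qed
  have "f \<in> bimod_hom A A P Q"
  proof (rule bimod_homI)
    fix p p' assume "p \<in> carrier P" "p' \<in> carrier P"
    then show "f (p \<otimes>\<^bsub>P\<^esub> p') = f p \<otimes>\<^bsub>Q\<^esub> f p'"
      unfolding f_def by (simp add: P.PR.pt_add_left bimod_hom_add[OF ah] hom_mult[OF \<rho>Q(1)] bimod_hom_closed[OF ah])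
  next
    fix x p assume "x \<in> carrier A" "p \<in> carrier P"
    then show "f (rmul P p x) = rmul Q (f p) x"
      using lin[of x p] cP cQ fc by (simp add: central_over_def)
  qed (simp_all add: fc lin)
  then have "f \<in> bimod_iso A A P Q" by (rule bimod_isoI[where g = g]) (simp_all add: gc gf fg)
  then show ?thesis by (auto simp: bimod_isomorphic_def)
qed

end

section \<open>Galois descent\<close>

text \<open>The construction of P_0 draws on three facts about the object: \<phi> is injective, P is
  central, and the image of \<phi> is stable under z |-> d_g z d_(g^-1). The last one is extracted
  from the invariance condition.\<close>

locale Galois_descent = partial_Galois_action G R e \<alpha> m x y + P: bimodule R R P +
    X: bimodule "skew_ring G R e \<alpha>" "skew_ring G R e \<alpha>" X
  for G :: "('g, 'y) monoid_scheme" and R :: "('r, 'z) ring_scheme"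
    and e :: "'g \<Rightarrow> 'r" and \<alpha> :: "'g \<Rightarrow> 'r \<Rightarrow> 'r" and m :: nat and x y :: "nat \<Rightarrow> 'r"
    and P :: "('r, 'r, 'p) bimod" and X :: "('g \<Rightarrow> 'r, 'g \<Rightarrow> 'r, 'x) bimod" +
  fixes \<phi> :: "'p \<Rightarrow> 'x"
  assumes phi: "\<phi> \<in> bimod_hom R R P (restrict_scalars (skew_incl G R) (skew_incl G R) X)"
    and cP: "central_over (carrier R) P"
    and phi_inj: "inj_on \<phi> (carrier P)"
    and twist: "g \<in> carrier G \<Longrightarrow> p \<in> carrier P \<Longrightarrow> \<exists>q\<in>carrier P.
      \<phi> q = lmul X (skew_delta G R (e g) g)
        (rmul X (\<phi> p) (skew_delta G R (e (inv\<^bsub>G\<^esub> g)) (inv\<^bsub>G\<^esub> g)))"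
begin

abbreviation twisted :: "'g \<Rightarrow> 'x \<Rightarrow> 'x" where
  "twisted g z \<equiv> lmul X (\<delta> g) (rmul X z (\<delta> (inv\<^bsub>G\<^esub> g)))"

lemma phi_closed [simp]: "p \<in> carrier P \<Longrightarrow> \<phi> p \<in> carrier X"
  using bimod_hom_closed[OF phi] by simp

lemma phi_add: "p \<in> carrier P \<Longrightarrow> q \<in> carrier P \<Longrightarrow> \<phi> (p \<otimes>\<^bsub>P\<^esub> q) = \<phi> p \<otimes>\<^bsub>X\<^esub> \<phi> q"
  using bimod_hom_add[OF phi] by simp

lemma phi_lmul: "r \<in> carrier R \<Longrightarrow> p \<in> carrier P \<Longrightarrow> \<phi> (lmul P r p) = lmul X (\<iota> r) (\<phi> p)"
  using bimod_hom_lmul[OF phi] by simp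

lemma rmul_P: "r \<in> carrier R \<Longrightarrow> p \<in> carrier P \<Longrightarrow> rmul P p r = lmul P r p"
  using cP by (simp add: central_over_def)

lemma phi_rmul: "r \<in> carrier R \<Longrightarrow> p \<in> carrier P \<Longrightarrow> rmul X (\<phi> p) (\<iota> r) = lmul X (\<iota> r) (\<phi> p)"
  using bimod_hom_rmul[OF phi, of r p] by (simp add: rmul_P phi_lmul)

lemma phi_hom: "\<phi> \<in> hom P X"
  by (simp add: hom_def phi_add)

lemma phi_eqD: "p \<in> carrier P \<Longrightarrow> q \<in> carrier P \<Longrightarrow> \<phi> p = \<phi> q \<Longrightarrow> p = q"
  using phi_inj by (simp add: inj_on_def)

text \<open>The value is unique by injectivity of \<phi>, so laws for \<open>\<tau> g\<close> are
  verified after applying \<phi>.\<close>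

definition \<tau> :: "'g \<Rightarrow> 'p \<Rightarrow> 'p" where
  "\<tau> g p = (SOME q. q \<in> carrier P \<and> \<phi> q = twisted g (\<phi> p))"

lemma
  assumes "g \<in> carrier G" "p \<in> carrier P"
  shows \<tau>_closed [simp]: "\<tau> g p \<in> carrier P" and phi_\<tau>: "\<phi> (\<tau> g p) = twisted g (\<phi> p)"
proof -
  have "\<exists>q. q \<in> carrier P \<and> \<phi> q = twisted g (\<phi> p)" using twist[OF assms] by blast
  from someI_ex[OF this] show "\<tau> g p \<in> carrier P" "\<phi> (\<tau> g p) = twisted g (\<phi> p)"
    by (simp_all add: \<tau>_def)
qed

lemma \<tau>_eqI:
  "g \<in> carrier G \<Longrightarrow> p \<in> carrier P \<Longrightarrow> q \<in> carrier P \<Longrightarrow> \<phi> q = twisted g (\<phi> p) \<Longrightarrow> \<tau> g p = q"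
  by (rule phi_eqD) (simp_all add: phi_\<tau>)

lemma \<tau>_add: "g \<in> carrier G \<Longrightarrow> p \<in> carrier P \<Longrightarrow> q \<in> carrier P \<Longrightarrow>
    \<tau> g (p \<otimes>\<^bsub>P\<^esub> q) = \<tau> g p \<otimes>\<^bsub>P\<^esub> \<tau> g q"
  by (rule \<tau>_eqI) (simp_all add: phi_add phi_\<tau> X.rmul_add_left X.lmul_add_right X.rmul_closed)

lemma \<tau>_lmul:
  assumes g: "g \<in> carrier G" and r: "r \<in> carrier R" and p: "p \<in> carrier P"
  shows "\<tau> g (lmul P r p) = lmul P (act g r) (\<tau> g p)"
proof (rule \<tau>_eqI[OF g])
  have "twisted g (\<phi> (lmul P r p)) = lmul X (\<delta> g) (lmul X (\<iota> r) (rmul X (\<phi> p) (\<delta> (inv\<^bsub>G\<^esub> g))))"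
    using g r p by (simp add: phi_lmul X.lmul_rmul)
  also have "\<dots> = lmul X (\<iota> (act g r)) (twisted g (\<phi> p))"
    using g r p by (simp add: X.lmul_assoc[symmetric] \<delta>_incl X.rmul_closed)
  finally show "\<phi> (lmul P (act g r) (\<tau> g p)) = twisted g (\<phi> (lmul P r p))"
    using g r p by (simp add: phi_lmul phi_\<tau>)
qed (use g r p in \<open>simp_all add: P.lmul_closed\<close>)

lemma incl_e_\<delta>: "g \<in> carrier G \<Longrightarrow> \<iota> (e g) \<otimes>\<^bsub>S\<^esub> \<delta> g = \<delta> g"
  by (simp add: incl_\<delta> e_closed e_idem)

text \<open>With k = hg, the product d_(k^-1) d_h equals 1_(k^-1) d_(g^-1), and d_k absorbs the
  idempotent. Then d_h d_g = 1_h d_k matches the two sides, the factor 1_h being free because d_h =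
  1_h d_h.\<close>

lemma \<tau>_shift:
  assumes g: "g \<in> carrier G" and h: "h \<in> carrier G" and p: "p \<in> carrier P"
  shows "lmul X (\<delta> h) (\<phi> (\<tau> g p)) = rmul X (\<phi> (\<tau> (h \<otimes>\<^bsub>G\<^esub> g) p)) (\<delta> h)"
proof -
  let ?k = "h \<otimes>\<^bsub>G\<^esub> g"
  let ?z = "rmul X (\<phi> p) (\<delta> (inv\<^bsub>G\<^esub> g))"
  have k: "?k \<in> carrier G" using g h by simp
  have z: "?z \<in> carrier X" using g p by (simp add: X.rmul_closed)
  have "inv\<^bsub>G\<^esub> ?k \<otimes>\<^bsub>G\<^esub> h = inv\<^bsub>G\<^esub> g" using g h by (simp add: G.inv_mult_group G.m_assoc)
  then have \<delta>\<delta>: "\<delta> (inv\<^bsub>G\<^esub> ?k) \<otimes>\<^bsub>S\<^esub> \<delta> h = \<iota> (e (inv\<^bsub>G\<^esub> ?k)) \<otimes>\<^bsub>S\<^esub> \<delta> (inv\<^bsub>G\<^esub> g)"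
    using \<delta>_\<delta>[of "inv\<^bsub>G\<^esub> ?k" h] k h by simp
  have ek: "e (inv\<^bsub>G\<^esub> ?k) \<in> carrier R" using k by (simp add: e_closed)
  have \<delta>e: "\<delta> ?k \<otimes>\<^bsub>S\<^esub> \<iota> (e (inv\<^bsub>G\<^esub> ?k)) = \<delta> ?k"
    using \<delta>_incl[OF k ek] incl_e_\<delta>[OF k] by (simp add: act_e_inv[OF k])
  have "rmul X (\<phi> (\<tau> ?k p)) (\<delta> h) = lmul X (\<delta> ?k) (rmul X (\<phi> p) (\<delta> (inv\<^bsub>G\<^esub> ?k) \<otimes>\<^bsub>S\<^esub> \<delta> h))"
    using k h p by (simp add: phi_\<tau> X.lmul_rmul X.rmul_closed X.rmul_assoc)
  also have "rmul X (\<phi> p) (\<delta> (inv\<^bsub>G\<^esub> ?k) \<otimes>\<^bsub>S\<^esub> \<delta> h) = lmul X (\<iota> (e (inv\<^bsub>G\<^esub> ?k))) ?z"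
    unfolding \<delta>\<delta> using ek g p by (simp add: X.rmul_assoc phi_rmul X.lmul_rmul)
  also have "lmul X (\<delta> ?k) \<dots> = lmul X (\<delta> ?k) ?z"
    using X.lmul_assoc[OF \<delta>_closed[OF k] incl_closed[OF ek] z] by (simp add: \<delta>e)
  finally have 1: "rmul X (\<phi> (\<tau> ?k p)) (\<delta> h) = lmul X (\<delta> ?k) ?z" .
  have eh: "e h \<in> carrier R" using h by (simp add: e_closed)
  have "rmul X (\<phi> (\<tau> ?k p)) (\<delta> h) = rmul X (\<phi> (\<tau> ?k p)) (\<iota> (e h) \<otimes>\<^bsub>S\<^esub> \<delta> h)"
    using incl_e_\<delta>[OF h] by simp
  also have "\<dots> = lmul X (\<iota> (e h)) (rmul X (\<phi> (\<tau> ?k p)) (\<delta> h))"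
    using k h p eh by (simp add: X.rmul_assoc phi_rmul X.lmul_rmul)
  also have "\<dots> = lmul X (\<iota> (e h) \<otimes>\<^bsub>S\<^esub> \<delta> ?k) ?z"
    unfolding 1 using eh k z by (simp add: X.lmul_assoc)
  also have "\<dots> = lmul X (\<delta> h) (\<phi> (\<tau> g p))"
    unfolding \<delta>_\<delta>[OF h g, symmetric] using g h p z by (simp add: X.lmul_assoc phi_\<tau>)
  finally show ?thesis by simp
qed

section \<open>The trace on P and the submodule of commuting elements\<close>

definition T :: "'p \<Rightarrow> 'p" where
  "T p = finprod P (\<lambda>g. \<tau> g p) (carrier G)"

lemma T_closed [simp]: "p \<in> carrier P \<Longrightarrow> T p \<in> carrier P"
  unfolding T_def by (rule P.M.finprod_closed) auto

lemma T_add: "p \<in> carrier P \<Longrightarrow> q \<in> carrier P \<Longrightarrow> T (p \<otimes>\<^bsub>P\<^esub> q) = T p \<otimes>\<^bsub>P\<^esub> T q"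
proof -
  assume *: "p \<in> carrier P" "q \<in> carrier P"
  have "T (p \<otimes>\<^bsub>P\<^esub> q) = finprod P (\<lambda>g. \<tau> g p \<otimes>\<^bsub>P\<^esub> \<tau> g q) (carrier G)"
    unfolding T_def by (rule P.M.finprod_cong') (use * in \<open>auto simp: \<tau>_add\<close>)
  also have "\<dots> = T p \<otimes>\<^bsub>P\<^esub> T q" unfolding T_def by (rule P.M.finprod_multf) (use * in auto)
  finally show ?thesis .
qed

lemma phi_T: "p \<in> carrier P \<Longrightarrow> \<phi> (T p) = finprod X (\<lambda>g. \<phi> (\<tau> g p)) (carrier G)"
  unfolding T_def by (rule hom_finprod[OF P.M.comm_group_axioms X.M.comm_group_axioms phi_hom]) auto

text \<open>S is spanned over R by the d_g, and R commutes with the image of P because P is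
  central.\<close>

lemma commute_all:
  assumes p: "p \<in> carrier P" and \<delta>: "\<And>g. g \<in> carrier G \<Longrightarrow> lmul X (\<delta> g) (\<phi> p) = rmul X (\<phi> p) (\<delta> g)"
    and s: "s \<in> carrier S"
  shows "lmul X s (\<phi> p) = rmul X (\<phi> p) s"
proof -
  let ?t = "\<lambda>g. \<iota> (s g) \<otimes>\<^bsub>S\<^esub> \<delta> g"
  have t: "?t \<in> carrier G \<rightarrow> carrier S" using s by simp
  have "lmul X (finsum S ?t (carrier G)) (\<phi> p) = finprod X (\<lambda>g. lmul X (?t g) (\<phi> p)) (carrier G)"
    by (rule X.lmul_finsum[OF phi_closed[OF p] t])
  also have "\<dots> = finprod X (\<lambda>g. rmul X (\<phi> p) (?t g)) (carrier G)"
  proof (rule X.M.finprod_cong')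
    fix g assume g: "g \<in> carrier G"
    then have "lmul X (?t g) (\<phi> p) = lmul X (\<iota> (s g)) (rmul X (\<phi> p) (\<delta> g))"
      using p s by (simp add: X.lmul_assoc \<delta>)
    also have "\<dots> = rmul X (\<phi> p) (?t g)"
      using g p s by (simp add: X.rmul_assoc phi_rmul X.lmul_rmul)
    finally show "lmul X (?t g) (\<phi> p) = rmul X (\<phi> p) (?t g)" .
  qed (use s p in \<open>auto simp: X.rmul_closed\<close>)
  also have "\<dots> = rmul X (\<phi> p) (finsum S ?t (carrier G))"
    by (rule X.rmul_finsum[symmetric, OF phi_closed[OF p] t])
  finally show ?thesis using S_expand[OF s] by simp
qed

definition P0 :: "('r, 'r, 'p) bimod" where
  "P0 = P\<lparr>carrier := {p \<in> carrier P. \<forall>s\<in>carrier S. lmul X s (\<phi> p) = rmul X (\<phi> p) s}\<rparr>"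

lemma P0_simps [simp]: "monoid.mult P0 = monoid.mult P" "one P0 = one P" "lmul P0 = lmul P" "rmul P0 = rmul P"
  by (simp_all add: P0_def)

lemma P0_carrier: "p \<in> carrier P0 \<longleftrightarrow>
    p \<in> carrier P \<and> (\<forall>s\<in>carrier S. lmul X s (\<phi> p) = rmul X (\<phi> p) s)"
  by (simp add: P0_def)

lemma P0_in_P [simp]: "p \<in> carrier P0 \<Longrightarrow> p \<in> carrier P"
  by (simp add: P0_carrier)

lemma P0_commute: "p \<in> carrier P0 \<Longrightarrow> s \<in> carrier S \<Longrightarrow> lmul X s (\<phi> p) = rmul X (\<phi> p) s"
  by (simp add: P0_carrier)

text \<open>By \<open>\<tau>_shift\<close>, moving d_h across the image of \<open>T p\<close>
  translates the summation index by h.\<close>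

lemma T_in_P0 [simp]:
  assumes p: "p \<in> carrier P" shows "T p \<in> carrier P0"
proof -
  have "lmul X (\<delta> h) (\<phi> (T p)) = rmul X (\<phi> (T p)) (\<delta> h)" if h: "h \<in> carrier G" for h
  proof -
    have "lmul X (\<delta> h) (\<phi> (T p)) = finprod X (\<lambda>g. lmul X (\<delta> h) (\<phi> (\<tau> g p))) (carrier G)"
      unfolding phi_T[OF p] by (rule X.lmul_finprod) (use h p in auto)
    also have "\<dots> = finprod X (\<lambda>g. rmul X (\<phi> (\<tau> (h \<otimes>\<^bsub>G\<^esub> g) p)) (\<delta> h)) (carrier G)"
      by (rule X.M.finprod_cong') (use h p in \<open>auto simp: \<tau>_shift X.rmul_closed\<close>)
    also have "\<dots> = finprod X (\<lambda>g. rmul X (\<phi> (\<tau> g p)) (\<delta> h)) (carrier G)"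
      by (rule finprod_shift[OF X.M.comm_monoid_axioms h]) (use h p in \<open>auto simp: X.rmul_closed\<close>)
    also have "\<dots> = rmul X (\<phi> (T p)) (\<delta> h)"
      unfolding phi_T[OF p] by (rule X.rmul_finprod[symmetric]) (use h p in auto)
    finally show ?thesis .
  qed
  then show ?thesis using commute_all[OF T_closed[OF p]] p by (simp add: P0_carrier)
qed

lemma P0_bimodule: "bimodule A A P0"
proof -
  have l: "lmul P a p \<in> carrier P0" if a: "a \<in> carrier A" and p: "p \<in> carrier P0" for a p
  proof -
    have aR: "a \<in> carrier R" by (rule fixed_in_R[OF a])
    have "lmul X s (\<phi> (lmul P a p)) = rmul X (\<phi> (lmul P a p)) s" if s: "s \<in> carrier S" for s
    proof -
      have "lmul X s (\<phi> (lmul P a p)) = lmul X (s \<otimes>\<^bsub>S\<^esub> \<iota> a) (\<phi> p)"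
        using aR p s by (simp add: phi_lmul X.lmul_assoc)
      also have "\<dots> = lmul X (\<iota> a) (rmul X (\<phi> p) s)"
        unfolding incl_central[OF a s, symmetric] using aR p s by (simp add: X.lmul_assoc P0_commute[OF p s])
      also have "\<dots> = rmul X (\<phi> (lmul P a p)) s"
        using aR p s by (simp add: phi_lmul X.lmul_rmul)
      finally show ?thesis .
    qed
    then show ?thesis using aR p by (simp add: P0_carrier P.lmul_closed)
  qed
  have r: "rmul P p a = lmul P a p" if "a \<in> carrier A" "p \<in> carrier P0" for a p
    using that by (simp add: rmul_P fixed_in_R)
  have add: "p \<otimes>\<^bsub>P\<^esub> q \<in> carrier P0" if "p \<in> carrier P0" "q \<in> carrier P0" for p q
    using that by (auto simp: P0_carrier phi_add X.lmul_add_right X.rmul_add_left)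
  have "\<phi> \<one>\<^bsub>P\<^esub> = \<one>\<^bsub>X\<^esub>" using hom_one[OF phi_hom P.M.is_group X.M.is_group] .
  then have one: "\<one>\<^bsub>P\<^esub> \<in> carrier P0" by (simp add: P0_carrier)
  interpret comm_group P0
  proof (rule comm_groupI)
    fix p assume p: "p \<in> carrier P0"
    \<comment> \<open>Negatives are produced by the action of minus one in A, under which
      \<open>P0\<close> is already known to be closed.\<close>
    have m1: "\<ominus>\<^bsub>A\<^esub> \<one>\<^bsub>A\<^esub> \<in> carrier A" "\<one>\<^bsub>A\<^esub> \<in> carrier A"
      by (rule TW.A.a_inv_closed[OF TW.A.one_closed]) (rule TW.A.one_closed)
    have "lmul P (\<ominus>\<^bsub>A\<^esub> \<one>\<^bsub>A\<^esub>) p \<otimes>\<^bsub>P\<^esub> lmul P \<one>\<^bsub>A\<^esub> p = lmul P (\<ominus>\<^bsub>A\<^esub> \<one>\<^bsub>A\<^esub> \<oplus>\<^bsub>A\<^esub> \<one>\<^bsub>A\<^esub>) p"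
      using p fixed_in_R[OF m1(1)] P.lmul_add_left[of "\<ominus>\<^bsub>A\<^esub> \<one>\<^bsub>A\<^esub>" "\<one>\<^bsub>R\<^esub>" p] by simp
    also have "\<dots> = \<one>\<^bsub>P\<^esub>" using p TW.A.l_neg[OF m1(2)] by simp
    finally show "\<exists>q\<in>carrier P0. q \<otimes>\<^bsub>P0\<^esub> p = \<one>\<^bsub>P0\<^esub>"
      using l[OF m1(1) p] p by (intro bexI[of _ "lmul P (\<ominus>\<^bsub>A\<^esub> \<one>\<^bsub>A\<^esub>) p"]) (simp_all add: P.lmul_one)
  qed (simp_all add: add one P.M.m_ac)
  show ?thesis
    by unfold_locales (simp_all add: l r[THEN ssubst, where P = "\<lambda>p. p \<in> carrier P0"] fixed_in_R
      P.lmul_add_left P.lmul_add_right P.rmul_add_left P.rmul_add_right P.lmul_assoc P.rmul_assoc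
      P.lmul_one P.rmul_one P.lmul_rmul)
qed

lemma cP0: "central_over (carrier A) P0"
  by (simp add: central_over_def rmul_P fixed_in_R)

text \<open>The computation of \<open>tr_expand\<close> on the module, with \<tau>_g(y_k p) =
  act_g(y_k) \<tau>_g(p).\<close>

lemma T_expand:
  assumes p: "p \<in> carrier P"
  shows "finprod P (\<lambda>k. lmul P (x k) (T (lmul P (y k) p))) {..<m} = p"
proof -
  note c = x_closed y_closed P.lmul_closed
  have "finprod P (\<lambda>k. lmul P (x k) (T (lmul P (y k) p))) {..<m} =
      finprod P (\<lambda>k. finprod P (\<lambda>g. lmul P (x k \<otimes>\<^bsub>R\<^esub> act g (y k)) (\<tau> g p)) (carrier G)) {..<m}"
  proof (rule P.M.finprod_cong')
    fix k assume "k \<in> {..<m}"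
    then have k: "x k \<in> carrier R" "y k \<in> carrier R" by (simp_all add: c)
    have "lmul P (x k) (T (lmul P (y k) p)) = finprod P (\<lambda>g. lmul P (x k) (\<tau> g (lmul P (y k) p))) (carrier G)"
      unfolding T_def by (rule P.lmul_finprod) (use k p c in auto)
    also have "\<dots> = finprod P (\<lambda>g. lmul P (x k \<otimes>\<^bsub>R\<^esub> act g (y k)) (\<tau> g p)) (carrier G)"
      by (rule P.M.finprod_cong') (use k p c in \<open>auto simp: \<tau>_lmul P.lmul_assoc\<close>)
    finally show "lmul P (x k) (T (lmul P (y k) p)) =
      finprod P (\<lambda>g. lmul P (x k \<otimes>\<^bsub>R\<^esub> act g (y k)) (\<tau> g p)) (carrier G)" .
  qed (use p c in auto)
  also have "\<dots> = finprod P (\<lambda>g. finprod P (\<lambda>k. lmul P (x k \<otimes>\<^bsub>R\<^esub> act g (y k)) (\<tau> g p)) {..<m}) (carrier G)"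
    by (rule P.M.finprod_swap[OF _ fin]) (use p c in auto)
  also have "\<dots> = finprod P (\<lambda>g. if g = \<one>\<^bsub>G\<^esub> then p else \<one>\<^bsub>P\<^esub>) (carrier G)"
  proof (rule P.M.finprod_cong')
    fix g assume g: "g \<in> carrier G"
    have t1: "\<tau> \<one>\<^bsub>G\<^esub> p = p"
      by (rule \<tau>_eqI) (use p in \<open>simp_all add: \<delta>_one X.rmul_one X.lmul_one\<close>)
    have "finprod P (\<lambda>k. lmul P (x k \<otimes>\<^bsub>R\<^esub> act g (y k)) (\<tau> g p)) {..<m} =
        lmul P (finsum R (\<lambda>k. x k \<otimes>\<^bsub>R\<^esub> act g (y k)) {..<m}) (\<tau> g p)"
      by (rule P.lmul_finsum[symmetric]) (use g p c in auto)
    then show "finprod P (\<lambda>k. lmul P (x k \<otimes>\<^bsub>R\<^esub> act g (y k)) (\<tau> g p)) {..<m} = (if g = \<one>\<^bsub>G\<^esub> then p else \<one>\<^bsub>P\<^esub>)"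
      using g p by (simp add: Galois t1 P.lmul_one)
  qed (use p in auto)
  also have "\<dots> = p"
    using P.M.finprod_singleton_swap[of "\<one>\<^bsub>G\<^esub>" "carrier G" "\<lambda>_. p"] fin p by simp
  finally show ?thesis .
qed

text \<open>For p in P_0 the factor d_(g^-1) moves to the left and d_g d_(g^-1) = 1_g, so \<tau>_g
  is multiplication by 1_g there.\<close>

lemma T_P0:
  assumes r: "r \<in> carrier R" and p: "p \<in> carrier P0"
  shows "T (lmul P r p) = lmul P (tr r) p"
proof -
  have pP: "p \<in> carrier P" using p by simp
  have "\<tau> g p = lmul P (e g) p" if g: "g \<in> carrier G" for g
  proof (rule \<tau>_eqI[OF g pP])
    have "twisted g (\<phi> p) = lmul X (\<delta> g) (lmul X (\<delta> (inv\<^bsub>G\<^esub> g)) (\<phi> p))"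
      using g p by (simp add: P0_commute)
    also have "\<dots> = lmul X (\<iota> (e g) \<otimes>\<^bsub>S\<^esub> \<one>\<^bsub>S\<^esub>) (\<phi> p)"
      using g p by (simp add: X.lmul_assoc[symmetric] \<delta>_\<delta> \<delta>_one del: S.r_one)
    finally show "\<phi> (lmul P (e g) p) = twisted g (\<phi> p)" using g p by (simp add: e_closed phi_lmul)
  qed (use g p e_closed P.lmul_closed in auto)
  then have t: "\<tau> g (lmul P r p) = lmul P (act g r) p" if "g \<in> carrier G" for g
    using that r p P.lmul_assoc[of "act g r" "e g" p] by (simp add: \<tau>_lmul e_closed)
  have "T (lmul P r p) = finprod P (\<lambda>g. lmul P (act g r) p) (carrier G)"
    unfolding T_def by (rule P.M.finprod_cong') (use r p t P.lmul_closed in auto)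
  also have "\<dots> = lmul P (tr r) p"
    unfolding tr_def by (rule P.lmul_finsum[symmetric]) (use r p in auto)
  finally show ?thesis .
qed

lemma P0_tower: "tower_module A R S \<iota> P0"
  using S_tower P0_bimodule by (rule tower_module.intro)

text \<open>Over R the map is p \<otimes> r |-> p r, inverted by means of \<open>T_expand\<close>
  and \<open>T_P0\<close>. Over S it is p \<otimes> s |-> \<phi>(p) s; for its inverse, X is
  identified with P \<otimes>_R S by the object condition, and P with P_0 \<otimes>_A R by the first
  map.\<close>

lemma P0_iso: 
  assumes ext: "ext_object \<iota> R S (P, X, \<phi>)"
  shows "ext_isomorphic R S (xi_object A \<iota> R S P0) (P, X, \<phi>)"
proof -
  interpret N: tower_module A R S \<iota> P0 by (rule P0_tower)
  note c = x_closed y_closed P.lmul_closed P.rmul_closed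
  define a where "a = tlift A P0 N.PR.T' P (rmul P)"
  note L = N.PR.Y_lift_hom[OF P.M.comm_group_axioms] N.PR.Y_lift_pt[OF P.M.comm_group_axioms]
  have a: "a \<in> hom N.PR.Y P"
    unfolding a_def by (rule L) (simp_all add: c P.rmul_add_left P.rmul_add_right P.rmul_assoc fixed_in_R)
  have ap: "a (N.PR.pt p r) = rmul P p r" if "p \<in> carrier P0" "r \<in> carrier R" for p r
    unfolding a_def by (rule L)
      (simp_all add: c P.rmul_add_left P.rmul_add_right P.rmul_assoc fixed_in_R that)
  have ah: "a \<in> bimod_hom R R N.PR.Y P"
    by (rule N.PR.Y_bimod_homI[OF P.bimodule_axioms a])
      (simp_all add: ap rmul_P P.lmul_assoc P.lmul_closed R.m_comm)
  define a' where "a' p = finprod N.PR.Y (\<lambda>k. N.PR.pt (T (lmul P (y k) p)) (x k)) {..<m}" for p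
  have a't: "(\<lambda>k. N.PR.pt (T (lmul P (y k) p)) (x k)) \<in> {..<m} \<rightarrow> carrier N.PR.Y" if "p \<in> carrier P" for p
    using that by (auto simp: c)
  have a'c: "a' p \<in> carrier N.PR.Y" if "p \<in> carrier P" for p
    unfolding a'_def by (rule N.PR.Y.finprod_closed[OF a't[OF that]])
  have a'add: "a' (p \<otimes>\<^bsub>P\<^esub> q) = a' p \<otimes>\<^bsub>N.PR.Y\<^esub> a' q" if "p \<in> carrier P" "q \<in> carrier P" for p q
  proof -
    have "a' (p \<otimes>\<^bsub>P\<^esub> q) = finprod N.PR.Y (\<lambda>k. N.PR.pt (T (lmul P (y k) p)) (x k) \<otimes>\<^bsub>N.PR.Y\<^esub>
        N.PR.pt (T (lmul P (y k) q)) (x k)) {..<m}"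
      unfolding a'_def
    proof (rule N.PR.Y.finprod_cong')
      fix k assume "k \<in> {..<m}"
      then have k: "x k \<in> carrier R" "y k \<in> carrier R" by (simp_all add: c)
      show "N.PR.pt (T (lmul P (y k) (p \<otimes>\<^bsub>P\<^esub> q))) (x k) = N.PR.pt (T (lmul P (y k) p)) (x k) \<otimes>\<^bsub>N.PR.Y\<^esub>
        N.PR.pt (T (lmul P (y k) q)) (x k)"
        using that k N.PR.pt_add_left[of "T (lmul P (y k) p)" "T (lmul P (y k) q)" "x k"]
        by (simp add: P.lmul_add_right T_add c)
    qed (use a't[OF that(1)] a't[OF that(2)] in auto)
    also have "\<dots> = a' p \<otimes>\<^bsub>N.PR.Y\<^esub> a' q"
      unfolding a'_def by (rule N.PR.Y.finprod_multf[OF a't[OF that(1)] a't[OF that(2)]])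
    finally show ?thesis .
  qed
  have aa': "a (a' p) = p" if p: "p \<in> carrier P" for p
  proof -
    have "a (a' p) = finprod P (\<lambda>k. a (N.PR.pt (T (lmul P (y k) p)) (x k))) {..<m}"
      unfolding a'_def by (rule hom_finprod[OF N.PR.Y.comm_group_axioms P.M.comm_group_axioms a a't[OF p]])
    also have "\<dots> = finprod P (\<lambda>k. lmul P (x k) (T (lmul P (y k) p))) {..<m}"
      by (rule P.M.finprod_cong') (use p in \<open>auto simp: ap rmul_P c\<close>)
    finally show ?thesis using T_expand[OF p] by simp
  qed
  have a'a: "a' (a z) = z" if z: "z \<in> carrier N.PR.Y" for z
  proof (rule N.PR.Y_induct[OF z])
    fix p r assume pr: "p \<in> carrier P0" "r \<in> carrier R"
    have pt: "N.PR.pt (T (lmul P (y k) (rmul P p r))) (x k) = N.PR.pt p (x k \<otimes>\<^bsub>R\<^esub> tr (y k \<otimes>\<^bsub>R\<^esub> r))"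
      if k: "k < m" for k
    proof -
      have k': "x k \<in> carrier R" "y k \<in> carrier R" using k by (simp_all add: c)
      have "lmul P (y k) (rmul P p r) = lmul P (y k \<otimes>\<^bsub>R\<^esub> r) p"
        using pr k' by (simp add: rmul_P P.lmul_assoc)
      then have "T (lmul P (y k) (rmul P p r)) = rmul P p (tr (y k \<otimes>\<^bsub>R\<^esub> r))"
        using pr k' by (simp add: T_P0 rmul_P)
      then show ?thesis
        using N.PR_middle[of p "tr (y k \<otimes>\<^bsub>R\<^esub> r)" "x k"] pr k' by (simp add: tr_fixed R.m_comm)
    qed
    have "a' (a (N.PR.pt p r)) = finprod N.PR.Y (\<lambda>k. N.PR.pt p (x k \<otimes>\<^bsub>R\<^esub> tr (y k \<otimes>\<^bsub>R\<^esub> r))) {..<m}"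
      unfolding ap[OF pr] a'_def
      by (rule N.PR.Y.finprod_cong') (use pr in \<open>auto simp: pt c\<close>)
    also have "\<dots> = N.PR.pt p (finprod (regular_bimod R) (\<lambda>k. x k \<otimes>\<^bsub>R\<^esub> tr (y k \<otimes>\<^bsub>R\<^esub> r)) {..<m})"
      by (rule hom_finprod[symmetric, OF comm_group_regular[OF R.ring_axioms]
            N.PR.Y.comm_group_axioms N.PR.pt_right_hom]) (use pr in \<open>auto simp: c\<close>)
    also have "\<dots> = N.PR.pt p r" using tr_expand[OF pr(2)] by (simp add: finprod_regular)
    finally show "a' (a (N.PR.pt p r)) = N.PR.pt p r" .
  next
    fix z w assume "z \<in> carrier N.PR.Y" "w \<in> carrier N.PR.Y" "a' (a z) = z" "a' (a w) = w"
    then show "a' (a (z \<otimes>\<^bsub>N.PR.Y\<^esub> w)) = z \<otimes>\<^bsub>N.PR.Y\<^esub> w"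
      by (simp add: hom_mult[OF a] a'add hom_in_carrier[OF a])
  qed
  have a_iso: "a \<in> bimod_iso R R N.PR.Y P"
    by (rule bimod_isoI[OF ah, where g = a']) (simp_all add: a'c a'a aa')
  \<comment> \<open>Linearity of \<open>a'\<close> is inherited from its inverse \<open>a\<close>;
    it is what makes \<open>h\<close> below balanced over R.\<close>
  have a'_iso: "a' \<in> bimod_hom R R P N.PR.Y"
  proof (rule bimod_homI)
    fix r p assume rp: "r \<in> carrier R" "p \<in> carrier P"
    show "a' (lmul P r p) = lmul N.PR.Y r (a' p)"
      using a'a[of "lmul N.PR.Y r (a' p)"] bimod_hom_lmul[OF ah rp(1) a'c[OF rp(2)]] rp
      by (simp add: aa' N.PR.Y.lmul_closed a'c)
    show "a' (rmul P p r) = rmul N.PR.Y (a' p) r"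
      using a'a[of "rmul N.PR.Y (a' p) r"] bimod_hom_rmul[OF ah rp(1) a'c[OF rp(2)]] rp
      by (simp add: aa' N.PR.Y.rmul_closed a'c)
  qed (simp_all add: a'c a'add)
  define b where "b = tlift A P0 N.PS.T' X (\<lambda>p s. rmul X (\<phi> p) s)"
  note L = N.PS.Y_lift_hom[OF X.M.comm_group_axioms] N.PS.Y_lift_pt[OF X.M.comm_group_axioms]
  have mid: "rmul X (\<phi> (rmul P p z)) s = rmul X (\<phi> p) (\<iota> z \<otimes>\<^bsub>S\<^esub> s)"
    if "p \<in> carrier P0" "z \<in> carrier A" "s \<in> carrier S" for p z s
    using that fixed_in_R[OF that(2)] by (simp add: rmul_P phi_lmul X.rmul_assoc phi_rmul)
  have b: "b \<in> hom N.PS.Y X"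
    unfolding b_def by (rule L) (simp_all add: mid X.rmul_closed phi_add X.rmul_add_left X.rmul_add_right)
  have bp: "b (N.PS.pt p s) = rmul X (\<phi> p) s" if "p \<in> carrier P0" "s \<in> carrier S" for p s
    unfolding b_def by (rule L)
      (simp_all add: mid X.rmul_closed phi_add X.rmul_add_left X.rmul_add_right that)
  have bh: "b \<in> bimod_hom S S N.PS.Y X"
  proof (rule N.PS.Y_bimod_homI[OF X.bimodule_axioms b])
    fix s p t assume spt: "s \<in> carrier S" "p \<in> carrier P0" "t \<in> carrier S"
    \<comment> \<open>Left linearity holds because elements of \<open>P0\<close> commute with
      S.\<close>
    show "b (N.PS.pt p (s \<otimes>\<^bsub>S\<^esub> t)) = lmul X s (b (N.PS.pt p t))"
      using spt X.lmul_rmul[of s "\<phi> p" t] by (simp add: bp X.rmul_assoc P0_commute)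
    show "b (N.PS.pt p (t \<otimes>\<^bsub>S\<^esub> s)) = rmul X (b (N.PS.pt p t)) s"
      using spt by (simp add: bp X.rmul_assoc)
  qed
  have b\<phi>: "b (N.\<phi> z) = \<phi> (a z)" if z: "z \<in> carrier N.PR.Y" for z
  proof (rule N.PR.Y_induct[OF z])
    fix p r assume "p \<in> carrier P0" "r \<in> carrier R"
    then show "b (N.\<phi> (N.PR.pt p r)) = \<phi> (a (N.PR.pt p r))"
      by (simp add: bp ap rmul_P phi_lmul phi_rmul)
  qed (simp_all del: id_apply add: hom_mult[OF N.phi_hom] hom_in_carrier[OF N.phi_hom] hom_mult[OF b]
      hom_mult[OF a] hom_in_carrier[OF a] phi_add)
  let ?S' = "restrict_scalars \<iota> id (regular_bimod S)"
  have S': "bimodule R S ?S'"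
    by (rule bimodule_restrict[OF bimodule_regular[OF S.ring_axioms] incl_hom _ R.ring_axioms S.ring_axioms])
      (auto simp: ring_hom_def)
  interpret D: tensor_pair R R S P ?S' using P.bimodule_axioms S' by (rule tensor_pair.intro)
  obtain f where f: "f \<in> bimod_iso R S D.X (restrict_scalars \<iota> id X)"
    "\<And>p s. p \<in> carrier P \<Longrightarrow> s \<in> carrier S \<Longrightarrow> f (D.pure p s) = rmul X (\<phi> p) s"
    using ext unfolding ext_object_def Let_def by auto
  define h where "h = tlift R P ?S' N.PS.Y (\<lambda>p s. rmul N.PS.Y (N.\<phi> (a' p)) s)"
  note Ns = bimod_hom_closed[OF N.phi_bimod_hom, simplified] bimod_hom_add[OF N.phi_bimod_hom, simplified]
    bimod_hom_rmul[OF N.phi_bimod_hom, simplified]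
  have bal: "balanced R P ?S' N.PS.Y (\<lambda>p s. rmul N.PS.Y (N.\<phi> (a' p)) s)"
    by (rule balancedI) (simp_all add: a'c a'add Ns N.PS.Y.rmul_closed N.PS.Y.rmul_add_left
        N.PS.Y.rmul_add_right N.PS.Y.rmul_assoc bimod_hom_rmul[OF a'_iso])
  have h: "h \<in> hom D.X N.PS.Y"
    "\<And>p s. p \<in> carrier P \<Longrightarrow> s \<in> carrier S \<Longrightarrow> h (D.pure p s) = rmul N.PS.Y (N.\<phi> (a' p)) s"
    using D.tlift_hom[OF N.PS.Y.comm_group_axioms bal] D.tlift_pure[OF N.PS.Y.comm_group_axioms bal]
    by (simp_all add: h_def)
  define f' where "f' = inv_into (carrier D.X) f"
  have fbij: "bij_betw f (carrier D.X) (carrier X)" using bimod_iso_bij[OF f(1)] by simp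
  have f'f: "f' (f z) = z" if "z \<in> carrier D.X" for z
    unfolding f'_def by (rule bij_betw_inv_into_left[OF fbij that])
  have ff': "f (f' w) = w" if "w \<in> carrier X" for w
    unfolding f'_def by (rule bij_betw_inv_into_right[OF fbij that])
  have f'c: "f' w \<in> carrier D.X" if "w \<in> carrier X" for w
    unfolding f'_def using bij_betw_inv_into[OF fbij] that by (auto simp: bij_betw_def)
  have f'add: "f' (w \<otimes>\<^bsub>X\<^esub> w') = f' w \<otimes>\<^bsub>D.X\<^esub> f' w'" if "w \<in> carrier X" "w' \<in> carrier X" for w w'
    using f'f[of "f' w \<otimes>\<^bsub>D.X\<^esub> f' w'"] bimod_hom_add[OF bimod_iso_hom[OF f(1)] f'c[OF that(1)] f'c[OF that(2)]] that
    by (simp add: ff' f'c)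
  have fh: "f \<in> hom D.X X" using bimod_hom_hom[OF bimod_iso_hom[OF f(1)]] by (simp add: hom_def)
  have bh_eq: "b (h z) = f z" if z: "z \<in> carrier D.X" for z
  proof (rule D.hom_eqI[where f = "\<lambda>z. b (h z)" and g = f and K = X, OF _ fh z])
    show "(\<lambda>z. b (h z)) \<in> hom D.X X" using hom_compose[OF h(1) b] by (simp add: comp_def)
    fix p s assume "p \<in> carrier P" "s \<in> carrier ?S'"
    then show "b (h (D.pure p s)) = f (D.pure p s)"
      by (simp add: h(2) f(2) bimod_hom_rmul[OF bh] Ns a'c b\<phi> aa')
  qed
  have hb: "h (f' (b z)) = z" if z: "z \<in> carrier N.PS.Y" for z
  proof (rule N.PS.Y_induct[OF z])
    fix p s assume ps: "p \<in> carrier P0" "s \<in> carrier S"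
    have "a' p = N.PR.pt p \<one>\<^bsub>R\<^esub>"
      using a'a[of "N.PR.pt p \<one>\<^bsub>R\<^esub>"] ps by (simp add: ap P.rmul_one)
    moreover have "f' (b (N.PS.pt p s)) = D.pure p s"
      using f'f[of "D.pure p s"] ps by (simp add: bp f(2))
    ultimately show "h (f' (b (N.PS.pt p s))) = N.PS.pt p s"
      using ps by (simp add: h(2))
  qed (simp_all del: id_apply add: hom_mult[OF b] hom_in_carrier[OF b] f'add f'c hom_mult[OF h(1)])
  have b_iso: "b \<in> bimod_iso S S N.PS.Y X"
    by (rule bimod_isoI[OF bh, where g = "\<lambda>w. h (f' w)"])
      (simp_all add: hom_in_carrier[OF h(1)] f'c hb bh_eq ff')
  show ?thesis
    unfolding N.xi_object_eq by (rule ext_isomorphicI[OF a_iso b_iso]) (rule b\<phi>)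
qed

text \<open>The functionals on P_0 are q |-> tr(t f_i(q)); their exchange law follows from that of
  f_i, since T(r q) = tr(r) q on P_0. By the expansion of p, each tr(t f_i(p)) with p in P is a sum
  of values of such functionals on P_0, and the sum of the tr(c f_i(u_i)) is tr(c) = 1.\<close>

lemma P0_central_invertible:
  assumes inv: "central_invertible R P"
  shows "central_invertible A P0"
proof -
  obtain k f u where "rank_one R P k f u"
    using central_invertible_rank_one[OF R.cring_axioms inv] by blast
  then interpret K: rank_one R P k f u .
  obtain c where c: "c \<in> carrier R" "tr c = \<one>\<^bsub>R\<^esub>" using trace_one by blast
  let ?B = "{f p | f p. f \<in> bimod_hom A A P0 (regular_bimod A) \<and>
      (\<forall>p\<in>carrier P0. \<forall>q\<in>carrier P0. lmul P0 (f p) q = lmul P0 (f q) p) \<and> p \<in> carrier P0}"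
  interpret Areg: bimodule A A "regular_bimod A" by (rule bimodule_regular[OF TW.A.ring_axioms])
  have Bc: "?B \<subseteq> carrier (regular_bimod A)"
  proof
    fix z assume "z \<in> ?B"
    then obtain f p where z: "z = f p" "f \<in> bimod_hom A A P0 (regular_bimod A)" "p \<in> carrier P0" by blast
    show "z \<in> carrier (regular_bimod A)" unfolding z(1) by (rule bimod_hom_closed[OF z(2,3)])
  qed
  have el: "tr (t \<otimes>\<^bsub>R\<^esub> f i p) \<in> sums_of (regular_bimod A) ?B"
    if t: "t \<in> carrier R" and i: "i < k" and p: "p \<in> carrier P" for t i p
  proof -
    note F = K.functional[OF K.f_hom[OF i]]
    have B: "tr (t \<otimes>\<^bsub>R\<^esub> f i q) \<in> ?B" if t: "t \<in> carrier R" and q: "q \<in> carrier P0" for t q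
    proof -
      let ?f = "\<lambda>q. tr (t \<otimes>\<^bsub>R\<^esub> f i q)"
      have lin: "?f (lmul P z q) = z \<otimes>\<^bsub>R\<^esub> ?f q" if "z \<in> carrier A" "q \<in> carrier P0" for z q
        using that t fixed_in_R[OF that(1)] tr_linear[of z "t \<otimes>\<^bsub>R\<^esub> f i q"] by (simp add: F R.m_lcomm)
      have 1: "?f \<in> bimod_hom A A P0 (regular_bimod A)"
        by (rule bimod_homI)
          (use t lin in \<open>simp_all add: F tr_fixed tr_add R.r_distr rmul_P fixed_in_R R.m_comm\<close>)
      have 2: "lmul P0 (?f q) q' = lmul P0 (?f q') q" if "q \<in> carrier P0" "q' \<in> carrier P0" for q q'
      proof -
        have "lmul P (?f q) q' = T (lmul P (t \<otimes>\<^bsub>R\<^esub> f i q) q')" using that t by (simp add: T_P0 F)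
        also have "\<dots> = T (lmul P (t \<otimes>\<^bsub>R\<^esub> f i q') q)"
          using that t K.f_swap[OF i, of q q'] by (simp add: P.lmul_assoc F)
        also have "\<dots> = lmul P (?f q') q" using that t by (simp add: T_P0 F)
        finally show ?thesis by simp
      qed
      show ?thesis
        by (rule CollectI, rule exI[of _ ?f], rule exI[of _ q]) (intro conjI refl ballI 1 2 q)
    qed
    let ?w = "\<lambda>l. lmul P (x l) (T (lmul P (y l) p))"
    have wc: "?w \<in> {..<m} \<rightarrow> carrier P" using p by (auto simp: x_closed y_closed P.lmul_closed)
    have tc: "(\<lambda>q. tr (t \<otimes>\<^bsub>R\<^esub> f i q)) \<in> hom P (regular_bimod R)"
      using t by (simp add: hom_def F tr_add R.r_distr)
    have "tr (t \<otimes>\<^bsub>R\<^esub> f i p) = finprod (regular_bimod R) (\<lambda>l. tr (t \<otimes>\<^bsub>R\<^esub> f i (?w l))) {..<m}"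
      using hom_finprod[OF P.M.comm_group_axioms comm_group_regular[OF R.ring_axioms] tc wc] T_expand[OF p]
      by simp
    \<comment> \<open>All summands are traces, so the sum may be formed in A.\<close>
    also have "\<dots> = finprod (regular_bimod A) (\<lambda>l. tr (t \<otimes>\<^bsub>R\<^esub> f i (?w l))) {..<m}"
      by (rule hom_finprod[symmetric, where h = "\<lambda>z. z", OF Areg.M.comm_group_axioms comm_group_regular[OF R.ring_axioms]])
        (use t wc in \<open>auto simp: hom_def fixed_in_R F tr_fixed Pi_iff\<close>)
    also have "\<dots> \<in> sums_of (regular_bimod A) ?B"
      unfolding sums_of_def
    proof (intro CollectI exI conjI)
      show "(\<lambda>l. tr (t \<otimes>\<^bsub>R\<^esub> f i (?w l))) \<in> {..<m} \<rightarrow> ?B"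
      proof
        fix l assume "l \<in> {..<m}"
        then have l: "x l \<in> carrier R" "y l \<in> carrier R" by (simp_all add: x_closed y_closed)
        \<comment> \<open>The factor \<open>x l\<close> is absorbed into \<open>t\<close>, which
          leaves an argument in P_0.\<close>
        have "tr (t \<otimes>\<^bsub>R\<^esub> f i (?w l)) = tr ((t \<otimes>\<^bsub>R\<^esub> x l) \<otimes>\<^bsub>R\<^esub> f i (T (lmul P (y l) p)))"
          using l t p by (simp add: F R.m_assoc P.lmul_closed)
        also have "\<dots> \<in> ?B" by (rule B) (use l t p in \<open>simp_all add: P.lmul_closed\<close>)
        finally show "tr (t \<otimes>\<^bsub>R\<^esub> f i (?w l)) \<in> ?B" .
      qed
    qed (rule refl)
    finally show ?thesis .
  qed
  have fu: "(\<lambda>i. c \<otimes>\<^bsub>R\<^esub> f i (u i)) \<in> {..<k} \<rightarrow> carrier R" using c by (auto simp: K.f_closed K.u_closed)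
  have "finsum R (\<lambda>i. c \<otimes>\<^bsub>R\<^esub> f i (u i)) {..<k} = c"
    using R.finsum_rdistr[of "{..<k}" c "\<lambda>i. f i (u i)"] c K.sum_fu by (simp add: K.f_closed K.u_closed Pi_iff)
  then have "\<one>\<^bsub>R\<^esub> = tr (finprod (regular_bimod R) (\<lambda>i. c \<otimes>\<^bsub>R\<^esub> f i (u i)) {..<k})"
    by (simp add: finprod_regular c(2))
  also have "\<dots> = finprod (regular_bimod R) (\<lambda>i. tr (c \<otimes>\<^bsub>R\<^esub> f i (u i))) {..<k}"
    by (rule hom_finprod[OF comm_group_regular[OF R.ring_axioms] comm_group_regular[OF R.ring_axioms] tr_hom])
      (use fu in simp)
  also have "\<dots> = finprod (regular_bimod A) (\<lambda>i. tr (c \<otimes>\<^bsub>R\<^esub> f i (u i))) {..<k}"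
    by (rule hom_finprod[symmetric, where h = "\<lambda>z. z", OF Areg.M.comm_group_axioms comm_group_regular[OF R.ring_axioms]])
      (use fu in \<open>auto simp: hom_def fixed_in_R tr_fixed Pi_iff\<close>)
  also have "\<dots> \<in> sums_of (regular_bimod A) ?B"
  proof -
    have "finprod (regular_bimod A) (\<lambda>i. tr (c \<otimes>\<^bsub>R\<^esub> f i (u i))) {..<n} \<in> sums_of (regular_bimod A) ?B"
      if "n \<le> k" for n
      using that
    proof (induction n)
      case 0
      then show ?case using Areg.M.one_in_sums_of by simp
    next
      case (Suc n)
      let ?t = "\<lambda>i. tr (c \<otimes>\<^bsub>R\<^esub> f i (u i))"
      have t: "?t i \<in> carrier (regular_bimod A)" if "i \<le> n" for i
        using that Suc.prems fu by (simp add: tr_fixed Pi_iff)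
      have "finprod (regular_bimod A) ?t {..<Suc n} = ?t n \<otimes>\<^bsub>regular_bimod A\<^esub> finprod (regular_bimod A) ?t {..<n}"
        unfolding lessThan_Suc by (rule Areg.M.finprod_insert) (use t in auto)
      moreover have "?t n \<in> sums_of (regular_bimod A) ?B"
        by (rule el) (use Suc.prems c in \<open>simp_all add: K.u_closed\<close>)
      ultimately show ?case using Areg.M.sums_of_mult[OF _ _ Bc] Suc by simp
    qed
    then show ?thesis by blast
  qed
  finally have "\<one>\<^bsub>A\<^esub> \<in> sums_of (regular_bimod A) ?B" by simp
  then obtain k' f' u' where "rank_one A P0 k' f' u'"
    by (rule rank_oneI_sums[OF TW.A.cring_axioms P0_bimodule cP0])
  then show ?thesis by (rule rank_one_central_invertible)
qed

end

section \<open>The isomorphism\<close>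

context partial_Galois_action begin

text \<open>The coefficient at the identity of G is a left R-linear map from S to R, so it induces a
  retraction of p |-> p \<otimes> 1 from P \<otimes>_R S to P.\<close>

lemma ext_object_inj:
  assumes ext: "ext_object \<iota> R S (P, X, \<phi>)"
  shows "inj_on \<phi> (carrier P)"
proof (rule inj_onI)
  fix p q assume p: "p \<in> carrier P" and q: "q \<in> carrier P" and eq: "\<phi> p = \<phi> q"
  note parts = ext_object_parts[OF ext]
  interpret P: bimodule R R P by (rule parts)
  let ?S' = "restrict_scalars \<iota> id (regular_bimod S)"
  have S': "bimodule R S ?S'"
    by (rule bimodule_restrict[OF bimodule_regular[OF S.ring_axioms] incl_hom _ R.ring_axioms S.ring_axioms])
      (auto simp: ring_hom_def)
  interpret D: tensor_pair R R S P ?S' using P.bimodule_axioms S' by (rule tensor_pair.intro)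
  obtain f where f: "f \<in> bimod_iso R S D.X (restrict_scalars \<iota> id X)"
    "\<And>p s. p \<in> carrier P \<Longrightarrow> s \<in> carrier S \<Longrightarrow> f (D.pure p s) = rmul X (\<phi> p) s"
    using ext unfolding ext_object_def Let_def by auto
  have "f (D.pure p \<one>\<^bsub>S\<^esub>) = f (D.pure q \<one>\<^bsub>S\<^esub>)" using f(2) p q eq by simp
  then have pq: "D.pure p \<one>\<^bsub>S\<^esub> = D.pure q \<one>\<^bsub>S\<^esub>"
    using bimod_iso_eq_iff[OF f(1), of "D.pure p \<one>\<^bsub>S\<^esub>" "D.pure q \<one>\<^bsub>S\<^esub>"] p q by simp
  note one = G.one_closed
  have bal: "balanced R P ?S' P (\<lambda>p s. rmul P p (s \<one>\<^bsub>G\<^esub>))"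
    by (rule balancedI) (simp_all add: P.rmul_closed P.rmul_add_left P.rmul_add_right P.rmul_assoc
        S_eqs(4) incl_mult(1))
  have "tlift R P ?S' P (\<lambda>p s. rmul P p (s \<one>\<^bsub>G\<^esub>)) (D.pure p \<one>\<^bsub>S\<^esub>) = p" if "p \<in> carrier P" for p
    using D.tlift_pure[OF P.M.comm_group_axioms bal that, of "\<one>\<^bsub>S\<^esub>"] that
    by (simp add: S_eqs(2) P.rmul_one)
  from this[OF p] this[OF q] show "p = q" unfolding pq by simp
qed

text \<open>By hypothesis d_g \<phi>(p) lies in \<phi>(P) D_g \<delta>_g. Right multiplication by
  d_(g^-1) carries D_g \<delta>_g into R, and therefore this set into \<phi>(P).\<close>

lemma Theta_twist:
  assumes ext: "ext_object \<iota> R S (P, X, \<phi>)"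
    and \<Theta>: "lprod_set X (Theta0 G R e g) (\<phi> ` carrier P) = rprod_set X (\<phi> ` carrier P) (Theta0 G R e g)"
    and g: "g \<in> carrier G" and p: "p \<in> carrier P"
  shows "\<exists>q\<in>carrier P. \<phi> q = lmul X (\<delta> g) (rmul X (\<phi> p) (\<delta> (inv\<^bsub>G\<^esub> g)))"
proof -
  note parts = ext_object_parts[OF ext]
  interpret P: bimodule R R P by (rule parts)
  interpret X: bimodule S S X by (rule parts)
  note phi = parts(3)
  have \<phi>c: "\<phi> p \<in> carrier X" if "p \<in> carrier P" for p using bimod_hom_closed[OF phi that] by simp
  let ?\<Theta> = "Theta0 G R e g" and ?U = "\<phi> ` carrier P" and ?g' = "inv\<^bsub>G\<^esub> g"
  have \<Theta>c: "\<theta> \<in> carrier S" if "\<theta> \<in> ?\<Theta>" for \<theta> using that g by (auto simp: Theta0_eq)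
  let ?L = "{lmul X \<theta> u | \<theta> u. \<theta> \<in> ?\<Theta> \<and> u \<in> ?U}" and ?R = "{rmul X u \<theta> | \<theta> u. \<theta> \<in> ?\<Theta> \<and> u \<in> ?U}"
  have Lc: "?L \<subseteq> carrier X" using \<phi>c \<Theta>c X.lmul_closed by blast
  have Rc: "?R \<subseteq> carrier X" using \<phi>c \<Theta>c X.rmul_closed by blast
  have "\<delta> g \<in> ?\<Theta>" using Theta0_memI[OF g R.one_closed] g by (simp add: S_one_incl[symmetric])
  then have "lmul X (\<delta> g) (\<phi> p) \<in> ?L" using p by blast
  then have "lmul X (\<delta> g) (\<phi> p) \<in> sums_of X ?R"
    using X.M.sums_of_incl[OF _ Lc] \<Theta> lprod_set_eq_sums_of[OF X.M.comm_monoid_axioms Lc]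
      rprod_set_eq_sums_of[OF X.M.comm_monoid_axioms Rc] by blast
  moreover have "sums_of X ?R \<subseteq> {z \<in> carrier X. \<exists>q\<in>carrier P. \<phi> q = rmul X z (\<delta> ?g')}" (is "_ \<subseteq> ?W")
  proof (rule X.M.sums_of_minimal[OF _ _ _ Rc])
    have "\<phi> \<in> hom P X" using bimod_hom_hom[OF phi] by (simp add: hom_def)
    then have "\<phi> \<one>\<^bsub>P\<^esub> = \<one>\<^bsub>X\<^esub>" by (rule hom_one[OF _ P.M.is_group X.M.is_group])
    then show "\<one>\<^bsub>X\<^esub> \<in> ?W" using g by (auto intro!: bexI[of _ "\<one>\<^bsub>P\<^esub>"])
    show "?R \<subseteq> ?W"
    proof
      fix z assume "z \<in> ?R"
      then obtain r u where ru: "r \<in> carrier R" "u \<in> carrier P" "z = rmul X (\<phi> u) (\<iota> r \<otimes>\<^bsub>S\<^esub> \<delta> g)"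
        using g by (auto simp: Theta0_eq)
      have eg: "e g \<in> carrier R" using g by (simp add: e_closed)
      have "\<iota> r \<otimes>\<^bsub>S\<^esub> \<delta> g \<otimes>\<^bsub>S\<^esub> \<delta> ?g' = \<iota> (r \<otimes>\<^bsub>R\<^esub> e g)"
        using g ru eg \<delta>_\<delta>[of g ?g'] by (simp add: S.m_assoc \<delta>_one)
      then have "rmul X z (\<delta> ?g') = rmul X (\<phi> u) (\<iota> (r \<otimes>\<^bsub>R\<^esub> e g))"
        using ru g \<phi>c by (simp add: X.rmul_assoc[symmetric] del: TW.i_mult)
      also have "\<dots> = \<phi> (rmul P u (r \<otimes>\<^bsub>R\<^esub> e g))"
        using bimod_hom_rmul[OF phi, of "r \<otimes>\<^bsub>R\<^esub> e g" u] ru eg by simp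
      finally have "\<phi> (rmul P u (r \<otimes>\<^bsub>R\<^esub> e g)) = rmul X z (\<delta> ?g')" by (rule sym)
      moreover have "rmul P u (r \<otimes>\<^bsub>R\<^esub> e g) \<in> carrier P" "z \<in> carrier X"
        using ru eg g \<phi>c by (simp_all add: P.rmul_closed X.rmul_closed)
      ultimately show "z \<in> ?W" by blast
    qed
    fix z w assume "z \<in> ?W" "w \<in> ?W"
    then obtain q q' where q: "z \<in> carrier X" "w \<in> carrier X" "q \<in> carrier P" "q' \<in> carrier P"
      "\<phi> q = rmul X z (\<delta> ?g')" "\<phi> q' = rmul X w (\<delta> ?g')" by auto
    then have "\<phi> (q \<otimes>\<^bsub>P\<^esub> q') = rmul X (z \<otimes>\<^bsub>X\<^esub> w) (\<delta> ?g')"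
      using bimod_hom_add[OF phi q(3,4)] g by (simp add: X.rmul_add_left)
    then show "z \<otimes>\<^bsub>X\<^esub> w \<in> ?W" using q by (auto intro!: bexI[of _ "q \<otimes>\<^bsub>P\<^esub> q'"])
  qed
  ultimately obtain q where "q \<in> carrier P" "\<phi> q = rmul X (lmul X (\<delta> g) (\<phi> p)) (\<delta> ?g')" by blast
  then show ?thesis using X.lmul_rmul[of "\<delta> g" "\<phi> p" "\<delta> ?g'"] g \<phi>c[OF p] by auto
qed

section \<open>The map \<xi> on classes: products, injectivity and surjectivity\<close>

abbreviation "PicA \<equiv> Pic_central (carrier A) A"
abbreviation "ExtPic \<equiv> ext_Pic_inv \<iota> R S (carrier G) (Theta0 G R e)"
abbreviation "\<xi> \<equiv> xi A \<iota> R S"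
abbreviation "obj P \<equiv> xi_object A \<iota> R S P"
abbreviation "cls u \<equiv> ext_class \<iota> R S u"

lemma tower_moduleI: "central_invertible A P \<Longrightarrow> tower_module A R S \<iota> P"
  using S_tower central_invertible_bimodule by (rule tower_module.intro)

lemma obj_ext: "central_invertible A P \<Longrightarrow> ext_object \<iota> R S (obj P)"
  by (rule tower_module.xi_ext_object[OF tower_moduleI])

lemma obj_class_cong:
  fixes P :: "('r, 'r, 'p) bimod" and Q :: "('r, 'r, 'q) bimod"
  assumes P: "central_invertible A P" and Q: "central_invertible A Q" and iso: "bimod_isomorphic A A P Q"
  shows "cls (obj P) = cls (obj Q)"
proof -
  obtain f where "f \<in> bimod_iso A A P Q" using iso by (auto simp: bimod_isomorphic_def)
  then show ?thesis
    by (rule ext_class_eqI[OF ext_object_pre[OF obj_ext[OF P]]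
          xi_object_cong[OF tower_moduleI[OF P] tower_moduleI[OF Q]]])
qed

text \<open>The union defining \<xi> has a single value by \<open>obj_class_cong\<close>, and it is
  taken over a nonempty class because P has a copy in the fixed carrier type.\<close>

lemma xi_class:
  fixes P :: "('r, 'r, 'p) bimod"
  assumes P: "central_invertible A P"
  shows "\<xi> (bimod_class A P) = cls (obj P)"
proof -
  obtain P' :: "('r, 'r, 'r fg) bimod" where P': "P' \<in> bimod_class A P"
    by (rule central_invertible_copy[OF TW.A.cring_axioms P])
  have "cls (obj Q) = cls (obj P)" if "Q \<in> bimod_class A P" for Q
    by (rule obj_class_cong[symmetric, OF P bimod_class_central[OF P that]])
  then show ?thesis using P' unfolding xi_def by blast
qed

text \<open>Invariance is required of every member of the class; \<open>xi_central_Theta\<close>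
  covers all objects isomorphic to the given one.\<close>

lemma cls_in_ExtPic:
  fixes P :: "('r, 'r, 'p) bimod"
  assumes P: "central_invertible A P"
  shows "cls (obj P) \<in> carrier ExtPic"
proof -
  obtain v :: "('r, 'g \<Rightarrow> 'r) ext_obj" where v: "v \<in> cls (obj P)"
    by (rule xi_object_copy[OF S_tower P])
  then have v': "ext_isomorphic R S (obj P) v" "inv_ext_object \<iota> R S v"
    by (auto simp: ext_class_def)
  have "cls (obj P) = cls v" by (rule ext_class_eqI[OF ext_object_pre[OF obj_ext[OF P]] v'(1)])
  with v'(2) have "cls (obj P) \<in> carrier (ext_Pic \<iota> R S)" by (cases v) (auto simp: ext_Pic_def)
  moreover have "central_over (carrier R) Q \<and> (\<forall>g\<in>carrier G.
      lprod_set X (Theta0 G R e g) (\<phi> ` carrier Q) = rprod_set X (\<phi> ` carrier Q) (Theta0 G R e g))"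
    if "(Q, X, \<phi>) \<in> cls (obj P)" for Q X \<phi>
  proof -
    have u: "ext_object \<iota> R S (Q, X, \<phi>)" "ext_isomorphic R S (obj P) (Q, X, \<phi>)"
      using that by (auto simp: ext_class_def inv_ext_object_def)
    show ?thesis
      using xi_central_Theta[OF tower_moduleI[OF P] u] by blast
  qed
  ultimately show ?thesis unfolding ext_Pic_inv_def by auto
qed

text \<open>The product is a union over pairs of representatives. Each pair yields the class of the
  object of M \<otimes> N by \<open>ext_tensor_cong\<close> and \<open>xi_object_tensor\<close>, and
  at least one pair exists.\<close>

lemma xi_mult:
  fixes M N :: "('r, 'r, 'r fg) bimod"
  assumes M: "central_invertible A M" and N: "central_invertible A N"
  shows "\<xi> (bimod_class A M \<otimes>\<^bsub>PicA\<^esub> bimod_class A N) = \<xi> (bimod_class A M) \<otimes>\<^bsub>ExtPic\<^esub> \<xi> (bimod_class A N)"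
proof -
  have MN: "central_invertible A (tensor A M N)"
    by (rule central_invertible_tensor[OF TW.A.cring_axioms M N])
  have cN: "central_over (carrier A) N" using N by (simp add: central_invertible_def)
  have each: "cls (ext_tensor R S u v) = cls (obj (tensor A M N))"
    if "u \<in> cls (obj M)" "v \<in> cls (obj N)" for u v
  proof -
    have u: "ext_object \<iota> R S u" "ext_isomorphic R S (obj M) u"
      using that(1) by (auto simp: ext_class_def inv_ext_object_def split: prod.splits)
    have v: "ext_object \<iota> R S v" "ext_isomorphic R S (obj N) v"
      using that(2) by (auto simp: ext_class_def inv_ext_object_def split: prod.splits)
    note o = obj_ext[OF M] obj_ext[OF N]
    have "ext_isomorphic R S (ext_tensor R S (obj M) (obj N)) (ext_tensor R S u v)"
      by (rule ext_tensor_cong[OF o u(1) v(1) u(2) v(2) incl_hom])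
    then have "cls (ext_tensor R S (obj M) (obj N)) = cls (ext_tensor R S u v)"
      by (rule ext_class_eqI[OF ext_pre_tensor[OF o incl_hom]])
    moreover have "cls (ext_tensor R S (obj M) (obj N)) = cls (obj (tensor A M N))"
      by (rule ext_class_eqI[OF ext_pre_tensor[OF o incl_hom] xi_object_tensor[OF tower_moduleI[OF M]
            tower_moduleI[OF N] tower_moduleI[OF MN] cN]])
    ultimately show ?thesis by simp
  qed
  obtain u v :: "('r, 'g \<Rightarrow> 'r) ext_obj" where uv: "u \<in> cls (obj M)" "v \<in> cls (obj N)"
    using xi_object_copy[OF S_tower M] xi_object_copy[OF S_tower N] by metis
  have "\<xi> (bimod_class A M) \<otimes>\<^bsub>ExtPic\<^esub> \<xi> (bimod_class A N) =
      (\<Union>u\<in>cls (obj M). \<Union>v\<in>cls (obj N). cls (ext_tensor R S u v))"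
    unfolding xi_class[OF M] xi_class[OF N] by (simp add: ext_Pic_inv_def ext_Pic_def)
  also have "\<dots> = (\<Union>u\<in>cls (obj M). \<Union>v\<in>cls (obj N). cls (obj (tensor A M N)))"
    using each by simp
  also have "\<dots> = cls (obj (tensor A M N))" using uv by auto
  finally show ?thesis
    unfolding TW.A.Pic_central_mult[OF M N] xi_class[OF MN] by simp
qed

lemma xi_one: "\<xi> \<one>\<^bsub>PicA\<^esub> = \<one>\<^bsub>ExtPic\<^esub>"
proof -
  note reg = TW.A.central_invertible_regular
  have "\<xi> \<one>\<^bsub>PicA\<^esub> = cls (obj (regular_bimod A))"
    unfolding TW.A.Pic_central_one by (rule xi_class[OF reg])
  also have "\<dots> = cls (regular_bimod R, regular_bimod S, \<iota>)"
    by (rule ext_class_eqI[OF ext_object_pre[OF obj_ext[OF reg]] TW.xi_object_regular])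
  also have "\<dots> = \<one>\<^bsub>ExtPic\<^esub>" by (simp add: ext_Pic_inv_def ext_Pic_def)
  finally show ?thesis .
qed

text \<open>Equal classes share a member, through which the two objects are isomorphic;
  \<open>xi_iso_descends\<close> then applies.\<close>

lemma xi_inj: "inj_on \<xi> (carrier PicA)"
proof (rule inj_onI)
  fix c d assume c: "c \<in> carrier PicA" and d: "d \<in> carrier PicA" and eq: "\<xi> c = \<xi> d"
  obtain M N :: "('r, 'r, 'r fg) bimod" where M: "central_invertible A M" "c = bimod_class A M"
    and N: "central_invertible A N" "d = bimod_class A N"
    using c d unfolding TW.A.Pic_central_carrier by blast
  have cls: "cls (obj M) = cls (obj N)"
    using eq unfolding M(2) N(2) xi_class[OF M(1)] xi_class[OF N(1)] .
  obtain v :: "('r, 'g \<Rightarrow> 'r) ext_obj" where v: "v \<in> cls (obj M)"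
    by (rule xi_object_copy[OF S_tower M(1)])
  then have "ext_isomorphic R S (obj M) v" "ext_isomorphic R S (obj N) v"
    using v cls by (auto simp: ext_class_def)
  then have "ext_isomorphic R S (obj M) (obj N)"
    using ext_isomorphic_trans ext_isomorphic_sym[OF ext_object_pre[OF obj_ext[OF N(1)]]] by blast
  then have "bimod_isomorphic A A M N"
    using xi_iso_descends[OF tower_moduleI[OF M(1)] tower_moduleI[OF N(1)]] M(1) N(1)
    by (simp add: central_invertible_def)
  then show "c = d"
    unfolding M(2) N(2) by (rule bimod_class_eqI[OF central_invertible_bimodule[OF M(1)]])
qed

lemma xi_surj:
  assumes c: "c \<in> carrier ExtPic"
  shows "\<exists>d\<in>carrier PicA. \<xi> d = c"
proof -
  obtain u :: "('r, 'g \<Rightarrow> 'r) ext_obj" where u: "inv_ext_object \<iota> R S u" "c = cls u"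
    using c by (auto simp: ext_Pic_inv_def ext_Pic_def)
  obtain P X \<phi> where e: "u = (P, X, \<phi>)" by (cases u)
  have ext: "ext_object \<iota> R S (P, X, \<phi>)" and inv: "invertible_bimod R P"
    using u(1) by (auto simp: inv_ext_object_def e)
  \<comment> \<open>The conditions on \<open>c\<close> concern all of its members, and
    \<open>u\<close> is one of them by reflexivity.\<close>
  have "u \<in> c" using u by (auto simp: ext_class_def ext_isomorphic_refl)
  then have cP: "central_over (carrier R) P" and \<Theta>: "\<And>g. g \<in> carrier G \<Longrightarrow>
      lprod_set X (Theta0 G R e g) (\<phi> ` carrier P) = rprod_set X (\<phi> ` carrier P) (Theta0 G R e g)"
    using c by (auto simp: ext_Pic_inv_def e)
  note parts = ext_object_parts[OF ext]
  interpret Galois_descent G R e \<alpha> m x y P X \<phi>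
    by (intro Galois_descent.intro Galois_descent_axioms.intro partial_Galois_action_axioms parts
        cP ext_object_inj[OF ext] Theta_twist[OF ext \<Theta>])
  have P0: "central_invertible A P0"
    by (rule P0_central_invertible) (simp add: central_invertible_def inv cP)
  have "\<xi> (bimod_class A P0) = c"
    unfolding xi_class[OF P0] u(2) e
    by (rule ext_class_eqI[OF ext_object_pre[OF obj_ext[OF P0]] P0_iso[OF ext]])
  then show ?thesis using TW.A.bimod_class_in_Pic[OF P0] by blast
qed

lemma xi_iso: "\<xi> \<in> iso PicA ExtPic"
proof (rule isoI)
  have closed: "\<xi> c \<in> carrier ExtPic" if "c \<in> carrier PicA" for c
    using that xi_class cls_in_ExtPic unfolding TW.A.Pic_central_carrier by metis
  show "\<xi> \<in> hom PicA ExtPic"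
  proof (rule homI)
    fix c d assume "c \<in> carrier PicA" "d \<in> carrier PicA"
    then show "\<xi> (c \<otimes>\<^bsub>PicA\<^esub> d) = \<xi> c \<otimes>\<^bsub>ExtPic\<^esub> \<xi> d"
      unfolding TW.A.Pic_central_carrier using xi_mult by blast
  qed (rule closed)
  show "bij_betw \<xi> (carrier PicA) (carrier ExtPic)"
    unfolding bij_betw_def using xi_inj closed xi_surj by blast
qed

lemma group_ExtPic: "group ExtPic"
proof -
  \<comment> \<open>Transport along a bijection gives a group whose unit is the image of the unit;
    \<open>xi_one\<close> identifies it with the unit of \<open>ExtPic\<close>.\<close>
  have "group (ExtPic\<lparr>one := \<xi> \<one>\<^bsub>PicA\<^esub>\<rparr>)"
    by (rule group.iso_imp_img_group[OF TW.A.group_Pic_central xi_iso])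
  then show ?thesis unfolding xi_one by simp
qed

end

text \<open>The clause with the free carrier type \<open>'p\<close> describes the map on a module in
  any carrier type, so forming classes in a fixed type does not narrow the result.\<close>

theorem theorem3p9:
  fixes G :: "('g, 'y) monoid_scheme" and R :: "('r, 'z) ring_scheme"
    and e :: "'g \<Rightarrow> 'r" and \<alpha> :: "'g \<Rightarrow> 'r \<Rightarrow> 'r"
  assumes "finite (carrier G)"
    and "cring R"
    and "unital_partial_action G R e \<alpha>"
    and "partial_Galois G R e \<alpha>"
  defines "A \<equiv> fixed_ring G R e \<alpha>"
    and "S \<equiv> skew_ring G R e \<alpha>"
    and "\<iota> \<equiv> skew_incl G R"
  shows "group (Pic_central (carrier A) A)
    \<and> group (ext_Pic_inv \<iota> R S (carrier G) (Theta0 G R e))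
    \<and> (\<forall>P :: ('r, 'r, 'p) bimod. invertible_bimod A P \<and> central_over (carrier A) P \<longrightarrow>
         xi A \<iota> R S (bimod_class A P) = ext_class \<iota> R S (xi_object A \<iota> R S P))
    \<and> xi A \<iota> R S \<in> iso (Pic_central (carrier A) A)
         (ext_Pic_inv \<iota> R S (carrier G) (Theta0 G R e))"
proof -
  obtain m x y where "partial_Galois_action G R e \<alpha> m x y"
    by (rule partial_GaloisE[OF assms(3,1,4)])
  then interpret partial_Galois_action G R e \<alpha> m x y .
  show ?thesis
    unfolding A_def S_def \<iota>_def
    using TW.A.group_Pic_central group_ExtPic xi_class xi_iso
    by (auto simp: central_invertible_def)
qed

end
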